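(* Let $\alpha=v-v^{-1}$, let $(\mathrm{tr}_n^B)_{n\ge1}$ and $(\mathrm{tr}_n^D)_{n\ge2}$ be the geometric Markov traces on the equal-parameter Iwahori-Hecke algebras $\mathcal{H}(B_n)$ and $\mathcal{H}(D_n)$ (defined in the context), and let $\mathrm{tr}_n^{X,k}:\mathcal{H}(X_n)\to\mathcal{A}$ ($X=B,D$) be the coefficient of $\mathrm{tr}_n^X$ at $a^k$, $k \ge 0$. (1) The functional $\mathrm{tr}_n^{B,k}$ is represented by the $k$th elementary symmetric polynomial in the Jucys-Murphy elements: for all $h\in\mathcal{H}(B_n)$, $$\mathrm{tr}_n^{B,k}(h)=\langle e_k(J_1^B,\dots,J_n^B),h\rangle .$$ (2) Let $e_k'(x_1,\dots,x_n;\alpha)$ be the symmetric polynomial in $(x_i)$ that is the degree $2k$ homogeneous part (in the $x_i$) of $$\prod_{i=1}^n(1+\alpha x_i-x_i^2)=\prod_{i=1}^n(v-x_i)(v^{-1}+x_i).$$ Then for all $h\in\mathcal{H}(D_n)$, $$\mathrm{tr}_n^{D,k}(h)=(-1)^k\langle e_k'(j_1^D,\dots,j_n^D;\alpha),h\rangle .$$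
   Context: **Hecke algebras.** $\mathcal{A}=\mathbb{Q}(v)$. $\mathcal{H}(B_n)$ ($n\ge1$) is the unital $\mathcal{A}$-algebra with generators $t_0,\dots,t_{n-1}$, the type $B_n$ braid relations for the path $0-1-\cdots-(n-1)$ with $m_{01}=4$, and $(t-v)(t+v^{-1})=0$ for every generator $t$ (all parameters equal to $v$). $\mathcal{H}(D_n)$ ($n\ge2$) is the unital $\mathcal{A}$-algebra with generators $t_1,t_{1'},t_2,\dots,t_{n-1}$, the braid relations of the path $1-2-\cdots-(n-1)$ together with a vertex $1'$ joined only to $2$ (for $n=2$: $t_1,t_{1'}$ commute), and the same quadratic relations. $t_w$ denotes the product of generators along a reduced expression of $w$; $\{t_w\}$ and $\{t_w^{-1}\}$ are $\mathcal{A}$-bases. $\iota:\mathcal{H}(X_{n-1})\to\mathcal{H}(X_n)$ is the embedding induced by labels; elements of smaller algebras are regarded in larger ones. **Pairing.** The bar involution is the $\mathbb{Q}$-algebra involution with $\overline{v}=v^{-1}$, $\overline{t_w}=t_{w^{-1}}^{-1}$; $i$ is the $\mathcal{A}$-linear anti-involution with $i(t_w)=t_{w^{-1}}$; $\tau(h)$ is the coefficient of $t_e^{-1}=1$ of $h$ in the basis $\{t_w^{-1}\}$; $\langle h,h'\rangle=\tau(i(\overline{h})h')$. **Elements.** $j_i^B=t_{i-1}\cdots t_1t_0t_1\cdots t_{i-1}$ ($j_1^B=t_0$), $J_i^B=(j_i^B)^2$. $j_1^D=1$, $j_i^D=t_{i-1}\cdots t_2t_{1'}t_1t_2\cdots t_{i-1}$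 for $i\ge2$. The $j_i^B$ commute with each other, as do the $j_i^D$. $T_1=t_0$, $T_n=t_{n-1}\cdots t_1t_0t_1^{-1}\cdots t_{n-1}^{-1}$ for $n\ge2$. $U_1=1$, $U_n=t_{n-1}\cdots t_2t_{1'}t_1^{-1}t_2^{-1}\cdots t_{n-1}^{-1}$ for $n\ge2$. **Markov traces.** A family of $\mathcal{A}$-linear functionals $\phi_n:\mathcal{H}(X_n)\to\mathcal{A}(a)$ ($n\ge1$ for $X=B$, $n\ge2$ for $X=D$) is a Markov trace with constants $\rho,\mu$ if (M1) $\phi_n(hh')=\phi_n(h'h)$; and for $n\ge2$ (resp. $n\ge3$ for $X=D$) and $h\in\mathcal{H}(X_{n-1})$: (U1) $\phi_n(\iota(h))=\rho\phi_{n-1}(h)$; (M2) $\phi_n(\iota(h)t_{n-1})=\mu\phi_{n-1}(h)$. **Geometric Markov traces.** By a theorem of Geck and Lambropoulou, a Markov trace with constants $\rho=1+a$, $\mu=\alpha$ and normalization $\phi_n(1)=(1+a)^n$ is uniquely determined by the values $\phi_n(T_1\cdots T_n)$, $n\ge1$, in type $B$, and $\phi_{2m}(U_1\cdots U_{2m})$, $m\ge1$, in type $D$, and these values can be prescribed arbitrarily. $(\mathrm{tr}_n^B)$ is the one with $\mathrm{tr}_n^B(T_1\cdots T_n)=\alpha^n$ for all $n\ge1$ (equivalently $y^n$ with $y=\mathrm{tr}_1^B(t_0)=\alpha$). $(\mathrm{tr}_n^D)$ is the one with $\mathrm{tr}_{2m}^D(U_1\cdots U_{2m})=(-\alpha^2a)^m$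 for all $m\ge1$ (equivalently $y^{2m}$ with $y^2$ determined by $\mathrm{tr}_2^D(t_1)=\mathrm{tr}_2^D(t_{1'})=\alpha(1+a)$, $\mathrm{tr}_2^D(t_1t_{1'})=\alpha^2$). These traces take values in $\mathcal{A}[a]$. *)

theory Defs
  imports
    "HOL-Algebra.QuotRing"
    "HOL-Computational_Algebra.Polynomial"
    "HOL-Computational_Algebra.Fraction_Field"
    "HOL-Library.Poly_Mapping"
    "HOL-Library.FuncSet"
begin

section \<open>The ground fields\<close>

text \<open>\<open>qv\<close> is $\mathbb{Q}(v)$ and \<open>qva\<close> is $\mathbb{Q}(v)(a)$.\<close>

type_synonym qv = "rat poly fract"
type_synonym qva = "qv poly fract"

definition q_const :: "rat \<Rightarrow> qv" where
  "q_const q = Fract [:q:] 1"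

definition v_var :: qv where
  "v_var = Fract [:0, 1:] 1"

definition alpha :: qv where
  "alpha = v_var - inverse v_var"

definition qva_const :: "qv \<Rightarrow> qva" where
  "qva_const c = Fract [:c:] 1"

definition a_var :: qva where
  "a_var = Fract [:0, 1:] 1"

text \<open>The coefficient at $a^k$ of an element of $\mathbb{Q}(v)[a] \subseteq \mathbb{Q}(v)(a)$;
  it carries no information for other elements of $\mathbb{Q}(v)(a)$.\<close>

definition a_coeff :: "nat \<Rightarrow> qva \<Rightarrow> qv" where
  "a_coeff k x = coeff (THE p. x = Fract p 1) k"


section \<open>Coxeter groups of types B and D\<close>

text \<open>Generators are natural numbers; the group (algebra) of rank \<open>n\<close> uses the labels
  \<open>0, \<dots>, n - 1\<close>. In type D the label \<open>0\<close> plays the role of $1'$: it commutes with \<open>1\<close>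
  and is joined to \<open>2\<close>.\<close>

definition coxeter_B :: "nat \<Rightarrow> nat \<Rightarrow> nat" where
  "coxeter_B i j =
    (if i = j then 1
     else if {i, j} = {0, 1} then 4
     else if j = i + 1 \<or> i = j + 1 then 3 else 2)"

definition coxeter_D :: "nat \<Rightarrow> nat \<Rightarrow> nat" where
  "coxeter_D i j =
    (if i = j then 1
     else if {i, j} = {0, 1} then 2
     else if {i, j} = {0, 2} then 3
     else if j = i + 1 \<or> i = j + 1 then 3 else 2)"

text \<open>\<open>alt_word i j k\<close> is \<open>i j i j \<dots>\<close> with \<open>k\<close> letters.\<close>

fun alt_word :: "nat \<Rightarrow> nat \<Rightarrow> nat \<Rightarrow> nat list" where
  "alt_word i j 0 = []"
| "alt_word i j (Suc k) = i # alt_word j i k"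

text \<open>Equality in the Coxeter group of words in its generators.\<close>

inductive coxeter_eq :: "(nat \<Rightarrow> nat \<Rightarrow> nat) \<Rightarrow> nat \<Rightarrow> nat list \<Rightarrow> nat list \<Rightarrow> bool"
  for m n where
  refl: "x \<in> lists {..<n} \<Longrightarrow> coxeter_eq m n x x"
| sym: "coxeter_eq m n x y \<Longrightarrow> coxeter_eq m n y x"
| trans: "coxeter_eq m n x y \<Longrightarrow> coxeter_eq m n y z \<Longrightarrow> coxeter_eq m n x z"
| square: "\<lbrakk>i < n; p \<in> lists {..<n}; q \<in> lists {..<n}\<rbrakk>
    \<Longrightarrow> coxeter_eq m n (p @ [i, i] @ q) (p @ q)"
| braid: "\<lbrakk>i < n; j < n; i \<noteq> j; p \<in> lists {..<n}; q \<in> lists {..<n}\<rbrakk>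
    \<Longrightarrow> coxeter_eq m n (p @ alt_word i j (m i j) @ q) (p @ alt_word j i (m i j) @ q)"

definition coxeter_rel :: "(nat \<Rightarrow> nat \<Rightarrow> nat) \<Rightarrow> nat \<Rightarrow> (nat list \<times> nat list) set" where
  "coxeter_rel m n = {(x, y). coxeter_eq m n x y}"

text \<open>Group elements are classes of words, so \<open>rev ` w\<close> is the inverse of \<open>w\<close>.\<close>

definition coxeter_group :: "(nat \<Rightarrow> nat \<Rightarrow> nat) \<Rightarrow> nat \<Rightarrow> nat list set set" where
  "coxeter_group m n = lists {..<n} // coxeter_rel m n"

definition coxeter_one :: "(nat \<Rightarrow> nat \<Rightarrow> nat) \<Rightarrow> nat \<Rightarrow> nat list set" where
  "coxeter_one m n = coxeter_rel m n `` {[]}"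

definition reduced_word :: "nat list set \<Rightarrow> nat list" where
  "reduced_word w = (ARG_MIN length x. x \<in> w)"


section \<open>Iwahori-Hecke algebras\<close>

text \<open>Words form a monoid under concatenation, so that finitely supported functions on words,
  with the convolution product of \<open>Poly_Mapping\<close>, are the free associative algebra.\<close>

instantiation list :: (type) monoid_add
begin
definition zero_list :: "'a list" where "zero_list = []"
definition plus_list :: "'a list \<Rightarrow> 'a list \<Rightarrow> 'a list" where "plus_list = (@)"
instance by standard (simp_all add: zero_list_def plus_list_def)
end

type_synonym free_elt = "nat list \<Rightarrow>\<^sub>0 qv"

definition free_word :: "nat list \<Rightarrow> free_elt" where
  "free_word x = Poly_Mapping.single x 1"

definition free_const :: "qv \<Rightarrow> free_elt" where
  "free_const c = Poly_Mapping.single [] c"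

definition free_algebra :: "nat \<Rightarrow> free_elt ring" where
  "free_algebra n =
    \<lparr>carrier = {f. Poly_Mapping.keys f \<subseteq> lists {..<n}}, monoid.mult = (*), one = 1, zero = 0, add = (+)\<rparr>"

definition hecke_relations :: "(nat \<Rightarrow> nat \<Rightarrow> nat) \<Rightarrow> nat \<Rightarrow> free_elt set" where
  "hecke_relations m n =
    {free_word (alt_word i j (m i j)) - free_word (alt_word j i (m i j)) | i j.
       i < n \<and> j < n \<and> i \<noteq> j}
    \<union> {(free_word [i] - free_const v_var) * (free_word [i] + free_const (inverse v_var)) | i. i < n}"

definition hecke_ideal :: "(nat \<Rightarrow> nat \<Rightarrow> nat) \<Rightarrow> nat \<Rightarrow> free_elt set" where
  "hecke_ideal m n = genideal (free_algebra n) (hecke_relations m n)"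

definition hecke :: "(nat \<Rightarrow> nat \<Rightarrow> nat) \<Rightarrow> nat \<Rightarrow> free_elt set ring" where
  "hecke m n = free_algebra n Quot hecke_ideal m n"

abbreviation hecke_B :: "nat \<Rightarrow> free_elt set ring" where
  "hecke_B \<equiv> hecke coxeter_B"

abbreviation hecke_D :: "nat \<Rightarrow> free_elt set ring" where
  "hecke_D \<equiv> hecke coxeter_D"

definition hecke_class :: "(nat \<Rightarrow> nat \<Rightarrow> nat) \<Rightarrow> nat \<Rightarrow> free_elt \<Rightarrow> free_elt set" where
  "hecke_class m n f = hecke_ideal m n +>\<^bsub>free_algebra n\<^esub> f"

definition hecke_gen :: "(nat \<Rightarrow> nat \<Rightarrow> nat) \<Rightarrow> nat \<Rightarrow> nat \<Rightarrow> free_elt set" where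
  "hecke_gen m n i = hecke_class m n (free_word [i])"

definition hecke_smult ::
    "(nat \<Rightarrow> nat \<Rightarrow> nat) \<Rightarrow> nat \<Rightarrow> qv \<Rightarrow> free_elt set \<Rightarrow> free_elt set" where
  "hecke_smult m n c h = hecke_class m n (free_const c) \<otimes>\<^bsub>hecke m n\<^esub> h"

text \<open>The product of a list of elements, in the order of the list.\<close>

definition hecke_prod ::
    "(nat \<Rightarrow> nat \<Rightarrow> nat) \<Rightarrow> nat \<Rightarrow> free_elt set list \<Rightarrow> free_elt set" where
  "hecke_prod m n xs = foldr (monoid.mult (hecke m n)) xs \<one>\<^bsub>hecke m n\<^esub>"

definition hecke_T :: "(nat \<Rightarrow> nat \<Rightarrow> nat) \<Rightarrow> nat \<Rightarrow> nat list set \<Rightarrow> free_elt set" where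
  "hecke_T m n w = hecke_prod m n (map (hecke_gen m n) (reduced_word w))"

text \<open>The map $\mathcal{H}(X_{n-1}) \to \mathcal{H}(X_n)$ sends the class of \<open>f\<close> to the class
  of \<open>f\<close>; since the ideals are nested, the union below is a single class.\<close>

definition hecke_embed ::
    "(nat \<Rightarrow> nat \<Rightarrow> nat) \<Rightarrow> nat \<Rightarrow> free_elt set \<Rightarrow> free_elt set" where
  "hecke_embed m n h = (\<Union>f\<in>h. hecke_class m n f)"


section \<open>The pairing\<close>

definition hecke_bar ::
    "(nat \<Rightarrow> nat \<Rightarrow> nat) \<Rightarrow> nat \<Rightarrow> free_elt set \<Rightarrow> free_elt set" where
  "hecke_bar m n = (THE f.
     f \<in> ring_hom (hecke m n) (hecke m n) \<and> f \<in> extensional (carrier (hecke m n)) \<and>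
     (\<forall>h\<in>carrier (hecke m n). f (f h) = h) \<and>
     (\<forall>q. \<forall>h\<in>carrier (hecke m n).
        f (hecke_smult m n (q_const q) h) = hecke_smult m n (q_const q) (f h)) \<and>
     f (hecke_class m n (free_const v_var)) = hecke_class m n (free_const (inverse v_var)) \<and>
     (\<forall>w\<in>coxeter_group m n.
        f (hecke_T m n w) = inv\<^bsub>hecke m n\<^esub> (hecke_T m n (rev ` w))))"

definition hecke_anti ::
    "(nat \<Rightarrow> nat \<Rightarrow> nat) \<Rightarrow> nat \<Rightarrow> free_elt set \<Rightarrow> free_elt set" where
  "hecke_anti m n = (THE f.
     f \<in> carrier (hecke m n) \<rightarrow>\<^sub>E carrier (hecke m n) \<and>
     (\<forall>h\<in>carrier (hecke m n). \<forall>h'\<in>carrier (hecke m n).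
        f (h \<oplus>\<^bsub>hecke m n\<^esub> h') = f h \<oplus>\<^bsub>hecke m n\<^esub> f h' \<and>
        f (h \<otimes>\<^bsub>hecke m n\<^esub> h') = f h' \<otimes>\<^bsub>hecke m n\<^esub> f h) \<and>
     (\<forall>c. \<forall>h\<in>carrier (hecke m n). f (hecke_smult m n c h) = hecke_smult m n c (f h)) \<and>
     (\<forall>h\<in>carrier (hecke m n). f (f h) = h) \<and>
     (\<forall>w\<in>coxeter_group m n. f (hecke_T m n w) = hecke_T m n (rev ` w)))"

definition hecke_tau :: "(nat \<Rightarrow> nat \<Rightarrow> nat) \<Rightarrow> nat \<Rightarrow> free_elt set \<Rightarrow> qv" where
  "hecke_tau m n h = (THE c. c \<in> extensional (coxeter_group m n) \<and>
     h = (\<Oplus>\<^bsub>hecke m n\<^esub>w\<in>coxeter_group m n.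
            hecke_smult m n (c w) (inv\<^bsub>hecke m n\<^esub> (hecke_T m n w)))) (coxeter_one m n)"

definition pairing ::
    "(nat \<Rightarrow> nat \<Rightarrow> nat) \<Rightarrow> nat \<Rightarrow> free_elt set \<Rightarrow> free_elt set \<Rightarrow> qv" where
  "pairing m n h h' =
     hecke_tau m n (hecke_anti m n (hecke_bar m n h) \<otimes>\<^bsub>hecke m n\<^esub> h')"


section \<open>Markov traces\<close>

definition markov_trace ::
    "(nat \<Rightarrow> nat \<Rightarrow> nat) \<Rightarrow> nat \<Rightarrow> qva \<Rightarrow> qva \<Rightarrow> (nat \<Rightarrow> free_elt set \<Rightarrow> qva) \<Rightarrow> bool"
  where
  "markov_trace m n0 \<rho> \<mu> \<phi> \<longleftrightarrow>
    (\<forall>n\<ge>n0. \<forall>h\<in>carrier (hecke m n). \<forall>h'\<in>carrier (hecke m n).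
       \<phi> n (h \<oplus>\<^bsub>hecke m n\<^esub> h') = \<phi> n h + \<phi> n h') \<and>
    (\<forall>n\<ge>n0. \<forall>c. \<forall>h\<in>carrier (hecke m n).
       \<phi> n (hecke_smult m n c h) = qva_const c * \<phi> n h) \<and>
    (\<forall>n\<ge>n0. \<forall>h\<in>carrier (hecke m n). \<forall>h'\<in>carrier (hecke m n).
       \<phi> n (h \<otimes>\<^bsub>hecke m n\<^esub> h') = \<phi> n (h' \<otimes>\<^bsub>hecke m n\<^esub> h)) \<and>
    (\<forall>n>n0. \<forall>h\<in>carrier (hecke m (n - 1)).
       \<phi> n (hecke_embed m n h) = \<rho> * \<phi> (n - 1) h) \<and>
    (\<forall>n>n0. \<forall>h\<in>carrier (hecke m (n - 1)).
       \<phi> n (hecke_embed m n h \<otimes>\<^bsub>hecke m n\<^esub> hecke_gen m n (n - 1)) = \<mu> * \<phi> (n - 1) h)"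

text \<open>In the following elements, the first argument \<open>n\<close> is the rank of the algebra in which
  the element is formed. In \<open>U_elt\<close> and \<open>jm_D\<close> the letter \<open>0\<close> is $1'$.\<close>

definition T_elt :: "nat \<Rightarrow> nat \<Rightarrow> free_elt set" where
  "T_elt n i = hecke_prod coxeter_B n
     (map (hecke_gen coxeter_B n) (rev [0..<i])
      @ map (\<lambda>k. inv\<^bsub>hecke_B n\<^esub> (hecke_gen coxeter_B n k)) [1..<i])"

definition U_elt :: "nat \<Rightarrow> nat \<Rightarrow> free_elt set" where
  "U_elt n i = (if i \<le> 1 then \<one>\<^bsub>hecke_D n\<^esub> else hecke_prod coxeter_D n
     (map (hecke_gen coxeter_D n) (rev [2..<i] @ [0])
      @ map (\<lambda>k. inv\<^bsub>hecke_D n\<^esub> (hecke_gen coxeter_D n k)) [1..<i]))"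

definition geometric_trace_B :: "(nat \<Rightarrow> free_elt set \<Rightarrow> qva) \<Rightarrow> bool" where
  "geometric_trace_B \<phi> \<longleftrightarrow>
     markov_trace coxeter_B 1 (1 + a_var) (qva_const alpha) \<phi> \<and>
     (\<forall>n\<ge>1. \<phi> n \<one>\<^bsub>hecke_B n\<^esub> = (1 + a_var) ^ n) \<and>
     (\<forall>n\<ge>1. \<phi> n (hecke_prod coxeter_B n (map (T_elt n) [1..<n + 1])) = qva_const alpha ^ n)"

definition geometric_trace_D :: "(nat \<Rightarrow> free_elt set \<Rightarrow> qva) \<Rightarrow> bool" where
  "geometric_trace_D \<phi> \<longleftrightarrow>
     markov_trace coxeter_D 2 (1 + a_var) (qva_const alpha) \<phi> \<and>
     (\<forall>n\<ge>2. \<phi> n \<one>\<^bsub>hecke_D n\<^esub> = (1 + a_var) ^ n) \<and>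
     (\<forall>m\<ge>1. \<phi> (2 * m) (hecke_prod coxeter_D (2 * m) (map (U_elt (2 * m)) [1..<2 * m + 1]))
              = (- (qva_const alpha ^ 2) * a_var) ^ m)"


section \<open>Symmetric polynomials in Jucys-Murphy elements\<close>

definition jm_B :: "nat \<Rightarrow> nat \<Rightarrow> free_elt set" where
  "jm_B n i = hecke_prod coxeter_B n (map (hecke_gen coxeter_B n) (rev [0..<i] @ [1..<i]))"

definition JM_B :: "nat \<Rightarrow> nat \<Rightarrow> free_elt set" where
  "JM_B n i = jm_B n i [^]\<^bsub>hecke_B n\<^esub> (2 :: nat)"

definition jm_D :: "nat \<Rightarrow> nat \<Rightarrow> free_elt set" where
  "jm_D n i = (if i \<le> 1 then \<one>\<^bsub>hecke_D n\<^esub>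
     else hecke_prod coxeter_D n (map (hecke_gen coxeter_D n) (rev [2..<i] @ [0] @ [1..<i])))"

text \<open>Multivariate polynomials over $\mathbb{Q}(v)$ are finitely supported functions on
  monomials \<open>nat \<Rightarrow>\<^sub>0 nat\<close>.\<close>

type_synonym qv_mpoly = "(nat \<Rightarrow>\<^sub>0 nat) \<Rightarrow>\<^sub>0 qv"

definition mvar :: "nat \<Rightarrow> qv_mpoly" where
  "mvar i = Poly_Mapping.single (Poly_Mapping.single i 1) 1"

definition mconst :: "qv \<Rightarrow> qv_mpoly" where
  "mconst c = Poly_Mapping.single 0 c"

definition homogeneous_part :: "nat \<Rightarrow> qv_mpoly \<Rightarrow> qv_mpoly" where
  "homogeneous_part d p =
     (\<Sum>t\<in>{t \<in> Poly_Mapping.keys p. (\<Sum>i\<in>Poly_Mapping.keys t. Poly_Mapping.lookup t i) = d}.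
        Poly_Mapping.single t (Poly_Mapping.lookup p t))"

definition elem_sym :: "nat \<Rightarrow> nat \<Rightarrow> qv_mpoly" where
  "elem_sym n k = (\<Sum>A\<in>{A. A \<subseteq> {1..n} \<and> card A = k}. \<Prod>i\<in>A. mvar i)"

definition elem_sym' :: "nat \<Rightarrow> nat \<Rightarrow> qv_mpoly" where
  "elem_sym' n k =
     homogeneous_part (2 * k) (\<Prod>i=1..n. 1 + mconst alpha * mvar i - mvar i ^ 2)"

text \<open>Evaluation at a family \<open>J\<close> of commuting elements; within a monomial the powers are
  multiplied in increasing order of the index.\<close>

definition hecke_eval ::
    "(nat \<Rightarrow> nat \<Rightarrow> nat) \<Rightarrow> nat \<Rightarrow> qv_mpoly \<Rightarrow> (nat \<Rightarrow> free_elt set) \<Rightarrow> free_elt set" where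
  "hecke_eval m n p J =
     (\<Oplus>\<^bsub>hecke m n\<^esub>t\<in>Poly_Mapping.keys p. hecke_smult m n (Poly_Mapping.lookup p t)
        (hecke_prod m n (map (\<lambda>i. J i [^]\<^bsub>hecke m n\<^esub> Poly_Mapping.lookup t i)
           (sorted_list_of_set (Poly_Mapping.keys t)))))"


section \<open>Basic facts\<close>

lemma v_var_nonzero: "v_var \<noteq> 0"
  by (simp add: v_var_def Zero_fract_def eq_fract)

lemma elem_sym'_factorization:
  "(\<Prod>i=1..n. 1 + mconst alpha * mvar i - mvar i ^ 2) =
   (\<Prod>i=1..n. (mconst v_var - mvar i) * (mconst (inverse v_var) + mvar i))"
proof (rule prod.cong[OF HOL.refl])
  fix i
  have 1: "mconst v_var * mconst (inverse v_var) = 1"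
    using v_var_nonzero by (simp add: mconst_def mult_single)
  have 2: "mconst alpha = mconst v_var - mconst (inverse v_var)"
    by (simp add: mconst_def alpha_def single_diff)
  have "(mconst v_var - mvar i) * (mconst (inverse v_var) + mvar i) =
        mconst v_var * mconst (inverse v_var) + (mconst v_var - mconst (inverse v_var)) * mvar i
        - mvar i ^ 2"
    by (simp add: algebra_simps power2_eq_square)
  then show "1 + mconst alpha * mvar i - mvar i ^ 2 =
        (mconst v_var - mvar i) * (mconst (inverse v_var) + mvar i)"
    by (simp only: 1 2)
qed

lemma free_algebra_ring: "ring (free_algebra n)"
proof (rule ringI)
  show "abelian_group (free_algebra n)"
  proof (rule abelian_groupI)
    fix x y assume "x \<in> carrier (free_algebra n)" "y \<in> carrier (free_algebra n)"
    then show "x \<oplus>\<^bsub>free_algebra n\<^esub> y \<in> carrier (free_algebra n)"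
      using keys_add[of x y] by (simp add: free_algebra_def) blast
  next
    fix x assume "x \<in> carrier (free_algebra n)"
    then have "- x \<in> carrier (free_algebra n)"
      by (simp add: free_algebra_def subset_iff in_keys_iff)
    then show "\<exists>y\<in>carrier (free_algebra n). y \<oplus>\<^bsub>free_algebra n\<^esub> x = \<zero>\<^bsub>free_algebra n\<^esub>"
      by (intro bexI[of _ "- x"]) (simp_all add: free_algebra_def)
  qed (simp_all add: free_algebra_def add.assoc add.commute)
  show "monoid (free_algebra n)"
  proof (rule monoidI)
    fix x y assume "x \<in> carrier (free_algebra n)" "y \<in> carrier (free_algebra n)"
    then have x: "Poly_Mapping.keys x \<subseteq> lists {..<n}" and y: "Poly_Mapping.keys y \<subseteq> lists {..<n}"
      by (simp_all add: free_algebra_def)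
    have "Poly_Mapping.keys (x * y) \<subseteq> lists {..<n}"
    proof
      fix t assume "t \<in> Poly_Mapping.keys (x * y)"
      then obtain r s where "t = r @ s" "r \<in> Poly_Mapping.keys x" "s \<in> Poly_Mapping.keys y"
        using keys_mult[of x y] unfolding plus_list_def by blast
      moreover with x y have "r \<in> lists {..<n}" "s \<in> lists {..<n}"
        by (blast, blast)
      ultimately show "t \<in> lists {..<n}"
        by simp
    qed
    then show "x \<otimes>\<^bsub>free_algebra n\<^esub> y \<in> carrier (free_algebra n)"
      by (simp add: free_algebra_def)
  qed (simp_all add: free_algebra_def zero_list_def mult.assoc)
qed (simp_all add: free_algebra_def distrib_left distrib_right)

lemma hecke_relations_carrier: "hecke_relations m n \<subseteq> carrier (free_algebra n)"
proof -
  interpret ring "free_algebra n" by (rule free_algebra_ring)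
  have word: "free_word x \<in> carrier (free_algebra n)" if "x \<in> lists {..<n}" for x
    using that by (simp add: free_algebra_def free_word_def)
  have const: "free_const c \<in> carrier (free_algebra n)" for c
    by (simp add: free_algebra_def free_const_def)
  have diff: "x - y \<in> carrier (free_algebra n)"
    if "x \<in> carrier (free_algebra n)" "y \<in> carrier (free_algebra n)" for x y
    using that by (simp add: free_algebra_def subset_iff in_keys_iff lookup_minus del: in_lists_conv_set)
      (metis diff_self)
  have alt: "alt_word i j k \<in> lists {..<n}" if "i < n" "j < n" for i j k
    using that by (induction k arbitrary: i j) auto
  have add_mult: "x + y \<in> carrier (free_algebra n)" "x * y \<in> carrier (free_algebra n)"
    if "x \<in> carrier (free_algebra n)" "y \<in> carrier (free_algebra n)" for x y
    using add.m_closed[OF that] m_closed[OF that] by (simp_all add: free_algebra_def)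
  have "free_word (alt_word i j k) - free_word (alt_word j i k) \<in> carrier (free_algebra n)"
    if "i < n" "j < n" for i j k
    by (intro diff word alt that)
  moreover have "(free_word [i] - free_const v_var) * (free_word [i] + free_const (inverse v_var))
      \<in> carrier (free_algebra n)" if "i < n" for i
    using that by (intro add_mult diff word const) auto
  ultimately show ?thesis
    unfolding hecke_relations_def by blast
qed

lemma hecke_ideal_ideal: "ideal (hecke_ideal m n) (free_algebra n)"
  unfolding hecke_ideal_def
  by (rule ring.genideal_ideal[OF free_algebra_ring hecke_relations_carrier])

lemma hecke_ring: "ring (hecke m n)"
  unfolding hecke_def by (rule ideal.quotient_is_ring[OF hecke_ideal_ideal])

end

theory Submission
  imports Defs "HOL-Computational_Algebra.Formal_Power_Series" "HOL-Combinatorics.Transposition"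
begin

text \<open>The map $h \mapsto i(\overline{h})$ sends a Jucys-Murphy element $j_i$ to its inverse $y_i$, so the
  claim is that $\mathrm{tr}^{X,k}(h) = (-1)^k \tau(F_{2k} h)$, where $F_d$ is the coefficient of $X^d$ in
  $\prod_i (1 - \kappa y_i X - y_i^2 X^2)$, with $\kappa = 0$ in type B and $\kappa = \alpha$ in type D. The
  functionals on the right-hand side form a Markov trace because the $F_d$ commute with all $t_i$, $i \ge 1$,
  and because the conditional expectation $E$ onto the next smaller algebra satisfies
  $E(1) = E(y^2) = 1$, $E(y) = E(y t) = E(y^2 t) = 0$ and $E(t) = \alpha$ at the top level. Since
  $E(y T) = 1$, $E(y^2 T) = 0$ and $E(T)$ is the quadratic parameter of $t_0$, it takes the prescribed values
  on the products of the $T_i$, and these determine a Markov trace.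

  Both types are treated at once: the crossed product of $\mathcal{H}(D_n)$ with its diagram automorphism
  $\varsigma$ is an algebra of type B in which $t_0 = \varsigma$ has quadratic parameter $0$. All algebras are
  realised as operators on functions on the group, where $\tau$ is the matrix entry at the identity.\<close>

section \<open>Coxeter groups and Matsumoto's theorem\<close>

text \<open>The pairing reads coefficients in the basis of the inverses of the t_w, and this shapes
  the argument: up to \<varsigma>, y_i is a single element of that basis, so its expectation
  vanishes, while t = t^{-1} + \<alpha> has expectation \<alpha>, the constant of (M2). A factor 1 -
  \<kappa> y X - y^2 X^2 then multiplies the functional of the smaller algebra by 1 - X^2, and the
  substitution a = -X^2 makes this the constant 1 + a of (U1); hence the sign (-1)^k. In type D the
  coefficient of X is -\<alpha> because the bar involution negates \<alpha>. The prescribed values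
  arise in different ways. In type B each factor T contributes \<alpha> in degree 0. In type D the
  expectation of T is 0, and each factor contributes -\<alpha> in degree 1 through E(y T), which
  gives (-\<alpha>)^n in degree n, that is (-\<alpha>^2 a)^m for n = 2m. The obstacle is that the
  Hecke algebras are quotients of free algebras and that the bar involution, i and \<tau> are given
  by descriptions. All of this becomes computable in one representation that serves every rank; its
  faithfulness and the finiteness of the groups have to be established.\<close>

inductive ceq :: "(nat \<Rightarrow> nat \<Rightarrow> nat) \<Rightarrow> nat list \<Rightarrow> nat list \<Rightarrow> bool" for m where
  ceq_refl: "ceq m x x"
| ceq_sym: "ceq m x y \<Longrightarrow> ceq m y x"
| ceq_trans: "ceq m x y \<Longrightarrow> ceq m y z \<Longrightarrow> ceq m x z"
| ceq_square: "ceq m (p @ [i, i] @ q) (p @ q)"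
| ceq_braid: "i \<noteq> j \<Longrightarrow> ceq m (p @ alt_word i j (m i j) @ q) (p @ alt_word j i (m i j) @ q)"

lemma length_alt_word [simp]: "length (alt_word i j k) = k"
  by (induction k arbitrary: i j) auto

lemma set_alt_word: "set (alt_word i j k) \<subseteq> {i, j}"
proof (induction k arbitrary: i j)
  case (Suc k) then show ?case using Suc[of j i] by auto
qed simp

lemma alt_word_append:
  "alt_word i j (a + b) = alt_word i j a @ (if even a then alt_word i j b else alt_word j i b)"
  by (induction a arbitrary: i j) auto

lemma rev_alt_word: "rev (alt_word i j k) = (if odd k then alt_word i j k else alt_word j i k)"
proof (induction k arbitrary: i j)
  case (Suc k)
  have "alt_word i j (Suc k) = alt_word i j k @ (if even k then [i] else [j])"
    using alt_word_append[of i j k 1] by simp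
  then have "rev (alt_word i j (Suc k)) = (if even k then [i] else [j]) @ rev (alt_word i j k)"
    by (simp del: alt_word.simps)
  then show ?case using Suc[of i j] by simp
qed simp

text \<open>\<open>ceq\<close> admits all natural numbers as letters and so describes one group of
  infinite rank that contains the groups of all finite ranks. The converse for words in the first n
  letters needs Matsumoto's theorem and is part of \<open>coxeter_eq_iff\<close>.\<close>

lemma coxeter_eq_ceq: "coxeter_eq m n x y \<Longrightarrow> ceq m x y"
proof (induction rule: coxeter_eq.induct)
  case (square i p q)
  show ?case by (rule ceq_square)
next
  case (braid i j p q)
  show ?case by (rule ceq_braid) fact
qed (blast intro: ceq.intros)+

lemma coxeter_eq_lists: "coxeter_eq m n x y \<Longrightarrow> x \<in> lists {..<n} \<and> y \<in> lists {..<n}"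
proof (induction rule: coxeter_eq.induct)
  case (braid i j p q)
  then show ?case using set_alt_word[of i j "m i j"] set_alt_word[of j i "m i j"]
    by (auto simp: in_lists_conv_set)
qed auto

lemma ceq_cong: "ceq m x y \<Longrightarrow> ceq m (p @ x @ q) (p @ y @ q)"
proof (induction rule: ceq.induct)
  case (ceq_square a i b)
  then show ?case using ceq.ceq_square[of m "p @ a" i "b @ q"] by simp
next
  case (ceq_braid i j a b)
  then show ?case using ceq.ceq_braid[of i j m "p @ a" "b @ q"] by simp
qed (blast intro: ceq.intros)+

lemma ceq_append: "ceq m x y \<Longrightarrow> ceq m x' y' \<Longrightarrow> ceq m (x @ x') (y @ y')"
  using ceq_cong[of m x y "[]" x'] ceq_cong[of m x' y' y "[]"] ceq_trans by fastforce

lemma ceq_rev_right: "ceq m (x @ rev x) []"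
proof (induction x)
  case (Cons i x)
  have "ceq m ([i] @ (x @ rev x) @ [i]) ([i] @ [] @ [i])" by (rule ceq_cong[OF Cons])
  moreover have "ceq m ([] @ [i, i] @ []) ([] @ [])" by (rule ceq_square)
  ultimately show ?case using ceq_trans by fastforce
qed (simp add: ceq_refl)

lemma ceq_rev_left: "ceq m (rev x @ x) []"
  using ceq_rev_right[of m "rev x"] by simp

lemma ceq_rev_left': "ceq m (p @ rev x @ x @ q) (p @ q)"
  using ceq_cong[OF ceq_rev_left[of m x], of p q] by simp

lemma ceq_rev_right': "ceq m (p @ x @ rev x @ q) (p @ q)"
  using ceq_cong[OF ceq_rev_right[of m x], of p q] by simp

lemma ceq_move_left: "ceq m (p @ x) y \<longleftrightarrow> ceq m x (rev p @ y)"
proof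
  assume "ceq m (p @ x) y"
  then have "ceq m (rev p @ p @ x) (rev p @ y)" by (rule ceq_append[OF ceq_refl])
  then show "ceq m x (rev p @ y)" using ceq_rev_left'[of m "[]" p x] by (auto intro: ceq_trans ceq_sym)
next
  assume "ceq m x (rev p @ y)"
  then have "ceq m (p @ x) (p @ rev p @ y)" by (rule ceq_append[OF ceq_refl])
  then show "ceq m (p @ x) y" using ceq_rev_right'[of m "[]" p y] by (auto intro: ceq_trans ceq_sym)
qed

lemma ceq_move_right: "ceq m (x @ p) y \<longleftrightarrow> ceq m x (y @ rev p)"
proof
  assume "ceq m (x @ p) y"
  then have "ceq m ((x @ p) @ rev p) (y @ rev p)" by (rule ceq_append[OF _ ceq_refl])
  then show "ceq m x (y @ rev p)" using ceq_rev_right'[of m x p "[]"] by (auto intro: ceq_trans ceq_sym)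
next
  assume "ceq m x (y @ rev p)"
  then have "ceq m (x @ p) ((y @ rev p) @ p)" by (rule ceq_append[OF _ ceq_refl])
  then show "ceq m (x @ p) y" using ceq_rev_left'[of m y p "[]"] by (auto intro: ceq_trans ceq_sym)
qed

lemma ceq_eq_iff: "ceq m x y \<longleftrightarrow> ceq m (x @ rev y) []"
  using ceq_move_right[of m x "rev y" "[]"] by simp

lemma ceq_left_cancel [simp]: "ceq m (p @ x) (p @ y) \<longleftrightarrow> ceq m x y"
  by (metis ceq_append ceq_move_left ceq_refl ceq_rev_left' append_Nil ceq_sym ceq_trans)

lemma ceq_cong_iff: "ceq m x x' \<Longrightarrow> ceq m y y' \<Longrightarrow> ceq m x y \<longleftrightarrow> ceq m x' y'"
  by (meson ceq_sym ceq_trans)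

text \<open>The reflection cocycle: a word i_1 ... i_k has the reflections i_1 ... i_l ... i_1, and
  this is the parity of the number of those that equal \<open>r\<close>. The recursion splits off
  the first letter and conjugates the rest. The parity, unlike the number, depends only on the group
  element, see \<open>nu_ceq\<close>.\<close>

fun nu :: "(nat \<Rightarrow> nat \<Rightarrow> nat) \<Rightarrow> nat list \<Rightarrow> nat list \<Rightarrow> bool" where
  "nu m [] r = False"
| "nu m (i # x) r = (ceq m r [i] \<noteq> nu m x ([i] @ r @ [i]))"

declare nu.simps(2) [simp del]

lemma nu_cong: "ceq m r r' \<Longrightarrow> nu m x r = nu m x r'"
proof (induction x arbitrary: r r')
  case (Cons i x)
  have "ceq m ([i] @ r @ [i]) ([i] @ r' @ [i])" by (rule ceq_cong[OF Cons.prems])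
  then have "nu m x ([i] @ r @ [i]) = nu m x ([i] @ r' @ [i])" by (rule Cons.IH)
  moreover have "ceq m r [i] = ceq m r' [i]" using Cons.prems ceq_refl by (rule ceq_cong_iff)
  ultimately show ?case by (simp add: nu.simps)
qed simp

lemma nu_append: "nu m (x @ y) r = (nu m x r \<noteq> nu m y (rev x @ r @ x))"
proof (induction x arbitrary: r)
  case (Cons i x)
  show ?case using Cons[of "[i] @ r @ [i]"] by (simp add: nu.simps) blast
qed simp

lemma nu_singleton: "nu m [i] r = ceq m r [i]"
  by (simp add: nu.simps)

lemma ceq_conj: "ceq m ([i] @ r @ [i]) y \<longleftrightarrow> ceq m r ([i] @ y @ [i])"
  using ceq_move_left[of m "[i]" "r @ [i]" y] ceq_move_right[of m r "[i]" "[i] @ y"] by simp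

lemma alt_word_conj: "[i] @ alt_word j i (2 * l + 1) @ [i] = alt_word i j (2 * Suc l + 1)"
  using alt_word_append[of i j "2 * l + 2" 1] by simp

text \<open>The reflections of an alternating word are the alternating words of odd length.
  Conjugation by the first letter lengthens them by two, which shifts the index l in the
  induction.\<close>

lemma nu_alt_word:
  "nu m (alt_word i j k) r \<longleftrightarrow> odd (card {l. l < k \<and> ceq m r (alt_word i j (2 * l + 1))})"
proof (induction k arbitrary: i j r)
  case (Suc k)
  let ?A = "{l. l < k \<and> ceq m ([i] @ r @ [i]) (alt_word j i (2 * l + 1))}"
  have A: "?A = {l. l < k \<and> ceq m r (alt_word i j (2 * Suc l + 1))}"
    by (subst ceq_conj) (simp only: alt_word_conj)
  have split: "{l. l < Suc k \<and> ceq m r (alt_word i j (2 * l + 1))} =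
      (if ceq m r [i] then insert 0 (Suc ` ?A) else Suc ` ?A)" (is "?L = ?R")
  proof (rule Set.set_eqI)
    fix l
    have "alt_word i j (2 * 0 + 1) = [i]" by simp
    then show "l \<in> ?L \<longleftrightarrow> l \<in> ?R"
      unfolding A by (cases l) (auto simp del: alt_word.simps)
  qed
  have "card (Suc ` ?A) = card ?A" by (rule card_image) simp
  moreover have "finite ?A" by simp
  ultimately have "card {l. l < Suc k \<and> ceq m r (alt_word i j (2 * l + 1))} =
      (if ceq m r [i] then 1 else 0) + card ?A"
    unfolding split by (auto simp: card_insert_if)
  then show ?case using Suc[of j i "[i] @ r @ [i]"] by (simp add: nu.simps)
qed simp

lemma alt_word_even_ceq:
  assumes "ceq m (alt_word i j k) (alt_word j i k)"
  shows "ceq m (alt_word i j (2 * k)) []"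
proof -
  have "alt_word i j (2 * k) = alt_word i j k @ rev (alt_word j i k)"
    using alt_word_append[of i j k k] by (simp add: rev_alt_word mult_2)
  also have "ceq m \<dots> (alt_word j i k @ rev (alt_word j i k))"
    by (rule ceq_append[OF assms ceq_refl])
  finally show ?thesis using ceq_rev_right ceq_trans by blast
qed

text \<open>Both sides of a braid relation have the same reflections, in opposite order. An
  alternating word of length 2m is trivial, so the palindrome of length 2l + 1 that begins with i
  equals the palindrome of the complementary length 2(m - 1 - l) + 1 that begins with j.\<close>

lemma nu_braid:
  assumes "i \<noteq> j"
  shows "nu m (alt_word i j (m i j)) r = nu m (alt_word j i (m i j)) r"
proof -
  let ?k = "m i j"
  have c: "ceq m (alt_word i j (2 * ?k)) []"
    using alt_word_even_ceq ceq_braid[OF assms, of m "[]" "[]"] by simp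
  have flip: "ceq m (alt_word i j (2 * l + 1)) (alt_word j i (2 * (?k - 1 - l) + 1))" if "l < ?k" for l
  proof -
    have e: "(2 * l + 1) + (2 * (?k - 1 - l) + 1) = 2 * ?k" using that by simp
    have "alt_word i j (2 * ?k) = alt_word i j (2 * l + 1) @ alt_word j i (2 * (?k - 1 - l) + 1)"
      unfolding e[symmetric] alt_word_append by simp
    moreover have "rev (alt_word j i (2 * (?k - 1 - l) + 1)) = alt_word j i (2 * (?k - 1 - l) + 1)"
      using rev_alt_word[of j i "2 * (?k - 1 - l) + 1"] by simp
    ultimately show ?thesis
      using c ceq_eq_iff by metis
  qed
  have "card {l. l < ?k \<and> ceq m r (alt_word i j (2 * l + 1))}
      = card {l. l < ?k \<and> ceq m r (alt_word j i (2 * l + 1))}"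
  proof (rule bij_betw_same_card[of "\<lambda>l. ?k - 1 - l"], rule bij_betwI[where g = "\<lambda>l. ?k - 1 - l"])
    show "(\<lambda>l. ?k - 1 - l) \<in> {l. l < ?k \<and> ceq m r (alt_word i j (2 * l + 1))} \<rightarrow>
        {l. l < ?k \<and> ceq m r (alt_word j i (2 * l + 1))}"
      using flip by (auto intro: ceq_trans)
    show "(\<lambda>l. ?k - 1 - l) \<in> {l. l < ?k \<and> ceq m r (alt_word j i (2 * l + 1))} \<rightarrow>
        {l. l < ?k \<and> ceq m r (alt_word i j (2 * l + 1))}"
    proof (rule funcsetI, simp only: mem_Collect_eq, elim conjE, intro conjI)
      fix l assume l: "l < ?k" "ceq m r (alt_word j i (2 * l + 1))"
      then show "?k - 1 - l < ?k" by simp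
      have "?k - 1 - (?k - 1 - l) = l" using l by simp
      then have "ceq m (alt_word i j (2 * (?k - 1 - l) + 1)) (alt_word j i (2 * l + 1))"
        using flip[of "?k - 1 - l"] l by simp
      then show "ceq m r (alt_word i j (2 * (?k - 1 - l) + 1))" using l ceq_trans ceq_sym by blast
    qed
  qed auto
  then show ?thesis by (simp add: nu_alt_word)
qed

lemma nu_ceq: "ceq m x y \<Longrightarrow> nu m x r = nu m y r"
proof (induction arbitrary: r rule: ceq.induct)
  case (ceq_square p i q)
  let ?r = "rev p @ r @ p"
  have "nu m (p @ [i, i] @ q) r = (nu m p r \<noteq> (nu m [i, i] ?r \<noteq> nu m q ([i, i] @ ?r @ [i, i])))"
    unfolding nu_append[of m p] nu_append[of m "[i, i]" q] by simp
  moreover have "nu m [i, i] ?r = False"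
    using ceq_conj[of m i ?r "[i]"] ceq_cong_iff[OF ceq_refl[of m ?r] ceq.ceq_square[of m "[i]" i "[]"]]
    by (simp add: nu.simps)
  moreover have "nu m q ([i, i] @ ?r @ [i, i]) = nu m q ?r"
    by (rule nu_cong) (use ceq.ceq_square[of m "[]" i "?r @ [i, i]"] ceq.ceq_square[of m "?r" i "[]"] in
      \<open>auto intro: ceq_trans\<close>)
  ultimately show ?case by (simp add: nu_append)
next
  case (ceq_braid i j p q)
  let ?r = "rev p @ r @ p"
  let ?a = "alt_word i j (m i j)" and ?b = "alt_word j i (m i j)"
  have ab: "ceq m ?a ?b" using ceq.ceq_braid[OF ceq_braid, of m "[]" "[]"] by simp
  have ba: "ceq m (rev ?a) (rev ?b)"
    using ab ceq_sym[OF ab] by (simp add: rev_alt_word)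
  have "ceq m (rev ?a @ ?r @ ?a) (rev ?b @ ?r @ ?b)"
    by (intro ceq_append ab ba ceq_refl)
  then have "nu m q (rev ?a @ ?r @ ?a) = nu m q (rev ?b @ ?r @ ?b)" by (rule nu_cong)
  then show ?case using nu_braid[OF ceq_braid] by (simp only: nu_append)
qed auto

lemma nu_Cons_self: "nu m (i # x) [i] \<longleftrightarrow> \<not> nu m x [i]"
proof -
  have "ceq m ([i] @ [i] @ [i]) [i]" using ceq_square[of m "[]" i "[i]"] by simp
  then show ?thesis using nu_cong by (simp add: nu.simps ceq_refl)
qed

text \<open>The cocycle vanishes on the trivial word x x^{-1}. This compares the inversions of an
  element with those of its inverse, as needed in \<open>L_R\<close> to relate left and right
  descents.\<close>

lemma nu_rev: "nu m (rev x) (rev x @ r @ x) = nu m x r"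
proof -
  have "nu m (x @ rev x) r = False" using nu_ceq[OF ceq_rev_right, of m x r] by simp
  then show ?thesis by (simp add: nu_append)
qed

text \<open>The strong exchange property: \<open>nu\<close> counts, modulo 2, the reflections whose deletion is
  the effect of multiplying by \<open>r\<close>.\<close>

lemma nu_exchange: "nu m x r \<Longrightarrow> \<exists>a c b. x = a @ c # b \<and> ceq m (r @ x) (a @ b)"
proof (induction x arbitrary: r)
  case (Cons i x)
  show ?case
  proof (cases "ceq m r [i]")
    case True
    then have "ceq m (r @ i # x) ([i] @ i # x)" by (rule ceq_append[OF _ ceq_refl])
    moreover have "ceq m ([i] @ i # x) x" using ceq_square[of m "[]" i x] by simp
    ultimately show ?thesis using ceq_trans by fastforce
  next
    case False
    with Cons.prems have "nu m x ([i] @ r @ [i])" by (simp add: nu.simps)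
    then obtain a c b where *: "x = a @ c # b" "ceq m (([i] @ r @ [i]) @ x) (a @ b)"
      using Cons.IH by blast
    then have "ceq m (r @ i # x) ((i # a) @ b)"
      using ceq_move_left[of m "[i]" "r @ [i] @ x" "a @ b"] by simp
    with *(1) show ?thesis by (intro exI[of _ "i # a"] exI[of _ c] exI[of _ b]) simp
  qed
qed simp

section \<open>Reduced words and descents\<close>

definition red :: "(nat \<Rightarrow> nat \<Rightarrow> nat) \<Rightarrow> nat list \<Rightarrow> bool" where
  "red m x \<longleftrightarrow> (\<forall>y. ceq m x y \<longrightarrow> length x \<le> length y)"

lemma red_exists: "\<exists>y. ceq m x y \<and> red m y"
proof -
  obtain y where y: "ceq m x y" "\<And>z. ceq m x z \<Longrightarrow> length y \<le> length z"
    using ex_has_least_nat[of "ceq m x" x length] ceq_refl by metis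
  then show ?thesis unfolding red_def using ceq_trans by blast
qed

lemma red_ceq: "red m x \<Longrightarrow> ceq m x y \<Longrightarrow> length y = length x \<Longrightarrow> red m y"
  unfolding red_def using ceq_trans by metis

lemma red_length: "red m x \<Longrightarrow> red m y \<Longrightarrow> ceq m x y \<Longrightarrow> length x = length y"
  unfolding red_def using ceq_sym by (simp add: dual_order.antisym)

lemma red_append: assumes "red m (x @ y)" shows "red m x" "red m y"
  using assms unfolding red_def
proof -
  assume a: "\<forall>z. ceq m (x @ y) z \<longrightarrow> length (x @ y) \<le> length z"
  show "\<forall>z. ceq m x z \<longrightarrow> length x \<le> length z"
    using a ceq_append[OF _ ceq_refl] by fastforce
  show "\<forall>z. ceq m y z \<longrightarrow> length y \<le> length z"
    using a ceq_append[OF ceq_refl] by fastforce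
qed

lemma red_Cons_tl: "red m (i # x) \<Longrightarrow> red m x"
  using red_append(2)[of m "[i]" x] by simp

lemma red_nu_down:
  assumes "red m x" "nu m x [i]"
  obtains a c b where "x = a @ c # b" "ceq m (i # x) (a @ b)" "ceq m x (i # a @ b)" "red m (i # a @ b)"
proof -
  obtain a c b where x: "x = a @ c # b" "ceq m (i # x) (a @ b)"
    using nu_exchange[OF assms(2)] by auto
  then have "ceq m x (i # a @ b)" using ceq_move_left[of m "[i]" x "a @ b"] by simp
  moreover from this have "red m (i # a @ b)" using red_ceq[OF assms(1)] x(1) by simp
  ultimately show ?thesis using that x by blast
qed

text \<open>If i is an inversion of x, exchange shortens i x. Otherwise i is an inversion of i x by
  \<open>nu_Cons_self\<close>, and exchange turns a reduced word y of i x into a word for x with one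
  letter less; hence y is longer than x.\<close>

lemma red_Cons_iff: assumes "red m x" shows "red m (i # x) \<longleftrightarrow> \<not> nu m x [i]"
proof
  assume r: "red m (i # x)"
  show "\<not> nu m x [i]"
  proof
    assume "nu m x [i]"
    then obtain a c b where "x = a @ c # b" "ceq m (i # x) (a @ b)"
      using red_nu_down[OF assms] by metis
    then show False using r unfolding red_def by fastforce
  qed
next
  assume n: "\<not> nu m x [i]"
  obtain y where y: "ceq m (i # x) y" "red m y" using red_exists by blast
  have "nu m y [i]" using n nu_Cons_self nu_ceq[OF y(1)] by blast
  then obtain a c b where ab: "y = a @ c # b" "ceq m (i # y) (a @ b)"
    using red_nu_down[OF y(2)] by metis
  have "ceq m x (i # y)" using y(1) ceq_move_left[of m "[i]" x y] by simp
  then have "ceq m x (a @ b)" using ab(2) ceq_trans by blast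
  then have "length x \<le> length (a @ b)" using assms unfolding red_def by blast
  then have "length (i # x) \<le> length y" using ab(1) by simp
  moreover have "length y \<le> length (i # x)" using y unfolding red_def by (blast intro: ceq_sym)
  ultimately show "red m (i # x)" using red_ceq[OF y(2) ceq_sym[OF y(1)]] by simp
qed

text \<open>\<open>m_order\<close> says that the dihedral relations do not collapse, so that the
  product of i and j has order exactly \<open>m i j\<close>. For the two types it is read off from
  an action by signed permutations.\<close>

locale coxeter =
  fixes m :: "nat \<Rightarrow> nat \<Rightarrow> nat"
  assumes m_sym: "m i j = m j i"
    and m_order: "i \<noteq> j \<Longrightarrow> 0 < l \<Longrightarrow> l < m i j \<Longrightarrow> \<not> ceq m (alt_word i j (2 * l)) []"
    and m_ge2: "i \<noteq> j \<Longrightarrow> 2 \<le> m i j"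
begin

abbreviation eqv (infix "\<asymp>" 50) where "eqv \<equiv> ceq m"

lemma ceq_rev: "x \<asymp> y \<Longrightarrow> rev x \<asymp> rev y"
proof -
  assume "x \<asymp> y"
  then have "x @ rev y \<asymp> []" by (simp add: ceq_eq_iff[of _ x y])
  then have "rev y \<asymp> rev x @ []" using ceq_move_left by blast
  then show ?thesis using ceq_sym by simp
qed

lemma red_rev: "red m x \<Longrightarrow> red m (rev x)"
  unfolding red_def using ceq_rev by fastforce

lemma nu_alt_word_False:
  assumes "i \<noteq> j" "k < m i j"
  shows "\<not> nu m (alt_word j i k) [i]"
proof -
  have "\<not> [i] \<asymp> alt_word j i (2 * l + 1)" if "l < k" for l
  proof
    assume "[i] \<asymp> alt_word j i (2 * l + 1)"
    then have "[] \<asymp> [i] @ alt_word j i (2 * l + 1)"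
      using ceq_move_left[of m "[i]" "[]" "alt_word j i (2 * l + 1)"] by simp
    then have "alt_word i j (2 * Suc l) \<asymp> []" using ceq_sym by simp
    then show False using m_order[of i j "Suc l"] assms that by auto
  qed
  then have "{l. l < k \<and> [i] \<asymp> alt_word j i (2 * l + 1)} = {}" by blast
  then show ?thesis unfolding nu_alt_word by (simp only: card.empty) simp
qed

lemma gens_distinct: "[i] \<asymp> [j] \<longleftrightarrow> i = j"
proof
  assume "[i] \<asymp> [j]"
  show "i = j"
  proof (rule ccontr)
    assume "i \<noteq> j"
    then have "\<not> nu m (alt_word j i 1) [i]"
      using nu_alt_word_False m_ge2 by (metis Suc_1 Suc_le_lessD)
    with \<open>[i] \<asymp> [j]\<close> show False by (simp add: nu_singleton)
  qed
qed (simp add: ceq_refl)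

lemma red_singleton: "red m [i]"
  using red_Cons_iff[of m "[]" i] by (simp add: red_def)

text \<open>The alternating prefix grows by one letter at a time, with i and j exchanging roles. A
  prefix shorter than \<open>m i j\<close> does not have i among its own reflections, so the
  exchange for i must delete a letter of the remainder z, and i moves to the front.\<close>

lemma two_descents:
  assumes "red m x" "nu m x [i]" "nu m x [j]" "i \<noteq> j" "x \<in> lists S" "k \<le> m i j"
  shows "\<exists>z\<in>lists S. x \<asymp> alt_word i j k @ z \<and> length x = k + length z"
  using assms
proof (induction k arbitrary: i j)
  case 0
  then show ?case using ceq_refl by auto
next
  case (Suc k)
  then obtain z where z: "z \<in> lists S" "x \<asymp> alt_word j i k @ z" "length x = k + length z"
    using m_sym by (metis Suc_leD)
  let ?a = "alt_word j i k"
  let ?r = "rev ?a @ [i] @ ?a"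
  have "nu m (?a @ z) [i]" using Suc.prems nu_ceq[OF z(2)] by simp
  moreover have "\<not> nu m ?a [i]" using Suc.prems nu_alt_word_False by simp
  ultimately have "nu m z ?r" by (simp add: nu_append)
  then obtain a c b where abc: "z = a @ c # b" "?r @ z \<asymp> a @ b" using nu_exchange by blast
  have "[i] @ ?a @ z \<asymp> ?a @ a @ b"
    using abc(2) ceq_move_left[of m "rev ?a" "[i] @ ?a @ z" "a @ b"] by simp
  moreover have "[i] @ x \<asymp> [i] @ ?a @ z" using z(2) by (rule ceq_append[OF ceq_refl])
  ultimately have "[i] @ x \<asymp> ?a @ a @ b" using ceq_trans by blast
  then have "x \<asymp> alt_word i j (Suc k) @ a @ b"
    using ceq_move_left[of m "[i]" x "?a @ a @ b"] by simp
  moreover have "a @ b \<in> lists S" using z(1) abc(1) by simp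
  ultimately show ?case using z(3) abc(1) by (intro bexI[of _ "a @ b"]) auto
qed

text \<open>Matsumoto's theorem, for an arbitrary equivalence \<open>P\<close> that is compatible with left
  multiplication and with braid moves at the beginning of a word.\<close>

lemma matsumoto:
  assumes P_refl: "\<And>x. x \<in> lists S \<Longrightarrow> P x x"
    and P_sym: "\<And>x y. P x y \<Longrightarrow> P y x"
    and P_trans: "\<And>x y z. P x y \<Longrightarrow> P y z \<Longrightarrow> P x z"
    and P_Cons: "\<And>i x y. i \<in> S \<Longrightarrow> x \<in> lists S \<Longrightarrow> y \<in> lists S \<Longrightarrow> P x y \<Longrightarrow> P (i # x) (i # y)"
    and P_braid: "\<And>i j z. i \<in> S \<Longrightarrow> j \<in> S \<Longrightarrow> i \<noteq> j \<Longrightarrow> z \<in> lists S \<Longrightarrow>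
      P (alt_word i j (m i j) @ z) (alt_word j i (m i j) @ z)"
    and xy: "red m x" "red m y" "x \<in> lists S" "y \<in> lists S" "x \<asymp> y"
  shows "P x y"
  using xy
proof (induction "length x" arbitrary: x y rule: less_induct)
  case less
  show ?case
  proof (cases x)
    case Nil
    then show ?thesis using red_length[OF less.prems(1,2,5)] P_refl by simp
  next
    case x: (Cons i x')
    then obtain j y' where y: "y = j # y'"
      using red_length[OF less.prems(1,2,5)] by (cases y) auto
    have same: "P (k # u) w"
      if "length (k # u) = length x" "w = k # v" "red m (k # u)" "red m w"
        "k # u \<in> lists S" "w \<in> lists S" "k # u \<asymp> w" for k u w v
    proof -
      have "u \<asymp> v" using that ceq_left_cancel[of m "[k]" u v] by simp
      moreover have "red m u" "red m v" using that red_Cons_tl by blast+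
      ultimately have "P u v" using less.hyps[of u v] that by simp
      then show ?thesis using P_Cons that by simp
    qed
    show ?thesis
    proof (cases "i = j")
      case True
      then show ?thesis using same[of i x' y y'] less.prems x y by simp
    next
      case False
      \<comment> \<open>Both i and j are descents, so the element has a reduced word beginning with
        either alternating word of full length. The words x and y are linked through these two: the
        outer links share a first letter, the middle one is the braid move.\<close>
      let ?m = "m i j"
      have d: "nu m x [i]" "nu m x [j]"
        using less.prems red_Cons_iff red_Cons_tl nu_Cons_self nu_ceq x y by blast+
      obtain z where z: "z \<in> lists S" "x \<asymp> alt_word i j ?m @ z" "length x = ?m + length z"
        using two_descents[OF less.prems(1) d False less.prems(3)] by blast
      let ?u = "alt_word i j ?m @ z" and ?v = "alt_word j i ?m @ z"
      have uv: "?u \<asymp> ?v" using ceq_braid[OF False, of m "[]" z] by simp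
      have lists: "?u \<in> lists S" "?v \<in> lists S"
        using z(1) less.prems(3,4) x y set_alt_word[of i j ?m] set_alt_word[of j i ?m]
        by (auto simp: in_lists_conv_set)
      have ru: "red m ?u" using red_ceq[OF less.prems(1) z(2)] z(3) by simp
      have rv: "red m ?v" using red_ceq[OF ru uv] by simp
      obtain k where k: "?m = Suc k" using m_ge2[OF False] by (cases ?m) auto
      have "P x ?u"
        using same[of i x' ?u "alt_word j i k @ z"] x less.prems ru lists z k by simp
      moreover have "P ?u ?v" using P_braid False less.prems(3,4) x y z(1) by simp
      moreover have "P y ?v"
      proof -
        have "y \<asymp> ?v" using less.prems(5) z(2) uv ceq_trans ceq_sym by blast
        moreover have "length y = length x" using red_length[OF less.prems(1,2,5)] by simp
        ultimately show ?thesis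
          using same[of j y' ?v "alt_word i j k @ z"] y less.prems rv lists k by simp
      qed
      ultimately show ?thesis using P_trans P_sym by blast
    qed
  qed
qed

end

section \<open>Finite rank inside infinite rank\<close>

lemma coxeter_eq_cong:
  "coxeter_eq m n x y \<Longrightarrow> p \<in> lists {..<n} \<Longrightarrow> q \<in> lists {..<n} \<Longrightarrow> coxeter_eq m n (p @ x @ q) (p @ y @ q)"
proof (induction rule: coxeter_eq.induct)
  case (square i a b)
  then show ?case using coxeter_eq.square[of i n "p @ a" "b @ q" m] by simp
next
  case (braid i j a b)
  then show ?case using coxeter_eq.braid[of i n j "p @ a" "b @ q" m] by simp
next
  case (refl x) then show ?case using coxeter_eq.refl[of "p @ x @ q" n m] by simp
qed (blast intro: coxeter_eq.intros)+

context coxeter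
begin

lemma matsumoto_coxeter_eq:
  assumes "red m x" "red m y" "x \<in> lists {..<n}" "y \<in> lists {..<n}" "x \<asymp> y"
  shows "coxeter_eq m n x y"
proof (rule matsumoto[where P = "coxeter_eq m n" and S = "{..<n}", OF _ _ _ _ _ assms])
  fix i x y assume "i \<in> {..<n}" "coxeter_eq m n x y"
  then show "coxeter_eq m n (i # x) (i # y)" using coxeter_eq_cong[of m n x y "[i]" "[]"] by simp
next
  fix i j z assume "i \<in> {..<n}" "j \<in> {..<n}" "i \<noteq> j" "z \<in> lists {..<n}"
  then show "coxeter_eq m n (alt_word i j (m i j) @ z) (alt_word j i (m i j) @ z)"
    using coxeter_eq.braid[of i n j "[]" z m] by simp
qed (blast intro: coxeter_eq.intros)+

lemma red_exists_coxeter_eq: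
  "x \<in> lists {..<n} \<Longrightarrow> \<exists>y. coxeter_eq m n x y \<and> red m y"
proof (induction x)
  case Nil
  then show ?case by (intro exI[of _ "[]"]) (simp add: coxeter_eq.refl red_def)
next
  case (Cons i x)
  then obtain y where y: "coxeter_eq m n x y" "red m y" by auto
  have iy: "coxeter_eq m n (i # x) (i # y)"
    using coxeter_eq_cong[OF y(1), of "[i]" "[]"] Cons.prems by simp
  show ?case
  proof (cases "nu m y [i]")
    case False
    then show ?thesis using red_Cons_iff[OF y(2)] iy by blast
  next
    case True
    obtain a c b where abc: "y = a @ c # b" "y \<asymp> i # a @ b" "red m (i # a @ b)"
      using red_nu_down[OF y(2) True] by metis
    have l: "y \<in> lists {..<n}" using coxeter_eq_lists[OF y(1)] by simp
    have "coxeter_eq m n y (i # a @ b)"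
      using matsumoto_coxeter_eq[OF y(2) abc(3) l _ abc(2)] l abc(1) Cons.prems by simp
    then have "coxeter_eq m n (i # y) ([i, i] @ a @ b)"
      using coxeter_eq_cong[of m n y "i # a @ b" "[i]" "[]"] Cons.prems by simp
    moreover have "coxeter_eq m n ([i, i] @ a @ b) (a @ b)"
      using coxeter_eq.square[of i n "[]" "a @ b" m] l abc(1) Cons.prems by simp
    ultimately have "coxeter_eq m n (i # x) (a @ b)" using iy coxeter_eq.trans by blast
    moreover have "red m (a @ b)" using red_Cons_tl[OF abc(3)] .
    ultimately show ?thesis by blast
  qed
qed

text \<open>Parabolic subgroups embed: a word in the first n letters can be reduced without leaving
  the alphabet, because exchange only deletes letters, and equal reduced words are linked by braid
  moves alone.\<close>

lemma coxeter_eq_iff: "coxeter_eq m n x y \<longleftrightarrow> x \<in> lists {..<n} \<and> y \<in> lists {..<n} \<and> x \<asymp> y"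
proof
  assume a: "x \<in> lists {..<n} \<and> y \<in> lists {..<n} \<and> x \<asymp> y"
  then obtain x' y' where x: "coxeter_eq m n x x'" "red m x'" and y: "coxeter_eq m n y y'" "red m y'"
    using red_exists_coxeter_eq by metis
  have "x' \<asymp> y'" using a x(1) y(1) coxeter_eq_ceq ceq_sym ceq_trans by metis
  then have "coxeter_eq m n x' y'"
    using matsumoto_coxeter_eq[OF x(2) y(2)] coxeter_eq_lists[OF x(1)] coxeter_eq_lists[OF y(1)] by simp
  then show "coxeter_eq m n x y" using x(1) y(1) coxeter_eq.trans coxeter_eq.sym by metis
qed (use coxeter_eq_ceq coxeter_eq_lists in blast)

lemma coxeter_class:
  assumes "x \<in> lists {..<n}"
  shows "coxeter_rel m n `` {x} = {y \<in> lists {..<n}. x \<asymp> y}"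
  using assms by (auto simp: coxeter_rel_def coxeter_eq_iff)

lemma coxeter_group_conv: "coxeter_group m n = (\<lambda>x. {y \<in> lists {..<n}. x \<asymp> y}) ` lists {..<n}"
proof -
  have "coxeter_group m n = (\<lambda>x. coxeter_rel m n `` {x}) ` lists {..<n}"
    unfolding coxeter_group_def quotient_def by blast
  also have "\<dots> = (\<lambda>x. {y \<in> lists {..<n}. x \<asymp> y}) ` lists {..<n}"
    by (rule image_cong) (simp_all only: coxeter_class)
  finally show ?thesis .
qed

text \<open>The word is chosen of minimal length among words in the first n letters. The point is
  that it is then also of minimal length among words in all letters.\<close>

lemma reduced_word:
  assumes "w \<in> coxeter_group m n"
  shows "reduced_word w \<in> w" "red m (reduced_word w)" "reduced_word w \<in> lists {..<n}"
    "w = {y \<in> lists {..<n}. reduced_word w \<asymp> y}"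
proof -
  obtain x where x: "x \<in> lists {..<n}" "w = {y \<in> lists {..<n}. x \<asymp> y}"
    using assms unfolding coxeter_group_conv by blast
  have "x \<in> w" using x ceq_refl by simp
  then have min: "reduced_word w \<in> w" "\<And>y. y \<in> w \<Longrightarrow> length (reduced_word w) \<le> length y"
    unfolding reduced_word_def by (rule arg_min_natI) (rule arg_min_nat_le)
  show "reduced_word w \<in> w" by (rule min)
  show l: "reduced_word w \<in> lists {..<n}" using min x(2) by simp
  obtain y where y: "coxeter_eq m n (reduced_word w) y" "red m y"
    using red_exists_coxeter_eq[OF l] by blast
  have e: "x \<asymp> reduced_word w" using min x(2) by simp
  have "y \<in> w" unfolding x(2)
    using coxeter_eq_lists[OF y(1)] coxeter_eq_ceq[OF y(1)] e ceq_trans by blast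
  then have "length (reduced_word w) \<le> length y" by (rule min)
  moreover have "length y \<le> length (reduced_word w)"
    using y(2) coxeter_eq_ceq[OF y(1)] ceq_sym unfolding red_def by blast
  ultimately show "red m (reduced_word w)"
    using red_ceq[OF y(2) ceq_sym[OF coxeter_eq_ceq[OF y(1)]]] by simp
  show "w = {y \<in> lists {..<n}. reduced_word w \<asymp> y}"
    unfolding x(2) using e ceq_trans ceq_sym x(2) by blast
qed

end

section \<open>Operators on an extended Coxeter group\<close>

type_synonym vec = "bool \<Rightarrow> nat list \<Rightarrow> qv"

definition linear_op :: "(vec \<Rightarrow> vec) \<Rightarrow> bool" where
  "linear_op F \<longleftrightarrow> (\<forall>c d f g. F (\<lambda>b w. c * f b w + d * g b w) = (\<lambda>b w. c * F f b w + d * F g b w))"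

text \<open>A type of its own makes the operators an instance of \<open>ring_1\<close>, so that the
  abstract tower of algebras and formal power series can be instantiated with them.\<close>

typedef endo = "{F. linear_op F}" morphisms app Endo
  by (rule exI[of _ "\<lambda>f. f"]) (simp add: linear_op_def)

lemma linear_op_app [simp]: "linear_op (app x)"
  using app[of x] by simp

lemma app_Endo [simp]: "linear_op F \<Longrightarrow> app (Endo F) = F"
  by (simp add: Endo_inverse)

lemma endo_eqI: "(\<And>f b w. app x f b w = app y f b w) \<Longrightarrow> x = y"
  by (simp add: app_inject[symmetric] fun_eq_iff)

lemma app_lin: "app x (\<lambda>b w. c * f b w + d * g b w) = (\<lambda>b w. c * app x f b w + d * app x g b w)"
  using linear_op_app[of x] unfolding linear_op_def by blast

lemma app_add_vec: "app x (\<lambda>b w. f b w + g b w) = (\<lambda>b w. app x f b w + app x g b w)"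
  using app_lin[of x 1 f 1 g] by simp

lemma app_scale_vec: "app x (\<lambda>b w. c * f b w) = (\<lambda>b w. c * app x f b w)"
  using app_lin[of x c f 0 f] by simp

instantiation endo :: ring_1
begin

definition zero_endo where "0 = Endo (\<lambda>f b w. 0)"
definition one_endo where "1 = Endo (\<lambda>f. f)"
definition plus_endo where "x + y = Endo (\<lambda>f b w. app x f b w + app y f b w)"
definition minus_endo where "x - y = Endo (\<lambda>f b w. app x f b w - app y f b w)"
definition uminus_endo where "- x = Endo (\<lambda>f b w. - app x f b w)"
definition times_endo where "x * y = Endo (\<lambda>f. app x (app y f))"

lemma app_zero [simp]: "app 0 f b w = 0"
  unfolding zero_endo_def by (subst app_Endo) (simp_all add: linear_op_def)

lemma app_one [simp]: "app 1 f = f"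
  unfolding one_endo_def by (subst app_Endo) (simp_all add: linear_op_def)

lemma app_add [simp]: "app (x + y) f b w = app x f b w + app y f b w"
  unfolding plus_endo_def
  by (subst app_Endo) (simp_all add: linear_op_def app_lin fun_eq_iff algebra_simps)

lemma app_minus [simp]: "app (x - y) f b w = app x f b w - app y f b w"
  unfolding minus_endo_def
  by (subst app_Endo) (simp_all add: linear_op_def app_lin fun_eq_iff algebra_simps)

lemma app_uminus [simp]: "app (- x) f b w = - app x f b w"
  unfolding uminus_endo_def
  by (subst app_Endo) (simp_all add: linear_op_def app_lin fun_eq_iff algebra_simps)

lemma app_mult [simp]: "app (x * y) f = app x (app y f)"
  unfolding times_endo_def
  by (subst app_Endo) (simp_all add: linear_op_def app_lin fun_eq_iff)

instance
proof
  fix x y z :: endo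
  show "x * (y + z) = x * y + x * z"
  proof (rule endo_eqI)
    fix f b w
    have "app (y + z) f = (\<lambda>b w. app y f b w + app z f b w)" by (simp add: fun_eq_iff)
    then show "app (x * (y + z)) f b w = app (x * y + x * z) f b w" by (simp add: app_add_vec)
  qed
  have "app 0 (\<lambda>b w. 1) False [] \<noteq> app 1 (\<lambda>b w. 1 :: qv) False []" by simp
  then show "(0 :: endo) \<noteq> 1" by metis
qed (rule endo_eqI, simp add: algebra_simps)+

end

definition scl :: "qv \<Rightarrow> endo" where
  "scl c = Endo (\<lambda>f b w. c * f b w)"

lemma app_scl [simp]: "app (scl c) f = (\<lambda>b w. c * f b w)"
  unfolding scl_def by (subst app_Endo) (simp_all add: linear_op_def algebra_simps)

lemma scl_add: "scl (c + d) = scl c + scl d"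
  by (rule endo_eqI) (simp add: algebra_simps)

lemma scl_mult: "scl (c * d) = scl c * scl d"
  by (rule endo_eqI) (simp add: algebra_simps)

lemma scl_one [simp]: "scl 1 = 1"
  by (rule endo_eqI) simp

lemma scl_zero [simp]: "scl 0 = 0"
  by (rule endo_eqI) simp

lemma scl_minus: "scl (- c) = - scl c"
  by (rule endo_eqI) simp

lemma scl_comm: "x * scl c = scl c * x"
  by (rule endo_eqI) (simp add: app_scale_vec)

section \<open>The regular representation of the extended group\<close>

definition nform :: "(nat \<Rightarrow> nat \<Rightarrow> nat) \<Rightarrow> nat list \<Rightarrow> nat list" where
  "nform m x = (SOME y. ceq m x y)"

lemma ceq_nform: "ceq m x (nform m x)"
  unfolding nform_def by (rule someI[of "ceq m x", OF ceq_refl])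

lemma nform_eq_iff: "nform m x = nform m y \<longleftrightarrow> ceq m x y"
proof
  assume "ceq m x y"
  then have "ceq m x = ceq m y" using ceq_trans ceq_sym by blast
  then show "nform m x = nform m y" by (simp add: nform_def)
qed (metis ceq_nform ceq_sym ceq_trans)

lemma nform_nform [simp]: "nform m (nform m x) = nform m x"
  by (metis nform_eq_iff ceq_nform)

lemma ceq_nform_left: "ceq m (nform m x) y \<longleftrightarrow> ceq m x y"
  by (metis ceq_nform ceq_sym ceq_trans)

definition twist :: "(nat \<Rightarrow> nat) \<Rightarrow> bool \<Rightarrow> nat \<Rightarrow> nat" where
  "twist sw b i = (if b then sw i else i)"

text \<open>The operators act on functions on $W \rtimes \langle\varsigma\rangle$, where $\varsigma$
  induces the diagram automorphism \<open>sw\<close>; \<open>(b, w)\<close> stands for $w\varsigma^b$, and \<open>w\<close> has to be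
  a normal form. On all other words they act by scalars that satisfy the same relations.\<close>

definition Lop :: "(nat \<Rightarrow> nat \<Rightarrow> nat) \<Rightarrow> nat \<Rightarrow> endo" where
  "Lop m i = Endo (\<lambda>f b w. if nform m w = w
     then f b (nform m (i # w)) + (if nu m w [i] then - alpha * f b w else 0)
     else inverse v_var * f b w)"

text \<open>Right multiplication by an inverse generator, as \<open>Lop\<close> is left
  multiplication. Since w \<varsigma>^b i = w sw^b(i) \<varsigma>^b, the letter is twisted on the
  layer b. In both operators the term with -\<alpha> at a descent comes from t^{-1} t^{-1} = 1 -
  \<alpha> t^{-1}.\<close>

definition Rop :: "(nat \<Rightarrow> nat \<Rightarrow> nat) \<Rightarrow> (nat \<Rightarrow> nat) \<Rightarrow> nat \<Rightarrow> endo" where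
  "Rop m sw i = Endo (\<lambda>f b w. if nform m w = w
     then f b (nform m (w @ [twist sw b i])) + (if nu m (rev w) [twist sw b i] then - alpha * f b w else 0)
     else inverse v_var * f b w)"

text \<open>Left multiplication by \<varsigma>, from \<varsigma> w = sw(w) \<varsigma>. The right
  multiplication by \<varsigma> is \<open>Pop\<close>.\<close>

definition Sop :: "(nat \<Rightarrow> nat \<Rightarrow> nat) \<Rightarrow> (nat \<Rightarrow> nat) \<Rightarrow> endo" where
  "Sop m sw = Endo (\<lambda>f b w. if nform m w = w then f (\<not> b) (nform m (map sw w)) else f (\<not> b) w)"

definition Pop :: endo where
  "Pop = Endo (\<lambda>f b w. f (\<not> b) w)"

definition layer :: "bool \<Rightarrow> endo" where
  "layer c = Endo (\<lambda>f b w. if b = c then f b w else 0)"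

lemma app_Pop [simp]: "app Pop f = (\<lambda>b w. f (\<not> b) w)"
  unfolding Pop_def by (subst app_Endo) (simp_all add: linear_op_def)

lemma app_layer [simp]: "app (layer c) f = (\<lambda>b w. if b = c then f b w else 0)"
  unfolding layer_def by (subst app_Endo) (auto simp: linear_op_def fun_eq_iff)

lemma app_Lop: "app (Lop m i) f = (\<lambda>b w. if nform m w = w
     then f b (nform m (i # w)) + (if nu m w [i] then - alpha * f b w else 0)
     else inverse v_var * f b w)"
  unfolding Lop_def by (subst app_Endo) (simp_all add: linear_op_def fun_eq_iff algebra_simps)

lemma app_Rop: "app (Rop m sw i) f = (\<lambda>b w. if nform m w = w
     then f b (nform m (w @ [twist sw b i])) + (if nu m (rev w) [twist sw b i] then - alpha * f b w else 0)
     else inverse v_var * f b w)"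
  unfolding Rop_def by (subst app_Endo) (simp_all add: linear_op_def fun_eq_iff algebra_simps)

lemma app_Sop: "app (Sop m sw) f =
    (\<lambda>b w. if nform m w = w then f (\<not> b) (nform m (map sw w)) else f (\<not> b) w)"
  unfolding Sop_def by (subst app_Endo) (simp_all add: linear_op_def fun_eq_iff)

lemma app_Lop_junk: "nform m w \<noteq> w \<Longrightarrow> app (Lop m i) f b w = inverse v_var * f b w"
  by (simp add: app_Lop)

lemma app_Rop_junk: "nform m w \<noteq> w \<Longrightarrow> app (Rop m sw i) f b w = inverse v_var * f b w"
  by (simp add: app_Rop)

lemma app_Sop_junk: "nform m w \<noteq> w \<Longrightarrow> app (Sop m sw) f b w = f (\<not> b) w"
  by (simp add: app_Sop)

lemma nform_Cons [simp]: "nform m (i # nform m w) = nform m (i # w)"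
  using ceq_append[OF ceq_refl ceq_nform, of m "[i]" w] by (simp add: nform_eq_iff ceq_sym)

lemma nform_append1 [simp]: "nform m (nform m w @ x) = nform m (w @ x)"
  using ceq_append[OF ceq_nform ceq_refl, of m w x] by (simp add: nform_eq_iff ceq_sym)

lemma nu_nform [simp]: "nu m (nform m w) r = nu m w r"
  using nu_ceq[OF ceq_nform] by blast

lemma app_Lop_nform: "app (Lop m i) f b (nform m w) =
    f b (nform m (i # w)) + (if nu m w [i] then - alpha * f b (nform m w) else 0)"
  by (simp add: app_Lop)

lemma endo_eqI_nform:
  assumes "\<And>f b w. app x f b (nform m w) = app y f b (nform m w)"
    and "\<And>f b w. nform m w \<noteq> w \<Longrightarrow> app x f b w = app y f b w"
  shows "x = y"
  by (rule endo_eqI) (metis assms)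

lemma alpha_quadratic: "inverse v_var * inverse v_var = 1 - alpha * inverse v_var"
  using v_var_nonzero by (simp add: alpha_def field_simps)

lemma Lop_quadratic: "Lop m i * Lop m i = 1 - scl alpha * Lop m i"
proof (rule endo_eqI_nform[where m = m])
  fix f b w
  have "nform m (i # i # w) = nform m w"
    using ceq_square[of m "[]" i w] by (simp add: nform_eq_iff)
  then show "app (Lop m i * Lop m i) f b (nform m w) = app (1 - scl alpha * Lop m i) f b (nform m w)"
    using nu_Cons_self[of m i w] by (auto simp: app_Lop_nform algebra_simps)
next
  fix f b w assume "nform m w \<noteq> w"
  then show "app (Lop m i * Lop m i) f b w = app (1 - scl alpha * Lop m i) f b w"
    using arg_cong[OF alpha_quadratic, of "\<lambda>c. c * f b w"]
    by (simp add: app_Lop_junk mult.assoc left_diff_distrib)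
qed

locale coxeter_aut = coxeter m for m +
  fixes sw :: "nat \<Rightarrow> nat"
  assumes sw_sw [simp]: "sw (sw i) = i" and m_sw: "m (sw i) (sw j) = m i j"
begin

abbreviation L where "L \<equiv> Lop m"
abbreviation R where "R \<equiv> Rop m sw"
abbreviation S where "S \<equiv> Sop m sw"
abbreviation N where "N \<equiv> nform m"

lemma sw_inject [simp]: "sw i = sw j \<longleftrightarrow> i = j"
  by (metis sw_sw)

lemma map_sw_sw [simp]: "map sw (map sw x) = x"
  by (simp add: o_def)

lemma map_sw_alt_word: "map sw (alt_word i j k) = alt_word (sw i) (sw j) k"
  by (induction k arbitrary: i j) auto

lemma ceq_map_sw: "x \<asymp> y \<Longrightarrow> map sw x \<asymp> map sw y"
proof (induction rule: ceq.induct)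
  case (ceq_square p i q)
  show ?case using ceq.ceq_square[of m "map sw p" "sw i" "map sw q"] by simp
next
  case (ceq_braid i j p q)
  then show ?case
    using ceq.ceq_braid[of "sw i" "sw j" m "map sw p" "map sw q"] by (simp add: map_sw_alt_word m_sw)
qed (blast intro: ceq_refl ceq_sym ceq_trans)+

lemma ceq_map_sw_iff: "map sw x \<asymp> map sw y \<longleftrightarrow> x \<asymp> y"
  using ceq_map_sw[of "map sw x" "map sw y"] ceq_map_sw[of x y] unfolding map_sw_sw by blast

lemma nu_map_sw: "nu m (map sw x) (map sw r) = nu m x r"
proof (induction x arbitrary: r)
  case (Cons i x)
  show ?case using Cons[of "[i] @ r @ [i]"] ceq_map_sw_iff[of r "[i]"] by (simp add: nu.simps)
qed simp

lemma nu_map_sw': "nu m (map sw x) [i] = nu m x [sw i]"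
  using nu_map_sw[of x "[sw i]"] by simp

lemma N_map_sw [simp]: "N (map sw (N w)) = N (map sw w)"
  by (simp add: nform_eq_iff ceq_map_sw_iff ceq_nform_left ceq_refl)

lemma ceq_rev_iff: "rev x \<asymp> rev y \<longleftrightarrow> x \<asymp> y"
  using ceq_rev[of x y] ceq_rev[of "rev x" "rev y"] unfolding rev_rev_ident by blast

lemma nu_rev_N [simp]: "nu m (rev (N w)) r = nu m (rev w) r"
  by (rule nu_ceq) (simp add: ceq_rev_iff ceq_nform_left ceq_refl)

lemma app_R_N: "app (R i) f b (N w) =
    f b (N (w @ [twist sw b i])) + (if nu m (rev w) [twist sw b i] then - alpha * f b (N w) else 0)"
  by (simp add: app_Rop)

lemma app_S_N: "app S f b (N w) = f (\<not> b) (N (map sw w))"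
  by (simp add: app_Sop)

text \<open>If i w and w j differ, multiplying by j on the right does not change whether i is a left
  descent, and vice versa. If they coincide, i is a left descent of w exactly when j is a right
  descent, and both properties flip at i w = w j, so the correction terms match.\<close>

lemma L_R: "L i * R j = R j * L i"
proof (rule endo_eqI_nform[where m = m])
  fix f b w
  let ?j = "twist sw b j"
  have l: "app (L i * R j) f b (N w) = f b (N (i # w @ [?j]))
      + (if nu m (rev w @ [i]) [?j] then - alpha * f b (N (i # w)) else 0)
      + (if nu m w [i] then - alpha * app (R j) f b (N w) else 0)"
    using app_R_N[of j f b "i # w"] by (simp add: app_Lop_nform)
  have r: "app (R j * L i) f b (N w) = f b (N (i # w @ [?j]))
      + (if nu m (w @ [?j]) [i] then - alpha * f b (N (w @ [?j])) else 0)
      + (if nu m (rev w) [?j] then - alpha * app (L i) f b (N w) else 0)"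
    using app_Lop_nform[of m i f b "w @ [?j]"] by (simp add: app_R_N)
  show "app (L i * R j) f b (N w) = app (R j * L i) f b (N w)"
  proof (cases "i # w \<asymp> w @ [?j]")
    case False
    have 1: "\<not> rev w @ [i] @ w \<asymp> [?j]"
      using False ceq_move_left[of m "rev w" "[i] @ w" "[?j]"] by simp
    have 2: "\<not> w @ [?j] @ rev w \<asymp> [i]"
      using False ceq_move_right[of m "w @ [?j]" "rev w" "[i]"] ceq_sym by auto
    have "nu m (rev w @ [i]) [?j] = nu m (rev w) [?j]" "nu m (w @ [?j]) [i] = nu m w [i]"
      using 1 2 nu_append[of m "rev w" "[i]" "[?j]"] nu_append[of m w "[?j]" "[i]"]
      by (simp_all add: nu_singleton)
    then show ?thesis unfolding l r by (simp add: app_Lop_nform app_R_N algebra_simps)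
  next
    case True
    have 1: "rev w @ [i] @ w \<asymp> [?j]"
      using True ceq_move_left[of m "rev w" "[i] @ w" "[?j]"] by simp
    have 2: "w @ [?j] @ rev w \<asymp> [i]"
      using True ceq_move_right[of m "w @ [?j]" "rev w" "[i]"] ceq_sym by auto
    have "nu m (rev w @ [i]) [?j] = (\<not> nu m (rev w) [?j])" "nu m (w @ [?j]) [i] = (\<not> nu m w [i])"
      using 1 2 nu_append[of m "rev w" "[i]" "[?j]"] nu_append[of m w "[?j]" "[i]"]
      by (simp_all add: nu_singleton)
    moreover have "nu m (rev w) [?j] = nu m w [i]"
      using nu_rev[of m w "[i]"] nu_cong[OF 1, of "rev w"] by simp
    moreover have "N (i # w) = N (w @ [?j])" using True by (simp add: nform_eq_iff)
    ultimately show ?thesis unfolding l r by (simp add: app_Lop_nform app_R_N)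
  qed
qed (simp add: app_Lop_junk app_Rop_junk)

lemma L_Pop: "L i * Pop = Pop * L i"
  by (rule endo_eqI) (simp add: app_Lop)

lemma S_Pop: "S * Pop = Pop * S"
  by (rule endo_eqI) (simp add: app_Sop)

lemma S_S: "S * S = 1"
proof (rule endo_eqI_nform[where m = m])
  fix f b w show "app (S * S) f b (N w) = app 1 f b (N w)"
    using map_sw_sw[of w] by (simp add: app_S_N del: map_map map_sw_sw)
qed (simp add: app_Sop_junk)

lemma S_R: "S * R j = R j * S"
proof (rule endo_eqI_nform[where m = m])
  fix f b w
  have tw: "sw (twist sw b j) = twist sw (\<not> b) j" by (simp add: twist_def)
  have "nu m (rev (map sw w)) [twist sw (\<not> b) j] = nu m (rev w) [twist sw b j]"
    using nu_map_sw[of "rev w" "[twist sw b j]"] by (simp add: rev_map tw)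
  then show "app (S * R j) f b (N w) = app (R j * S) f b (N w)"
    by (simp add: app_R_N app_S_N tw)
qed (simp add: app_Sop_junk app_Rop_junk)

lemma S_L: "S * L i = L (sw i) * S"
proof (rule endo_eqI_nform[where m = m])
  fix f b w show "app (S * L i) f b (N w) = app (L (sw i) * S) f b (N w)"
    by (simp add: app_S_N app_Lop_nform nu_map_sw')
qed (simp add: app_Sop_junk app_Lop_junk)

lemma layer_S: "layer c * S = S * layer (\<not> c)"
  by (rule endo_eqI) (auto simp: app_Sop)

text \<open>The commutant of the right multiplications. It contains the represented algebra, and its
  elements are controlled by their values at the identity, see \<open>com_app_zero\<close>.\<close>

definition com :: "endo \<Rightarrow> bool" where
  "com x \<longleftrightarrow> (\<forall>i. x * R i = R i * x) \<and> x * Pop = Pop * x"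

lemma com_L: "com (L i)" and com_S: "com S" and com_scl: "com (scl c)"
  by (auto simp: com_def L_R L_Pop S_R S_Pop scl_comm)

lemma com_add: "com x \<Longrightarrow> com y \<Longrightarrow> com (x + y)"
  by (simp add: com_def algebra_simps)

lemma com_mult: "com x \<Longrightarrow> com y \<Longrightarrow> com (x * y)"
  unfolding com_def by (metis mult.assoc)

definition sword :: "nat list \<Rightarrow> endo" where
  "sword x = prod_list (map L x)"

lemma sword_simps [simp]: "sword [] = 1" "sword (i # x) = L i * sword x"
  "sword (x @ y) = sword x * sword y"
  by (simp_all add: sword_def)

lemma com_sword: "com (sword x)"
proof (induction x)
  case Nil show ?case using com_scl[of 1] by simp
qed (simp add: com_mult com_L)

lemma app_sword_red: "red m (rev x @ y) \<Longrightarrow> app (sword x) f b (N y) = f b (N (rev x @ y))"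
proof (induction x arbitrary: y)
  case (Cons i x)
  then have "red m (rev x @ (i # y))" by simp
  moreover from this have "red m (i # y)" by (rule red_append)
  moreover from this have "\<not> nu m y [i]" using red_Cons_tl red_Cons_iff by blast
  ultimately show ?case using Cons.IH[of "i # y"] by (simp add: app_Lop_nform)
qed simp

lemma app_sword_junk: "N w \<noteq> w \<Longrightarrow> app (sword x) f b w = inverse v_var ^ length x * f b w"
  by (induction x) (simp_all add: app_Lop_junk)

lemma app_Rs_red:
  "red m (x @ y) \<Longrightarrow> app (prod_list (map (\<lambda>i. R (twist sw b i)) y)) f b (N x) = f b (N (x @ y))"
proof (induction y arbitrary: x)
  case (Cons i y)
  then have r: "red m ((x @ [i]) @ y)" by simp
  then have "red m (x @ [i])" by (rule red_append)
  then have "red m (i # rev x)" using red_rev[of "x @ [i]"] by simp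
  then have "\<not> nu m (rev x) [i]" using red_Cons_tl red_Cons_iff by blast
  moreover have "twist sw b (twist sw b i) = i" by (simp add: twist_def)
  ultimately show ?case using Cons.IH[OF r] by (simp add: app_R_N)
qed simp

lemma red_alt_word: "i \<noteq> j \<Longrightarrow> k \<le> m i j \<Longrightarrow> red m (alt_word i j k)"
proof (induction k arbitrary: i j)
  case 0 show ?case by (simp add: red_def)
next
  case (Suc k)
  have "red m (alt_word j i k)" using Suc.IH[of j i] Suc.prems m_sym by simp
  moreover have "\<not> nu m (alt_word j i k) [i]" using Suc.prems nu_alt_word_False by simp
  ultimately show ?case using red_Cons_iff by simp
qed

text \<open>Along a reduced word of w, right multiplications turn evaluation at the identity into
  evaluation at w without correction terms, and x commutes with them.\<close>

lemma com_app_zero: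
  assumes "com x" and zero: "\<And>f b. app x f b (N []) = 0"
  shows "app x f b (N w) = 0"
proof -
  obtain y where y: "w \<asymp> y" "red m y" using red_exists by blast
  let ?r = "prod_list (map (\<lambda>i. R (twist sw b i)) y)"
  have "x * ?r = ?r * x"
  proof (induction y)
    case (Cons i y)
    have "x * R (twist sw b i) = R (twist sw b i) * x" using assms(1) by (simp add: com_def)
    then show ?case using Cons unfolding list.map prod_list.Cons by (metis mult.assoc)
  qed simp
  then have "app ?r (app x f) b (N []) = app x (app ?r f) b (N [])"
    using app_mult by metis
  then have "app ?r (app x f) b (N []) = 0" using zero by simp
  moreover have "app ?r (app x f) b (N []) = app x f b (N y)"
    using app_Rs_red[of "[]" y b "app x f"] y by simp
  moreover have "N y = N w" using y(1) ceq_sym by (simp add: nform_eq_iff)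
  ultimately show ?thesis by simp
qed

text \<open>Both sides lie in the commutant, so only their values at the identity have to be
  compared. There no correction term occurs, because alternating words of length
  \<open>m i j\<close> are reduced.\<close>

lemma L_braid: "sword (alt_word i j (m i j)) = sword (alt_word j i (m i j))"
proof (cases "i = j")
  case False
  let ?a = "alt_word i j (m i j)" and ?b = "alt_word j i (m i j)"
  let ?d = "sword ?a - sword ?b"
  have ab: "?a \<asymp> ?b" using ceq_braid[OF False, of m "[]" "[]"] by simp
  have "red m ?a" by (rule red_alt_word[OF False order.refl])
  then have ra: "red m (rev ?a)" by (rule red_rev)
  have "red m ?b" using red_alt_word[of j i "m i j"] False m_sym[of j i] by simp
  then have rb: "red m (rev ?b)" by (rule red_rev)
  have N_ab: "N (rev ?a) = N (rev ?b)" using ceq_rev[OF ab] by (simp add: nform_eq_iff)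
  have zero: "app ?d f b (N []) = 0" for f b
  proof -
    have "app (sword ?a) f b (N []) = f b (N (rev ?a))" using app_sword_red[of ?a "[]"] ra by simp
    moreover have "app (sword ?b) f b (N []) = f b (N (rev ?b))"
      using app_sword_red[of ?b "[]"] rb by simp
    ultimately show ?thesis using N_ab by simp
  qed
  have "com ?d"
    using com_sword[of ?a] com_sword[of ?b] by (simp add: com_def left_diff_distrib right_diff_distrib)
  then have eq: "app ?d f b (N w) = 0" for f b w using zero by (rule com_app_zero)
  show ?thesis
  proof (rule endo_eqI_nform[where m = m])
    fix f b w show "app (sword ?a) f b (N w) = app (sword ?b) f b (N w)"
      using eq[of f b w] by simp
  qed (simp add: app_sword_junk)
qed simp

section \<open>The functional \<tau> and supports of functions\<close>

definition delta :: "bool \<Rightarrow> nat list \<Rightarrow> vec" where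
  "delta c y = (\<lambda>b w. if b = c \<and> w = N y then 1 else 0)"

definition tau :: "endo \<Rightarrow> qv" where
  "tau x = app x (delta False []) False (N [])"

lemma tau_add: "tau (x + y) = tau x + tau y" and tau_minus: "tau (x - y) = tau x - tau y"
  and tau_scl: "tau (scl c * x) = c * tau x" and tau_zero: "tau 0 = 0" and tau_one: "tau 1 = 1"
  by (simp_all add: tau_def delta_def)

lemma app_L_delta: "\<not> nu m y [i] \<Longrightarrow> app (L i) (delta c y) = delta c (i # y)"
proof (intro ext)
  fix b w assume n: "\<not> nu m y [i]"
  show "app (L i) (delta c y) b w = delta c (i # y) b w"
  proof (cases "N w = w")
    case True
    have "N (i # w) = N y \<longleftrightarrow> w = N (i # y)"
      using ceq_move_left[of m "[i]" w y] True nform_eq_iff[of m w "i # y"] by (simp add: nform_eq_iff)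
    moreover have "w = N y \<Longrightarrow> \<not> nu m w [i]" using n by simp
    ultimately show ?thesis using True by (auto simp: app_Lop delta_def)
  next
    case False
    then have "w \<noteq> N y" "w \<noteq> N (i # y)" by auto
    then show ?thesis using False by (simp add: app_Lop delta_def)
  qed
qed

lemma app_sword_delta: "red m (x @ y) \<Longrightarrow> app (sword x) (delta c y) = delta c (x @ y)"
proof (induction x)
  case (Cons i x)
  then have "red m (x @ y)" using red_Cons_tl by simp
  moreover from this have "\<not> nu m (x @ y) [i]" using Cons.prems red_Cons_iff by simp
  ultimately show ?case using Cons.IH by (simp add: app_L_delta)
qed simp

lemma app_R_delta: "app (R i) (delta False []) = delta False [i]"
proof (intro ext)
  fix b w
  show "app (R i) (delta False []) b w = delta False [i] b w"
  proof (cases "N w = w")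
    case True
    have "N (w @ [i]) = N [] \<longleftrightarrow> w = N [i]"
      using ceq_move_right[of m w "[i]" "[]"] True nform_eq_iff[of m w "[i]"] by (simp add: nform_eq_iff)
    moreover have "\<not> nu m (rev w) [i]" if "w = N []"
      using nu_rev_N[of "[]" "[i]"] that by simp
    moreover have "N [i] \<noteq> N []"
      using red_singleton[of i] unfolding red_def by (fastforce simp: nform_eq_iff)
    ultimately show ?thesis using True by (auto simp: app_Rop delta_def twist_def)
  next
    case False
    then have "w \<noteq> N []" "w \<noteq> N [i]" by auto
    then show ?thesis using False by (simp add: app_Rop delta_def)
  qed
qed

lemma app_S_delta: "app S (delta c y) = delta (\<not> c) (map sw y)"
proof (intro ext)
  fix b w
  show "app S (delta c y) b w = delta (\<not> c) (map sw y) b w"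
  proof (cases "N w = w")
    case True
    have "N (map sw w) = N y \<longleftrightarrow> w = N (map sw y)"
      using ceq_map_sw_iff[of w "map sw y"] True nform_eq_iff[of m w "map sw y"] map_sw_sw[of y]
      by (simp add: nform_eq_iff del: map_map map_sw_sw)
    then show ?thesis using True by (auto simp: app_Sop delta_def)
  next
    case False
    then have "w \<noteq> N y" "w \<noteq> N (map sw y)" by auto
    then show ?thesis using False by (simp add: app_Sop delta_def)
  qed
qed

text \<open>At the identity, left and right multiplication by an inverse generator agree, both on
  the basis vector to which they are applied and on the coefficient that is read off. In between,
  the right multiplication can be moved past x.\<close>

lemma tau_L_comm: "com x \<Longrightarrow> tau (x * L i) = tau (L i * x)"
proof -
  assume "com x"
  then have "x * R i = R i * x" by (simp add: com_def)
  then have e: "app x (app (R i) f) = app (R i) (app x f)" for f using app_mult by metis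
  have "app (L i) (delta False []) = app (R i) (delta False [])"
    by (simp add: app_L_delta app_R_delta)
  then have "tau (x * L i) = app (R i) (app x (delta False [])) False (N [])"
    by (simp add: tau_def e)
  then show ?thesis by (simp add: tau_def app_R_N app_Lop_nform twist_def)
qed

lemma tau_S_comm: "com x \<Longrightarrow> tau (x * S) = tau (S * x)"
proof -
  assume "com x"
  then have "x * Pop = Pop * x" by (simp add: com_def)
  then have e: "app x (app Pop f) = app Pop (app x f)" for f using app_mult by metis
  have "app S (delta False []) = app Pop (delta False [])"
    by (simp add: app_S_delta fun_eq_iff) (auto simp: delta_def)
  then have "tau (x * S) = app Pop (app x (delta False [])) False (N [])"
    by (simp add: tau_def e del: app_Pop)
  then show ?thesis by (simp add: tau_def app_S_N)
qed

lemma tau_sword: "red m x \<Longrightarrow> tau (sword x) = (if x \<asymp> [] then 1 else 0)"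
  using app_sword_delta[of x "[]" False] by (auto simp: tau_def delta_def nform_eq_iff intro: ceq_sym)

text \<open>The device for showing that \<tau> vanishes: a set of group elements that is stable
  under the generators in question and does not contain the identity.\<close>

definition supported :: "(nat list \<Rightarrow> bool) \<Rightarrow> vec \<Rightarrow> bool" where
  "supported Z f \<longleftrightarrow> (\<forall>b w. f b (N w) \<noteq> 0 \<longrightarrow> Z w)"

lemma supported_L:
  assumes "supported Z f" "\<And>w. Z (i # w) \<Longrightarrow> Z w"
  shows "supported Z (app (L i) f)"
  unfolding supported_def
proof (intro allI impI)
  fix b w assume "app (L i) f b (N w) \<noteq> 0"
  then have "f b (N (i # w)) \<noteq> 0 \<or> f b (N w) \<noteq> 0" by (auto simp: app_Lop_nform split: if_splits)
  then show "Z w" using assms unfolding supported_def by blast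
qed

lemma supported_S:
  assumes "supported Z f" "\<And>w. Z (map sw w) \<Longrightarrow> Z w"
  shows "supported Z (app S f)"
  unfolding supported_def
proof (intro allI impI)
  fix b w assume "app S f b (N w) \<noteq> 0"
  then have "f (\<not> b) (N (map sw w)) \<noteq> 0" by (simp add: app_S_N)
  then show "Z w" using assms unfolding supported_def by blast
qed

lemma supported_delta:
  assumes "\<And>x y. x \<asymp> y \<Longrightarrow> Z x \<Longrightarrow> Z y" "Z y"
  shows "supported Z (delta c y)"
  unfolding supported_def
proof (intro allI impI)
  fix b w assume "delta c y b (N w) \<noteq> 0"
  then have "y \<asymp> w" by (auto simp: delta_def nform_eq_iff split: if_splits intro: ceq_sym)
  then show "Z w" using assms by blast
qed

lemma tau_not_supported:
  "app y (delta False []) = delta c u \<Longrightarrow> supported Z (app x (delta c u)) \<Longrightarrow> \<not> Z [] \<Longrightarrow> tau (x * y) = 0"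
  unfolding supported_def tau_def by auto

end

section \<open>Jucys-Murphy elements in a tower of algebras\<close>

locale tower =
  fixes t s :: "nat \<Rightarrow> 'h :: ring_1" and C :: "qv \<Rightarrow> 'h" and \<beta> :: qv
  assumes C_add: "C (c + d) = C c + C d" and C_mult: "C (c * d) = C c * C d"
    and C_one [simp]: "C 1 = 1" and C_comm: "x * C c = C c * x"
    and t_0: "t 0 = s 0 + C \<beta>" and t_Suc: "1 \<le> i \<Longrightarrow> t i = s i + C alpha"
    and ts [simp]: "t i * s i = 1" and st [simp]: "s i * t i = 1"
    and braid_01: "t 0 * t 1 * t 0 * t 1 = t 1 * t 0 * t 1 * t 0"
    and braid: "1 \<le> i \<Longrightarrow> t i * t (Suc i) * t i = t (Suc i) * t i * t (Suc i)"
    and far: "i + 2 \<le> j \<Longrightarrow> t i * t j = t j * t i"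
begin

lemma C_zero [simp]: "C 0 = 0"
  using C_add[of 0 0] by simp

lemma C_minus: "C (- c) = - C c"
  using C_add[of c "- c"] by (simp add: add_eq_0_iff)

lemma ts' [simp]: "t i * (s i * x) = x" and st' [simp]: "s i * (t i * x) = x"
  by (simp_all flip: mult.assoc)

lemma inverse_comm: "x * t i = t i * x \<Longrightarrow> x * s i = s i * x"
proof -
  assume a: "x * t i = t i * x"
  have "x * s i = s i * (t i * x) * s i" by simp
  also have "\<dots> = s i * x" unfolding a[symmetric] by (simp add: mult.assoc)
  finally show ?thesis .
qed

lemma t_quad: "1 \<le> i \<Longrightarrow> t i * t i = 1 + C alpha * t i"
  using ts[of i] t_Suc[of i] by (metis C_comm add_diff_cancel_right' diff_add_cancel distrib_left)

lemma s_quad: "1 \<le> i \<Longrightarrow> s i * s i = 1 - C alpha * s i"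
  using st[of i] t_Suc[of i] by (metis C_comm add_diff_cancel_right' distrib_left)

lemma s0_quad: "s 0 * s 0 = 1 - C \<beta> * s 0"
  using st[of 0] t_0 by (metis C_comm add_diff_cancel_right' distrib_left)

lemma t0_quad: "t 0 * t 0 = 1 + C \<beta> * t 0"
  using ts[of 0] t_0 by (metis C_comm add_diff_cancel_right' diff_add_cancel distrib_left)

section \<open>Subalgebras and Jucys-Murphy elements\<close>

inductive_set A :: "nat \<Rightarrow> 'h set" for n where
  A_C: "C c \<in> A n"
| A_t: "i < n \<Longrightarrow> t i \<in> A n"
| A_add: "x \<in> A n \<Longrightarrow> y \<in> A n \<Longrightarrow> x + y \<in> A n"
| A_mult: "x \<in> A n \<Longrightarrow> y \<in> A n \<Longrightarrow> x * y \<in> A n"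

lemma A_one [simp]: "1 \<in> A n"
  using A_C[of 1 n] by simp

lemma A_zero [simp]: "0 \<in> A n"
  using A_C[of 0 n] by simp

lemma A_minus: "x \<in> A n \<Longrightarrow> - x \<in> A n"
  using A_mult[OF A_C[of "- 1" n], of x] by (simp add: C_minus)

lemma A_diff: "x \<in> A n \<Longrightarrow> y \<in> A n \<Longrightarrow> x - y \<in> A n"
  using A_add[of x n "- y"] A_minus by simp

lemma A_mono: "x \<in> A n \<Longrightarrow> n \<le> n' \<Longrightarrow> x \<in> A n'"
  by (induction rule: A.induct) (auto intro: A.intros)

lemma A_Suc: "x \<in> A n \<Longrightarrow> x \<in> A (Suc n)"
  using A_mono[of x n "Suc n"] by simp

lemma A_s: "i < n \<Longrightarrow> s i \<in> A n"
proof -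
  assume i: "i < n"
  have "s i = t i - C (if i = 0 then \<beta> else alpha)" using t_0 t_Suc[of i] by (cases i) auto
  then show ?thesis using i A_diff A_t A_C by metis
qed

lemma A_0: "x \<in> A 0 \<Longrightarrow> \<exists>c. x = C c"
  by (induction rule: A.induct) (metis C_add C_mult not_less_zero)+

lemma A_comm_ind:
  assumes "x \<in> A n" "\<And>i. i < n \<Longrightarrow> z * t i = t i * z"
  shows "z * x = x * z"
  using assms(1)
proof (induction rule: A.induct)
  case (A_mult x y) then show ?case by (metis mult.assoc)
qed (simp_all add: C_comm assms(2) distrib_left distrib_right)

lemma A_t_comm: "x \<in> A k \<Longrightarrow> k + 1 \<le> j \<Longrightarrow> t j * x = x * t j"
proof (rule A_comm_ind)
  fix i assume "i < k" "k + 1 \<le> j"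
  then show "t j * t i = t i * t j" using far[of i j] by simp
qed

lemma A_t_comm_Suc: "x \<in> A k \<Longrightarrow> t (Suc k) * x = x * t (Suc k)"
  by (rule A_t_comm) auto

lemma A_s_comm_Suc: "x \<in> A k \<Longrightarrow> s (Suc k) * x = x * s (Suc k)"
  using inverse_comm[OF A_t_comm_Suc[symmetric]] by simp

text \<open>Indices start at 0, so \<open>jj k\<close> belongs to the Jucys-Murphy element of index
  k + 1 and \<open>yy k\<close> to its inverse. In type D they differ from these by a factor
  \<varsigma>, which is accounted for in \<open>theta_gD\<close>.\<close>

fun jj :: "nat \<Rightarrow> 'h" where
  "jj 0 = t 0"
| "jj (Suc k) = t (Suc k) * jj k * t (Suc k)"

fun yy :: "nat \<Rightarrow> 'h" where
  "yy 0 = s 0"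
| "yy (Suc k) = s (Suc k) * yy k * s (Suc k)"

lemma jj_A: "jj k \<in> A (Suc k)"
proof (induction k)
  case (Suc k)
  then show ?case using A_mono[OF Suc] by (auto intro!: A.intros)
qed (auto intro: A.intros)

lemma yy_A: "yy k \<in> A (Suc k)"
proof (induction k)
  case (Suc k)
  then show ?case using A_mono[OF Suc] A_s[of "Suc k" "Suc (Suc k)"] by (auto intro!: A.intros)
qed (auto intro: A_s)

lemma jj_yy [simp]: "jj k * yy k = 1" and yy_jj [simp]: "yy k * jj k = 1"
proof (induction k)
  case (Suc k)
  have r: "jj k * (yy k * x) = x" "yy k * (jj k * x) = x" for x
    using Suc by (simp_all flip: mult.assoc)
  show "jj (Suc k) * yy (Suc k) = 1" by (simp add: mult.assoc r)
  show "yy (Suc k) * jj (Suc k) = 1" by (simp add: mult.assoc r)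
qed simp_all

lemma jj_yy' [simp]: "jj k * (yy k * x) = x" and yy_jj' [simp]: "yy k * (jj k * x) = x"
  by (simp_all only: jj_yy yy_jj mult_1_left flip: mult.assoc)

text \<open>Only i = k does not follow from the induction hypothesis and far commutation. There
  \<open>jj (Suc k)\<close> is t_{k+1} t_k j t_k t_{k+1} with j = \<open>jj (k - 1)\<close>, which
  commutes with t_{k+1}, and two uses of the braid relation carry t_k from the right end to the
  left. For k = 0 this is the relation of length four.\<close>

lemma jj_t_comm: "i < k \<Longrightarrow> jj k * t i = t i * jj k"
proof (induction k)
  case (Suc k)
  let ?t = "t (Suc k)"
  consider "i < k" | "i = k" "k = 0" | k' where "i = k" "k = Suc k'" using Suc.prems
    by (metis less_antisym not0_implies_Suc)
  then show ?case
  proof cases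
    case 1
    then have "?t * t i = t i * ?t" using far[of i "Suc k"] by simp
    then show ?thesis using Suc.IH[OF 1] by (simp add: mult.assoc) (metis mult.assoc)
  next
    case 2
    then show ?thesis using braid_01 by (simp add: mult.assoc)
  next
    case 3
    have c: "?t * jj k' = jj k' * ?t" using A_t_comm[OF jj_A[of k'], of "Suc k"] 3 by simp
    have b: "t i * ?t * t i = ?t * t i * ?t" using braid[of i] 3 by simp
    have "jj (Suc k) * t i = ?t * t i * jj k' * (t i * ?t * t i)" using 3 by (simp add: mult.assoc)
    also have "\<dots> = ?t * t i * (jj k' * ?t) * t i * ?t" unfolding b by (simp add: mult.assoc)
    also have "\<dots> = (?t * t i * ?t) * jj k' * t i * ?t" unfolding c[symmetric] by (simp add: mult.assoc)
    also have "\<dots> = t i * jj (Suc k)" unfolding b[symmetric] using 3 by (simp add: mult.assoc)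
    finally show ?thesis .
  qed
qed simp

lemma jj_comm: "x \<in> A k \<Longrightarrow> jj k * x = x * jj k"
  by (rule A_comm_ind[OF _ jj_t_comm])

lemma yy_comm: "x \<in> A k \<Longrightarrow> yy k * x = x * yy k"
proof -
  assume "x \<in> A k"
  then have c: "jj k * x = x * jj k" by (rule jj_comm)
  have "yy k * x = yy k * (x * jj k) * yy k" by (simp add: mult.assoc)
  also have "\<dots> = yy k * jj k * x * yy k" unfolding c[symmetric] by (simp add: mult.assoc)
  finally show ?thesis by simp
qed

lemma yy_yy_comm: "yy k * yy l = yy l * yy k"
  by (cases k l rule: linorder_cases) (metis A_mono Suc_leI yy_A yy_comm)+

text \<open>\<open>Lset k\<close> is the span of $A_k \cup A_k t_k A_k$; together with $A_k j_k$ it is all of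
  $A_{k+1}$. \<open>K k\<close> is the kernel of the conditional expectation $A_{k+1} \to A_k$.\<close>

inductive_set Lset :: "nat \<Rightarrow> 'h set" for k where
  Lset_A: "x \<in> A k \<Longrightarrow> x \<in> Lset k"
| Lset_t: "x \<in> A k \<Longrightarrow> y \<in> A k \<Longrightarrow> 1 \<le> k \<Longrightarrow> x * t k * y \<in> Lset k"
| Lset_add: "x \<in> Lset k \<Longrightarrow> y \<in> Lset k \<Longrightarrow> x + y \<in> Lset k"

inductive_set K :: "nat \<Rightarrow> 'h set" for k where
  K_zero: "0 \<in> K k"
| K_s: "x \<in> A k \<Longrightarrow> y \<in> A k \<Longrightarrow> 1 \<le> k \<Longrightarrow> x * s k * y \<in> K k"
| K_yy: "x \<in> A k \<Longrightarrow> x * yy k \<in> K k"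
| K_add: "x \<in> K k \<Longrightarrow> y \<in> K k \<Longrightarrow> x + y \<in> K k"

lemma Lset_subset: "x \<in> Lset k \<Longrightarrow> x \<in> A (Suc k)"
  by (induction rule: Lset.induct) (auto intro: A.intros A_Suc)

lemma Lset_left: "x \<in> Lset k \<Longrightarrow> a \<in> A k \<Longrightarrow> a * x \<in> Lset k"
proof (induction rule: Lset.induct)
  case (Lset_t x y)
  then show ?case using Lset.Lset_t[of "a * x" k y] by (simp add: mult.assoc A_mult)
qed (auto simp: distrib_left intro: Lset.intros A_mult)

lemma Lset_right: "x \<in> Lset k \<Longrightarrow> a \<in> A k \<Longrightarrow> x * a \<in> Lset k"
proof (induction rule: Lset.induct)
  case (Lset_t x y)
  then show ?case using Lset.Lset_t[of x k "y * a"] by (simp add: mult.assoc A_mult)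
qed (auto simp: distrib_right intro: Lset.intros A_mult)

lemma K_left: "x \<in> K k \<Longrightarrow> a \<in> A k \<Longrightarrow> a * x \<in> K k"
proof (induction rule: K.induct)
  case (K_s x y)
  then show ?case using K.K_s[of "a * x" k y] by (simp add: mult.assoc A_mult)
next
  case (K_yy x)
  then show ?case using K.K_yy[of "a * x" k] by (simp add: mult.assoc A_mult)
qed (auto simp: distrib_left intro: K.intros)

lemma K_right: "x \<in> K k \<Longrightarrow> a \<in> A k \<Longrightarrow> x * a \<in> K k"
proof (induction rule: K.induct)
  case (K_s x y)
  then show ?case using K.K_s[of x k "y * a"] by (simp add: mult.assoc A_mult)
next
  case (K_yy x)
  then show ?case using K.K_yy[of "x * a" k] yy_comm[of a k] by (simp add: mult.assoc A_mult)
qed (auto simp: distrib_right intro: K.intros)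

lemma K_minus: "x \<in> K k \<Longrightarrow> - x \<in> K k"
  using K_left[OF _ A_C[of "- 1"], of x k] by (simp add: C_minus)

lemma K_diff: "x \<in> K k \<Longrightarrow> y \<in> K k \<Longrightarrow> x - y \<in> K k"
  using K_add[of x k "- y"] K_minus by simp

lemma Lset_minus: "x \<in> Lset k \<Longrightarrow> - x \<in> Lset k"
  using Lset_left[OF _ A_C[of "- 1"], of x k] by (simp add: C_minus)

lemma Lset_diff: "x \<in> Lset k \<Longrightarrow> y \<in> Lset k \<Longrightarrow> x - y \<in> Lset k"
  using Lset_add[of x k "- y"] Lset_minus by simp

lemma Lset_t1: "x \<in> A k \<Longrightarrow> 1 \<le> k \<Longrightarrow> x * t k \<in> Lset k"
  using Lset_t[of x k 1] by simp

lemma K_s1: "x \<in> A k \<Longrightarrow> 1 \<le> k \<Longrightarrow> x * s k \<in> K k"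
  using K_s[of x k 1] by simp

section \<open>One step of the tower\<close>

lemma sandwich_A: "a \<in> A k \<Longrightarrow> t (Suc k) * a * t (Suc k) \<in> Lset (Suc k)"
proof -
  assume a: "a \<in> A k"
  have "t (Suc k) * a * t (Suc k) = a * (t (Suc k) * t (Suc k))"
    by (simp add: A_t_comm_Suc[OF a] mult.assoc)
  also have "\<dots> = a + a * C alpha * t (Suc k)"
    by (simp add: t_quad distrib_left mult.assoc)
  finally show ?thesis
    using Lset_add[OF Lset_A[OF A_Suc[OF a]] Lset_t1[OF A_mult[OF A_Suc[OF a] A_C]]] by simp
qed

text \<open>Elements of \<open>A k\<close> pass through t_{k+1}, and the braid relation turns
  t_{k+1} t_k t_{k+1} into t_k t_{k+1} t_k, where t_{k+1} stands between two elements of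
  \<open>A (Suc k)\<close>.\<close>

lemma sandwich_Lset: "x \<in> Lset k \<Longrightarrow> t (Suc k) * x * t (Suc k) \<in> Lset (Suc k)"
proof (induction rule: Lset.induct)
  case (Lset_A x) then show ?case by (rule sandwich_A)
next
  case (Lset_t b c)
  let ?t = "t (Suc k)"
  have "?t * (b * t k * c) * ?t = b * (?t * t k * ?t) * c"
    using A_t_comm_Suc[OF Lset_t(1)] A_t_comm_Suc[OF Lset_t(2)]
    by (metis mult.assoc)
  also have "\<dots> = (b * t k) * ?t * (t k * c)"
    unfolding braid[OF Lset_t(3), symmetric] by (simp add: mult.assoc)
  finally show ?case
    using Lset_t by (auto intro!: Lset.Lset_t A_mult A_t intro: A_Suc)
next
  case (Lset_add x y)
  then show ?case using Lset.Lset_add by (simp add: distrib_left distrib_right)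
qed

text \<open>The algebraic counterpart of the three double cosets of the group of rank k in that of
  rank k + 1. The set D of all sums of the required form contains 1, so it is enough that left
  multiplication by the generators preserves it. The only difficult product is t b t with t the new
  generator and b of the preceding rank: decomposing b by induction splits it into a sandwiched
  element of \<open>Lset k\<close> and a multiple of the next Jucys-Murphy element.\<close>

lemma decompose: "x \<in> A (Suc k) \<Longrightarrow> \<exists>l\<in>Lset k. \<exists>a\<in>A k. x = l + a * jj k"
proof (induction k arbitrary: x)
  case 0
  define D where "D = {l + a * jj 0 | l a. l \<in> Lset 0 \<and> a \<in> A 0}"
  have key: "x * z \<in> D" if "x \<in> A (Suc 0)" "z \<in> D" for x z
    using that
  proof (induction arbitrary: z rule: A.induct)
    case (A_C c)
    then obtain l a where z: "z = l + a * jj 0" "l \<in> Lset 0" "a \<in> A 0" unfolding D_def by blast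
    have "C c * z = C c * l + (C c * a) * jj 0" unfolding z(1) by (simp only: distrib_left mult.assoc)
    moreover have "C c * l \<in> Lset 0" using z(2) A.A_C by (rule Lset_left)
    moreover have "C c * a \<in> A 0" using A.A_C z(3) by (rule A_mult)
    ultimately show ?case unfolding D_def by (intro CollectI exI conjI)
  next
    case (A_t i)
    then obtain l a where z: "z = l + a * jj 0" "l \<in> Lset 0" "a \<in> A 0" unfolding D_def by blast
    have lA: "l \<in> A 0" using z(2)
      by (induction rule: Lset.induct) (auto intro: A.intros)
    obtain c d where cd: "l = C c" "a = C d" using A_0 lA z(3) by blast
    have "t 0 * z = C d + (C c + C d * C \<beta>) * jj 0"
    proof -
      have "t 0 * z = t 0 * C c + t 0 * C d * t 0" unfolding z(1) cd by (simp add: distrib_left mult.assoc)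
      also have "\<dots> = C c * t 0 + C d * (t 0 * t 0)" unfolding C_comm by (simp add: mult.assoc)
      also have "\<dots> = C d + (C c + C d * C \<beta>) * jj 0"
        by (simp add: t0_quad distrib_left distrib_right mult.assoc)
      finally show ?thesis .
    qed
    moreover have "C d \<in> Lset 0" "C c + C d * C \<beta> \<in> A 0" by (auto intro!: A.intros Lset_A)
    ultimately show ?case using A_t unfolding D_def by auto
  next
    case (A_add x y)
    then obtain l a l' a' where "x * z = l + a * jj 0" "l \<in> Lset 0" "a \<in> A 0"
      "y * z = l' + a' * jj 0" "l' \<in> Lset 0" "a' \<in> A 0" unfolding D_def by blast
    then have "(x + y) * z = (l + l') + (a + a') * jj 0" "l + l' \<in> Lset 0" "a + a' \<in> A 0"
      by (simp_all only: distrib_right add_ac Lset_add A.A_add)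
    then show ?case unfolding D_def by (intro CollectI exI conjI)
  next
    case (A_mult x y)
    then show ?case by (simp add: mult.assoc)
  qed
  have "1 = 1 + 0 * jj 0" "1 \<in> Lset 0" by (simp_all add: Lset_A)
  then have "1 \<in> D" unfolding D_def using A_zero by blast
  then show ?case using key[OF 0] unfolding D_def by fastforce
next
  case (Suc k)
  let ?k = "Suc k" let ?t = "t ?k"
  define D where "D = {l + a * jj ?k | l a. l \<in> Lset ?k \<and> a \<in> A ?k}"
  have D_add: "x + y \<in> D" if "x \<in> D" "y \<in> D" for x y
  proof -
    obtain l a where 1: "x = l + a * jj ?k" "l \<in> Lset ?k" "a \<in> A ?k"
      using \<open>x \<in> D\<close> unfolding D_def by blast
    obtain l' a' where 2: "y = l' + a' * jj ?k" "l' \<in> Lset ?k" "a' \<in> A ?k"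
      using \<open>y \<in> D\<close> unfolding D_def by blast
    have "x + y = (l + l') + (a + a') * jj ?k" unfolding 1 2 by (simp only: distrib_right add_ac)
    then show ?thesis unfolding D_def using Lset_add[OF 1(2) 2(2)] A_add[OF 1(3) 2(3)]
      by (intro CollectI exI conjI)
  qed
  have D_L: "l \<in> D" if "l \<in> Lset ?k" for l
  proof -
    have "l = l + 0 * jj ?k" by simp
    then show ?thesis unfolding D_def using that A_zero by (intro CollectI exI conjI)
  qed
  have D_J: "a * jj ?k \<in> D" if "a \<in> A ?k" for a
  proof -
    have "a * jj ?k = 0 + a * jj ?k" by simp
    then show ?thesis unfolding D_def using that Lset_A[OF A_zero] by (intro CollectI exI conjI)
  qed
  have D_left: "a * z \<in> D" if "a \<in> A ?k" "z \<in> D" for a z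
  proof -
    obtain l b where 1: "z = l + b * jj ?k" "l \<in> Lset ?k" "b \<in> A ?k"
      using \<open>z \<in> D\<close> unfolding D_def by blast
    have "a * z = a * l + (a * b) * jj ?k" unfolding 1 by (simp only: distrib_left mult.assoc)
    then show ?thesis unfolding D_def using Lset_left[OF 1(2) that(1)] A_mult[OF that(1) 1(3)]
      by (intro CollectI exI conjI)
  qed
  have tbt: "?t * b * ?t * c \<in> D" if bc: "b \<in> A ?k" "c \<in> A ?k" for b c
  proof -
    obtain l a where la: "b = l + a * jj k" "l \<in> Lset k" "a \<in> A k" using Suc.IH[OF bc(1)] by blast
    have "?t * b * ?t * c = ?t * l * ?t * c + (a * c) * jj ?k"
    proof -
      have "?t * (a * jj k) * ?t * c = a * (jj ?k * c)"
        using A_t_comm_Suc[OF la(3)] by (simp flip: mult.assoc)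
      also have "\<dots> = (a * c) * jj ?k" unfolding jj_comm[OF bc(2)] by (simp only: mult.assoc)
      finally show ?thesis unfolding la(1) by (simp only: distrib_left distrib_right)
    qed
    moreover have "?t * l * ?t * c \<in> D" using D_L Lset_right[OF sandwich_Lset[OF la(2)] bc(2)] .
    moreover have "(a * c) * jj ?k \<in> D" using D_J A_mult[OF A_Suc[OF la(3)] bc(2)] .
    ultimately show ?thesis using D_add by metis
  qed
  have tl: "?t * l \<in> D" if "l \<in> Lset ?k" for l
    using that
  proof (induction rule: Lset.induct)
    case (Lset_A x)
    then show ?case using D_L Lset_t[of 1 ?k x] by simp
  next
    case (Lset_t x y)
    then show ?case using tbt by (simp add: mult.assoc)
  next
    case (Lset_add x y)
    then show ?case using D_add by (simp add: distrib_left)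
  qed
  have tj: "?t * (a * jj ?k) \<in> D" if a: "a \<in> A ?k" for a
  proof -
    have "?t * (a * jj ?k) = (?t * ?t) * jj k * ?t * a"
      using jj_comm[OF a] by (simp add: mult.assoc)
    also have "\<dots> = jj k * ?t * a + C alpha * a * jj ?k"
      using jj_comm[OF a] by (simp add: t_quad distrib_right mult.assoc)
    finally show ?thesis
      using D_add[OF D_L[OF Lset_t[OF jj_A a]] D_J[OF A_mult[OF A_C a]]] by simp
  qed
  have key: "x * z \<in> D" if "x \<in> A (Suc ?k)" "z \<in> D" for x z
    using that
  proof (induction arbitrary: z rule: A.induct)
    case (A_C c)
    then show ?case using D_left[OF A.A_C] by simp
  next
    case (A_t i)
    show ?case
    proof (cases "i = ?k")
      case True
      from A_t(2) obtain l a where "z = l + a * jj ?k" "l \<in> Lset ?k" "a \<in> A ?k"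
        unfolding D_def by blast
      then show ?thesis using D_add[OF tl tj] True by (simp add: distrib_left)
    next
      case False
      then show ?thesis using D_left[OF A.A_t] A_t by simp
    qed
  next
    case (A_add x y)
    then show ?case using D_add by (simp add: distrib_right)
  next
    case (A_mult x y)
    then show ?case by (simp add: mult.assoc)
  qed
  have "1 \<in> D" by (rule D_L) (simp add: Lset_A)
  then show ?case using key[OF Suc.prems] unfolding D_def by fastforce
qed

text \<open>The map that multiplies by s_{k+1} on both sides carries the kernel of rank k into that
  of rank k + 1, by the braid relation for s_k and by the recursion for y. On \<open>A k\<close> it
  is multiplication by s_{k+1}^2 = 1 - \<alpha> s_{k+1}, whose expectation is 1. Thus it preserves
  expectations, and these can be computed by induction on the rank.\<close>

lemma sandwich_K:
  assumes "x - z \<in> K k" "z \<in> A k"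
  shows "s (Suc k) * x * s (Suc k) - z \<in> K (Suc k)"
proof -
  let ?s = "s (Suc k)"
  have 1: "?s * y * ?s \<in> K (Suc k)" if "y \<in> K k" for y
    using that
  proof (induction rule: K.induct)
    case (K_s b c)
    have sbraid: "?s * s k * ?s = s k * ?s * s k"
    proof -
      have "t k * ?s * s k = ?s * s k * t (Suc k)"
      proof -
        have "t (Suc k) * t k * (?s * s k * t (Suc k)) = t (Suc k) * (t k * ?s * s k * t (Suc k))"
          by (simp add: mult.assoc)
        have "?s * s k * (t k * t (Suc k) * t k) * ?s * s k = ?s * s k * (t (Suc k) * t k * t (Suc k)) * ?s * s k"
          using braid[OF K_s(3)] by simp
        then show ?thesis by (simp add: mult.assoc)
      qed
      then have "s k * (t k * ?s * s k) * ?s = s k * (?s * s k * t (Suc k)) * ?s" by simp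
      then show ?thesis by (simp add: mult.assoc)
    qed
    have "?s * (b * s k * c) * ?s = b * (?s * s k * ?s) * c"
      using A_s_comm_Suc[OF K_s(1)] A_s_comm_Suc[OF K_s(2)] by (metis mult.assoc)
    also have "\<dots> = (b * s k) * ?s * (s k * c)" unfolding sbraid by (simp add: mult.assoc)
    finally show ?case using K_s by (auto intro!: K.K_s A_mult A_s intro: A_Suc)
  next
    case (K_yy x)
    have "?s * (x * yy k) * ?s = x * yy (Suc k)"
      using A_s_comm_Suc[OF K_yy] by simp (metis mult.assoc)
    then show ?case using K.K_yy[OF A_Suc[OF K_yy]] by simp
  qed (auto simp: distrib_left distrib_right intro: K.intros)
  have "?s * z * ?s - z = - (z * C alpha * ?s)"
    using A_s_comm_Suc[OF assms(2)] s_quad[of "Suc k"]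
    by (simp add: mult.assoc right_diff_distrib)
  moreover have "\<dots> \<in> K (Suc k)"
    using A_Suc[OF assms(2)] by (intro K_minus K_s1 A_mult A_C) auto
  ultimately have 2: "?s * z * ?s - z \<in> K (Suc k)" by simp
  have eq: "?s * x * ?s - z = ?s * (x - z) * ?s + (?s * z * ?s - z)"
    by (simp add: algebra_simps)
  show ?thesis unfolding eq by (rule K_add[OF 1[OF assms(1)] 2])
qed

section \<open>Values of the conditional expectation\<close>

lemma K_yy1: "yy k \<in> K k"
  using K_yy[of 1 k] by simp

lemma yy_s: "yy (Suc k) * s (Suc k) = s (Suc k) * yy k - C alpha * yy (Suc k)"
proof -
  let ?s = "s (Suc k)"
  have "yy (Suc k) * ?s = ?s * yy k * (?s * ?s)" by (simp add: mult.assoc)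
  also have "\<dots> = ?s * yy k - ?s * yy k * C alpha * ?s"
    by (simp add: s_quad right_diff_distrib mult.assoc)
  also have "?s * yy k * C alpha * ?s = C alpha * yy (Suc k)"
    unfolding C_comm by (simp add: mult.assoc)
  finally show ?thesis .
qed

lemma s_yy_K: "s (Suc k) * yy k \<in> K (Suc k)"
  using K_s[of 1 "Suc k" "yy k"] yy_A[of k] by simp

lemma yy_s_K: "yy (Suc k) * s (Suc k) \<in> K (Suc k)"
  unfolding yy_s using K_left[OF K_yy1 A_C] by (intro K_diff s_yy_K)

lemma yy_t_K: "yy (Suc k) * t (Suc k) \<in> K (Suc k)"
  using s_yy_K by (simp add: mult.assoc)

lemma yy2_t_K: "yy (Suc k) * yy (Suc k) * t (Suc k) \<in> K (Suc k)"
proof -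
  have "yy (Suc k) * yy (Suc k) * t (Suc k) = (yy (Suc k) * s (Suc k)) * yy k"
    by (simp add: mult.assoc)
  then show ?thesis using K_right[OF yy_s_K yy_A] by simp
qed

text \<open>The induction step for expectations that involve y^2: the inner s^2 is expanded by the
  quadratic relation. The last term is in the kernel by \<open>yy_s_K\<close>, and the first is a
  sandwich. The formula is used with x = 1 and with x = \<open>TT k\<close>.\<close>

lemma yy2_product:
  assumes "x \<in> A (Suc k)"
  shows "yy (Suc k) * (s (Suc k) * yy k * x * s (Suc k)) =
    s (Suc k) * (yy k * yy k * x) * s (Suc k) - C alpha * (yy k * x) * (yy (Suc k) * s (Suc k))"
proof -
  let ?s = "s (Suc k)"
  have "yy (Suc k) * (?s * yy k * x * ?s) = ?s * yy k * (?s * ?s) * yy k * x * ?s"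
    by (simp add: mult.assoc)
  also have "\<dots> = ?s * (yy k * yy k * x) * ?s - C alpha * yy (Suc k) * (yy k * x) * ?s"
    using C_comm[of "?s * yy k" alpha]
    by (simp add: s_quad right_diff_distrib left_diff_distrib mult.assoc) (metis mult.assoc)
  also have "C alpha * yy (Suc k) * (yy k * x) * ?s = C alpha * (yy k * x) * (yy (Suc k) * ?s)"
    using yy_comm[OF A_mult[OF yy_A assms]] by (metis mult.assoc)
  finally show ?thesis .
qed

lemma yy2_K: "yy k * yy k - 1 \<in> K k"
proof (induction k)
  case 0
  have eq: "yy 0 * yy 0 - 1 = - (C \<beta> * yy 0)" using s0_quad by simp
  show ?case unfolding eq by (rule K_minus[OF K_left[OF K_yy1 A_C]])
next
  case (Suc k)
  have "yy (Suc k) * yy (Suc k) - 1 = (s (Suc k) * (yy k * yy k) * s (Suc k) - 1) -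
      C alpha * yy k * (yy (Suc k) * s (Suc k))"
    using yy2_product[OF A_one, of k] by (simp del: yy.simps(2)) (simp add: mult.assoc)
  moreover have "\<dots> \<in> K (Suc k)"
    by (rule K_diff[OF sandwich_K[OF Suc A_one] K_left[OF yy_s_K A_mult[OF A_C yy_A]]])
  ultimately show ?case by (simp only:)
qed

section \<open>The elements T\<close>

fun TT :: "nat \<Rightarrow> 'h" where
  "TT 0 = t 0"
| "TT (Suc k) = t (Suc k) * TT k * s (Suc k)"

lemma TT_A: "TT k \<in> A (Suc k)"
proof (induction k)
  case (Suc k)
  then show ?case using A_mono[OF Suc] A_s[of "Suc k" "Suc (Suc k)"] by (auto intro!: A.intros)
qed (auto intro: A_t)

text \<open>Replacing the leading t by s + \<alpha> turns T into a sandwich and a term of the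
  kernel. The expectation is therefore the one of t_0 = s_0 + \<beta>.\<close>

lemma TT_K: "TT k - C \<beta> \<in> K k"
proof (induction k)
  case 0
  then show ?case using K_yy1[of 0] t_0 by simp
next
  case (Suc k)
  have eq: "TT (Suc k) - C \<beta> = (s (Suc k) * TT k * s (Suc k) - C \<beta>) + C alpha * TT k * s (Suc k)"
    by (simp add: t_Suc distrib_right)
  moreover have "C alpha * TT k * s (Suc k) \<in> K (Suc k)"
    using TT_A by (intro K_s1 A_mult A_C) auto
  ultimately show ?case unfolding eq using K_add[OF sandwich_K[OF Suc A_C]] by blast
qed

lemma yy_TT_Suc: "yy (Suc k) * TT (Suc k) = s (Suc k) * yy k * TT k * s (Suc k)"
  by (simp add: mult.assoc)

lemma yy_TT_K: "yy k * TT k - 1 \<in> K k"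
proof (induction k)
  case (Suc k)
  show ?case using sandwich_K[OF Suc A_one] unfolding yy_TT_Suc by (simp add: mult.assoc)
qed (simp add: K_zero)

lemma yy2_TT_K: "yy k * yy k * TT k \<in> K k"
proof (induction k)
  case (Suc k)
  have "yy (Suc k) * yy (Suc k) * TT (Suc k) = yy (Suc k) * (s (Suc k) * yy k * TT k * s (Suc k))"
    by (simp only: mult.assoc[of "yy (Suc k)"] yy_TT_Suc)
  also have "\<dots> = (s (Suc k) * (yy k * yy k * TT k) * s (Suc k) - 0)
      - C alpha * (yy k * TT k) * (yy (Suc k) * s (Suc k))"
    unfolding yy2_product[OF TT_A] by simp
  also have "\<dots> \<in> K (Suc k)"
    using sandwich_K[of "yy k * yy k * TT k" 0 k] Suc
    by (intro K_diff K_left[OF yy_s_K] A_mult A_C yy_A TT_A K_zero) simp_all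
  finally show ?case .
next
  case 0
  show ?case using K_yy1[of 0] by (simp add: mult.assoc)
qed

text \<open>Replacing the trailing s by t - \<alpha> reduces the difference to a sandwich of the
  previous one and a term with a single t. This lets products of the T be traded for products of the
  j in \<open>Pr_Jp\<close>.\<close>

lemma TT_jj: "TT k - jj k \<in> Lset k"
proof (induction k)
  case 0
  show ?case by (simp add: Lset_A)
next
  case (Suc k)
  let ?t = "t (Suc k)"
  have "s (Suc k) = ?t - C alpha" using t_Suc[of "Suc k"] by simp
  then have "TT (Suc k) - jj (Suc k) = ?t * (TT k - jj k) * ?t - C alpha * ?t * TT k"
    using C_comm[of "?t * TT k" alpha] by (simp add: left_diff_distrib right_diff_distrib mult.assoc)
  moreover have "C alpha * ?t * TT k \<in> Lset (Suc k)"
    using TT_A by (intro Lset_t A_C) auto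
  ultimately show ?case using Lset_diff[OF sandwich_Lset[OF Suc]] by simp
qed

end

section \<open>Uniqueness of Markov traces\<close>

unbundle fps_syntax

lemma prod_list_comm:
  "(\<And>y. y \<in> set ys \<Longrightarrow> x * y = y * x) \<Longrightarrow> x * prod_list ys = prod_list ys * (x :: 'r :: ring_1)"
proof (induction ys)
  case (Cons y ys)
  then have "x * prod_list ys = prod_list ys * x" "x * y = y * x" by auto
  then show ?case by (simp flip: mult.assoc) (simp add: mult.assoc)
qed simp

context tower
begin

definition Jp :: "nat \<Rightarrow> nat \<Rightarrow> 'h" where
  "Jp k n = prod_list (map jj [k..<n])"

lemma Jp_self [simp]: "Jp n n = 1"
  by (simp add: Jp_def)

lemma Jp_Cons: "k < n \<Longrightarrow> Jp k n = jj k * Jp (Suc k) n"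
  by (simp add: Jp_def upt_conv_Cons)

lemma prod_list_A: "(\<And>x. x \<in> set xs \<Longrightarrow> x \<in> A n) \<Longrightarrow> prod_list xs \<in> A n"
  by (induction xs) (auto intro: A_mult)

lemma Jp_A: "Jp k n \<in> A n"
  unfolding Jp_def by (rule prod_list_A) (auto intro: A_mono[OF jj_A])

lemma Jp_comm: "x \<in> A k \<Longrightarrow> x * Jp k n = Jp k n * x"
  unfolding Jp_def
proof (rule prod_list_comm)
  fix y assume "x \<in> A k" "y \<in> set (map jj [k..<n])"
  then show "x * y = y * x" using jj_comm A_mono by fastforce
qed

text \<open>With e = 1 this is the product T_1 ... T_n of type B. With e = \<varsigma> it is the
  product U_1 ... U_n of type D, see \<open>S_TT\<close>.\<close>

definition Pr :: "'h \<Rightarrow> nat \<Rightarrow> 'h" where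
  "Pr e n = prod_list (map (\<lambda>i. e * TT i) [0..<n])"

lemma Pr_Suc: "Pr e (Suc n) = Pr e n * (e * TT n)"
  by (simp add: Pr_def)

lemma power_A: "x \<in> A n \<Longrightarrow> x ^ r \<in> A n"
  by (induction r) (auto intro: A_mult)

lemma Pr_A: assumes "e \<in> A 1" shows "Pr e n \<in> A n"
  unfolding Pr_def using assms by (intro prod_list_A) (auto intro!: A_mult A_mono[OF TT_A] A_mono[OF assms])

end

text \<open>Intended for the difference of two traces that agree in rank n - 1. By (U1) and (M2), or
  by the initial value when n = 1, it vanishes on \<open>Lset (n - 1)\<close>, which leaves only
  multiples of the last Jucys-Murphy element.\<close>

locale tower_functional = tower t s C \<beta>
  for t s :: "nat \<Rightarrow> 'h :: ring_1" and C :: "qv \<Rightarrow> 'h" and \<beta> :: qv +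
  fixes \<delta> :: "'h \<Rightarrow> 'f :: ab_group_add" and n :: nat
  assumes n_pos: "1 \<le> n"
    and add: "x \<in> A n \<Longrightarrow> y \<in> A n \<Longrightarrow> \<delta> (x + y) = \<delta> x + \<delta> y"
    and hom: "x \<in> A n \<Longrightarrow> \<delta> x = 0 \<Longrightarrow> \<delta> (C c * x) = 0"
    and cyc: "1 \<le> i \<Longrightarrow> i < n \<Longrightarrow> x \<in> A n \<Longrightarrow> \<delta> (t i * x) = \<delta> (x * t i)"
    and van: "l \<in> Lset (n - 1) \<Longrightarrow> \<delta> l = 0"
begin

text \<open>Write the first factor of the product as t j t with t = t_{k+1} and j =
  \<open>jj k\<close>. Cyclicity moves the leading t to the end and replaces l by j t l t, which
  lies in \<open>Lset (Suc k)\<close>. In this way the factors of the product disappear one by one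
  until \<open>van\<close> applies.\<close>

lemma vanish_Lset: "k < n \<Longrightarrow> l \<in> Lset k \<Longrightarrow> \<delta> (Jp (Suc k) n * l) = 0"
proof (induction "n - Suc k" arbitrary: k l)
  case 0
  then have "n = Suc k" by simp
  then show ?case using van 0 by simp
next
  case (Suc d)
  then have k: "Suc k < n" by simp
  let ?t = "t (Suc k)" and ?J = "Jp (Suc (Suc k)) n"
  have l: "jj k * (?t * l * ?t) \<in> Lset (Suc k)"
    using Lset_left[OF sandwich_Lset[OF Suc.prems(2)] jj_A] .
  have A: "jj k * ?t * ?J * l \<in> A n"
    using k by (intro A_mult Jp_A A_mono[OF jj_A] A_t A_mono[OF Lset_subset[OF Suc.prems(2)]]) auto
  have c: "(jj k * ?t) * ?J = ?J * (jj k * ?t)"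
    by (rule Jp_comm, rule A_mult[OF A_Suc[OF jj_A] A_t]) simp
  have "\<delta> (Jp (Suc k) n * l) = \<delta> (?t * (jj k * ?t * ?J * l))"
    using Jp_Cons[OF k] by (simp add: mult.assoc)
  also have "\<dots> = \<delta> (jj k * ?t * ?J * l * ?t)" using cyc[OF _ k A] by simp
  also have "\<dots> = \<delta> (?J * (jj k * (?t * l * ?t)))" unfolding c by (simp add: mult.assoc)
  also have "\<dots> = 0" using Suc.hyps(1)[OF _ k l] Suc.hyps(2) by simp
  finally show ?case .
qed

text \<open>In the decomposition of x, the part in \<open>Lset k\<close> is killed by
  \<open>vanish_Lset\<close>, and the part a j lengthens the product of Jucys-Murphy elements by one
  factor while a has smaller rank. In rank 0 only scalars are left.\<close>

lemma vanish:
  assumes "\<delta> (Jp 0 n) = 0" "x \<in> A n"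
  shows "\<delta> x = 0"
proof -
  have "\<delta> (Jp k n * x) = 0" if "k \<le> n" "x \<in> A k" for k x
    using that
  proof (induction k arbitrary: x)
    case 0
    then obtain c where "x = C c" using A_0 by blast
    then show ?case using hom[OF Jp_A assms(1)] by (simp add: C_comm)
  next
    case (Suc k)
    then obtain l a where la: "l \<in> Lset k" "a \<in> A k" "x = l + a * jj k" using decompose by blast
    have "Jp (Suc k) n * (a * jj k) = Jp k n * a"
    proof -
      have "Jp (Suc k) n * (a * jj k) = Jp (Suc k) n * jj k * a" using jj_comm[OF la(2)] by (simp add: mult.assoc)
      also have "\<dots> = Jp k n * a" using Jp_comm[OF jj_A[of k], of n] Jp_Cons[of k n] Suc.prems by simp
      finally show ?thesis .
    qed
    then have e: "Jp (Suc k) n * x = Jp (Suc k) n * l + Jp k n * a" by (simp add: la(3) distrib_left)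
    have "\<delta> (Jp (Suc k) n * x) = \<delta> (Jp (Suc k) n * l) + \<delta> (Jp k n * a)" unfolding e
      using Suc.prems by (intro add A_mult Jp_A A_mono[OF Lset_subset[OF la(1)]] A_mono[OF la(2)]) auto
    then show ?case using vanish_Lset[OF _ la(1)] Suc.IH[OF _ la(2)] Suc.prems by simp
  qed
  from this[of n x] assms(2) show ?thesis by simp
qed

text \<open>A telescope: each step trades one T for the corresponding j and moves a factor e to the
  far right. The error contains the difference of T and j, hence lies in the span that
  \<open>vanish_Lset\<close> kills. For k = 0 the two coincide, and for k \<ge> 1 the factor e
  belongs to \<open>A k\<close>.\<close>

lemma Pr_Jp:
  assumes e: "e \<in> A 1" "\<And>i. e * jj i = jj i * e" and k: "k \<le> n"
  shows "\<delta> (Pr e k * Jp k n * e ^ (n - k)) = \<delta> (Jp 0 n * e ^ n)"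
  using k
proof (induction k)
  case 0
  show ?case by (simp add: Pr_def)
next
  case (Suc k)
  then have k: "k < n" by simp
  let ?J = "Jp (Suc k) n" and ?r = "e ^ (n - Suc k)"
  define l where "l = TT k - jj k"
  have eJ: "e * Jp i n = Jp i n * e" for i
    unfolding Jp_def by (rule prod_list_comm) (auto simp: e(2))
  have er: "e * ?r = e ^ (n - k)" using k by (simp add: Suc_diff_Suc flip: power_Suc)
  have eA: "e \<in> A n" using A_mono[OF e(1)] n_pos by simp
  have 0: "\<delta> (Pr e k * e * l * ?J * ?r) = 0"
  proof (cases "k = 0")
    case True
    have "\<delta> 0 = 0" using add[of 0 0] by simp
    then show ?thesis using True by (simp add: l_def)
  next
    case False
    then have eAk: "e \<in> A k" using A_mono[OF e(1), of k] by simp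
    have L: "Pr e k * e * l * ?r \<in> Lset k"
      unfolding l_def by (intro Lset_left Lset_right TT_jj A_mult power_A Pr_A e eAk)
    have lc: "l * ?J = ?J * l" using Jp_comm[of l "Suc k" n] TT_A jj_A by (simp add: l_def A_diff)
    have pc: "(Pr e k * e) * ?J = ?J * (Pr e k * e)"
      by (rule Jp_comm[OF A_Suc[OF A_mult[OF Pr_A[OF e(1)] eAk]]])
    have "Pr e k * e * l * ?J * ?r = (Pr e k * e) * (l * ?J) * ?r" by (simp only: mult.assoc)
    also have "\<dots> = ((Pr e k * e) * ?J) * l * ?r" unfolding lc by (simp only: mult.assoc)
    also have "\<dots> = ?J * (Pr e k * e * l * ?r)" unfolding pc by (simp only: mult.assoc)
    finally show ?thesis using vanish_Lset[OF k L] by simp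
  qed
  have "Pr e (Suc k) * ?J * ?r = Pr e k * e * (jj k + l) * ?J * ?r"
    by (simp add: Pr_Suc l_def mult.assoc)
  also have "\<dots> = Pr e k * e * jj k * ?J * ?r + Pr e k * e * l * ?J * ?r"
    by (simp only: distrib_left distrib_right)
  also have "Pr e k * e * jj k * ?J * ?r = Pr e k * (e * Jp k n) * ?r"
    using Jp_Cons[OF k] by (simp add: mult.assoc)
  also have "\<dots> = Pr e k * Jp k n * e ^ (n - k)" unfolding eJ er[symmetric] by (simp only: mult.assoc)
  finally have eq: "Pr e (Suc k) * ?J * ?r = Pr e k * Jp k n * e ^ (n - k) + Pr e k * e * l * ?J * ?r" .
  have "\<delta> (Pr e (Suc k) * ?J * ?r) = \<delta> (Pr e k * Jp k n * e ^ (n - k)) + \<delta> (Pr e k * e * l * ?J * ?r)"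
    unfolding eq using k eA
    by (intro add A_mult Jp_A power_A A_mono[OF Pr_A[OF e(1)]])
      (auto simp: l_def intro!: A_diff A_mono[OF TT_A] A_mono[OF jj_A])
  then show ?case using 0 Suc by simp
qed

lemma vanish_Pr:
  assumes "e \<in> A 1" "\<And>i. e * jj i = jj i * e" "e ^ n = 1" "\<delta> (Pr e n) = 0" "x \<in> A n"
  shows "\<delta> x = 0"
  using Pr_Jp[OF assms(1,2), of n] vanish[OF _ assms(5)] assms(3,4) by simp

end

section \<open>The generating series F\<close>

lemma commute_mult: "z * x = x * z \<Longrightarrow> z * y = y * z \<Longrightarrow> z * (x * y) = (x * y) * z"
  for x y z :: "'r :: semigroup_mult"
  by (metis mult.assoc)

text \<open>Only x + y and x y occur on the right, so whatever commutes with these two, with a and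
  with b commutes with the product. The commutation rules are spelled out because the identity is
  used for power series over a noncommutative ring.\<close>

lemma symmetric_product:
  fixes a b x y :: "'r :: ring_1"
  assumes "x * a = a * x" "y * a = a * y" "x * b = b * x" "y * b = b * y" "b * a = a * b" "y * x = x * y"
  shows "(1 - a * x - b * (x * x)) * (1 - a * y - b * (y * y)) =
    1 - a * (x + y) - b * ((x + y) * (x + y) - x * y - x * y) + a * a * (x * y)
    + a * b * ((x * y) * (x + y)) + b * b * ((x * y) * (x * y))"
proof -
  have r: "x * (a * z) = a * (x * z)" "y * (a * z) = a * (y * z)" "x * (b * z) = b * (x * z)"
    "y * (b * z) = b * (y * z)" "b * (a * z) = a * (b * z)" "y * (x * z) = x * (y * z)" for z
    by (simp_all add: assms flip: mult.assoc)
  show ?thesis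
    by (simp add: algebra_simps assms r)
qed

lemma fps_mult_const_X_nth: "(F * (fps_const c * fps_X)) $ d = (if d = 0 then 0 else F $ (d - 1) * c)"
  for F :: "'r :: ring_1 fps"
  by (simp flip: mult.assoc)

lemma fps_mult_const_XX_nth: "(F * (fps_const c * (fps_X * fps_X))) $ d = (if d < 2 then 0 else F $ (d - 2) * c)"
  for F :: "'r :: ring_1 fps"
proof -
  have "(F * (fps_const c * (fps_X * fps_X))) $ d = ((F * fps_const c) * fps_X * fps_X) $ d"
    by (simp add: mult.assoc)
  also have "\<dots> = (if d = 0 then 0 else if d - 1 = 0 then 0 else F $ (d - 1 - 1) * c)" by simp
  finally show ?thesis by (auto simp: numeral_2_eq_2)
qed

context tower
begin

text \<open>The factors \<kappa> X and X^2 stand on the left, as the a and b of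
  \<open>symmetric_product\<close>. The form with coefficients in front of powers of X is
  \<open>QQ_alt\<close>.\<close>

definition QQ :: "qv \<Rightarrow> nat \<Rightarrow> 'h fps" where
  "QQ \<kappa> k = 1 - (fps_const (C \<kappa>) * fps_X) * fps_const (yy k)
     - (fps_X * fps_X) * (fps_const (yy k) * fps_const (yy k))"

fun FF :: "qv \<Rightarrow> nat \<Rightarrow> 'h fps" where
  "FF \<kappa> 0 = 1"
| "FF \<kappa> (Suc k) = FF \<kappa> k * QQ \<kappa> k"

lemma QQ_alt: "QQ \<kappa> k = 1 - fps_const (C \<kappa> * yy k) * fps_X - fps_const (yy k * yy k) * (fps_X * fps_X)"
proof -
  have "(fps_const (C \<kappa>) * fps_X) * fps_const (yy k) = fps_const (C \<kappa> * yy k) * fps_X"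
    unfolding mult.assoc fps_mult_fps_X_commute by (simp flip: mult.assoc)
  moreover have "(fps_X * fps_X) * (fps_const (yy k) * fps_const (yy k)) = fps_const (yy k * yy k) * (fps_X * fps_X)"
    using fps_mult_fps_X_power_commute[of 2 "fps_const (yy k * yy k)"] by (simp add: power2_eq_square)
  ultimately show ?thesis unfolding QQ_def by simp
qed

lemma FF_nth: "FF \<kappa> (Suc k) $ d = FF \<kappa> k $ d - (if d = 0 then 0 else FF \<kappa> k $ (d - 1) * (C \<kappa> * yy k))
    - (if d < 2 then 0 else FF \<kappa> k $ (d - 2) * (yy k * yy k))"
  unfolding FF.simps QQ_alt right_diff_distrib fps_sub_nth fps_mult_const_X_nth fps_mult_const_XX_nth
  by simp

lemma FF_A: "FF \<kappa> k $ d \<in> A k"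
proof (induction k arbitrary: d)
  case (Suc k)
  show ?case unfolding FF_nth
    using A_Suc[OF Suc] yy_A[of k] by (auto intro!: A_diff A_mult A_C)
qed simp

lemma FF_zero: "2 * k < d \<Longrightarrow> FF \<kappa> k $ d = 0"
proof (induction k arbitrary: d)
  case (Suc k)
  then show ?case unfolding FF_nth by simp
qed simp

text \<open>The relations of an affine Hecke algebra: moving s past y_p and past y_{p+1} produces
  the same multiple of y_{p+1} with opposite signs, so that the corrections cancel in the sum. For
  the product, y_{p+1} = s y_p s and the commutation of the y suffice.\<close>

lemma yy_sum_comm: "t (Suc p) * (yy p + yy (Suc p)) = (yy p + yy (Suc p)) * t (Suc p)"
  and yy_prod_comm: "t (Suc p) * (yy p * yy (Suc p)) = (yy p * yy (Suc p)) * t (Suc p)"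
proof -
  let ?s = "s (Suc p)" and ?y = "yy p" and ?z = "yy (Suc p)"
  have "?s * ?z = (?s * ?s) * ?y * ?s" by (simp add: mult.assoc)
  also have "\<dots> = ?y * ?s - C alpha * ?z" by (simp add: s_quad left_diff_distrib mult.assoc)
  finally have sz: "?s * ?z = ?y * ?s - C alpha * ?z" .
  have sy: "?s * ?y = ?z * ?s + C alpha * ?z" using yy_s[of p] by simp
  have "?s * (?y + ?z) = (?y + ?z) * ?s" by (simp add: distrib_left distrib_right sy sz del: yy.simps)
  then show "t (Suc p) * (?y + ?z) = (?y + ?z) * t (Suc p)"
    using C_comm[of "?y + ?z" alpha] by (simp add: t_Suc distrib_left distrib_right)
  have "?s * (?y * ?z) = ?z * ?y * ?s" by (simp add: mult.assoc)
  then have "?s * (?y * ?z) = (?y * ?z) * ?s" by (metis yy_yy_comm)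
  then show "t (Suc p) * (?y * ?z) = (?y * ?z) * t (Suc p)"
    using C_comm[of "?y * ?z" alpha] by (simp add: t_Suc distrib_left distrib_right del: yy.simps)
qed

lemma QQ_pair_comm:
  "fps_const (t (Suc p)) * (QQ \<kappa> p * QQ \<kappa> (Suc p)) = (QQ \<kappa> p * QQ \<kappa> (Suc p)) * fps_const (t (Suc p))"
proof -
  let ?T = "fps_const (t (Suc p))" and ?x = "fps_const (yy p)" and ?y = "fps_const (yy (Suc p))"
  define a b :: "'h fps" where "a = fps_const (C \<kappa>) * fps_X" and "b = fps_X * fps_X"
  have ca: "fps_const u * a = a * fps_const u" for u
    unfolding a_def using C_comm[of u \<kappa>] fps_mult_fps_X_commute[of "fps_const u"]
    by (metis fps_const_mult mult.assoc)
  have cb: "fps_const u * b = b * fps_const u" for u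
    unfolding b_def using fps_mult_fps_X_commute[of "fps_const u"] by (metis mult.assoc)
  have ba: "b * a = a * b"
    unfolding a_def b_def by (metis fps_mult_fps_X_commute mult.assoc)
  have yx: "?y * ?x = ?x * ?y" using yy_yy_comm[of p "Suc p"] by (simp del: yy.simps)
  define e1 e2 where "e1 = ?x + ?y" and "e2 = ?x * ?y"
  have T: "?T * e1 = e1 * ?T" "?T * e2 = e2 * ?T" "?T * a = a * ?T" "?T * b = b * ?T"
    unfolding e1_def e2_def using yy_sum_comm[of p] yy_prod_comm[of p] ca cb
    by (simp_all del: yy.simps)
  have T': "?T * (e1 * z) = e1 * (?T * z)" "?T * (e2 * z) = e2 * (?T * z)"
    "?T * (a * z) = a * (?T * z)" "?T * (b * z) = b * (?T * z)" for z
    using T by (simp_all flip: mult.assoc)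
  have "QQ \<kappa> p * QQ \<kappa> (Suc p) = 1 - a * e1 - b * (e1 * e1 - e2 - e2) + a * a * e2
    + a * b * (e2 * e1) + b * b * (e2 * e2)"
    unfolding QQ_def a_def[symmetric] b_def[symmetric] e1_def e2_def
    by (rule symmetric_product) (use ca cb ba yx in \<open>simp_all del: yy.simps\<close>)
  then show ?thesis
    by (simp add: distrib_left distrib_right left_diff_distrib right_diff_distrib mult.assoc T T')
qed

lemma fps_const_comm: "(\<And>d. c * (F $ d) = F $ d * c) \<Longrightarrow> fps_const c * F = F * fps_const c"
  for F :: "'r :: ring_1 fps"
  by (simp add: fps_eq_iff)

lemma fps_const_X_comm:
  fixes c u :: "'r :: ring_1" assumes "c * u = u * c"
  shows "fps_const c * (fps_const u * fps_X ^ k) = (fps_const u * fps_X ^ k) * fps_const c"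
proof -
  have "fps_const c * (fps_const u * fps_X ^ k) = fps_const (u * c) * fps_X ^ k"
    using assms by (simp flip: mult.assoc)
  also have "\<dots> = fps_const u * (fps_const c * fps_X ^ k)" by (simp flip: mult.assoc)
  also have "\<dots> = fps_const u * fps_X ^ k * fps_const c"
    by (simp only: mult.assoc fps_mult_fps_X_power_commute)
  finally show ?thesis .
qed

text \<open>The factors before y_{i-1} have coefficients in \<open>A (i - 1)\<close>, which commutes
  with t_i, and the later y commute with all of \<open>A i\<close> and with t_i. The two remaining
  factors form a symmetric pair, treated by \<open>QQ_pair_comm\<close>.\<close>

lemma FF_comm: "1 \<le> i \<Longrightarrow> i < n \<Longrightarrow> fps_const (t i) * FF \<kappa> n = FF \<kappa> n * fps_const (t i)"
proof (induction n)
  case (Suc n)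
  let ?T = "fps_const (t i)"
  show ?case
  proof (cases "i = n")
    case True
    then obtain p where p: "i = Suc p" "n = Suc p" using Suc.prems by (cases i) auto
    have "?T * FF \<kappa> p = FF \<kappa> p * ?T"
      unfolding p using A_t_comm_Suc[OF FF_A] by (rule fps_const_comm)
    then show ?thesis using commute_mult[OF _ QQ_pair_comm[of p \<kappa>]] unfolding p FF.simps
      by (simp only: mult.assoc)
  next
    case False
    then have "?T * FF \<kappa> n = FF \<kappa> n * ?T" using Suc by simp
    moreover have "?T * QQ \<kappa> n = QQ \<kappa> n * ?T"
    proof -
      have y: "t i * yy n = yy n * t i" using yy_comm[OF A_t[of i n]] Suc.prems False by simp
      have "t i * (C \<kappa> * yy n) = (C \<kappa> * yy n) * t i" by (rule commute_mult[OF C_comm y])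
      moreover have "t i * (yy n * yy n) = (yy n * yy n) * t i" by (rule commute_mult[OF y y])
      ultimately show ?thesis
        using fps_const_X_comm[of "t i" "C \<kappa> * yy n" 1] fps_const_X_comm[of "t i" "yy n * yy n" 2]
        unfolding QQ_alt right_diff_distrib left_diff_distrib power2_eq_square power_one_right by simp
    qed
    ultimately show ?thesis unfolding FF.simps by (rule commute_mult)
  qed
qed simp

lemma FF_nth_comm: "1 \<le> i \<Longrightarrow> i < n \<Longrightarrow> t i * FF \<kappa> n $ d = FF \<kappa> n $ d * t i"
  using arg_cong[OF FF_comm, of i n "\<lambda>F. F $ d" \<kappa>] by simp

end

locale tower_trace = tower t s C \<beta>
  for t s :: "nat \<Rightarrow> 'h :: ring_1" and C :: "qv \<Rightarrow> 'h" and \<beta> :: qv +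
  fixes \<tau> :: "'h \<Rightarrow> qv" and \<kappa> :: qv
  assumes tr_add: "\<tau> (x + y) = \<tau> x + \<tau> y"
    and tr_C: "\<tau> (C c * x) = c * \<tau> x"
    and tr_comm: "1 \<le> i \<Longrightarrow> i < n \<Longrightarrow> x \<in> A n \<Longrightarrow> \<tau> (t i * x) = \<tau> (x * t i)"
    and tr_K_s: "1 \<le> k \<Longrightarrow> x \<in> A k \<Longrightarrow> y \<in> A k \<Longrightarrow> \<tau> (x * s k * y) = 0"
    and tr_K_yy: "x \<in> A k \<Longrightarrow> \<tau> (x * yy k) = 0"
begin

lemma tr_zero: "\<tau> 0 = 0"
  using tr_add[of 0 0] by simp

lemma tr_minus: "\<tau> (x - y) = \<tau> x - \<tau> y"
  using tr_add[of "x - y" y] by simp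

lemma tr_K: "x \<in> K k \<Longrightarrow> \<tau> x = 0"
  by (induction rule: K.induct) (simp_all add: tr_zero tr_add tr_K_s tr_K_yy)

text \<open>The first assumption says that the conditional expectation of u is c. The kernel of the
  expectation is a bimodule over \<open>A k\<close>, and \<tau> vanishes on it.\<close>

lemma tr_expect:
  assumes "u - C c \<in> K k" "x \<in> A k" "z \<in> A k"
  shows "\<tau> (x * u * z) = c * \<tau> (x * z)"
proof -
  have "\<tau> (x * (u - C c) * z) = 0" by (rule tr_K[OF K_right[OF K_left]]) (rule assms)+
  moreover have "x * (u - C c) * z = x * u * z - C c * (x * z)"
    using C_comm[of x c] by (simp add: right_diff_distrib left_diff_distrib flip: mult.assoc)
  ultimately show ?thesis by (simp add: tr_minus tr_C)
qed

definition Ps :: "nat \<Rightarrow> nat \<Rightarrow> 'h \<Rightarrow> qv" where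
  "Ps n d x = \<tau> (FF \<kappa> n $ d * x)"

lemma Ps_add: "Ps n d (x + y) = Ps n d x + Ps n d y"
  by (simp add: Ps_def distrib_left tr_add)

lemma Ps_C: "Ps n d (C c * x) = c * Ps n d x"
proof -
  have "FF \<kappa> n $ d * (C c * x) = C c * (FF \<kappa> n $ d * x)"
    using C_comm[of "FF \<kappa> n $ d" c] by (simp flip: mult.assoc)
  then show ?thesis by (simp add: Ps_def tr_C)
qed

lemma Ps_comm: "1 \<le> i \<Longrightarrow> i < n \<Longrightarrow> x \<in> A n \<Longrightarrow> Ps n d (t i * x) = Ps n d (x * t i)"
  using tr_comm[of i n "FF \<kappa> n $ d * x"] FF_nth_comm[of i n \<kappa> d] A_mult[OF FF_A]
  by (simp add: Ps_def flip: mult.assoc)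

text \<open>The three expectations determine how \<open>Ps\<close> acts on a product in which \<open>u\<close> is the only
  factor outside of $A_k$.\<close>

lemma Ps_expect:
  assumes u: "u - C c0 \<in> K k" "yy k * u - C c1 \<in> K k" "yy k * yy k * u - C c2 \<in> K k"
    and xz: "x \<in> A k" "z \<in> A k"
  shows "Ps (Suc k) d (x * u * z) = c0 * Ps k d (x * z)
    - (if d = 0 then 0 else \<kappa> * c1 * Ps k (d - 1) (x * z))
    - (if d < 2 then 0 else c2 * Ps k (d - 2) (x * z))"
proof -
  have y: "yy k * x = x * yy k" by (rule yy_comm[OF xz(1)])
  have 1: "\<tau> (F * (C \<kappa> * yy k) * (x * u * z)) = \<kappa> * (c1 * \<tau> (F * (x * z)))" if "F \<in> A k" for F
  proof -
    have "F * (C \<kappa> * yy k) * (x * u * z) = (F * C \<kappa>) * (yy k * x) * u * z" by (simp only: mult.assoc)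
    also have "\<dots> = C \<kappa> * ((F * x) * (yy k * u) * z)" unfolding y C_comm by (simp only: mult.assoc)
    finally show ?thesis using tr_expect[OF u(2) A_mult[OF that xz(1)] xz(2)] by (simp add: tr_C mult.assoc)
  qed
  have 2: "\<tau> (F * (yy k * yy k) * (x * u * z)) = c2 * \<tau> (F * (x * z))" if "F \<in> A k" for F
  proof -
    have yyx: "(yy k * yy k) * x = x * (yy k * yy k)"
      using commute_mult[OF y[symmetric] y[symmetric]] by simp
    have "F * (yy k * yy k) * (x * u * z) = F * ((yy k * yy k) * x) * u * z" by (simp only: mult.assoc)
    also have "\<dots> = (F * x) * (yy k * yy k * u) * z" unfolding yyx by (simp only: mult.assoc)
    finally show ?thesis using tr_expect[OF u(3) A_mult[OF that xz(1)] xz(2)] by (simp add: mult.assoc)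
  qed
  have 0: "\<tau> (F * (x * u * z)) = c0 * \<tau> (F * (x * z))" if "F \<in> A k" for F
    using tr_expect[OF u(1) A_mult[OF that xz(1)] xz(2)] by (simp add: mult.assoc)
  show ?thesis
    unfolding Ps_def FF_nth
    using 0[OF FF_A, of \<kappa> d] 1[OF FF_A, of \<kappa> "d - 1"] 2[OF FF_A, of \<kappa> "d - 2"]
    by (cases "d = 1") (auto simp: left_diff_distrib tr_minus tr_zero)
qed

lemma Ps_A: "x \<in> A k \<Longrightarrow> Ps (Suc k) d x = Ps k d x - (if d < 2 then 0 else Ps k (d - 2) x)"
  using Ps_expect[of 1 1 k 0 1 x 1 d] K_yy1 yy2_K by (simp add: K_zero)

lemma Ps_t:
  assumes "x \<in> A k" "z \<in> A k" "1 \<le> k"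
  shows "Ps (Suc k) d (x * t k * z) = alpha * Ps k d (x * z)"
proof -
  obtain p where p: "k = Suc p" using assms(3) by (cases k) auto
  have "t k - C alpha \<in> K k" using t_Suc[OF assms(3)] K_s[of 1 k 1] assms(3) by simp
  moreover have "yy k * t k - C 0 \<in> K k" "yy k * yy k * t k - C 0 \<in> K k"
    unfolding p using yy_t_K yy2_t_K by simp_all
  ultimately show ?thesis using Ps_expect[of "t k" alpha k 0 0 x z d] assms(1,2) by simp
qed

text \<open>The expectations of T, y T and y^2 T are \<beta>, 1 and 0. In type B only the first term
  survives, in type D only the second. The power of e collects on the right the factors \<varsigma>
  that occur between the T.\<close>

lemma Ps_Pr:
  assumes "e \<in> A 1" "1 \<le> k"
  shows "Ps (Suc k) d (Pr e (Suc k) * e ^ r) = \<beta> * Ps k d (Pr e k * e ^ Suc r)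
    - (if d = 0 then 0 else \<kappa> * Ps k (d - 1) (Pr e k * e ^ Suc r))"
proof -
  have e: "e \<in> A k" using A_mono[OF assms] .
  have "Pr e (Suc k) * e ^ r = (Pr e k * e) * TT k * e ^ r" by (simp add: Pr_Suc mult.assoc)
  moreover have "(Pr e k * e) * e ^ r = Pr e k * e ^ Suc r" by (simp add: mult.assoc)
  moreover have "yy k * TT k - C 1 \<in> K k" "yy k * yy k * TT k - C 0 \<in> K k"
    using yy_TT_K yy2_TT_K by simp_all
  ultimately show ?thesis
    using Ps_expect[OF TT_K _ _ A_mult[OF Pr_A[OF assms(1)] e] power_A[OF e, of r], of 1 0 d] by simp
qed

text \<open>The substitution X^2 = -a in the even part of the generating series. Since F has degree
  at most 2n in X, the range of the sum loses nothing, and \<open>coeff_psi\<close> holds for every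
  k.\<close>

definition psi :: "nat \<Rightarrow> 'h \<Rightarrow> qv poly" where
  "psi n x = (\<Sum>k\<le>n. monom ((- 1) ^ k * Ps n (2 * k) x) k)"

lemma coeff_psi: "coeff (psi n x) k = (- 1) ^ k * Ps n (2 * k) x"
proof -
  have "coeff (psi n x) k = (if k \<le> n then (- 1) ^ k * Ps n (2 * k) x else 0)"
    by (simp add: psi_def coeff_sum)
  moreover have "Ps n (2 * k) x = 0" if "\<not> k \<le> n"
    using that FF_zero[of n "2 * k"] by (simp add: Ps_def tr_zero)
  ultimately show ?thesis by auto
qed

lemma psi_add: "psi n (x + y) = psi n x + psi n y"
  by (rule poly_eqI) (simp add: coeff_psi Ps_add distrib_left)

lemma psi_C: "psi n (C c * x) = smult c (psi n x)"
  by (rule poly_eqI) (simp add: coeff_psi Ps_C)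

lemma psi_comm: "1 \<le> i \<Longrightarrow> i < n \<Longrightarrow> x \<in> A n \<Longrightarrow> psi n (t i * x) = psi n (x * t i)"
  by (rule poly_eqI) (simp add: coeff_psi Ps_comm)

lemma psi_A: "x \<in> A n \<Longrightarrow> psi (Suc n) x = [:1, 1:] * psi n x"
proof (rule poly_eqI)
  fix k assume x: "x \<in> A n"
  show "coeff (psi (Suc n) x) k = coeff ([:1, 1:] * psi n x) k"
    by (cases k) (simp_all add: coeff_psi Ps_A[OF x] algebra_simps)
qed

lemma psi_t: "x \<in> A n \<Longrightarrow> z \<in> A n \<Longrightarrow> 1 \<le> n \<Longrightarrow> psi (Suc n) (x * t n * z) = smult alpha (psi n (x * z))"
  by (rule poly_eqI) (simp add: coeff_psi Ps_t)

end

section \<open>Polynomials in a and uniqueness of the geometric trace\<close>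

definition pol :: "qv poly \<Rightarrow> qva" where
  "pol p = Fract p 1"

lemma pol_add: "pol (p + q) = pol p + pol q" and pol_mult: "pol (p * q) = pol p * pol q"
  and pol_inject: "pol p = pol q \<longleftrightarrow> p = q"
  by (simp_all add: pol_def eq_fract)

lemma pol_smult: "pol (smult c p) = qva_const c * pol p"
  by (simp add: pol_def qva_const_def)

lemma pol_one_a: "pol [:1, 1:] = 1 + a_var"
proof -
  have "pol [:1, 1:] = pol 1 + pol [:0, 1:]" by (simp add: one_pCons flip: pol_add)
  then show ?thesis by (simp add: pol_def a_var_def One_fract_def)
qed

lemma pol_power: "pol (p ^ n) = pol p ^ n"
  by (induction n) (simp_all add: pol_mult, simp add: pol_def One_fract_def)

lemma a_coeff_pol: "a_coeff k (pol p) = coeff p k"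
proof -
  have "(THE q. pol p = Fract q 1) = p"
    using pol_inject[of p] by (intro the_equality) (auto simp: pol_def)
  then show ?thesis by (simp add: a_coeff_def)
qed

context tower_trace
begin

text \<open>The alternative in \<open>fin\<close> covers three situations: in type B and in even
  rank of type D the value on the product of the T or U is prescribed, while in odd rank of type D
  from 3 on both sides vanish on the product of the Jucys-Murphy elements, and rank 1 of type D
  agrees by construction. The power e^n = 1 is what makes the telescope of \<open>Pr_Jp\<close> end
  at this product.\<close>

lemma geometric_unique:
  fixes \<Phi> :: "nat \<Rightarrow> 'h \<Rightarrow> qva"
  assumes add: "\<And>n x y. 1 \<le> n \<Longrightarrow> x \<in> A n \<Longrightarrow> y \<in> A n \<Longrightarrow> \<Phi> n (x + y) = \<Phi> n x + \<Phi> n y"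
    and hom: "\<And>n x c. 1 \<le> n \<Longrightarrow> x \<in> A n \<Longrightarrow> \<Phi> n (C c * x) = qva_const c * \<Phi> n x"
    and comm: "\<And>n i x. 1 \<le> i \<Longrightarrow> i < n \<Longrightarrow> x \<in> A n \<Longrightarrow> \<Phi> n (t i * x) = \<Phi> n (x * t i)"
    and U: "\<And>n x. 1 \<le> n \<Longrightarrow> x \<in> A n \<Longrightarrow> \<Phi> (Suc n) x = (1 + a_var) * \<Phi> n x"
    and M: "\<And>n x z. 1 \<le> n \<Longrightarrow> x \<in> A n \<Longrightarrow> z \<in> A n \<Longrightarrow>
      \<Phi> (Suc n) (x * t n * z) = qva_const alpha * \<Phi> n (x * z)"
    and init: "\<Phi> 1 1 = pol (psi 1 1)"
    and e: "e \<in> A 1" "\<And>i. e * jj i = jj i * e"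
    and fin: "\<And>n. 1 \<le> n \<Longrightarrow> \<Phi> n (Jp 0 n) = pol (psi n (Jp 0 n)) \<or>
      e ^ n = 1 \<and> \<Phi> n (Pr e n) = pol (psi n (Pr e n))"
    and "1 \<le> n" "x \<in> A n"
  shows "\<Phi> n x = pol (psi n x)"
  using \<open>1 \<le> n\<close> \<open>x \<in> A n\<close>
proof (induction n arbitrary: x rule: less_induct)
  case (less n)
  define \<delta> where "\<delta> x = \<Phi> n x - pol (psi n x)" for x
  have dadd: "\<delta> (x + y) = \<delta> x + \<delta> y" if "x \<in> A n" "y \<in> A n" for x y
    using add[OF less.prems(1) that] by (simp add: \<delta>_def psi_add pol_add)
  have dhom: "\<delta> (C c * x) = qva_const c * \<delta> x" if "x \<in> A n" for c x
    using hom[OF less.prems(1) that] by (simp add: \<delta>_def psi_C pol_smult right_diff_distrib)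
  have van: "\<delta> l = 0" if "l \<in> Lset (n - 1)" for l
  proof (cases "n = 1")
    case True
    have "l \<in> Lset 0" using that True by simp
    then have "l \<in> A 0" by (induction rule: Lset.induct) (auto intro: A_add)
    then obtain c where "l = C c * 1" using A_0 by auto
    then show ?thesis using dhom[of 1 c] init True by (simp add: \<delta>_def)
  next
    case False
    then obtain k where k: "n = Suc k" "1 \<le> k" using less.prems(1) by (cases n) auto
    have IH: "\<Phi> k x = pol (psi k x)" if "x \<in> A k" for x using less.IH[OF _ k(2) that] k(1) by simp
    have "l \<in> Lset k" using that k by simp
    then show ?thesis
    proof (induction rule: Lset.induct)
      case (Lset_A x)
      have "pol (psi n x) = (1 + a_var) * pol (psi k x)"
        unfolding k psi_A[OF Lset_A] by (simp only: pol_mult pol_one_a)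
      then show ?case using U[OF k(2) Lset_A] IH[OF Lset_A] by (simp add: \<delta>_def k)
    next
      case (Lset_t x y)
      then show ?case
        using M[OF k(2)] IH[OF A_mult] by (simp add: \<delta>_def k psi_t pol_smult)
    next
      case (Lset_add x y)
      then show ?case using dadd[of x y] Lset_subset k(1) by simp
    qed
  qed
  interpret tower_functional t s C \<beta> \<delta> n
  proof
    fix i x assume "1 \<le> i" "i < n" "x \<in> A n"
    then show "\<delta> (t i * x) = \<delta> (x * t i)" using comm psi_comm by (simp add: \<delta>_def)
  qed (use less.prems dadd dhom van in auto)
  have "\<delta> (Jp 0 n) = 0 \<or> e ^ n = 1 \<and> \<delta> (Pr e n) = 0" using fin[OF less.prems(1)] by (auto simp: \<delta>_def)
  then have "\<delta> x = 0" using vanish[OF _ less.prems(2)] vanish_Pr[OF e _ _ less.prems(2)] by blast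
  then show ?case by (simp add: \<delta>_def)
qed

end

section \<open>The bar involution and free algebras\<close>

lemma q_const_add: "q_const (a + b) = q_const a + q_const b"
  and q_const_mult: "q_const (a * b) = q_const a * q_const b"
  and q_const_zero [simp]: "q_const 0 = 0" and q_const_one [simp]: "q_const 1 = 1"
  by (simp_all add: q_const_def Zero_fract_def One_fract_def one_pCons mult.commute)

text \<open>The bar involution on polynomials, by evaluation at v^{-1}. Extending it to fractions
  requires nonzero polynomials to have nonzero values, which is \<open>evq_nonzero\<close>.\<close>

definition evq :: "rat poly \<Rightarrow> qv" where
  "evq p = poly (map_poly q_const p) (inverse v_var)"

lemma evq_zero [simp]: "evq 0 = 0"
  by (simp add: evq_def)

lemma evq_pCons: "evq (pCons a p) = q_const a + inverse v_var * evq p"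
  by (simp add: evq_def map_poly_pCons)

lemma evq_add: "evq (p + q) = evq p + evq q"
proof -
  have "map_poly q_const (p + q) = map_poly q_const p + map_poly q_const q"
    by (rule poly_eqI) (simp add: coeff_map_poly q_const_add)
  then show ?thesis by (simp add: evq_def)
qed

lemma evq_smult: "evq (smult a p) = q_const a * evq p"
proof -
  have "map_poly q_const (smult a p) = smult (q_const a) (map_poly q_const p)"
    by (rule poly_eqI) (simp add: coeff_map_poly q_const_mult)
  then show ?thesis by (simp add: evq_def)
qed

lemma evq_mult: "evq (p * q) = evq p * evq q"
proof (induction p)
  case (pCons a p)
  have "evq (pCons a p * q) = q_const a * evq q + inverse v_var * (evq p * evq q)"
    using pCons by (simp add: evq_add evq_smult evq_pCons)
  then show ?case by (simp add: evq_pCons algebra_simps)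
qed simp

lemma evq_one [simp]: "evq 1 = 1"
  by (simp add: one_pCons evq_pCons)

text \<open>Multiplication by $v^n$ turns \<open>evq p\<close> into the reversal of \<open>p\<close>.\<close>

lemma evq_reverse: "p \<noteq> 0 \<Longrightarrow> \<exists>n r. v_var ^ n * evq p = Fract r 1 \<and> coeff r 0 \<noteq> 0"
proof (induction p)
  case (pCons a p)
  show ?case
  proof (cases "p = 0")
    case True
    then have "v_var ^ 0 * evq (pCons a p) = Fract [:a:] 1" "coeff [:a:] 0 \<noteq> 0"
      using pCons by (auto simp: evq_pCons q_const_def)
    then show ?thesis by blast
  next
    case False
    then obtain n r where r: "v_var ^ n * evq p = Fract r 1" "coeff r 0 \<noteq> 0" using pCons by blast
    have pow: "v_var ^ k = Fract ([:0, 1:] ^ k) 1" for k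
      by (induction k) (simp_all add: v_var_def One_fract_def)
    have "v_var ^ Suc n * evq (pCons a p) = q_const a * v_var ^ Suc n + v_var ^ n * evq p"
      using v_var_nonzero by (simp add: evq_pCons algebra_simps)
    also have "q_const a * v_var ^ Suc n = Fract (smult a ([:0, 1:] ^ Suc n)) 1"
      unfolding pow q_const_def by (simp del: power_Suc)
    also have "\<dots> + v_var ^ n * evq p = Fract (smult a ([:0, 1:] ^ Suc n) + r) 1"
      unfolding r(1) by (simp del: power_Suc)
    finally have "v_var ^ Suc n * evq (pCons a p) = Fract (smult a ([:0, 1:] ^ Suc n) + r) 1" .
    moreover have "coeff (smult a ([:0, 1:] ^ Suc n) + r) 0 \<noteq> 0" using r(2) by simp
    ultimately show ?thesis by blast
  qed
qed simp

lemma evq_nonzero: "p \<noteq> 0 \<Longrightarrow> evq p \<noteq> 0"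
proof
  assume "p \<noteq> 0" "evq p = 0"
  then obtain r where "Fract r 1 = (0 :: qv)" "coeff r 0 \<noteq> 0" using evq_reverse[of p] by auto
  then show False by (simp add: Zero_fract_def eq_fract)
qed

definition qbar :: "qv \<Rightarrow> qv" where
  "qbar x = (THE y. \<exists>p q. q \<noteq> 0 \<and> x = Fract p q \<and> y = evq p / evq q)"

lemma qbar_Fract: "q \<noteq> 0 \<Longrightarrow> qbar (Fract p q) = evq p / evq q"
  unfolding qbar_def
proof (rule the_equality)
  fix y assume q: "q \<noteq> 0" and "\<exists>p' q'. q' \<noteq> 0 \<and> Fract p q = Fract p' q' \<and> y = evq p' / evq q'"
  then obtain p' q' where *: "q' \<noteq> 0" "Fract p q = Fract p' q'" "y = evq p' / evq q'" by blast
  then have "p * q' = p' * q" using q by (simp add: eq_fract)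
  then have "evq p * evq q' = evq p' * evq q" by (simp flip: evq_mult)
  then show "y = evq p / evq q"
    unfolding *(3) using evq_nonzero[OF q] evq_nonzero[OF *(1)] by (simp add: frac_eq_eq)
qed blast

lemma qbar_add: "qbar (x + y) = qbar x + qbar y"
proof (cases x; cases y)
  fix p q p' q' assume "x = Fract p q" "q \<noteq> 0" "y = Fract p' q'" "q' \<noteq> 0"
  then show ?thesis
    using evq_nonzero[of q] evq_nonzero[of q'] by (simp add: qbar_Fract evq_add evq_mult field_simps)
qed

lemma qbar_mult: "qbar (x * y) = qbar x * qbar y"
proof (cases x; cases y)
  fix p q p' q' assume "x = Fract p q" "q \<noteq> 0" "y = Fract p' q'" "q' \<noteq> 0"
  then show ?thesis by (simp add: qbar_Fract evq_mult)
qed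

lemma qbar_q_const [simp]: "qbar (q_const a) = q_const a"
  by (simp add: q_const_def[of a] qbar_Fract) (simp add: evq_pCons q_const_def)

lemma qbar_v [simp]: "qbar v_var = inverse v_var"
  unfolding v_var_def by (simp add: qbar_Fract evq_pCons) (simp add: v_var_def)

lemma qbar_one [simp]: "qbar 1 = 1" and qbar_zero [simp]: "qbar 0 = 0"
  using qbar_q_const[of 1] qbar_q_const[of 0] by simp_all

lemma qbar_minus: "qbar (- x) = - qbar x"
  using qbar_add[of x "- x"] by (simp add: eq_neg_iff_add_eq_0 add.commute)

lemma qbar_inverse: "qbar (inverse x) = inverse (qbar x)"
proof (cases "x = 0")
  case False
  then have "qbar (inverse x) * qbar x = 1" by (simp flip: qbar_mult)
  then show ?thesis by (metis inverse_unique mult.commute)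
qed simp

lemma Fract_pCons: "Fract (pCons a p) 1 = q_const a + v_var * Fract p 1"
  by (simp add: q_const_def v_var_def)

lemma Fract_quotient: "q \<noteq> 0 \<Longrightarrow> Fract p q = Fract p 1 * inverse (Fract q 1)"
  by simp

lemma qbar_evq: "qbar (evq p) = Fract p 1"
proof (induction p)
  case 0 show ?case by (simp flip: Zero_fract_def)
next
  case (pCons a p)
  then show ?case by (simp add: evq_pCons Fract_pCons qbar_add qbar_mult qbar_inverse)
qed

lemma qbar_qbar [simp]: "qbar (qbar x) = x"
proof (cases x)
  case (Fract p q)
  then show ?thesis
    by (simp add: qbar_Fract divide_inverse qbar_mult qbar_inverse qbar_evq)
qed

lemma qbar_alpha [simp]: "qbar alpha = - alpha"
  using qbar_add[of v_var "- inverse v_var"] by (simp add: alpha_def qbar_minus qbar_inverse)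

text \<open>A map out of $\mathbb{Q}(v)$ that preserves sums and products is determined by its values
  on $\mathbb{Q}$ and at $v$.\<close>

lemma qv_hom_eq:
  fixes \<psi> \<phi> :: "qv \<Rightarrow> 'r :: ring_1"
  assumes add: "\<And>x y. \<psi> (x + y) = \<psi> x + \<psi> y" "\<And>x y. \<phi> (x + y) = \<phi> x + \<phi> y"
    and mult: "\<And>x y. \<psi> (x * y) = \<psi> x * \<psi> y" "\<And>x y. \<phi> (x * y) = \<phi> x * \<phi> y"
    and q: "\<And>a. \<psi> (q_const a) = \<phi> (q_const a)" and v: "\<psi> v_var = \<phi> v_var" and one: "\<phi> 1 = 1"
  shows "\<psi> x = \<phi> x"
proof -
  have zero: "\<psi> 0 = 0" "\<phi> 0 = 0" using add(1)[of 0 0] add(2)[of 0 0] by simp_all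
  have pol: "\<psi> (Fract p 1) = \<phi> (Fract p 1)" for p
  proof (induction p)
    case 0 show ?case by (simp add: zero flip: Zero_fract_def)
  next
    case (pCons a p) then show ?case by (simp add: Fract_pCons add mult q v)
  qed
  have one': "\<psi> 1 = 1" using q[of 1] one by simp
  obtain p q where pq: "x = Fract p q" "q \<noteq> 0" by (cases x)
  define d :: qv where "d = Fract q 1"
  have nz: "d \<noteq> 0" using pq by (simp add: d_def Zero_fract_def eq_fract)
  have d: "\<psi> d = \<phi> d" unfolding d_def by (rule pol)
  have "\<psi> (inverse d) = (\<phi> (inverse d) * \<phi> d) * \<psi> (inverse d)"
    using nz by (simp add: one flip: mult(2))
  also have "\<dots> = \<phi> (inverse d) * \<psi> (d * inverse d)" unfolding mult(1) d by (simp only: mult.assoc)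
  finally have inv: "\<psi> (inverse d) = \<phi> (inverse d)" using nz one' by simp
  show ?thesis unfolding pq(1) Fract_quotient[OF pq(2)] mult pol d_def[symmetric] inv ..
qed

section \<open>Additive extension from monomials\<close>

definition lin :: "('k \<Rightarrow> 'c \<Rightarrow> 'g) \<Rightarrow> ('k \<Rightarrow>\<^sub>0 'c :: comm_monoid_add) \<Rightarrow> 'g :: comm_monoid_add" where
  "lin \<phi> f = (\<Sum>k\<in>Poly_Mapping.keys f. \<phi> k (Poly_Mapping.lookup f k))"

text \<open>Only additivity in the coefficient is demanded, not linearity, so that semilinear maps
  such as the bar involution are covered as well.\<close>

definition additive_family :: "('k \<Rightarrow> 'c :: comm_monoid_add \<Rightarrow> 'g :: comm_monoid_add) \<Rightarrow> bool" where
  "additive_family \<phi> \<longleftrightarrow> (\<forall>k. \<phi> k 0 = 0) \<and> (\<forall>k a b. \<phi> k (a + b) = \<phi> k a + \<phi> k b)"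

lemma lin_superset:
  assumes "additive_family \<phi>" "finite X" "Poly_Mapping.keys f \<subseteq> X"
  shows "lin \<phi> f = (\<Sum>k\<in>X. \<phi> k (Poly_Mapping.lookup f k))"
  unfolding lin_def using assms
  by (intro sum.mono_neutral_left) (auto simp: additive_family_def in_keys_iff)

lemma lin_add:
  assumes "additive_family \<phi>"
  shows "lin \<phi> (f + g) = lin \<phi> f + lin \<phi> g"
proof -
  let ?X = "Poly_Mapping.keys f \<union> Poly_Mapping.keys g"
  have "lin \<phi> (f + g) = (\<Sum>k\<in>?X. \<phi> k (Poly_Mapping.lookup (f + g) k))"
    using keys_add[of f g] by (intro lin_superset assms) auto
  also have "\<dots> = lin \<phi> f + lin \<phi> g"
    using assms by (simp add: lin_superset[of \<phi> ?X] lookup_add additive_family_def sum.distrib)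
  finally show ?thesis .
qed

lemma lin_zero [simp]: "lin \<phi> 0 = 0"
  by (simp add: lin_def)

lemma lin_single: "additive_family \<phi> \<Longrightarrow> lin \<phi> (Poly_Mapping.single k c) = \<phi> k c"
  by (cases "c = 0") (simp_all add: lin_def additive_family_def)

lemma lin_sum: "additive_family \<phi> \<Longrightarrow> lin \<phi> (\<Sum>i\<in>X. f i) = (\<Sum>i\<in>X. lin \<phi> (f i))"
  by (induction X rule: infinite_finite_induct) (simp_all add: lin_add)

lemma lin_minus:
  fixes \<phi> :: "'k \<Rightarrow> 'c :: ab_group_add \<Rightarrow> 'g :: ab_group_add"
  assumes "additive_family \<phi>"
  shows "lin \<phi> (f - g) = lin \<phi> f - lin \<phi> g"
  using lin_add[OF assms, of "f - g" g] by simp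

lemma sum_single: "(\<Sum>k\<in>Poly_Mapping.keys f. Poly_Mapping.single k (Poly_Mapping.lookup f k)) = f"
  by (rule poly_mapping_eqI)
    (simp add: lookup_sum lookup_single when_def in_keys_iff)

lemma mult_expand:
  fixes f g :: "'k :: monoid_add \<Rightarrow>\<^sub>0 'c :: semiring_0"
  shows "f * g = (\<Sum>x\<in>Poly_Mapping.keys f. \<Sum>y\<in>Poly_Mapping.keys g.
    Poly_Mapping.single (x + y) (Poly_Mapping.lookup f x * Poly_Mapping.lookup g y))"
  by (subst (1) sum_single[of f, symmetric], subst (1) sum_single[of g, symmetric])
    (simp only: sum_product mult_single)

lemma lin_mult:
  fixes \<phi> :: "'k :: monoid_add \<Rightarrow> 'c :: semiring_0 \<Rightarrow> 'g :: semiring_0"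
  assumes "additive_family \<phi>" "\<And>x y a b. \<phi> (x + y) (a * b) = \<phi> x a * \<phi> y b"
  shows "lin \<phi> (f * g) = lin \<phi> f * lin \<phi> g"
  unfolding mult_expand[of f g] by (simp add: lin_sum lin_single assms) (simp add: lin_def sum_product)

lemma lin_mult_anti:
  fixes \<phi> :: "'k :: monoid_add \<Rightarrow> 'c :: semiring_0 \<Rightarrow> 'g :: semiring_0"
  assumes "additive_family \<phi>" "\<And>x y a b. \<phi> (x + y) (a * b) = \<phi> y b * \<phi> x a"
  shows "lin \<phi> (f * g) = lin \<phi> g * lin \<phi> f"
  unfolding mult_expand[of f g]
  by (simp add: lin_sum lin_single assms) (simp add: lin_def sum_product sum.swap[of _ "Poly_Mapping.keys f"])

section \<open>The free algebra and the Hecke ideal\<close>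

abbreviation Fr :: "nat \<Rightarrow> free_elt set" where
  "Fr n \<equiv> carrier (free_algebra n)"

lemma Fr_iff: "f \<in> Fr n \<longleftrightarrow> Poly_Mapping.keys f \<subseteq> lists {..<n}"
  by (simp add: free_algebra_def)

lemma free_algebra_simps [simp]:
  "x \<otimes>\<^bsub>free_algebra n\<^esub> y = x * y" "x \<oplus>\<^bsub>free_algebra n\<^esub> y = x + y"
  "\<one>\<^bsub>free_algebra n\<^esub> = 1" "\<zero>\<^bsub>free_algebra n\<^esub> = 0"
  by (simp_all add: free_algebra_def)

lemma Fr_word: "x \<in> lists {..<n} \<Longrightarrow> free_word x \<in> Fr n"
  by (simp add: Fr_iff free_word_def)

lemma Fr_gen: "i < n \<Longrightarrow> free_word [i] \<in> Fr n"
  by (rule Fr_word) simp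

lemma Fr_const: "free_const c \<in> Fr n"
  by (simp add: Fr_iff free_const_def)

lemma Fr_add: "f \<in> Fr n \<Longrightarrow> g \<in> Fr n \<Longrightarrow> f + g \<in> Fr n"
  and Fr_mult: "f \<in> Fr n \<Longrightarrow> g \<in> Fr n \<Longrightarrow> f * g \<in> Fr n"
  and Fr_one: "1 \<in> Fr n" and Fr_zero: "0 \<in> Fr n"
proof -
  interpret ring "free_algebra n" by (rule free_algebra_ring)
  show "f \<in> Fr n \<Longrightarrow> g \<in> Fr n \<Longrightarrow> f + g \<in> Fr n" "f \<in> Fr n \<Longrightarrow> g \<in> Fr n \<Longrightarrow> f * g \<in> Fr n"
    "1 \<in> Fr n" "0 \<in> Fr n"
    using a_closed m_closed one_closed zero_closed by simp_all
qed

lemma Fr_uminus: "f \<in> Fr n \<Longrightarrow> - f \<in> Fr n"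
  by (simp add: Fr_iff subset_iff in_keys_iff)

lemma Fr_minus: "f \<in> Fr n \<Longrightarrow> g \<in> Fr n \<Longrightarrow> f - g \<in> Fr n"
  using Fr_add[of f n "- g"] Fr_uminus by simp

lemma Fr_sum: "(\<And>i. i \<in> X \<Longrightarrow> f i \<in> Fr n) \<Longrightarrow> (\<Sum>i\<in>X. f i) \<in> Fr n"
  by (induction X rule: infinite_finite_induct) (auto intro: Fr_add Fr_zero)

lemma Fr_prod_list: "(\<And>x. x \<in> set xs \<Longrightarrow> x \<in> Fr n) \<Longrightarrow> prod_list xs \<in> Fr n"
  by (induction xs) (auto intro: Fr_mult Fr_one)

lemma Fr_mono: "f \<in> Fr n \<Longrightarrow> n \<le> n' \<Longrightarrow> f \<in> Fr n'"
  unfolding Fr_iff using lists_mono[of "{..<n}" "{..<n'}"] by auto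

lemma Fr_a_inv: "f \<in> Fr n \<Longrightarrow> \<ominus>\<^bsub>free_algebra n\<^esub> f = - f"
proof -
  interpret ring "free_algebra n" by (rule free_algebra_ring)
  assume "f \<in> Fr n"
  then show ?thesis using minus_equality[of "- f" f] Fr_uminus by simp
qed

lemma Fr_a_minus: "f \<in> Fr n \<Longrightarrow> g \<in> Fr n \<Longrightarrow> f \<ominus>\<^bsub>free_algebra n\<^esub> g = f - g"
  by (simp add: a_minus_def Fr_a_inv)

lemma free_word_append: "free_word (x @ y) = free_word x * free_word y"
  by (simp add: free_word_def mult_single plus_list_def)

lemma free_word_Nil: "free_word [] = 1"
  by (simp add: free_word_def flip: zero_list_def)

lemma free_word_Cons: "free_word (i # x) = free_word [i] * free_word x"
  using free_word_append[of "[i]" x] by simp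

lemma free_const_add: "free_const (c + d) = free_const c + free_const d"
  and free_const_mult: "free_const (c * d) = free_const c * free_const d"
  and free_const_one: "free_const 1 = 1"
  by (simp_all add: free_const_def mult_single single_add plus_list_def) (simp flip: zero_list_def)

lemma single_free: "Poly_Mapping.single x c = free_const c * free_word x"
  by (simp add: free_const_def free_word_def mult_single plus_list_def)

lemma free_const_comm: "free_const c * f = f * free_const c"
proof -
  have "free_const c * Poly_Mapping.single x d = Poly_Mapping.single x d * free_const c" for x d
    by (simp add: free_const_def mult_single plus_list_def mult.commute)
  then have "free_const c * (\<Sum>x\<in>Poly_Mapping.keys f. Poly_Mapping.single x (Poly_Mapping.lookup f x))
    = (\<Sum>x\<in>Poly_Mapping.keys f. Poly_Mapping.single x (Poly_Mapping.lookup f x)) * free_const c"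
    by (simp add: sum_distrib_left sum_distrib_right)
  then show ?thesis by (simp only: sum_single)
qed

lemma free_expand: "f = (\<Sum>x\<in>Poly_Mapping.keys f. free_const (Poly_Mapping.lookup f x) * free_word x)"
  by (simp only: single_free[symmetric] sum_single)

lemma Fr_induct [consumes 1, case_names const gen add mult]:
  assumes "f \<in> Fr n" and const: "\<And>c. P (free_const c)" and gen: "\<And>i. i < n \<Longrightarrow> P (free_word [i])"
    and add: "\<And>f g. f \<in> Fr n \<Longrightarrow> g \<in> Fr n \<Longrightarrow> P f \<Longrightarrow> P g \<Longrightarrow> P (f + g)"
    and mult: "\<And>f g. f \<in> Fr n \<Longrightarrow> g \<in> Fr n \<Longrightarrow> P f \<Longrightarrow> P g \<Longrightarrow> P (f * g)"
  shows "P f"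
proof -
  have word: "P (free_word x)" if "x \<in> lists {..<n}" for x
    using that
  proof (induction x)
    case Nil
    show ?case using const[of 1] by (simp add: free_word_Nil free_const_one)
  next
    case (Cons i x)
    then have "i < n" "x \<in> lists {..<n}" "P (free_word x)" by auto
    then have "P (free_word [i] * free_word x)" by (intro mult Fr_gen Fr_word gen)
    then show ?case by (simp only: free_word_Cons[of i x])
  qed
  have zero: "P 0" using const[of 0] by (simp add: free_const_def)
  have sum: "P (\<Sum>x\<in>X. free_const (c x) * free_word x) \<and> (\<Sum>x\<in>X. free_const (c x) * free_word x) \<in> Fr n"
    if "finite X" "X \<subseteq> lists {..<n}" for X c
    using that
  proof (induction X rule: finite_induct)
    case empty
    then show ?case using zero Fr_zero by simp
  next
    case (insert x X)
    then have x: "x \<in> lists {..<n}" by blast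
    let ?f = "free_const (c x) * free_word x" and ?g = "\<Sum>x\<in>X. free_const (c x) * free_word x"
    have f: "?f \<in> Fr n" "P ?f"
      using x by (auto intro!: Fr_mult Fr_const Fr_word mult const word simp del: in_lists_conv_set)
    have g: "?g \<in> Fr n" "P ?g" using insert.IH insert.prems by simp_all
    have ins: "(\<Sum>x\<in>insert x X. free_const (c x) * free_word x) = ?f + ?g"
      by (rule sum.insert) (use insert.hyps in auto)
    show ?case unfolding ins by (intro conjI add Fr_add f g)
  qed
  then have "P (\<Sum>x\<in>Poly_Mapping.keys f. free_const (Poly_Mapping.lookup f x) * free_word x)"
    using sum[of "Poly_Mapping.keys f" "Poly_Mapping.lookup f"] assms(1) by (simp only: Fr_iff finite_keys)
  then show ?thesis by (simp only: free_expand[symmetric])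
qed

text \<open>Modulo the quadratic relation t - \<alpha> is the inverse of t, so this lifts a product
  of inverse generators to the free algebra.\<close>

definition sfree :: "nat list \<Rightarrow> free_elt" where
  "sfree x = prod_list (map (\<lambda>i. free_word [i] - free_const alpha) x)"

lemma sfree_simps [simp]: "sfree [] = 1" "sfree (i # x) = (free_word [i] - free_const alpha) * sfree x"
  "sfree (x @ y) = sfree x * sfree y"
  by (simp_all add: sfree_def)

lemma Fr_sfree: "x \<in> lists {..<n} \<Longrightarrow> sfree x \<in> Fr n"
  unfolding sfree_def by (rule Fr_prod_list) (auto intro!: Fr_minus Fr_gen Fr_const)

text \<open>The elements of the free algebra that g kills form an ideal containing the relations.
  The disjunction admits antihomomorphisms, which is needed for the anti-involution i.\<close>

lemma hecke_ideal_vanish: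
  fixes g :: "free_elt \<Rightarrow> 'r :: ring_1"
  assumes add: "\<And>x y. g (x + y) = g x + g y"
    and mult: "(\<forall>x y. g (x * y) = g x * g y) \<or> (\<forall>x y. g (x * y) = g y * g x)"
    and rel: "\<And>f. f \<in> hecke_relations m n \<Longrightarrow> g f = 0"
    and f: "f \<in> hecke_ideal m n"
  shows "g f = 0"
proof -
  interpret ring "free_algebra n" by (rule free_algebra_ring)
  let ?I = "{f \<in> Fr n. g f = 0}"
  have zero: "g 0 = 0" using add[of 0 0] by simp
  have minus: "g (- x) = - g x" for x using add[of x "- x"] zero by (simp add: eq_neg_iff_add_eq_0 add.commute)
  have "ideal ?I (free_algebra n)"
  proof (rule idealI)
    show "ring (free_algebra n)" by (rule free_algebra_ring)
    show "subgroup ?I (add_monoid (free_algebra n))"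
    proof (rule add.subgroupI)
      show "?I \<noteq> {}" using Fr_zero zero by blast
      fix a assume "a \<in> ?I"
      then show "\<ominus>\<^bsub>free_algebra n\<^esub> a \<in> ?I" using Fr_a_inv[of a n] Fr_uminus minus by simp
    next
      fix a b assume "a \<in> ?I" "b \<in> ?I"
      then show "a \<oplus>\<^bsub>free_algebra n\<^esub> b \<in> ?I" using add by (simp add: Fr_add)
    qed blast
  qed (use mult in \<open>auto simp: Fr_mult\<close>)
  moreover have "hecke_relations m n \<subseteq> ?I" using hecke_relations_carrier rel by blast
  ultimately have "hecke_ideal m n \<subseteq> ?I"
    unfolding hecke_ideal_def by (rule genideal_minimal)
  then show ?thesis using f by blast
qed

lemma hecke_ideal_closed:
  shows hI_Fr: "f \<in> hecke_ideal m n \<Longrightarrow> f \<in> Fr n"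
    and hI_add: "f \<in> hecke_ideal m n \<Longrightarrow> g \<in> hecke_ideal m n \<Longrightarrow> f + g \<in> hecke_ideal m n"
    and hI_left: "f \<in> hecke_ideal m n \<Longrightarrow> g \<in> Fr n \<Longrightarrow> g * f \<in> hecke_ideal m n"
    and hI_right: "f \<in> hecke_ideal m n \<Longrightarrow> g \<in> Fr n \<Longrightarrow> f * g \<in> hecke_ideal m n"
    and hI_zero: "0 \<in> hecke_ideal m n"
    and hI_rel: "f \<in> hecke_relations m n \<Longrightarrow> f \<in> hecke_ideal m n"
proof -
  interpret ideal "hecke_ideal m n" "free_algebra n" by (rule hecke_ideal_ideal)
  show "f \<in> hecke_ideal m n \<Longrightarrow> f \<in> Fr n" using a_subset by blast
  show "f \<in> hecke_ideal m n \<Longrightarrow> g \<in> hecke_ideal m n \<Longrightarrow> f + g \<in> hecke_ideal m n"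
    using additive_subgroup.a_closed[OF additive_subgroup_axioms] by simp
  show "f \<in> hecke_ideal m n \<Longrightarrow> g \<in> Fr n \<Longrightarrow> g * f \<in> hecke_ideal m n" using I_l_closed by simp
  show "f \<in> hecke_ideal m n \<Longrightarrow> g \<in> Fr n \<Longrightarrow> f * g \<in> hecke_ideal m n" using I_r_closed by simp
  show "0 \<in> hecke_ideal m n" using additive_subgroup.zero_closed[OF additive_subgroup_axioms] by simp
  show "f \<in> hecke_relations m n \<Longrightarrow> f \<in> hecke_ideal m n"
    unfolding hecke_ideal_def
    using ring.genideal_self[OF free_algebra_ring hecke_relations_carrier] by blast
qed

lemma hI_uminus: "f \<in> hecke_ideal m n \<Longrightarrow> - f \<in> hecke_ideal m n"
  using hI_left[OF _ Fr_uminus[OF Fr_one], of f m n] by simp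

section \<open>Computation in the quotient\<close>

context
  fixes m :: "nat \<Rightarrow> nat \<Rightarrow> nat" and n :: nat
begin

definition hequiv :: "free_elt \<Rightarrow> free_elt \<Rightarrow> bool" where
  "hequiv f g \<longleftrightarrow> f \<in> Fr n \<and> g \<in> Fr n \<and> f - g \<in> hecke_ideal m n"

lemma hequiv_refl: "f \<in> Fr n \<Longrightarrow> hequiv f f"
  by (simp add: hequiv_def hI_zero)

lemma hequiv_sym: "hequiv f g \<Longrightarrow> hequiv g f"
  using hI_uminus[of "f - g"] by (simp add: hequiv_def)

lemma hequiv_trans: "hequiv f g \<Longrightarrow> hequiv g h \<Longrightarrow> hequiv f h"
  using hI_add[of "f - g" m n "g - h"] by (simp add: hequiv_def)

lemma hequiv_add: "hequiv f g \<Longrightarrow> hequiv f' g' \<Longrightarrow> hequiv (f + f') (g + g')"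
  using hI_add[of "f - g" m n "f' - g'"] by (simp add: hequiv_def Fr_add algebra_simps)

lemma hequiv_mult: "hequiv f g \<Longrightarrow> hequiv f' g' \<Longrightarrow> hequiv (f * f') (g * g')"
proof -
  assume a: "hequiv f g" "hequiv f' g'"
  have "f * f' - g * g' = (f - g) * f' + g * (f' - g')" by (simp add: algebra_simps)
  moreover have "(f - g) * f' \<in> hecke_ideal m n" "g * (f' - g') \<in> hecke_ideal m n"
    using a hI_left hI_right unfolding hequiv_def by blast+
  ultimately show ?thesis using a hI_add by (simp add: hequiv_def Fr_mult)
qed

abbreviation cl :: "free_elt \<Rightarrow> free_elt set" where "cl \<equiv> hecke_class m n"

lemma cl_eq_iff: "f \<in> Fr n \<Longrightarrow> g \<in> Fr n \<Longrightarrow> cl f = cl g \<longleftrightarrow> hequiv f g"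
  using ring.quotient_eq_iff_same_a_r_cos[OF free_algebra_ring hecke_ideal_ideal, of f n g m]
    Fr_a_minus[of f n g]
  by (simp add: hecke_class_def hequiv_def)

lemma hecke_carrier: "carrier (hecke m n) = cl ` Fr n"
  by (auto simp: hecke_def FactRing_def A_RCOSETS_def' hecke_class_def)

lemma cl_closed: "f \<in> Fr n \<Longrightarrow> cl f \<in> carrier (hecke m n)"
  by (simp add: hecke_carrier)

lemma cl_hom: "cl \<in> ring_hom (free_algebra n) (hecke m n)"
proof -
  have "cl = (+>\<^bsub>free_algebra n\<^esub>) (hecke_ideal m n)" by (rule ext) (simp add: hecke_class_def)
  then show ?thesis
    unfolding hecke_def by (simp only: ideal.rcos_ring_hom[OF hecke_ideal_ideal])
qed

lemma cl_mult: "f \<in> Fr n \<Longrightarrow> g \<in> Fr n \<Longrightarrow> cl f \<otimes>\<^bsub>hecke m n\<^esub> cl g = cl (f * g)"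
  using ring_hom_mult[OF cl_hom, of f g] by simp

lemma cl_add: "f \<in> Fr n \<Longrightarrow> g \<in> Fr n \<Longrightarrow> cl f \<oplus>\<^bsub>hecke m n\<^esub> cl g = cl (f + g)"
  using ring_hom_add[OF cl_hom, of f g] by simp

lemma cl_one: "\<one>\<^bsub>hecke m n\<^esub> = cl 1"
  using ring_hom_one[OF cl_hom] by simp

lemma cl_zero: "\<zero>\<^bsub>hecke m n\<^esub> = cl 0"
proof -
  interpret ring "hecke m n" by (rule hecke_ring)
  have "cl 0 \<oplus>\<^bsub>hecke m n\<^esub> cl 0 = cl 0" using cl_add[OF Fr_zero Fr_zero] by simp
  then show ?thesis using cl_closed[OF Fr_zero] by simp
qed

lemma cl_smult: "f \<in> Fr n \<Longrightarrow> hecke_smult m n c (cl f) = cl (free_const c * f)"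
  by (simp add: hecke_smult_def cl_mult Fr_const)

lemma cl_prod: "(\<And>f. f \<in> set fs \<Longrightarrow> f \<in> Fr n) \<Longrightarrow> hecke_prod m n (map cl fs) = cl (prod_list fs)"
  by (induction fs) (simp_all add: hecke_prod_def cl_one cl_mult Fr_prod_list)

lemma cl_sum: "finite X \<Longrightarrow> (\<And>i. i \<in> X \<Longrightarrow> f i \<in> Fr n) \<Longrightarrow>
  (\<Oplus>\<^bsub>hecke m n\<^esub>i\<in>X. cl (f i)) = cl (\<Sum>i\<in>X. f i)"
proof (induction X rule: finite_induct)
  interpret ring "hecke m n" by (rule hecke_ring)
  {
    case empty
    show ?case by (simp add: cl_zero)
  next
    case (insert i X)
    then have "(\<Oplus>\<^bsub>hecke m n\<^esub>i\<in>insert i X. cl (f i)) = cl (f i) \<oplus>\<^bsub>hecke m n\<^esub> (\<Oplus>\<^bsub>hecke m n\<^esub>i\<in>X. cl (f i))"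
      by (intro finsum_insert) (auto simp: cl_closed)
    then show ?case using insert by (simp add: cl_add Fr_sum)
  }
qed

lemma cl_inv: "f \<in> Fr n \<Longrightarrow> g \<in> Fr n \<Longrightarrow> hequiv (f * g) 1 \<Longrightarrow> hequiv (g * f) 1 \<Longrightarrow>
  inv\<^bsub>hecke m n\<^esub> (cl f) = cl g"
proof -
  interpret ring "hecke m n" by (rule hecke_ring)
  assume "f \<in> Fr n" "g \<in> Fr n" "hequiv (f * g) 1" "hequiv (g * f) 1"
  then show ?thesis
    using cl_eq_iff[of "f * g" 1] cl_eq_iff[of "g * f" 1] Fr_one Fr_mult
    by (intro inv_char) (auto simp: cl_closed cl_mult cl_one)
qed

lemma cl_power: "f \<in> Fr n \<Longrightarrow> cl f [^]\<^bsub>hecke m n\<^esub> (k :: nat) = cl (f ^ k)"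
proof (induction k)
  case 0 then show ?case by (simp add: cl_one)
next
  case (Suc k)
  have "f ^ k \<in> Fr n" using Suc.prems by (induction k) (auto intro: Fr_one Fr_mult)
  then show ?case using Suc by (simp add: cl_mult power_commutes)
qed

lemma word_inverse:
  assumes "x \<in> lists {..<n}"
  shows "hequiv (sfree (rev x) * free_word x) 1" "hequiv (free_word x * sfree (rev x)) 1"
proof -
  have gen: "hequiv ((free_word [i] - free_const alpha) * free_word [i]) 1"
    "hequiv (free_word [i] * (free_word [i] - free_const alpha)) 1" if i: "i < n" for i
  proof -
    let ?t = "free_word [i]" and ?v = "free_const v_var" and ?w = "free_const (inverse v_var)"
    have vw: "?v * ?w = 1" using v_var_nonzero by (simp flip: free_const_mult free_const_one)
    have al: "free_const alpha = ?v - ?w"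
      by (simp add: free_const_def alpha_def single_diff)
    have c: "?t * ?v = ?v * ?t" "?t * ?w = ?w * ?t" by (simp_all only: free_const_comm)
    \<comment> \<open>The relation written as (t - \<alpha>) t = 1 and as t (t - \<alpha>) = 1,
      which gives a left and a right inverse.\<close>
    have e: "(?t - ?v) * (?t + ?w) = (?t - free_const alpha) * ?t - 1"
      "(?t - ?v) * (?t + ?w) = ?t * (?t - free_const alpha) - 1"
      by (simp_all add: al algebra_simps vw c)
    have "(?t - ?v) * (?t + ?w) \<in> hecke_ideal m n"
      using i by (intro hI_rel) (auto simp: hecke_relations_def)
    then show "hequiv ((?t - free_const alpha) * ?t) 1" "hequiv (?t * (?t - free_const alpha)) 1"
      using e i by (auto simp: hequiv_def Fr_one intro!: Fr_mult Fr_minus Fr_gen Fr_const)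
  qed
  have "hequiv (sfree (rev x) * free_word x) 1 \<and> hequiv (free_word x * sfree (rev x)) 1"
    using assms
  proof (induction x)
    case Nil
    show ?case by (simp add: free_word_Nil hequiv_refl Fr_one)
  next
    case (Cons i x)
    let ?t = "free_word [i]" and ?s = "free_word [i] - free_const alpha"
    have i: "i < n" and l: "x \<in> lists {..<n}" "rev x \<in> lists {..<n}" using Cons by auto
    have x: "free_word x \<in> Fr n" "sfree (rev x) \<in> Fr n" by (rule Fr_word[OF l(1)], rule Fr_sfree[OF l(2)])
    have 1: "hequiv (sfree (rev x) * (?s * ?t) * free_word x) (sfree (rev x) * 1 * free_word x)"
      using gen(1)[OF i] x by (intro hequiv_mult hequiv_refl)
    have 2: "hequiv (?t * (free_word x * sfree (rev x)) * ?s) (?t * 1 * ?s)"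
      using Cons i by (intro hequiv_mult hequiv_refl Fr_gen Fr_minus Fr_const) auto
    have "hequiv (sfree (rev (i # x)) * free_word (i # x)) (sfree (rev x) * free_word x)"
      using 1 by (simp add: free_word_Cons[of i x] mult.assoc)
    moreover have "hequiv (free_word (i # x) * sfree (rev (i # x))) (?t * ?s)"
      using 2 by (simp add: free_word_Cons[of i x] mult.assoc)
    ultimately show ?case using Cons gen(2)[OF i] hequiv_trans by auto
  qed
  then show "hequiv (sfree (rev x) * free_word x) 1" "hequiv (free_word x * sfree (rev x)) 1" by auto
qed

end

section \<open>Hecke algebras as algebras of operators\<close>

lemma app_sum: "app (\<Sum>i\<in>X. x i) f b w = (\<Sum>i\<in>X. app (x i) f b w)"
  by (induction X rule: infinite_finite_induct) auto

text \<open>The vector space structure serves the dimension count in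
  \<open>finite_coxeter_group\<close>.\<close>

interpretation endo_vs: vector_space "\<lambda>c x. scl c * x"
  by unfold_locales (simp_all add: scl_add scl_mult distrib_left distrib_right mult.assoc)

lemma scl_diff: "scl (c - d) = scl c - scl d"
  by (rule endo_eqI) (simp add: algebra_simps)

lemma additive_familyI:
  fixes \<phi> :: "'k \<Rightarrow> 'c :: ab_group_add \<Rightarrow> 'g :: ab_group_add"
  assumes "\<And>k a b. \<phi> k (a + b) = \<phi> k a + \<phi> k b" shows "additive_family \<phi>"
  unfolding additive_family_def using assms by (metis add_cancel_right_right add.right_neutral)

lemma prod_list_free_word: "prod_list (map (\<lambda>i. free_word [i]) x) = free_word x"
proof (induction x)
  case Nil show ?case by (simp add: free_word_Nil)
next
  case (Cons i x) then show ?case by (simp only: list.map prod_list.Cons free_word_Cons[of i x])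
qed

section \<open>Representations of the free algebra\<close>

definition barF :: "free_elt \<Rightarrow> free_elt" where
  "barF = lin (\<lambda>x a. free_const (qbar a) * sfree x)"

definition antiF :: "free_elt \<Rightarrow> free_elt" where
  "antiF = lin (\<lambda>x a. free_const a * free_word (rev x))"

lemma Fr_barF: "f \<in> Fr n \<Longrightarrow> barF f \<in> Fr n"
  unfolding barF_def lin_def Fr_iff[of f]
  by (rule Fr_sum, rule Fr_mult[OF Fr_const], rule Fr_sfree) blast

lemma Fr_antiF: "f \<in> Fr n \<Longrightarrow> antiF f \<in> Fr n"
  unfolding antiF_def lin_def Fr_iff[of f]
  by (rule Fr_sum, rule Fr_mult[OF Fr_const], rule Fr_word) auto

context coxeter_aut
begin

lemma tau_sum: "tau (\<Sum>i\<in>X. x i) = (\<Sum>i\<in>X. tau (x i))"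
  by (induction X rule: infinite_finite_induct) (simp_all add: tau_zero tau_add)

definition T :: "nat \<Rightarrow> endo" where "T i = L i + scl alpha"

definition tword :: "nat list \<Rightarrow> endo" where "tword x = prod_list (map T x)"

lemma tword_simps [simp]: "tword [] = 1" "tword (i # x) = T i * tword x"
  "tword (x @ y) = tword x * tword y"
  by (simp_all add: tword_def)

lemma T_L [simp]: "T i * L i = 1" and L_T [simp]: "L i * T i = 1"
  by (simp_all add: T_def distrib_left distrib_right Lop_quadratic scl_comm)

lemma tword_sword [simp]: "tword x * sword (rev x) = 1" and sword_tword [simp]: "sword (rev x) * tword x = 1"
proof (induction x)
  case (Cons i x)
  have "tword (i # x) * sword (rev (i # x)) = T i * (tword x * sword (rev x)) * L i"
    by (simp add: mult.assoc)
  then show "tword (i # x) * sword (rev (i # x)) = 1" by (simp only: Cons mult_1_right T_L)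
  have "sword (rev (i # x)) * tword (i # x) = sword (rev x) * (L i * T i) * tword x"
    by (simp add: mult.assoc del: L_T)
  then show "sword (rev (i # x)) * tword (i # x) = 1" by (simp add: Cons)
qed simp_all

lemma tword_eq_of_sword: "sword (rev x) = sword (rev y) \<Longrightarrow> tword x = tword y"
proof -
  assume a: "sword (rev x) = sword (rev y)"
  have "tword x = tword x * (sword (rev y) * tword y)" by simp
  also have "\<dots> = (tword x * sword (rev x)) * tword y" unfolding a[symmetric] by (simp only: mult.assoc)
  finally show ?thesis by simp
qed

lemma T_braid: "tword (alt_word i j (m i j)) = tword (alt_word j i (m i j))"
  by (rule tword_eq_of_sword) (use L_braid[of i j] in \<open>simp add: rev_alt_word\<close>)

text \<open>The representation itself. The next three maps are its composites with the bar
  involution, with i, and with both; \<open>rho_barF\<close> and the equations proved with it say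
  so. The last one, \<open>theta\<close>, is what the pairing applies to its first argument.\<close>

definition rho :: "free_elt \<Rightarrow> endo" where "rho = lin (\<lambda>x a. scl a * tword x)"

definition rhob :: "free_elt \<Rightarrow> endo" where "rhob = lin (\<lambda>x a. scl (qbar a) * sword x)"

definition rhoa :: "free_elt \<Rightarrow> endo" where "rhoa = lin (\<lambda>x a. scl a * tword (rev x))"

definition theta :: "free_elt \<Rightarrow> endo" where "theta = lin (\<lambda>x a. scl (qbar a) * sword (rev x))"

lemma families: "additive_family (\<lambda>x a. scl a * tword (g x))"
  "additive_family (\<lambda>x a. scl (qbar a) * sword (g x))"
  by (auto intro!: additive_familyI simp: scl_add qbar_add distrib_right)

lemma scl_swap: "scl a * x * (scl b * y) = scl (a * b) * (x * y)"
proof -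
  have "scl a * x * (scl b * y) = scl a * (x * scl b) * y" by (simp only: mult.assoc)
  then show ?thesis unfolding scl_comm[of x b] scl_mult by (simp only: mult.assoc)
qed

lemma rho_add: "rho (f + g) = rho f + rho g" and rho_minus: "rho (f - g) = rho f - rho g"
  and rhob_add: "rhob (f + g) = rhob f + rhob g" and rhob_minus: "rhob (f - g) = rhob f - rhob g"
  and rhoa_add: "rhoa (f + g) = rhoa f + rhoa g" and rhoa_minus: "rhoa (f - g) = rhoa f - rhoa g"
  and rho_sum: "rho (\<Sum>i\<in>X. h i) = (\<Sum>i\<in>X. rho (h i))"
  and rhoa_sum: "rhoa (\<Sum>i\<in>X. h i) = (\<Sum>i\<in>X. rhoa (h i))"
  and rhob_sum: "rhob (\<Sum>i\<in>X. h i) = (\<Sum>i\<in>X. rhob (h i))"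
  and theta_sum: "theta (\<Sum>i\<in>X. h i) = (\<Sum>i\<in>X. theta (h i))"
  unfolding rho_def rhob_def rhoa_def theta_def
  using families[of "\<lambda>x. x"] families[of rev]
  by (simp_all add: lin_add lin_minus lin_sum)

lemma rho_mult: "rho (f * g) = rho f * rho g"
  unfolding rho_def
  by (rule lin_mult) (use families[of "\<lambda>x. x"] in \<open>simp_all add: plus_list_def scl_swap\<close>)

lemma rhob_mult: "rhob (f * g) = rhob f * rhob g"
  unfolding rhob_def
  by (rule lin_mult) (use families[of "\<lambda>x. x"] in \<open>simp_all add: plus_list_def scl_swap qbar_mult\<close>)

lemma rhoa_mult: "rhoa (f * g) = rhoa g * rhoa f"
  unfolding rhoa_def
  by (rule lin_mult_anti) (use families[of rev] in \<open>simp_all add: plus_list_def scl_swap mult.commute[of _ "_ :: qv"]\<close>)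

lemma theta_mult: "theta (f * g) = theta g * theta f"
  unfolding theta_def
  by (rule lin_mult_anti)
    (use families[of rev] in \<open>simp_all add: plus_list_def scl_swap qbar_mult mult.commute[of _ "_ :: qv"]\<close>)

lemma rho_word [simp]: "rho (free_word x) = tword x"
  and rho_const [simp]: "rho (free_const c) = scl c"
  and rhob_word [simp]: "rhob (free_word x) = sword x"
  and rhob_const [simp]: "rhob (free_const c) = scl (qbar c)"
  and rhoa_word [simp]: "rhoa (free_word x) = tword (rev x)"
  and rhoa_const [simp]: "rhoa (free_const c) = scl c"
  and theta_word [simp]: "theta (free_word x) = sword (rev x)"
  and theta_const [simp]: "theta (free_const c) = scl (qbar c)"
  using families[of "\<lambda>x. x"] families[of rev]
  unfolding rho_def rhob_def rhoa_def theta_def free_word_def free_const_def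
  by (simp_all add: lin_single)

lemma rho_one [simp]: "rho 1 = 1" and rhob_one [simp]: "rhob 1 = 1"
  and rhoa_one [simp]: "rhoa 1 = 1" and theta_one [simp]: "theta 1 = 1"
  using rho_const[of 1] rhob_const[of 1] rhoa_const[of 1] theta_const[of 1]
  by (simp_all add: free_const_one)

lemma rho_sfree [simp]: "rho (sfree x) = sword x"
  and rhoa_sfree [simp]: "rhoa (sfree x) = sword (rev x)"
  and rhob_sfree [simp]: "rhob (sfree x) = tword x"
  by (induction x) (simp_all add: rho_mult rho_minus rhoa_mult rhoa_minus rhob_mult rhob_minus T_def
      scl_minus)

lemma rho_barF: "rho (barF f) = rhob f" and rhob_barF: "rhob (barF f) = rho f"
  and rhoa_barF: "rhoa (barF f) = theta f" and rho_antiF: "rho (antiF f) = rhoa f"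
  and rhoa_antiF: "rhoa (antiF f) = rho f"
  unfolding barF_def antiF_def lin_def[of _ f] rho_sum rhob_sum rhoa_sum
  unfolding rho_def[of] rhob_def[of] rhoa_def[of] theta_def[of]
  unfolding lin_def[of _ f]
  unfolding rho_def[symmetric] rhob_def[symmetric] rhoa_def[symmetric] theta_def[symmetric]
  by (simp_all add: rho_mult rhob_mult rhoa_mult scl_comm)

lemma scl_v: "scl (inverse v_var) * scl v_var = 1" "scl v_var * scl (inverse v_var) = 1"
  "scl alpha = scl v_var - scl (inverse v_var)"
proof -
  show "scl (inverse v_var) * scl v_var = 1" "scl v_var * scl (inverse v_var) = 1"
    using v_var_nonzero by (simp_all flip: scl_mult)
  show "scl alpha = scl v_var - scl (inverse v_var)"
    using scl_add[of alpha "inverse v_var"] by (simp add: alpha_def)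
qed

lemma L_relation: "(L i - scl (inverse v_var)) * (L i + scl v_var) = 0"
proof -
  have "(L i - scl (inverse v_var)) * (L i + scl v_var) =
      L i * L i + L i * scl v_var - scl (inverse v_var) * L i - scl (inverse v_var) * scl v_var"
    by (simp add: left_diff_distrib distrib_left)
  also have "\<dots> = L i * L i + scl alpha * L i - 1"
    unfolding scl_v scl_comm[of "L i" v_var] by (simp add: left_diff_distrib)
  finally show ?thesis by (simp add: Lop_quadratic)
qed

lemma T_relation: "(T i - scl v_var) * (T i + scl (inverse v_var)) = 0"
  using L_relation[of i] by (simp add: T_def scl_v(3) algebra_simps)

lemma T_relation': "(T i + scl (inverse v_var)) * (T i - scl v_var) = 0"
proof -
  have "(T i + scl (inverse v_var)) * (T i - scl v_var) = (T i - scl v_var) * (T i + scl (inverse v_var))"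
    unfolding distrib_right distrib_left left_diff_distrib right_diff_distrib scl_comm[of "T i"] scl_v
    by simp
  then show ?thesis by (simp only: T_relation)
qed

lemma rho_relations:
  assumes "f \<in> hecke_relations m n"
  shows "rho f = 0" "rhob f = 0" "rhoa f = 0"
proof -
  consider i j where "f = free_word (alt_word i j (m i j)) - free_word (alt_word j i (m i j))"
    | i where "f = (free_word [i] - free_const v_var) * (free_word [i] + free_const (inverse v_var))"
    using assms unfolding hecke_relations_def by blast
  then have "rho f = 0 \<and> rhob f = 0 \<and> rhoa f = 0"
  proof cases
    case (1 i j)
    then show ?thesis
      using T_braid[of i j] L_braid[of i j] by (simp add: rho_minus rhob_minus rhoa_minus rev_alt_word)
  next
    case (2 i)
    then show ?thesis
      using T_relation[of i] T_relation'[of i] L_relation[of i]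
      by (simp add: rho_mult rhob_mult rhoa_mult rho_minus rhob_minus rhoa_minus rho_add rhob_add rhoa_add
          qbar_inverse)
  qed
  then show "rho f = 0" "rhob f = 0" "rhoa f = 0" by auto
qed

lemma rho_ideal: "f \<in> hecke_ideal m n \<Longrightarrow> rho f = 0"
  by (rule hecke_ideal_vanish[of rho]) (auto simp: rho_add rho_mult rho_relations)

lemma rhob_ideal: "f \<in> hecke_ideal m n \<Longrightarrow> rhob f = 0"
  by (rule hecke_ideal_vanish[of rhob]) (auto simp: rhob_add rhob_mult rho_relations)

lemma rhoa_ideal: "f \<in> hecke_ideal m n \<Longrightarrow> rhoa f = 0"
  by (rule hecke_ideal_vanish[of rhoa]) (auto simp: rhoa_add rhoa_mult rho_relations)

text \<open>Matsumoto's theorem for congruence modulo the ideal: braid moves are relations of the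
  algebra, and no quadratic relation is required to pass between reduced words.\<close>

lemma hequiv_free_word_red:
  assumes "red m x" "red m y" "x \<in> lists {..<n}" "y \<in> lists {..<n}" "x \<asymp> y"
  shows "hequiv m n (free_word x) (free_word y)"
proof (rule matsumoto[where P = "\<lambda>x y. hequiv m n (free_word x) (free_word y)" and S = "{..<n}",
    OF _ _ _ _ _ assms])
  fix x y z
  show "x \<in> lists {..<n} \<Longrightarrow> hequiv m n (free_word x) (free_word x)" by (intro hequiv_refl Fr_word)
  show "hequiv m n (free_word x) (free_word y) \<Longrightarrow> hequiv m n (free_word y) (free_word x)"
    by (rule hequiv_sym)
  show "hequiv m n (free_word x) (free_word y) \<Longrightarrow> hequiv m n (free_word y) (free_word z) \<Longrightarrow>
      hequiv m n (free_word x) (free_word z)"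
    by (rule hequiv_trans)
next
  fix i x y assume "i \<in> {..<n}" "hequiv m n (free_word x) (free_word y)"
  then have "hequiv m n (free_word [i] * free_word x) (free_word [i] * free_word y)"
    by (intro hequiv_mult hequiv_refl Fr_gen) simp_all
  then show "hequiv m n (free_word (i # x)) (free_word (i # y))"
    by (simp only: free_word_Cons[of i x] free_word_Cons[of i y])
next
  fix i j z assume ij: "i \<in> {..<n}" "j \<in> {..<n}" "i \<noteq> j" "z \<in> lists {..<n}"
  let ?a = "alt_word i j (m i j)" and ?b = "alt_word j i (m i j)"
  have "?a \<in> lists {..<n}" "?b \<in> lists {..<n}"
    using ij set_alt_word[of i j "m i j"] set_alt_word[of j i "m i j"] by (auto simp: in_lists_conv_set)
  moreover have "free_word ?a - free_word ?b \<in> hecke_relations m n"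
    using ij unfolding hecke_relations_def by blast
  ultimately have "hequiv m n (free_word ?a) (free_word ?b)"
    by (simp only: hequiv_def Fr_word hI_rel simp_thms)
  then show "hequiv m n (free_word (?a @ z)) (free_word (?b @ z))"
    unfolding free_word_append using ij(4) by (intro hequiv_mult hequiv_refl Fr_word)
qed

text \<open>The two elements are inverse to the reversed words, and inverses of congruent elements
  are congruent.\<close>

lemma hequiv_sfree_red:
  assumes "red m x" "red m y" "x \<in> lists {..<n}" "y \<in> lists {..<n}" "x \<asymp> y"
  shows "hequiv m n (sfree x) (sfree y)"
proof -
  have rl: "rev x \<in> lists {..<n}" "rev y \<in> lists {..<n}" using assms by auto
  have F: "sfree x \<in> Fr n" "sfree y \<in> Fr n" 
    by (rule Fr_sfree[OF assms(3)], rule Fr_sfree[OF assms(4)])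
  have "hequiv m n (free_word (rev x)) (free_word (rev y))"
    by (rule hequiv_free_word_red[OF red_rev[OF assms(1)] red_rev[OF assms(2)] rl ceq_rev[OF assms(5)]])
  then have 1: "hequiv m n (sfree x * free_word (rev x) * sfree y) (sfree x * free_word (rev y) * sfree y)"
    using F by (intro hequiv_mult hequiv_refl)
  have A: "hequiv m n (sfree x * free_word (rev x) * sfree y) (1 * sfree y)"
    using word_inverse(1)[OF rl(1)] F by (intro hequiv_mult hequiv_refl) simp_all
  have "hequiv m n (sfree x * (free_word (rev y) * sfree y)) (sfree x * 1)"
    using word_inverse(2)[OF rl(2)] F by (intro hequiv_mult hequiv_refl) simp_all
  then have "hequiv m n (sfree x) (sfree x * free_word (rev y) * sfree y)"
    using hequiv_sym by (simp add: mult.assoc)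
  from hequiv_trans[OF this hequiv_trans[OF hequiv_sym[OF 1] A]] show ?thesis by simp
qed

text \<open>Inversion reverses products: the inverse of t_w is the product of the inverse generators
  along this word.\<close>

definition cword :: "nat list set \<Rightarrow> nat list" where
  "cword w = rev (reduced_word w)"

lemma cword:
  assumes "w \<in> coxeter_group m n"
  shows "red m (cword w)" "cword w \<in> lists {..<n}"
  using reduced_word[OF assms] by (auto simp: cword_def intro: red_rev)

lemma class_in_group: "x \<in> lists {..<n} \<Longrightarrow> {y \<in> lists {..<n}. x \<asymp> y} \<in> coxeter_group m n"
  unfolding coxeter_group_conv by blast

lemma reduced_word_class:
  assumes "x \<in> lists {..<n}"
  shows "reduced_word {y \<in> lists {..<n}. x \<asymp> y} \<asymp> x"
  using reduced_word(1)[OF class_in_group[OF assms]] ceq_sym by blast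

lemma cword_class:
  assumes "x \<in> lists {..<n}"
  shows "cword {y \<in> lists {..<n}. rev x \<asymp> y} \<asymp> x"
proof -
  have "rev x \<in> lists {..<n}" using assms by auto
  then show ?thesis using ceq_rev[OF reduced_word_class[of "rev x" n]] by (simp only: cword_def rev_rev_ident)
qed

lemma reduced_word_inj:
  assumes "w \<in> coxeter_group m n" "w' \<in> coxeter_group m n" "reduced_word w \<asymp> reduced_word w'"
  shows "w = w'"
  using reduced_word(4)[OF assms(1)] reduced_word(4)[OF assms(2)] assms(3) ceq_trans ceq_sym by blast

text \<open>Applied to the basis vector at u and evaluated at the identity, the operator belonging
  to w gives 1 for w = u and 0 for all other w.\<close>

lemma sword_independent:
  assumes "finite X" "X \<subseteq> coxeter_group m n" "(\<Sum>w\<in>X. scl (c w) * sword (cword w)) = 0" "u \<in> X"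
  shows "c u = 0"
proof -
  let ?f = "delta False (reduced_word u)"
  have "app (sword (cword w)) ?f False (N []) = (if w = u then 1 else 0)" if "w \<in> X" for w
  proof -
    have w: "w \<in> coxeter_group m n" and u: "u \<in> coxeter_group m n" using that assms by blast+
    have "app (sword (cword w)) ?f False (N []) = ?f False (N (reduced_word w))"
      using app_sword_red[of "cword w" "[]"] reduced_word(2)[OF w] by (simp add: cword_def)
    then show ?thesis using reduced_word_inj[OF w u] by (auto simp: delta_def nform_eq_iff ceq_refl)
  qed
  then have "app (\<Sum>w\<in>X. scl (c w) * sword (cword w)) ?f False (N []) = (\<Sum>w\<in>X. c w * (if w = u then 1 else 0))"
    unfolding app_sum by (intro sum.cong) auto
  also have "\<dots> = (\<Sum>w\<in>X. if w = u then c w else 0)" by (intro sum.cong) auto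
  also have "\<dots> = c u" using assms(1,4) by simp
  finally show ?thesis unfolding assms(3) by simp
qed

text \<open>Operators of distinct group elements are linearly independent, so a finite-dimensional
  algebra forces a finite group. The dimension bound is supplied by \<open>finite_dim\<close>, and
  no enumeration of the group takes place.\<close>

lemma finite_coxeter_group:
  assumes "finite B" "\<And>x. x \<in> lists {..<n} \<Longrightarrow> sword x \<in> endo_vs.span B"
  shows "finite (coxeter_group m n)"
proof (rule ccontr)
  assume "infinite (coxeter_group m n)"
  then obtain X where X: "finite X" "card X = Suc (card B)" "X \<subseteq> coxeter_group m n"
    using infinite_arbitrarily_large by blast
  let ?s = "\<lambda>w. sword (cword w)"
  have inj: "inj_on ?s X"
  proof (rule inj_onI, rule ccontr)
    fix u w assume uw: "u \<in> X" "w \<in> X" "?s u = ?s w" "u \<noteq> w"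
    define c where "c z = (if z = u then 1 else if z = w then - 1 else (0 :: qv))" for z
    have "(\<Sum>z\<in>X. scl (c z) * ?s z) = (\<Sum>z\<in>{u, w}. scl (c z) * ?s z)"
      using uw X(1) by (intro sum.mono_neutral_right) (auto simp: c_def)
    also have "\<dots> = 0" using uw(3,4) by (simp add: c_def scl_minus)
    finally have "c u = 0" using sword_independent[OF X(1,3)] uw(1) by blast
    then show False by (simp add: c_def)
  qed
  have "endo_vs.independent (?s ` X)"
  proof (rule ccontr)
    assume "\<not> endo_vs.independent (?s ` X)"
    then obtain u v where u: "v \<in> ?s ` X" "u v \<noteq> 0" "(\<Sum>v\<in>?s ` X. scl (u v) * v) = 0"
      using endo_vs.dependent_finite[of "?s ` X"] X(1) by auto
    have "(\<Sum>w\<in>X. scl (u (?s w)) * ?s w) = 0" using u(3) by (simp add: sum.reindex[OF inj])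
    then have "\<And>w. w \<in> X \<Longrightarrow> u (?s w) = 0" by (rule sword_independent[OF X(1,3)])
    then show False using u(1,2) by blast
  qed
  moreover have "?s ` X \<subseteq> endo_vs.span B"
    using assms(2) cword(2) X(3) by blast
  ultimately have "card (?s ` X) \<le> card B" using endo_vs.independent_span_bound assms(1) by blast
  then show False using card_image[OF inj] X(2) by simp
qed

end

section \<open>Faithfulness of the representation and the pairing\<close>

locale finite_coxeter = coxeter_aut m sw for m sw +
  fixes n :: nat
  assumes fin: "finite (coxeter_group m n)"
begin

abbreviation W where "W \<equiv> coxeter_group m n"
abbreviation H where "H \<equiv> hecke m n"
abbreviation he where "he \<equiv> hequiv m n"
abbreviation clH where "clH \<equiv> hecke_class m n"

definition comb :: "(nat list set \<Rightarrow> qv) \<Rightarrow> free_elt" where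
  "comb c = (\<Sum>w\<in>W. free_const (c w) * sfree (cword w))"

lemma comb_Fr: "comb c \<in> Fr n"
  unfolding comb_def by (rule Fr_sum, rule Fr_mult[OF Fr_const Fr_sfree], rule cword(2))

definition spanned :: "free_elt \<Rightarrow> bool" where
  "spanned f \<longleftrightarrow> (\<exists>c. he f (comb c))"

lemma spanned_cong: "he f g \<Longrightarrow> spanned g \<Longrightarrow> spanned f"
  unfolding spanned_def using hequiv_trans by blast

lemma spanned_add: "spanned f \<Longrightarrow> spanned g \<Longrightarrow> spanned (f + g)"
proof -
  assume "spanned f" "spanned g"
  then obtain c d where "he f (comb c)" "he g (comb d)" by (auto simp: spanned_def)
  then have "he (f + g) (comb c + comb d)" by (rule hequiv_add)
  moreover have "comb c + comb d = comb (\<lambda>w. c w + d w)"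
    by (simp add: comb_def free_const_add distrib_right sum.distrib)
  ultimately show ?thesis unfolding spanned_def by auto
qed

lemma spanned_const: "spanned f \<Longrightarrow> spanned (free_const d * f)"
proof -
  assume "spanned f"
  then obtain c where "he f (comb c)" by (auto simp: spanned_def)
  then have "he (free_const d * f) (free_const d * comb c)" by (intro hequiv_mult hequiv_refl Fr_const)
  moreover have "free_const d * comb c = comb (\<lambda>w. d * c w)"
    by (simp add: comb_def free_const_mult sum_distrib_left mult.assoc)
  ultimately show ?thesis unfolding spanned_def by auto
qed

lemma spanned_red: assumes "red m x" "x \<in> lists {..<n}" shows "spanned (sfree x)"
proof -
  define u where "u = {y \<in> lists {..<n}. rev x \<asymp> y}"
  have u: "u \<in> W" unfolding u_def using assms(2) by (intro class_in_group) auto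
  have "cword u \<asymp> x" unfolding u_def by (rule cword_class[OF assms(2)])
  then have "he (sfree x) (sfree (cword u))"
    using hequiv_sfree_red[OF assms(1) cword(1)[OF u] assms(2) cword(2)[OF u]] ceq_sym by blast
  moreover have "comb (\<lambda>w. if w = u then 1 else 0) = sfree (cword u)"
  proof -
    have "comb (\<lambda>w. if w = u then 1 else 0) = (\<Sum>w\<in>W. if w = u then sfree (cword w) else 0)"
      unfolding comb_def by (intro sum.cong) (simp_all add: free_const_one, simp add: free_const_def)
    then show ?thesis using u fin by simp
  qed
  ultimately show ?thesis unfolding spanned_def by metis
qed

lemma spanned_sum: "finite X \<Longrightarrow> (\<And>i. i \<in> X \<Longrightarrow> spanned (f i)) \<Longrightarrow> spanned (\<Sum>i\<in>X. f i)"
proof (induction X rule: finite_induct)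
  case empty
  have "spanned (sfree [])" by (rule spanned_red) (simp_all add: red_def)
  then have "spanned (free_const 0 * sfree [])" by (rule spanned_const)
  then show ?case by (simp add: free_const_def)
next
  case (insert i X)
  then show ?case using spanned_add by simp
qed

text \<open>At a descent x may be rewritten to begin with i. The square of the inverse generator is
  then 1 minus \<alpha> times itself, which leaves two reduced words.\<close>

lemma spanned_Cons:
  assumes "red m x" "x \<in> lists {..<n}" "i < n" shows "spanned (sfree (i # x))"
proof (cases "nu m x [i]")
  case False
  then show ?thesis using spanned_red[of "i # x"] assms red_Cons_iff[OF assms(1)] by (simp del: sfree_simps)
next
  case True
  obtain a c b where abc: "x = a @ c # b" "x \<asymp> i # a @ b" "red m (i # a @ b)"
    using red_nu_down[OF assms(1) True] by metis
  let ?z = "a @ b" let ?t = "free_word [i]" let ?s = "?t - free_const alpha"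
  have z: "?z \<in> lists {..<n}" "i # ?z \<in> lists {..<n}" using assms abc by auto
  have F: "?t \<in> Fr n" "?s \<in> Fr n" "sfree ?z \<in> Fr n"
    using Fr_gen[OF assms(3)] Fr_minus[OF Fr_gen[OF assms(3)] Fr_const] Fr_sfree[OF z(1)] by blast+
  have A: "he (?s * sfree x) (?s * sfree (i # ?z))"
    by (intro hequiv_mult hequiv_refl F hequiv_sfree_red abc assms z)
  have B: "he (?s * ?s * sfree ?z) ((1 + free_const (- alpha) * ?s) * sfree ?z)"
  proof (rule hequiv_mult[OF _ hequiv_refl[OF F(3)]])
    have "he (sfree (rev [i]) * free_word [i] + free_const (- alpha) * ?s) (1 + free_const (- alpha) * ?s)"
      using assms(3) by (intro hequiv_add word_inverse hequiv_refl Fr_mult Fr_const F) auto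
    moreover have "sfree (rev [i]) * free_word [i] + free_const (- alpha) * ?s = ?s * ?s"
    proof -
      have "?s * ?s = ?s * ?t - ?s * free_const alpha" by (rule right_diff_distrib)
      moreover have "free_const (- alpha) = - free_const alpha"
        by (simp add: free_const_def single_uminus)
      ultimately show ?thesis by (simp add: free_const_comm[of alpha ?s])
    qed
    ultimately show "he (?s * ?s) (1 + free_const (- alpha) * ?s)" by simp
  qed
  have D: "spanned ((1 + free_const (- alpha) * ?s) * sfree ?z)"
  proof -
    have "spanned (sfree ?z + free_const (- alpha) * sfree (i # ?z))"
      by (intro spanned_add spanned_const spanned_red z abc red_Cons_tl[OF abc(3)])
    then show ?thesis by (simp add: distrib_right mult.assoc)
  qed
  have "he (?s * sfree x) (?s * ?s * sfree ?z)" using A by (simp add: mult.assoc)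
  from spanned_cong[OF hequiv_trans[OF this B] D] show ?thesis by simp
qed

lemma spanned_gen: "spanned f \<Longrightarrow> i < n \<Longrightarrow> spanned ((free_word [i] - free_const alpha) * f)"
proof -
  let ?s = "free_word [i] - free_const alpha"
  assume f: "spanned f" and i: "i < n"
  then obtain c where "he f (comb c)" by (auto simp: spanned_def)
  then have "he (?s * f) (?s * comb c)" using i by (intro hequiv_mult hequiv_refl Fr_minus Fr_gen Fr_const)
  moreover have "?s * comb c = (\<Sum>w\<in>W. free_const (c w) * sfree (i # cword w))"
  proof -
    have "?s * (free_const (c w) * y) = free_const (c w) * (?s * y)" for w y
      using free_const_comm[of "c w" ?s] by (simp flip: mult.assoc)
    then show ?thesis by (simp add: comb_def sum_distrib_left)
  qed
  moreover have "spanned (\<Sum>w\<in>W. free_const (c w) * sfree (i # cword w))"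
    by (rule spanned_sum[OF fin], rule spanned_const, rule spanned_Cons[OF cword(1) cword(2) i])
  ultimately show ?thesis using spanned_cong by simp
qed

lemma spanned_all: assumes "f \<in> Fr n" shows "spanned f"
proof -
  have "\<forall>g. spanned g \<longrightarrow> spanned (f * g)"
    using assms
  proof (induction rule: Fr_induct)
    case (const c) show ?case using spanned_const by blast
  next
    case (gen i)
    show ?case
    proof (intro allI impI)
      fix g assume g: "spanned g"
      have "free_word [i] * g = (free_word [i] - free_const alpha) * g + free_const alpha * g"
        by (simp add: left_diff_distrib)
      then show "spanned (free_word [i] * g)"
        using spanned_add[OF spanned_gen[OF g gen] spanned_const[OF g]] by simp
    qed
  next
    case (add f g) then show ?case using spanned_add by (simp add: distrib_right)
  next
    case (mult f g) then show ?case by (simp add: mult.assoc)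
  qed
  moreover have "spanned 1" using spanned_red[of "[]"] by (simp add: red_def)
  ultimately show ?thesis by (metis mult.right_neutral)
qed

lemma rho_comb: "rho (comb c) = (\<Sum>w\<in>W. scl (c w) * sword (cword w))"
  by (simp add: comb_def rho_sum rho_mult)

text \<open>The lifts of the inverses of the t_w span the free algebra modulo the ideal and have
  independent images, so nothing outside the ideal is killed.\<close>

lemma kernel: assumes "f \<in> Fr n" "rho f = 0" shows "f \<in> hecke_ideal m n"
proof -
  obtain c where c: "he f (comb c)" using spanned_all[OF assms(1)] by (auto simp: spanned_def)
  then have "rho (f - comb c) = 0" using rho_ideal[of _ n] by (simp add: hequiv_def)
  then have "(\<Sum>w\<in>W. scl (c w) * sword (cword w)) = 0" using assms(2) by (simp add: rho_minus rho_comb)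
  then have "c w = 0" if "w \<in> W" for w using sword_independent[OF fin order.refl _ that] by blast
  then have "comb c = 0" unfolding comb_def by (intro sum.neutral) (simp add: free_const_def)
  then show ?thesis using c by (simp add: hequiv_def)
qed

lemma he_iff: "f \<in> Fr n \<Longrightarrow> g \<in> Fr n \<Longrightarrow> he f g \<longleftrightarrow> rho f = rho g"
  using kernel[of "f - g"] rho_ideal[of "f - g"] Fr_minus by (auto simp: hequiv_def rho_minus)

lemma clH_eq_iff: "f \<in> Fr n \<Longrightarrow> g \<in> Fr n \<Longrightarrow> clH f = clH g \<longleftrightarrow> rho f = rho g"
  by (simp add: cl_eq_iff he_iff)

definition rep :: "free_elt set \<Rightarrow> free_elt" where
  "rep h = (SOME f. f \<in> Fr n \<and> h = clH f)"

lemma rep: "h \<in> carrier H \<Longrightarrow> rep h \<in> Fr n" "h \<in> carrier H \<Longrightarrow> clH (rep h) = h"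
proof -
  assume "h \<in> carrier H"
  then have "\<exists>f. f \<in> Fr n \<and> h = clH f" unfolding hecke_carrier by blast
  then have "rep h \<in> Fr n \<and> h = clH (rep h)" unfolding rep_def by (rule someI_ex)
  then show "rep h \<in> Fr n" "clH (rep h) = h" by simp_all
qed

definition hR :: "free_elt set \<Rightarrow> endo" where
  "hR h = rho (rep h)"

lemma hR_cl [simp]: "f \<in> Fr n \<Longrightarrow> hR (clH f) = rho f"
  using rep[OF cl_closed] clH_eq_iff[OF rep(1)[OF cl_closed]] by (simp add: hR_def)

lemma hR_inject: "h \<in> carrier H \<Longrightarrow> h' \<in> carrier H \<Longrightarrow> hR h = hR h' \<Longrightarrow> h = h'"
proof -
  assume "h \<in> carrier H" "h' \<in> carrier H" and e: "hR h = hR h'"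
  then obtain f g where "f \<in> Fr n" "h = clH f" "g \<in> Fr n" "h' = clH g"
    unfolding hecke_carrier by blast
  then show ?thesis using e clH_eq_iff by simp
qed

lemma hecke_gen_cl: "hecke_gen m n i = clH (free_word [i])"
  by (simp add: hecke_gen_def)

lemma hecke_T_cl: "w \<in> W \<Longrightarrow> hecke_T m n w = clH (free_word (reduced_word w))"
proof -
  assume w: "w \<in> W"
  have "hecke_prod m n (map clH (map (\<lambda>i. free_word [i]) (reduced_word w))) =
      clH (prod_list (map (\<lambda>i. free_word [i]) (reduced_word w)))"
    using reduced_word(3)[OF w] by (intro cl_prod) (auto intro!: Fr_gen)
  moreover have "map (hecke_gen m n) (reduced_word w) = map clH (map (\<lambda>i. free_word [i]) (reduced_word w))"
    by (simp add: hecke_gen_cl)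
  ultimately show ?thesis by (simp only: hecke_T_def prod_list_free_word)
qed

lemma inv_word_cl: "x \<in> lists {..<n} \<Longrightarrow> inv\<^bsub>H\<^esub> (clH (free_word x)) = clH (sfree (rev x))"
  by (intro cl_inv word_inverse Fr_word Fr_sfree) auto

lemma inv_T_cl: "w \<in> W \<Longrightarrow> inv\<^bsub>H\<^esub> (hecke_T m n w) = clH (sfree (cword w))"
  using inv_word_cl[OF reduced_word(3)] by (simp only: hecke_T_cl cword_def)

lemma rev_class:
  assumes "x \<in> lists {..<n}"
  shows "rev ` {y \<in> lists {..<n}. x \<asymp> y} = {y \<in> lists {..<n}. rev x \<asymp> y}"
proof (intro equalityI subsetI)
  fix y assume "y \<in> {y \<in> lists {..<n}. rev x \<asymp> y}"
  then have "rev y \<in> {y \<in> lists {..<n}. x \<asymp> y}" using ceq_rev[of "rev x" y] by auto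
  then show "y \<in> rev ` {y \<in> lists {..<n}. x \<asymp> y}" by (metis image_eqI rev_rev_ident)
qed (auto intro: ceq_rev)

lemma rev_W:
  assumes "w \<in> W"
  shows "rev ` w \<in> W" "reduced_word (rev ` w) \<asymp> cword w"
proof -
  let ?x = "reduced_word w"
  have x: "?x \<in> lists {..<n}" "rev ?x \<in> lists {..<n}" using reduced_word(3)[OF assms] by auto
  have e: "rev ` w = {y \<in> lists {..<n}. rev ?x \<asymp> y}"
    by (subst reduced_word(4)[OF assms]) (rule rev_class[OF x(1)])
  show "rev ` w \<in> W" unfolding e by (rule class_in_group[OF x(2)])
  show "reduced_word (rev ` w) \<asymp> cword w" unfolding e cword_def by (rule reduced_word_class[OF x(2)])
qed

lemma cl_free_word_rev: assumes "w \<in> W" shows "hecke_T m n (rev ` w) = clH (free_word (cword w))"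
  unfolding hecke_T_cl[OF rev_W(1)[OF assms]]
  using hequiv_free_word_red[OF reduced_word(2)[OF rev_W(1)[OF assms]] cword(1)[OF assms]
      reduced_word(3)[OF rev_W(1)[OF assms]] cword(2)[OF assms] rev_W(2)[OF assms]]
  by (subst cl_eq_iff) (auto simp: hequiv_def)

lemma inv_T_rev: assumes "w \<in> W" shows "inv\<^bsub>H\<^esub> (hecke_T m n (rev ` w)) = clH (sfree (reduced_word w))"
  unfolding cl_free_word_rev[OF assms] using inv_word_cl[OF cword(2)[OF assms]] by (simp add: cword_def)

lemma gen_class:
  assumes "i < n"
  defines "w \<equiv> {y \<in> lists {..<n}. [i] \<asymp> y}"
  shows "w \<in> W" "reduced_word w = [i]"
proof -
  show w: "w \<in> W" unfolding w_def using assms(1) by (intro class_in_group) simp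
  have c: "reduced_word w \<asymp> [i]" unfolding w_def using assms(1) by (intro reduced_word_class) simp
  have "length (reduced_word w) = 1"
    using red_length[OF reduced_word(2)[OF w] red_singleton c] by simp
  then obtain j where "reduced_word w = [j]" by (metis One_nat_def Suc_length_conv length_0_conv)
  then show "reduced_word w = [i]" using c gens_distinct by simp
qed

text \<open>A map of the free algebra pushed down along chosen representatives. Its restriction to
  the carrier matches the extensionality demanded in the descriptions of the bar involution and of
  i.\<close>

definition desc :: "(free_elt \<Rightarrow> free_elt) \<Rightarrow> free_elt set \<Rightarrow> free_elt set" where
  "desc B = (\<lambda>h\<in>carrier H. clH (B (rep h)))"

lemma desc_cl:
  assumes "\<And>f. f \<in> Fr n \<Longrightarrow> B f \<in> Fr n"
    and "\<And>f g. f \<in> Fr n \<Longrightarrow> g \<in> Fr n \<Longrightarrow> he f g \<Longrightarrow> rho (B f) = rho (B g)" and f: "f \<in> Fr n"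
  shows "desc B (clH f) = clH (B f)"
proof -
  have r: "rep (clH f) \<in> Fr n" "clH (rep (clH f)) = clH f" using rep cl_closed f by auto
  then have "he (rep (clH f)) f" using cl_eq_iff[OF r(1) f] by simp
  then have "rho (B (rep (clH f))) = rho (B f)" by (rule assms(2)[OF r(1) f])
  then show ?thesis using assms(1) r(1) f by (simp add: desc_def cl_closed clH_eq_iff)
qed

lemma desc_bar: "f \<in> Fr n \<Longrightarrow> desc barF (clH f) = clH (barF f)"
proof (rule desc_cl)
  fix f g assume "he f g"
  then show "rho (barF f) = rho (barF g)"
    using rhob_ideal[of "f - g" n] by (simp add: rho_barF hequiv_def rhob_minus)
qed (simp_all add: Fr_barF)

lemma desc_anti: "f \<in> Fr n \<Longrightarrow> desc antiF (clH f) = clH (antiF f)"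
proof (rule desc_cl)
  fix f g assume "he f g"
  then show "rho (antiF f) = rho (antiF g)"
    using rhoa_ideal[of "f - g" n] by (simp add: rho_antiF hequiv_def rhoa_minus)
qed (simp_all add: Fr_antiF)

text \<open>For uniqueness, a candidate is composed with the faithful representation. The result
  agrees with \<open>rhob\<close> on scalars by \<open>qv_hom_eq\<close> and on the generators,
  which are the T_w of one-letter words, and both sides respect sums and products.\<close>

lemma hecke_bar_eq: "hecke_bar m n = desc barF"
  unfolding hecke_bar_def
proof (rule the_equality)
  have mem: "desc barF h \<in> carrier H" if "h \<in> carrier H" for h
    using that desc_bar Fr_barF cl_closed unfolding hecke_carrier by auto
  have hom: "desc barF \<in> ring_hom H H"
  proof (rule ring_hom_memI)
    fix h h' assume "h \<in> carrier H" "h' \<in> carrier H"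
    then obtain f g where fg: "f \<in> Fr n" "h = clH f" "g \<in> Fr n" "h' = clH g" unfolding hecke_carrier by blast
    show "desc barF (h \<otimes>\<^bsub>H\<^esub> h') = desc barF h \<otimes>\<^bsub>H\<^esub> desc barF h'"
      "desc barF (h \<oplus>\<^bsub>H\<^esub> h') = desc barF h \<oplus>\<^bsub>H\<^esub> desc barF h'"
      unfolding fg(2,4) using fg(1,3)
      by (simp_all add: cl_mult cl_add desc_bar Fr_mult Fr_add Fr_barF clH_eq_iff rho_barF rho_mult rho_add
          rhob_mult rhob_add)
  next
    show "desc barF \<one>\<^bsub>H\<^esub> = \<one>\<^bsub>H\<^esub>"
      by (simp add: cl_one desc_bar Fr_one Fr_barF clH_eq_iff rho_barF)
  qed (rule mem)
  have smult: "desc barF (hecke_smult m n (q_const q) h) = hecke_smult m n (q_const q) (desc barF h)"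
    if "h \<in> carrier H" for q h
  proof -
    obtain f where f: "f \<in> Fr n" "h = clH f" using \<open>h \<in> carrier H\<close> unfolding hecke_carrier by blast
    show ?thesis unfolding f(2) using f(1)
      by (simp add: cl_smult desc_bar Fr_mult Fr_const Fr_barF clH_eq_iff rho_barF rho_mult rhob_mult)
  qed
  have invol: "desc barF (desc barF h) = h" if "h \<in> carrier H" for h
  proof -
    obtain f where f: "f \<in> Fr n" "h = clH f" using \<open>h \<in> carrier H\<close> unfolding hecke_carrier by blast
    show ?thesis unfolding f(2) using f(1)
      by (simp add: desc_bar Fr_barF clH_eq_iff rho_barF rhob_barF)
  qed
  have v: "desc barF (clH (free_const v_var)) = clH (free_const (inverse v_var))"
    by (simp add: desc_bar Fr_const Fr_barF clH_eq_iff rho_barF)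
  have T: "desc barF (hecke_T m n w) = inv\<^bsub>H\<^esub> (hecke_T m n (rev ` w))" if w: "w \<in> W" for w
  proof -
    have l: "reduced_word w \<in> lists {..<n}" by (rule reduced_word(3)[OF w])
    show ?thesis unfolding inv_T_rev[OF w] hecke_T_cl[OF w] desc_bar[OF Fr_word[OF l]]
      by (subst clH_eq_iff[OF Fr_barF[OF Fr_word[OF l]] Fr_sfree[OF l]]) (simp add: rho_barF)
  qed
  show "desc barF \<in> ring_hom H H \<and> desc barF \<in> extensional (carrier H) \<and>
     (\<forall>h\<in>carrier H. desc barF (desc barF h) = h) \<and>
     (\<forall>q. \<forall>h\<in>carrier H. desc barF (hecke_smult m n (q_const q) h) = hecke_smult m n (q_const q) (desc barF h)) \<and>
     desc barF (clH (free_const v_var)) = clH (free_const (inverse v_var)) \<and>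
     (\<forall>w\<in>W. desc barF (hecke_T m n w) = inv\<^bsub>H\<^esub> (hecke_T m n (rev ` w)))"
    using hom smult invol v T by (simp add: desc_def[of barF])
next
  fix F
  assume "F \<in> ring_hom H H \<and> F \<in> extensional (carrier H) \<and>
     (\<forall>h\<in>carrier H. F (F h) = h) \<and>
     (\<forall>q. \<forall>h\<in>carrier H. F (hecke_smult m n (q_const q) h) = hecke_smult m n (q_const q) (F h)) \<and>
     F (clH (free_const v_var)) = clH (free_const (inverse v_var)) \<and>
     (\<forall>w\<in>W. F (hecke_T m n w) = inv\<^bsub>H\<^esub> (hecke_T m n (rev ` w)))"
  then have hom: "F \<in> ring_hom H H" and ext: "F \<in> extensional (carrier H)"
    and smult: "\<And>q h. h \<in> carrier H \<Longrightarrow> F (hecke_smult m n (q_const q) h) = hecke_smult m n (q_const q) (F h)"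
    and v: "F (clH (free_const v_var)) = clH (free_const (inverse v_var))"
    and T: "\<And>w. w \<in> W \<Longrightarrow> F (hecke_T m n w) = inv\<^bsub>H\<^esub> (hecke_T m n (rev ` w))" by auto
  have Fc: "F h \<in> carrier H" if "h \<in> carrier H" for h using ring_hom_closed[OF hom that] .
  have Fcl: "\<exists>g\<in>Fr n. F (clH f) = clH g" if "f \<in> Fr n" for f
    using Fc[OF cl_closed[OF that]] unfolding hecke_carrier by blast
  have add: "hR (F (clH (f + g))) = hR (F (clH f)) + hR (F (clH g))" if fg: "f \<in> Fr n" "g \<in> Fr n" for f g
  proof -
    obtain f' g' where *: "f' \<in> Fr n" "F (clH f) = clH f'" "g' \<in> Fr n" "F (clH g) = clH g'"
      using Fcl fg by metis
    have "F (clH (f + g)) = clH (f' + g')"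
      using ring_hom_add[OF hom cl_closed[OF fg(1)] cl_closed[OF fg(2)]] * fg by (simp add: cl_add)
    then show ?thesis using * by (simp add: Fr_add rho_add)
  qed
  have mult: "hR (F (clH (f * g))) = hR (F (clH f)) * hR (F (clH g))" if fg: "f \<in> Fr n" "g \<in> Fr n" for f g
  proof -
    obtain f' g' where *: "f' \<in> Fr n" "F (clH f) = clH f'" "g' \<in> Fr n" "F (clH g) = clH g'"
      using Fcl fg by metis
    have "F (clH (f * g)) = clH (f' * g')"
      using ring_hom_mult[OF hom cl_closed[OF fg(1)] cl_closed[OF fg(2)]] * fg by (simp add: cl_mult)
    then show ?thesis using * by (simp add: Fr_mult rho_mult)
  qed
  have const: "hR (F (clH (free_const c))) = scl (qbar c)" for c
  proof (rule qv_hom_eq[of "\<lambda>c. hR (F (clH (free_const c)))" "\<lambda>c. scl (qbar c)"])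
    have one: "F (clH 1) = clH 1" using ring_hom_one[OF hom] by (simp add: cl_one)
    fix a show "hR (F (clH (free_const (q_const a)))) = scl (qbar (q_const a))"
      using smult[OF cl_closed[OF Fr_one], of a] by (simp add: one cl_smult Fr_one Fr_const)
  qed (simp_all add: free_const_add free_const_mult add mult Fr_const scl_add scl_mult qbar_add qbar_mult v)
  have "hR (F (clH f)) = rhob f" if "f \<in> Fr n" for f
    using that
  proof (induction rule: Fr_induct)
    case (const c) then show ?case by (simp add: \<open>\<And>c. hR (F (clH (free_const c))) = scl (qbar c)\<close>)
  next
    case (gen i)
    note w = gen_class[OF gen]
    have l: "[i] \<in> lists {..<n}" using gen by simp
    have "F (clH (free_word [i])) = clH (sfree [i])"
      using T[OF w(1)] inv_T_rev[OF w(1)] hecke_T_cl[OF w(1)] by (simp only: w(2))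
    then show ?case using Fr_sfree[OF l] by (simp only: hR_cl rho_sfree rhob_word)
  next
    case (add f g) then show ?case using \<open>\<And>f g. f \<in> Fr n \<Longrightarrow> g \<in> Fr n \<Longrightarrow> hR (F (clH (f + g))) = hR (F (clH f)) + hR (F (clH g))\<close> by (simp add: rhob_add)
  next
    case (mult f g) then show ?case using \<open>\<And>f g. f \<in> Fr n \<Longrightarrow> g \<in> Fr n \<Longrightarrow> hR (F (clH (f * g))) = hR (F (clH f)) * hR (F (clH g))\<close> by (simp add: rhob_mult)
  qed
  then have eq: "F (clH f) = clH (barF f)" if "f \<in> Fr n" for f
    using that by (intro hR_inject Fc) (auto simp: cl_closed Fr_barF rho_barF)
  show "F = desc barF"
  proof (rule extensionalityI[OF ext])
    show "desc barF \<in> extensional (carrier H)" by (simp add: desc_def)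
    fix h assume "h \<in> carrier H"
    then show "F h = desc barF h" unfolding hecke_carrier using eq desc_bar by auto
  qed
qed

lemma empty_class:
  "coxeter_one m n \<in> W" "reduced_word (coxeter_one m n) = []"
proof -
  have e: "coxeter_one m n = {y \<in> lists {..<n}. [] \<asymp> y}"
    unfolding coxeter_one_def by (rule coxeter_class) simp
  show w: "coxeter_one m n \<in> W" unfolding e by (rule class_in_group) simp
  have "reduced_word (coxeter_one m n) \<asymp> []" unfolding e by (rule reduced_word_class) simp
  then have "length (reduced_word (coxeter_one m n)) \<le> length ([] :: nat list)"
    using reduced_word(2)[OF w] unfolding red_def by blast
  then show "reduced_word (coxeter_one m n) = []" by simp
qed

lemma hecke_anti_eq: "hecke_anti m n = desc antiF"
  unfolding hecke_anti_def
proof (rule the_equality)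
  have mem: "desc antiF h \<in> carrier H" if "h \<in> carrier H" for h
    using that desc_anti Fr_antiF cl_closed unfolding hecke_carrier by auto
  have ext: "desc antiF \<in> carrier H \<rightarrow>\<^sub>E carrier H"
    using mem by (auto simp: PiE_def desc_def[of antiF] extensional_def)
  have hom: "desc antiF (h \<oplus>\<^bsub>H\<^esub> h') = desc antiF h \<oplus>\<^bsub>H\<^esub> desc antiF h' \<and>
      desc antiF (h \<otimes>\<^bsub>H\<^esub> h') = desc antiF h' \<otimes>\<^bsub>H\<^esub> desc antiF h"
    if hh: "h \<in> carrier H" "h' \<in> carrier H" for h h'
  proof -
    obtain f g where fg: "f \<in> Fr n" "h = clH f" "g \<in> Fr n" "h' = clH g"
      using hh unfolding hecke_carrier by blast
    show ?thesis
      unfolding fg(2,4) using fg(1,3)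
      by (simp_all add: cl_mult cl_add desc_anti Fr_mult Fr_add Fr_antiF clH_eq_iff rho_antiF rho_mult rho_add
          rhoa_mult rhoa_add)
  qed
  have smult: "desc antiF (hecke_smult m n c h) = hecke_smult m n c (desc antiF h)"
    if "h \<in> carrier H" for c h
  proof -
    obtain f where f: "f \<in> Fr n" "h = clH f" using \<open>h \<in> carrier H\<close> unfolding hecke_carrier by blast
    show ?thesis unfolding f(2) using f(1)
      by (simp add: cl_smult desc_anti Fr_mult Fr_const Fr_antiF clH_eq_iff rho_antiF rho_mult rhoa_mult
          scl_comm[of "rhoa f"])
  qed
  have invol: "desc antiF (desc antiF h) = h" if "h \<in> carrier H" for h
  proof -
    obtain f where f: "f \<in> Fr n" "h = clH f" using \<open>h \<in> carrier H\<close> unfolding hecke_carrier by blast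
    show ?thesis unfolding f(2) using f(1)
      by (simp add: desc_anti Fr_antiF clH_eq_iff rho_antiF rhoa_antiF)
  qed
  have T: "desc antiF (hecke_T m n w) = hecke_T m n (rev ` w)" if w: "w \<in> W" for w
  proof -
    have l: "reduced_word w \<in> lists {..<n}" by (rule reduced_word(3)[OF w])
    show ?thesis unfolding cl_free_word_rev[OF w] hecke_T_cl[OF w] desc_anti[OF Fr_word[OF l]]
      by (subst clH_eq_iff[OF Fr_antiF[OF Fr_word[OF l]] Fr_word[OF cword(2)[OF w]]])
        (simp add: rho_antiF cword_def)
  qed
  show "desc antiF \<in> carrier H \<rightarrow>\<^sub>E carrier H \<and>
     (\<forall>h\<in>carrier H. \<forall>h'\<in>carrier H.
        desc antiF (h \<oplus>\<^bsub>H\<^esub> h') = desc antiF h \<oplus>\<^bsub>H\<^esub> desc antiF h' \<and>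
        desc antiF (h \<otimes>\<^bsub>H\<^esub> h') = desc antiF h' \<otimes>\<^bsub>H\<^esub> desc antiF h) \<and>
     (\<forall>c. \<forall>h\<in>carrier H. desc antiF (hecke_smult m n c h) = hecke_smult m n c (desc antiF h)) \<and>
     (\<forall>h\<in>carrier H. desc antiF (desc antiF h) = h) \<and>
     (\<forall>w\<in>W. desc antiF (hecke_T m n w) = hecke_T m n (rev ` w))"
    by (intro conjI ballI allI ext smult invol T hom[THEN conjunct1] hom[THEN conjunct2])
next
  fix F
  assume a: "F \<in> carrier H \<rightarrow>\<^sub>E carrier H \<and>
     (\<forall>h\<in>carrier H. \<forall>h'\<in>carrier H.
        F (h \<oplus>\<^bsub>H\<^esub> h') = F h \<oplus>\<^bsub>H\<^esub> F h' \<and> F (h \<otimes>\<^bsub>H\<^esub> h') = F h' \<otimes>\<^bsub>H\<^esub> F h) \<and>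
     (\<forall>c. \<forall>h\<in>carrier H. F (hecke_smult m n c h) = hecke_smult m n c (F h)) \<and>
     (\<forall>h\<in>carrier H. F (F h) = h) \<and>
     (\<forall>w\<in>W. F (hecke_T m n w) = hecke_T m n (rev ` w))"
  then have Fadd: "\<And>h h'. h \<in> carrier H \<Longrightarrow> h' \<in> carrier H \<Longrightarrow> F (h \<oplus>\<^bsub>H\<^esub> h') = F h \<oplus>\<^bsub>H\<^esub> F h'"
    and Fmult: "\<And>h h'. h \<in> carrier H \<Longrightarrow> h' \<in> carrier H \<Longrightarrow> F (h \<otimes>\<^bsub>H\<^esub> h') = F h' \<otimes>\<^bsub>H\<^esub> F h"
    and smult: "\<And>c h. h \<in> carrier H \<Longrightarrow> F (hecke_smult m n c h) = hecke_smult m n c (F h)"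
    and T: "\<And>w. w \<in> W \<Longrightarrow> F (hecke_T m n w) = hecke_T m n (rev ` w)" by auto
  have F: "F \<in> carrier H \<rightarrow>\<^sub>E carrier H" using a by (rule conjunct1)
  have Fc: "F h \<in> carrier H" if "h \<in> carrier H" for h by (rule PiE_mem[OF F that])
  have Fcl: "\<exists>g\<in>Fr n. F (clH f) = clH g" if "f \<in> Fr n" for f
    using Fc[OF cl_closed[OF that]] unfolding hecke_carrier by blast
  have add: "hR (F (clH (f + g))) = hR (F (clH f)) + hR (F (clH g))" if fg: "f \<in> Fr n" "g \<in> Fr n" for f g
  proof -
    obtain f' g' where *: "f' \<in> Fr n" "F (clH f) = clH f'" "g' \<in> Fr n" "F (clH g) = clH g'"
      using Fcl fg by metis
    have "F (clH (f + g)) = clH (f' + g')"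
      using Fadd[OF cl_closed[OF fg(1)] cl_closed[OF fg(2)]] * fg by (simp add: cl_add)
    then show ?thesis using * by (simp add: Fr_add rho_add)
  qed
  have mult: "hR (F (clH (f * g))) = hR (F (clH g)) * hR (F (clH f))" if fg: "f \<in> Fr n" "g \<in> Fr n" for f g
  proof -
    obtain f' g' where *: "f' \<in> Fr n" "F (clH f) = clH f'" "g' \<in> Fr n" "F (clH g) = clH g'"
      using Fcl fg by metis
    have "F (clH (f * g)) = clH (g' * f')"
      using Fmult[OF cl_closed[OF fg(1)] cl_closed[OF fg(2)]] * fg by (simp add: cl_mult)
    then show ?thesis using * by (simp add: Fr_mult rho_mult)
  qed
  \<comment> \<open>The image of the unit is known because 1 is T_w for the trivial w. With it the
    image of every scalar follows.\<close>
  have one: "F (clH 1) = clH 1"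
    using T[OF empty_class(1)] hecke_T_cl[OF empty_class(1)] cl_free_word_rev[OF empty_class(1)]
    by (simp add: cword_def empty_class(2) free_word_Nil)
  have main: "hR (F (clH f)) = rhoa f" if "f \<in> Fr n" for f
    using that
  proof (induction rule: Fr_induct)
    case (const c)
    show ?case using smult[OF cl_closed[OF Fr_one], of c] by (simp add: one cl_smult Fr_one Fr_const)
  next
    case (gen i)
    note w = gen_class[OF gen]
    have "F (clH (free_word [i])) = clH (free_word [i])"
      using T[OF w(1)] cl_free_word_rev[OF w(1)] hecke_T_cl[OF w(1)] by (simp add: w(2) cword_def)
    then show ?case using Fr_gen[OF gen] by simp
  qed (simp_all add: add mult rhoa_add rhoa_mult)
  have eq: "F (clH f) = clH (antiF f)" if "f \<in> Fr n" for f
    using that by (intro hR_inject Fc) (auto simp: cl_closed Fr_antiF rho_antiF main)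
  show "F = desc antiF"
  proof (rule extensionalityI)
    show "F \<in> extensional (carrier H)" using F by (simp add: PiE_def)
    show "desc antiF \<in> extensional (carrier H)" by (simp add: desc_def)
    fix h assume "h \<in> carrier H"
    then show "F h = desc antiF h" unfolding hecke_carrier using eq desc_anti by auto
  qed
qed

text \<open>Independence makes the family of coefficients unique, so the description returns the one
  found by spanning. Its entry at the identity is \<tau> because the other basis elements have
  \<tau> equal to 0.\<close>

lemma hecke_tau_eq: assumes f: "f \<in> Fr n" shows "hecke_tau m n (clH f) = tau (rho f)"
proof -
  have finsum: "(\<Oplus>\<^bsub>H\<^esub>w\<in>W. hecke_smult m n (c w) (inv\<^bsub>H\<^esub> (hecke_T m n w))) = clH (comb c)" for c
  proof -
    interpret ring H by (rule hecke_ring)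
    have F: "sfree (cword w) \<in> Fr n" if "w \<in> W" for w using Fr_sfree[OF cword(2)[OF that]] .
    have "(\<Oplus>\<^bsub>H\<^esub>w\<in>W. hecke_smult m n (c w) (inv\<^bsub>H\<^esub> (hecke_T m n w))) =
        (\<Oplus>\<^bsub>H\<^esub>w\<in>W. clH (free_const (c w) * sfree (cword w)))"
      by (rule finsum_cong') (auto simp: inv_T_cl cl_smult F intro!: cl_closed Fr_mult Fr_const F)
    also have "\<dots> = clH (comb c)"
      unfolding comb_def by (rule cl_sum[OF fin]) (intro Fr_mult Fr_const F)
    finally show ?thesis .
  qed
  obtain c where c: "he f (comb c)" using spanned_all[OF f] by (auto simp: spanned_def)
  define d where "d = restrict c W"
  have comb_d: "comb d = comb c" by (simp add: comb_def d_def)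
  have "(THE c. c \<in> extensional W \<and> clH f = clH (comb c)) = d"
  proof (rule the_equality)
    show "d \<in> extensional W \<and> clH f = clH (comb d)"
      using c cl_eq_iff[OF f comb_Fr] unfolding comb_d by (simp add: d_def)
    fix c' assume c': "c' \<in> extensional W \<and> clH f = clH (comb c')"
    then have "rho (comb c') = rho (comb c)"
      using c clH_eq_iff[OF f comb_Fr] he_iff[OF f comb_Fr] by simp
    then have "(\<Sum>w\<in>W. scl (c' w - c w) * sword (cword w)) = 0"
      by (simp add: rho_comb scl_diff left_diff_distrib sum_subtractf)
    then have "c' w = d w" if "w \<in> W" for w
      using sword_independent[OF fin order.refl _ that, of "\<lambda>w. c' w - c w"] that by (simp add: d_def)
    then show "c' = d" using c' by (intro extensionalityI[of c' W d]) (auto simp: d_def)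
  qed
  then have "hecke_tau m n (clH f) = d (coxeter_one m n)" by (simp add: hecke_tau_def finsum)
  also have "\<dots> = (\<Sum>w\<in>W. if w = coxeter_one m n then c w else 0)"
    using fin empty_class(1) by (simp add: d_def)
  also have "\<dots> = (\<Sum>w\<in>W. c w * tau (sword (cword w)))"
  proof (rule sum.cong[OF HOL.refl])
    fix w assume w: "w \<in> W"
    have "cword w \<asymp> [] \<longleftrightarrow> w = coxeter_one m n"
    proof
      assume "cword w \<asymp> []"
      then have "reduced_word w \<asymp> reduced_word (coxeter_one m n)"
        using ceq_rev_iff[of "reduced_word w" "[]"] by (simp add: cword_def empty_class(2))
      then show "w = coxeter_one m n" by (rule reduced_word_inj[OF w empty_class(1)])
    qed (simp add: cword_def empty_class(2) ceq_refl)
    then show "(if w = coxeter_one m n then c w else 0) = c w * tau (sword (cword w))"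
      using tau_sword[OF cword(1)[OF w]] by simp
  qed
  also have "\<dots> = tau (rho (comb c))"
    by (simp add: rho_comb tau_sum tau_scl)
  also have "\<dots> = tau (rho f)" using c he_iff[OF f comb_Fr] by simp
  finally show ?thesis .
qed

lemma pairing_eq:
  assumes "f \<in> Fr n" "g \<in> Fr n"
  shows "pairing m n (clH f) (clH g) = tau (theta f * rho g)"
  using assms
  by (simp add: pairing_def hecke_bar_eq hecke_anti_eq desc_bar desc_anti Fr_barF Fr_antiF cl_mult
      hecke_tau_eq Fr_mult rho_mult rho_antiF rhoa_barF)

end

section \<open>Types B and D\<close>

lemma foldr_ceq:
  assumes "\<And>i z. \<pi> i (\<pi> i z) = z"
    and "\<And>i j z. i \<noteq> j \<Longrightarrow> foldr \<pi> (alt_word i j (m i j)) z = foldr \<pi> (alt_word j i (m i j)) z"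
    and "ceq m x y"
  shows "foldr \<pi> x z = foldr \<pi> y z"
  using assms(3)
proof (induction arbitrary: z rule: ceq.induct)
  case (ceq_square p i q) show ?case by (simp add: assms(1))
next
  case (ceq_braid i j p q)
  show ?case using assms(2)[OF ceq_braid, of "foldr \<pi> q z"] by simp
qed auto

lemma foldr_displacement:
  fixes pos :: "int \<Rightarrow> int"
  assumes "\<And>i z. \<bar>pos (\<pi> i z) - pos z\<bar> \<le> 1"
  shows "\<bar>pos (foldr \<pi> x z) - pos z\<bar> \<le> int (length x)"
proof (induction x)
  case (Cons i x)
  then show ?case using assms[of i "foldr \<pi> x z"] by simp
qed simp

text \<open>A lower bound for the length: each letter changes the height \<open>pos\<close> of a
  point by at most one, so a word that changes a height by its own length cannot be
  shortened.\<close>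

lemma red_displacement:
  fixes pos :: "int \<Rightarrow> int"
  assumes "\<And>x y z. ceq m x y \<Longrightarrow> foldr \<pi> x z = foldr \<pi> y z"
    and "\<And>i z. \<bar>pos (\<pi> i z) - pos z\<bar> \<le> 1"
    and "\<bar>pos (foldr \<pi> x z) - pos z\<bar> = int (length x)"
  shows "red m x"
  unfolding red_def
proof (intro allI impI)
  fix y assume "ceq m x y"
  then have e: "foldr \<pi> y z = foldr \<pi> x z" by (rule assms(1)[symmetric])
  have "\<bar>pos (foldr \<pi> y z) - pos z\<bar> \<le> int (length y)" using assms(2) by (rule foldr_displacement)
  then show "length x \<le> length y" unfolding e assms(3) by simp
qed

text \<open>Words act on the integers by signed permutations, the last letter first.\<close>

definition swp :: "int \<Rightarrow> int \<Rightarrow> int" where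
  "swp a z = (if z = a then a + 1 else if z = a + 1 then a
    else if z = - a then - (a + 1) else if z = - (a + 1) then - a else z)"

definition piB :: "nat \<Rightarrow> int \<Rightarrow> int" where
  "piB i z = (if i = 0 then (if \<bar>z\<bar> = 1 then - z else z) else swp (int i) z)"

definition piD :: "nat \<Rightarrow> int \<Rightarrow> int" where
  "piD i z = (if i = 0 then (if z = 1 then - 2 else if z = 2 then - 1 else if z = - 1 then 2
    else if z = - 2 then 1 else z) else swp (int i) z)"

definition swD :: "nat \<Rightarrow> nat" where
  "swD i = (if i = 0 then 1 else if i = 1 then 0 else i)"

lemma alt_word_numerals:
  "alt_word i j 2 = [i, j]" "alt_word i j 3 = [i, j, i]" "alt_word i j 4 = [i, j, i, j]"
  "alt_word i j 6 = [i, j, i, j, i, j]"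
  by (simp_all add: eval_nat_numeral)

lemma swp_swp: "1 \<le> a \<Longrightarrow> swp a (swp a z) = z"
  by (auto simp: swp_def)

definition swp_set :: "int \<Rightarrow> int set" where
  "swp_set a = {z. \<bar>z\<bar> = a \<or> \<bar>z\<bar> = a + 1}"

lemma swp_out: "1 \<le> a \<Longrightarrow> z \<notin> swp_set a \<Longrightarrow> swp a z = z"
  unfolding swp_set_def swp_def by auto

lemma swp_in: "1 \<le> a \<Longrightarrow> z \<in> swp_set a \<Longrightarrow> swp a z \<in> swp_set a"
  unfolding swp_set_def swp_def by auto

lemma commute_disjoint:
  assumes "\<And>z. z \<notin> X \<Longrightarrow> f z = z" "\<And>z. z \<in> X \<Longrightarrow> f z \<in> X"
    and "\<And>z. z \<notin> Y \<Longrightarrow> g z = z" "\<And>z. z \<in> Y \<Longrightarrow> g z \<in> Y" and "X \<inter> Y = {}"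
  shows "f (g z) = g (f z)"
proof -
  consider "z \<in> X" "z \<notin> Y" | "z \<in> Y" "z \<notin> X" | "z \<notin> X" "z \<notin> Y" using assms(5) by blast
  then show ?thesis
  proof cases
    case 1
    then have "f z \<notin> Y" using assms(2)[of z] assms(5) by blast
    then show ?thesis using assms(3)[of z] assms(3)[of "f z"] 1 by simp
  next
    case 2
    then have "g z \<notin> X" using assms(4)[of z] assms(5) by blast
    then show ?thesis using assms(1)[of z] assms(1)[of "g z"] 2 by simp
  next
    case 3
    then show ?thesis using assms(1,3)[of z] by simp
  qed
qed

lemma swp_far: "1 \<le> a \<Longrightarrow> a + 2 \<le> b \<Longrightarrow> swp a (swp b z) = swp b (swp a z)"
  by (rule commute_disjoint[of "swp_set a" "swp a" "swp_set b" "swp b"])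
    (auto simp: swp_out swp_in, auto simp: swp_set_def)

lemma swp_neg: "1 \<le> a \<Longrightarrow> swp a (- z) = - swp a z"
  by (auto simp: swp_def)

lemma swp_pos: "1 \<le> a \<Longrightarrow> 0 \<le> z \<Longrightarrow> swp a z = Transposition.transpose a (a + 1) z \<and> 0 \<le> swp a z"
  by (auto simp: swp_def Transposition.transpose_def)

text \<open>For z \<ge> 0 this is the braid relation of transpositions, and negative z follow
  because \<open>swp\<close> is an odd function.\<close>

lemma swp_braid:
  assumes a: "1 \<le> a" shows "swp a (swp (a + 1) (swp a z)) = swp (a + 1) (swp a (swp (a + 1) z))"
proof -
  have b: "1 \<le> a + 1" using a by simp
  have pos: "swp a (swp (a + 1) (swp a z)) = swp (a + 1) (swp a (swp (a + 1) z))" if z: "0 \<le> z" for z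
  proof -
    note A = swp_pos[OF a] and B = swp_pos[OF b]
    have "swp a (swp (a + 1) (swp a z)) = Transposition.transpose a (a + 1)
        (Transposition.transpose (a + 1) (2 + a) (Transposition.transpose a (a + 1) z))"
      using A[OF z] B[of "swp a z"] A[of "swp (a + 1) (swp a z)"] by simp
    moreover have "swp (a + 1) (swp a (swp (a + 1) z)) = Transposition.transpose (a + 1) (2 + a)
        (Transposition.transpose a (a + 1) (Transposition.transpose (a + 1) (2 + a) z))"
      using B[OF z] A[of "swp (a + 1) z"] B[of "swp a (swp (a + 1) z)"] by simp
    ultimately show ?thesis by (simp add: Transposition.transpose_def)
  qed
  show ?thesis
  proof (cases "0 \<le> z")
    case False
    then show ?thesis using pos[of "- z"] by (simp add: swp_neg[OF a] swp_neg[OF b])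
  qed (rule pos)
qed

lemma coxeter_B_sym: "coxeter_B i j = coxeter_B j i"
  by (auto simp: coxeter_B_def insert_commute)

lemma coxeter_D_sym: "coxeter_D i j = coxeter_D j i"
  by (auto simp: coxeter_D_def insert_commute)

lemma coxeter_B_values:
  "coxeter_B 0 (Suc 0) = 4" "1 \<le> i \<Longrightarrow> coxeter_B i (Suc i) = 3" "i + 2 \<le> j \<Longrightarrow> coxeter_B i j = 2"
  by (auto simp: coxeter_B_def doubleton_eq_iff)

lemma coxeter_D_values:
  "coxeter_D 0 (Suc 0) = 2" "coxeter_D 0 2 = 3" "1 \<le> i \<Longrightarrow> coxeter_D i (Suc i) = 3"
  "1 \<le> i \<Longrightarrow> i + 2 \<le> j \<Longrightarrow> coxeter_D i j = 2" "3 \<le> j \<Longrightarrow> coxeter_D 0 j = 2"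
  by (auto simp: coxeter_D_def doubleton_eq_iff)

lemma letter_pair_cases:
  fixes i j :: nat
  assumes "i < j"
  obtains "i = 0" "j = 1" | "i = 0" "j = 2" | "i = 0" "3 \<le> j" | "1 \<le> i" "j = Suc i" | "1 \<le> i" "i + 2 \<le> j"
proof -
  have "(i = 0 \<and> j = 1) \<or> (i = 0 \<and> j = 2) \<or> (i = 0 \<and> 3 \<le> j) \<or> (1 \<le> i \<and> j = Suc i) \<or> (1 \<le> i \<and> i + 2 \<le> j)"
    using assms by arith
  then show ?thesis using that by blast
qed

lemma piB_zero_far: "2 \<le> j \<Longrightarrow> piB 0 (swp (int j) z) = swp (int j) (piB 0 z)"
  by (rule commute_disjoint[of "{z. \<bar>z\<bar> = 1}" "piB 0" "swp_set (int j)" "swp (int j)"])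
    (auto simp: swp_out swp_in piB_def, auto simp: swp_set_def)

lemma piD_zero_far: "3 \<le> j \<Longrightarrow> piD 0 (swp (int j) z) = swp (int j) (piD 0 z)"
  by (rule commute_disjoint[of "{z. \<bar>z\<bar> = 1 \<or> \<bar>z\<bar> = 2}" "piD 0" "swp_set (int j)" "swp (int j)"])
    (auto simp: swp_out swp_in piD_def, auto simp: swp_set_def)

lemma pi_positive: "1 \<le> i \<Longrightarrow> piB i z = swp (int i) z" "1 \<le> i \<Longrightarrow> piD i z = swp (int i) z"
  by (simp_all add: piB_def piD_def)

lemma piB_table: "piB 0 1 = - 1" "piB 0 (- 1) = 1" "piB 0 2 = 2" "piB 0 (- 2) = - 2"
  "piB (Suc 0) 1 = 2" "piB (Suc 0) 2 = 1" "piB (Suc 0) (- 1) = - 2" "piB (Suc 0) (- 2) = - 1"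
  "z \<notin> {1, - 1, 2, - 2} \<Longrightarrow> piB 0 z = z" "z \<notin> {1, - 1, 2, - 2} \<Longrightarrow> piB (Suc 0) z = z"
  by (auto simp add: piB_def swp_def)

lemma piD_table: "piD 0 1 = - 2" "piD 0 (- 1) = 2" "piD 0 2 = - 1" "piD 0 (- 2) = 1"
  "piD 0 3 = 3" "piD 0 (- 3) = - 3"
  "piD (Suc 0) 1 = 2" "piD (Suc 0) 2 = 1" "piD (Suc 0) (- 1) = - 2" "piD (Suc 0) (- 2) = - 1"
  "piD (Suc 0) 3 = 3" "piD (Suc 0) (- 3) = - 3"
  "piD 2 1 = 1" "piD 2 (- 1) = - 1" "piD 2 2 = 3" "piD 2 (- 2) = - 3" "piD 2 3 = 2" "piD 2 (- 3) = - 2"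
  by (simp_all add: piD_def swp_def)

lemma piD_table_out:
  assumes "z \<notin> {1, - 1, 2, - 2, 3, - 3}"
  shows "piD 0 z = z" "piD (Suc 0) z = z" "piD 2 z = z"
  using assms by (auto simp: piD_def swp_def)

lemma piB_piB: "piB i (piB i z) = z"
  using swp_swp[of "int i" z] by (cases "i = 0") (simp_all add: piB_def)

lemma piD_piD: "piD i (piD i z) = z"
proof (cases "i = 0")
  case True
  consider "z = 1" | "z = - 1" | "z = 2" | "z = - 2" | "z = 3" | "z = - 3"
    | "z \<notin> {1, - 1, 2, - 2, 3, - 3}" by blast
  then have "piD 0 (piD 0 z) = z"
  proof cases
    case 7 show ?thesis by (simp only: piD_table_out[OF 7])
  qed (simp_all only: piD_table)
  with True show ?thesis by simp
qed (use swp_swp[of "int i" z] in \<open>simp add: piD_def\<close>)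

lemma piB_braid_less:
  assumes "i < j"
  shows "foldr piB (alt_word i j (coxeter_B i j)) z = foldr piB (alt_word j i (coxeter_B i j)) z"
  using assms
proof (cases rule: letter_pair_cases)
  case 1
  have "foldr piB (alt_word 0 (Suc 0) 4) z = foldr piB (alt_word (Suc 0) 0 4) z"
  proof -
    consider "z = 1" | "z = - 1" | "z = 2" | "z = - 2" | "z \<notin> {1, - 1, 2, - 2}" by blast
    then show ?thesis
    proof cases
      case 5
      show ?thesis by (simp only: piB_table(9,10)[OF 5] alt_word_numerals foldr.simps o_apply id_apply)
    qed (simp_all only: piB_table alt_word_numerals foldr.simps o_apply id_apply)
  qed
  then show ?thesis using 1 by (simp add: coxeter_B_values)
next
  case 2
  then show ?thesis using piB_zero_far[of 2 z] by (simp add: coxeter_B_values alt_word_numerals pi_positive)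
next
  case 3
  then show ?thesis using piB_zero_far[of j z] by (simp add: coxeter_B_values alt_word_numerals pi_positive)
next
  case 4
  then show ?thesis using swp_braid[of "int i" z]
    by (simp add: coxeter_B_values alt_word_numerals pi_positive add.commute)
next
  case 5
  then show ?thesis using swp_far[of "int i" "int j" z]
    by (simp add: coxeter_B_values alt_word_numerals pi_positive)
qed

lemma piD_braid_less:
  assumes "i < j"
  shows "foldr piD (alt_word i j (coxeter_D i j)) z = foldr piD (alt_word j i (coxeter_D i j)) z"
  using assms
proof (cases rule: letter_pair_cases)
  case 1
  have "foldr piD (alt_word 0 (Suc 0) 2) z = foldr piD (alt_word (Suc 0) 0 2) z"
  proof -
    consider "z = 1" | "z = - 1" | "z = 2" | "z = - 2" | "z = 3" | "z = - 3"
      | "z \<notin> {1, - 1, 2, - 2, 3, - 3}" by blast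
    then show ?thesis
    proof cases
      case 7
      show ?thesis by (simp only: piD_table_out[OF 7] alt_word_numerals foldr.simps o_apply id_apply)
    qed (simp_all only: piD_table alt_word_numerals foldr.simps o_apply id_apply)
  qed
  then show ?thesis using 1 by (simp add: coxeter_D_values)
next
  case 2
  have "foldr piD (alt_word 0 2 3) z = foldr piD (alt_word 2 0 3) z"
  proof -
    consider "z = 1" | "z = - 1" | "z = 2" | "z = - 2" | "z = 3" | "z = - 3"
      | "z \<notin> {1, - 1, 2, - 2, 3, - 3}" by blast
    then show ?thesis
    proof cases
      case 7
      show ?thesis by (simp only: piD_table_out[OF 7] alt_word_numerals foldr.simps o_apply id_apply)
    qed (simp_all only: piD_table alt_word_numerals foldr.simps o_apply id_apply)
  qed
  then show ?thesis using 2 by (simp add: coxeter_D_values)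
next
  case 3
  then show ?thesis using piD_zero_far[of j z] by (simp add: coxeter_D_values alt_word_numerals pi_positive)
next
  case 4
  then show ?thesis using swp_braid[of "int i" z]
    by (simp add: coxeter_D_values alt_word_numerals pi_positive add.commute)
next
  case 5
  then show ?thesis using swp_far[of "int i" "int j" z]
    by (simp add: coxeter_D_values alt_word_numerals pi_positive)
qed

lemma piB_ceq: "ceq coxeter_B x y \<Longrightarrow> foldr piB x z = foldr piB y z"
proof (rule foldr_ceq)
  fix i j :: nat and z assume "i \<noteq> j"
  then show "foldr piB (alt_word i j (coxeter_B i j)) z = foldr piB (alt_word j i (coxeter_B i j)) z"
    using piB_braid_less[of i j z] piB_braid_less[of j i z] coxeter_B_sym[of i j] by (cases "i < j") auto
qed (simp_all add: piB_piB)

lemma piD_ceq: "ceq coxeter_D x y \<Longrightarrow> foldr piD x z = foldr piD y z"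
proof (rule foldr_ceq)
  fix i j :: nat and z assume "i \<noteq> j"
  then show "foldr piD (alt_word i j (coxeter_D i j)) z = foldr piD (alt_word j i (coxeter_D i j)) z"
    using piD_braid_less[of i j z] piD_braid_less[of j i z] coxeter_D_sym[of i j] by (cases "i < j") auto
qed (simp_all add: piD_piD)

lemma order_values: "0 < l \<Longrightarrow> l < 2 \<Longrightarrow> l = (1::nat)" "0 < l \<Longrightarrow> l < 3 \<Longrightarrow> l = 1 \<or> l = (2::nat)"
  "0 < l \<Longrightarrow> l < 4 \<Longrightarrow> l = 1 \<or> l = 2 \<or> l = (3::nat)"
  by arith+

lemma swp_values: "1 \<le> a \<Longrightarrow> swp a a = a + 1" "1 \<le> a \<Longrightarrow> swp a (a + 1) = a"
  "1 \<le> a \<Longrightarrow> swp (a + 1) a = a" "1 \<le> a \<Longrightarrow> a + 2 \<le> b \<Longrightarrow> swp a b = b"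
  by (simp_all add: swp_def)

lemma swp_order:
  assumes "1 \<le> a"
  shows "swp a (swp (a + 1) (a + 1 + 1)) = a"
    "swp a (swp (a + 1) (swp a (swp (a + 1) (a + 1 + 1)))) = a + 1"
  using assms swp_values(2)[of "a + 1"] by (simp_all add: swp_values)

text \<open>A nontrivial signed permutation is recognised by a point that it moves, and j + 1 serves
  in all cases.\<close>

lemma piB_order:
  assumes "i < j" "0 < l" "l < coxeter_B i j"
  shows "\<not> ceq coxeter_B (alt_word i j (2 * l)) []"
proof -
  have "foldr piB (alt_word i j (2 * l)) (int j + 1) \<noteq> int j + 1"
    using assms(1)
  proof (cases rule: letter_pair_cases)
    case 1
    then have "l = 1 \<or> l = 2 \<or> l = 3" using order_values(3)[OF assms(2)] assms(3) by (simp add: coxeter_B_values)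
    then show ?thesis using 1 by (auto simp: alt_word_numerals piB_table)
  next
    case 2
    then have "l = 1" using order_values(1)[OF assms(2)] assms(3) by (simp add: coxeter_B_values)
    then show ?thesis using 2 swp_values(2)[of 2] by (simp add: alt_word_numerals pi_positive piB_table)
  next
    case 3
    then have "l = 1" using order_values(1)[OF assms(2)] assms(3) by (simp add: coxeter_B_values)
    then show ?thesis using 3 by (simp add: alt_word_numerals pi_positive swp_values piB_def)
  next
    case 4
    then have "l = 1 \<or> l = 2" using order_values(2)[OF assms(2)] assms(3) by (simp add: coxeter_B_values)
    then show ?thesis using 4 swp_order[of "int i"] by (auto simp: alt_word_numerals pi_positive add_ac)
  next
    case 5
    then have "l = 1" using order_values(1)[OF assms(2)] assms(3) by (simp add: coxeter_B_values)
    then show ?thesis using 5 by (simp add: alt_word_numerals pi_positive swp_values)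
  qed
  then show ?thesis using piB_ceq by fastforce
qed

lemma piD_order:
  assumes "i < j" "0 < l" "l < coxeter_D i j"
  shows "\<not> ceq coxeter_D (alt_word i j (2 * l)) []"
proof -
  have "foldr piD (alt_word i j (2 * l)) (int j + 1) \<noteq> int j + 1"
    using assms(1)
  proof (cases rule: letter_pair_cases)
    case 1
    then have "l = 1" using order_values(1)[OF assms(2)] assms(3) by (simp add: coxeter_D_values)
    then show ?thesis using 1 by (auto simp: alt_word_numerals piD_table)
  next
    case 2
    then have "l = 1 \<or> l = 2" using order_values(2)[OF assms(2)] assms(3) by (simp add: coxeter_D_values)
    then show ?thesis using 2 by (auto simp: alt_word_numerals piD_table)
  next
    case 3
    then have "l = 1" using order_values(1)[OF assms(2)] assms(3) by (simp add: coxeter_D_values)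
    then show ?thesis using 3 by (simp add: alt_word_numerals pi_positive swp_values piD_def)
  next
    case 4
    then have "l = 1 \<or> l = 2" using order_values(2)[OF assms(2)] assms(3) by (simp add: coxeter_D_values)
    then show ?thesis using 4 swp_order[of "int i"] by (auto simp: alt_word_numerals pi_positive add_ac)
  next
    case 5
    then have "l = 1" using order_values(1)[OF assms(2)] assms(3) by (simp add: coxeter_D_values)
    then show ?thesis using 5 by (simp add: alt_word_numerals pi_positive swp_values)
  qed
  then show ?thesis using piD_ceq by fastforce
qed

lemma alt_word_swap_ceq: "ceq m (alt_word j i (2 * l)) [] \<Longrightarrow> ceq m (alt_word i j (2 * l)) []"
  using ceq_move_left[of m "alt_word j i (2 * l)" "[]" "[]"] rev_alt_word[of j i "2 * l"] ceq_sym by simp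

lemma coxeterI:
  assumes "\<And>i j. m i j = m j i" "\<And>i j. i \<noteq> j \<Longrightarrow> 2 \<le> m i j"
    and "\<And>i j l. i < j \<Longrightarrow> 0 < l \<Longrightarrow> l < m i j \<Longrightarrow> \<not> ceq m (alt_word i j (2 * l)) []"
  shows "coxeter m"
proof
  fix i j l :: nat assume "i \<noteq> j" "0 < l" "l < m i j"
  then show "\<not> ceq m (alt_word i j (2 * l)) []"
    using assms(1)[of i j] assms(3)[of i j l] assms(3)[of j i l] alt_word_swap_ceq[of m i j l]
    by (cases "i < j") auto
qed (use assms in blast)+

interpretation B: coxeter_aut coxeter_B id
proof -
  interpret coxeter coxeter_B
    by (rule coxeterI[OF coxeter_B_sym _ piB_order]) (auto simp: coxeter_B_def)
  show "coxeter_aut coxeter_B id" by unfold_locales simp_all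
qed

lemma swD_values: "swD 0 = 1" "swD (Suc 0) = 0" "2 \<le> i \<Longrightarrow> swD i = i"
  by (auto simp: swD_def)

lemma coxeter_D_swD_less:
  assumes "i < j" shows "coxeter_D (swD i) (swD j) = coxeter_D i j"
  using assms
proof (cases rule: letter_pair_cases)
  case 1
  then show ?thesis using coxeter_D_sym[of 0 "Suc 0"] by (simp add: swD_values)
next
  case 2
  then show ?thesis using coxeter_D_values(2) coxeter_D_values(3)[of 1]
    by (simp add: swD_values numeral_2_eq_2)
next
  case 3
  then show ?thesis by (simp add: swD_values coxeter_D_values)
next
  case 4
  show ?thesis
  proof (cases "i = 1")
    case True
    then show ?thesis using 4 coxeter_D_values(2) coxeter_D_values(3)[of 1]
      by (simp add: swD_values numeral_2_eq_2)
  qed (use 4 in \<open>simp add: swD_values\<close>)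
next
  case 5
  show ?thesis
  proof (cases "i = 1")
    case True
    then show ?thesis using 5 by (simp add: swD_values coxeter_D_values)
  qed (use 5 in \<open>simp add: swD_values\<close>)
qed

lemma coxeter_D_swD: "coxeter_D (swD i) (swD j) = coxeter_D i j"
proof (cases i j rule: linorder_cases)
  case less then show ?thesis by (rule coxeter_D_swD_less)
next
  case equal then show ?thesis by (simp add: coxeter_D_def)
next
  case greater
  then show ?thesis using coxeter_D_swD_less[of j i] coxeter_D_sym by metis
qed

interpretation D: coxeter_aut coxeter_D swD
proof -
  interpret coxeter coxeter_D
    by (rule coxeterI[OF coxeter_D_sym _ piD_order]) (auto simp: coxeter_D_def)
  show "coxeter_aut coxeter_D swD" by unfold_locales (simp_all add: coxeter_D_swD, simp add: swD_def)
qed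

context coxeter_aut
begin

lemma T_braid2: "m i j = 2 \<Longrightarrow> T i * T j = T j * T i"
  and T_braid3: "m i j = 3 \<Longrightarrow> T i * T j * T i = T j * T i * T j"
  and T_braid4: "m i j = 4 \<Longrightarrow> T i * T j * T i * T j = T j * T i * T j * T i"
  using T_braid[of i j] by (simp_all add: alt_word_numerals mult.assoc)

lemma S_T: "S * T i = T (sw i) * S"
  by (simp add: T_def distrib_left distrib_right S_L scl_comm)

lemma com_T: "com (T i)"
  unfolding T_def by (intro com_add com_L com_scl)

lemma supported_add: "supported Z (app x f) \<Longrightarrow> supported Z (app y f) \<Longrightarrow> supported Z (app (x + y) f)"
  unfolding supported_def
proof (intro allI impI)
  fix b w
  assume "\<forall>b w. app x f b (N w) \<noteq> 0 \<longrightarrow> Z w" "\<forall>b w. app y f b (N w) \<noteq> 0 \<longrightarrow> Z w"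
    and "app (x + y) f b (N w) \<noteq> 0"
  then show "Z w" by (cases "app x f b (N w) = 0") auto
qed

lemma supported_scl: "supported Z f \<Longrightarrow> supported Z (app (scl c) f)"
  unfolding supported_def by auto

lemma supported_T:
  assumes "supported Z f" "\<And>w. Z (i # w) \<Longrightarrow> Z w"
  shows "supported Z (app (T i) f)"
  unfolding T_def by (rule supported_add[OF supported_L[OF assms] supported_scl[OF assms(1)]])

end

locale endo_tower = coxeter_aut m sw + tower t s scl \<beta>
  for m sw and t s :: "nat \<Rightarrow> endo" and \<beta> +
  assumes t_cases: "t i = T i \<or> t i = S"
begin

lemma com_t: "com (t i)"
  using t_cases[of i] com_T com_S by auto

lemma tau_t: "com x \<Longrightarrow> tau (x * t i) = tau (t i * x)"
  using t_cases[of i] tau_S_comm tau_L_comm scl_comm[of x alpha]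
  by (auto simp: T_def distrib_left distrib_right tau_add)

lemma com_A: "x \<in> A n \<Longrightarrow> com x"
  by (induction rule: A.induct) (auto intro: com_scl com_t com_add com_mult)

lemma tau_A_comm: "x \<in> A n \<Longrightarrow> com y \<Longrightarrow> tau (x * y) = tau (y * x)"
proof (induction arbitrary: y rule: A.induct)
  case (A_C c) show ?case by (simp add: scl_comm)
next
  case (A_t i) then show ?case by (simp add: tau_t)
next
  case (A_add x1 x2) then show ?case by (simp add: distrib_left distrib_right tau_add)
next
  case (A_mult x1 x2)
  have "tau (x1 * (x2 * y)) = tau (x2 * y * x1)"
    using A_mult com_A[of x2] by (intro A_mult.IH(1) com_mult) auto
  also have "\<dots> = tau (x2 * (y * x1))" by (simp add: mult.assoc)
  also have "\<dots> = tau (y * x1 * x2)"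
    using A_mult com_A[of x1] by (intro A_mult.IH(2) com_mult) auto
  finally show ?case by (simp add: mult.assoc)
qed

lemma supported_A:
  assumes "x \<in> A n" "supported Z f"
    and inv: "\<And>i. i < n \<Longrightarrow> t i = T i \<and> (\<forall>w. Z (i # w) \<longrightarrow> Z w) \<or> t i = S \<and> (\<forall>w. Z (map sw w) \<longrightarrow> Z w)"
  shows "supported Z (app x f)"
  using assms(1,2)
proof (induction arbitrary: f rule: A.induct)
  case (A_C c) then show ?case by (intro supported_scl)
next
  case (A_t i)
  from inv[OF A_t(1)] show ?case
  proof (elim disjE conjE)
    assume "t i = T i" and Z: "\<forall>w. Z (i # w) \<longrightarrow> Z w"
    then show ?thesis using supported_T[OF A_t(2), of i] by simp
  next
    assume "t i = S" and Z: "\<forall>w. Z (map sw w) \<longrightarrow> Z w"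
    then show ?thesis using supported_S[OF A_t(2)] by simp
  qed
qed (auto intro: supported_add)

text \<open>The vector y applied to the identity is concentrated at u. Multiplication by
  \<open>A k\<close> keeps it inside Z, so the coefficient at the identity is 0.\<close>

lemma tau_vanish:
  assumes "x \<in> A k" "app y (delta False []) = delta c u"
    and "\<And>v w. v \<asymp> w \<Longrightarrow> Z v \<Longrightarrow> Z w" "Z u" "\<not> Z []"
    and "\<And>i. i < k \<Longrightarrow> t i = T i \<and> (\<forall>w. Z (i # w) \<longrightarrow> Z w) \<or> t i = S \<and> (\<forall>w. Z (map sw w) \<longrightarrow> Z w)"
  shows "tau (x * y) = 0"
proof (rule tau_not_supported[where Z = Z, OF assms(2) _ assms(5)])
  have "supported Z (delta c u)" using assms(3,4) by (rule supported_delta)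
  then show "supported Z (app x (delta c u))" using assms(6) by (rule supported_A[OF assms(1)])
qed

lemma span_mult:
  assumes "x \<in> endo_vs.span X" "y \<in> endo_vs.span Y"
  shows "x * z * y \<in> endo_vs.span {b * z * c | b c. b \<in> X \<and> c \<in> Y}" (is "_ \<in> endo_vs.span ?Z")
proof -
  have 1: "b * z * y \<in> endo_vs.span ?Z" if b: "b \<in> X" for b
    using assms(2)
  proof (induction rule: endo_vs.span_induct_alt)
    case base show ?case by (simp add: endo_vs.span_zero)
  next
    case (step c u v)
    have "b * z * (scl c * u + v) = scl c * (b * z * u) + b * z * v"
      using scl_comm[of "b * z" c] by (simp add: distrib_left flip: mult.assoc)
    moreover have "b * z * u \<in> endo_vs.span ?Z" using b step(1) by (intro endo_vs.span_base) blast
    ultimately show ?case using step by (simp add: endo_vs.span_add endo_vs.span_scale)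
  qed
  show ?thesis
    using assms(1)
  proof (induction rule: endo_vs.span_induct_alt)
    case base show ?case by (simp add: endo_vs.span_zero)
  next
    case (step c u v)
    have "(scl c * u + v) * z * y = scl c * (u * z * y) + v * z * y"
      by (simp add: distrib_right mult.assoc)
    then show ?case using step 1 by (simp add: endo_vs.span_add endo_vs.span_scale)
  qed
qed

text \<open>By \<open>decompose\<close>, rank k + 1 is spanned by products of two elements of rank k
  with 1, t_k or j_k in between. Minimality of the spanning set does not matter here.\<close>

lemma finite_dim: "\<exists>X. finite X \<and> A n \<subseteq> endo_vs.span X"
proof (induction n)
  case 0
  have "A 0 \<subseteq> endo_vs.span {1}"
  proof
    fix x assume "x \<in> A 0"
    then obtain c where "x = scl c * 1" using A_0 by auto
    then show "x \<in> endo_vs.span {1}" by (metis endo_vs.span_base endo_vs.span_scale singletonI)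
  qed
  then show ?case by blast
next
  case (Suc k)
  then obtain X where X: "finite X" "A k \<subseteq> endo_vs.span X" by blast
  let ?P = "\<lambda>z. {b * z * c | b c. b \<in> X \<and> c \<in> X}"
  let ?Y = "?P 1 \<union> ?P (t k) \<union> ?P (jj k)"
  have P: "finite (?P z)" for z
  proof -
    have "?P z = (\<lambda>(b, c). b * z * c) ` (X \<times> X)" by auto
    then show ?thesis using X(1) by simp
  qed
  have m: "x * z * y \<in> endo_vs.span ?Y" if "x \<in> A k" "y \<in> A k" "z \<in> {1, t k, jj k}" for x y z
    using span_mult[of x X y X z] X(2) that endo_vs.span_mono[of "?P z" ?Y] by blast
  have main: "x \<in> endo_vs.span ?Y" if xA: "x \<in> A (Suc k)" for x
  proof -
    obtain l a where la: "l \<in> Lset k" "a \<in> A k" "x = l + a * jj k" using decompose[OF xA] by blast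
    have "l \<in> endo_vs.span ?Y" using la(1)
    proof (induction rule: Lset.induct)
      case (Lset_A x) then show ?case using m[of x 1 1] by simp
    next
      case (Lset_t x y) then show ?case using m by simp
    next
      case (Lset_add x y) then show ?case by (simp add: endo_vs.span_add)
    qed
    moreover have "a * jj k \<in> endo_vs.span ?Y" using m[of a 1 "jj k"] la(2) by simp
    ultimately show ?thesis unfolding la(3) by (rule endo_vs.span_add)
  qed
  have "finite ?Y" using P by blast
  then show ?case by (intro exI[of _ ?Y] conjI subsetI main)
qed

lemma finite_coxeter_of_sword:
  assumes "\<And>x. x \<in> lists {..<n} \<Longrightarrow> sword x \<in> A n"
  shows "finite (coxeter_group m n)"
proof -
  obtain X where "finite X" "A n \<subseteq> endo_vs.span X" using finite_dim by blast
  then show ?thesis using finite_coxeter_group[of X n] assms by blast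
qed

end

interpretation BT: endo_tower coxeter_B id B.T "Lop coxeter_B" alpha
proof unfold_locales
  show "B.T 0 * B.T 1 * B.T 0 * B.T 1 = B.T 1 * B.T 0 * B.T 1 * B.T 0"
    using B.T_braid4[of 0 1] coxeter_B_values by simp
  show "B.T i * B.T (Suc i) * B.T i = B.T (Suc i) * B.T i * B.T (Suc i)" if "1 \<le> i" for i
    using B.T_braid3[of i "Suc i"] coxeter_B_values that by simp
  show "B.T i * B.T j = B.T j * B.T i" if "i + 2 \<le> j" for i j
    using B.T_braid2[of i j] coxeter_B_values that by simp
  show "x * scl c = scl c * x" for x c by (rule scl_comm)
  show "B.T i = Lop coxeter_B i + scl alpha" if "1 \<le> i" for i by (rule B.T_def)
  show "B.T 0 = Lop coxeter_B 0 + scl alpha" by (rule B.T_def)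
qed (simp_all add: scl_add scl_mult)

definition tD :: "nat \<Rightarrow> endo" where
  "tD i = (if i = 0 then D.S else D.T i)"

definition sD :: "nat \<Rightarrow> endo" where
  "sD i = (if i = 0 then D.S else Lop coxeter_D i)"

lemma tD_simps [simp]: "tD 0 = D.S" "tD (Suc i) = D.T (Suc i)" "sD 0 = D.S" "sD (Suc i) = Lop coxeter_D (Suc i)"
  by (simp_all add: tD_def sD_def)

lemma D_T0: "D.S * D.T (Suc 0) * D.S = D.T 0"
  by (simp add: D.S_T swD_values mult.assoc D.S_S)

lemma D_L0: "D.S * Lop coxeter_D (Suc 0) * D.S = Lop coxeter_D 0"
  by (simp add: D.S_L swD_values mult.assoc D.S_S)

interpretation DT: endo_tower coxeter_D swD tD sD 0
proof unfold_locales
  \<comment> \<open>Because \<varsigma> t_1 \<varsigma> = t_{1'}, the relation of length four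
    between \<varsigma> and t_1 is the commutation of t_1 with t_{1'}.\<close>
  show "tD 0 * tD 1 * tD 0 * tD 1 = tD 1 * tD 0 * tD 1 * tD 0"
    using D.T_braid2[of 0 "Suc 0"] coxeter_D_values D_T0 by (simp add: mult.assoc)
  show "tD i * tD (Suc i) * tD i = tD (Suc i) * tD i * tD (Suc i)" if "1 \<le> i" for i
    using D.T_braid3[of i "Suc i"] coxeter_D_values that by (simp add: tD_def)
  show "tD i * tD j = tD j * tD i" if "i + 2 \<le> j" for i j
    using D.T_braid2[of i j] coxeter_D_values that D.S_T[of j] swD_values by (auto simp: tD_def)
  show "x * scl c = scl c * x" for x c by (rule scl_comm)
  show "tD i = sD i + scl alpha" if "1 \<le> i" for i
    using that by (simp add: tD_def sD_def D.T_def)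
  show "tD i * sD i = 1" "sD i * tD i = 1" for i by (simp_all add: tD_def sD_def D.S_S)
  show "tD i = D.T i \<or> tD i = D.S" for i by (simp add: tD_def)
qed (simp_all add: scl_add scl_mult)

section \<open>Reducedness of the Jucys-Murphy words\<close>

definition posB :: "int \<Rightarrow> int" where "posB z = (if 0 < z then z else z + 1)"

text \<open>The letter 0 exchanges 1 with -2 and 2 with -1, so 1 and -1 must share one height
  between those of 2 and -2. In type B, by contrast, 1 and -1 are neighbours and only the gap at 0
  is closed.\<close>

definition posD :: "int \<Rightarrow> int" where
  "posD z = (if 0 < z then z else if z \<le> - 2 then z + 2 else 1)"

lemma swp_cases:
  assumes "1 \<le> a"
  obtains "z = a" "swp a z = a + 1" | "z = a + 1" "swp a z = a" | "z = - a" "swp a z = - a - 1"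
    | "z = - a - 1" "swp a z = - a" | "swp a z = z"
proof -
  consider "z = a" | "z = a + 1" | "z = - a" | "z = - a - 1"
    | "z \<noteq> a" "z \<noteq> a + 1" "z \<noteq> - a" "z \<noteq> - a - 1" by blast
  then show thesis by cases (use assms that in \<open>simp_all add: swp_def\<close>)
qed

lemma posB_piB: "\<bar>posB (piB i z) - posB z\<bar> \<le> 1"
proof (cases "i = 0")
  case True then show ?thesis by (auto simp: piB_def posB_def)
next
  case False
  then have "1 \<le> int i" by simp
  then show ?thesis by (cases rule: swp_cases[of _ z]) (use False in \<open>auto simp: piB_def posB_def\<close>)
qed

lemma posD_piD: "\<bar>posD (piD i z) - posD z\<bar> \<le> 1"
proof (cases "i = 0")
  case True then show ?thesis by (auto simp: piD_def posD_def)
next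
  case False
  then have "1 \<le> int i" by simp
  then show ?thesis by (cases rule: swp_cases[of _ z]) (use False in \<open>auto simp: piD_def posD_def\<close>)
qed

fun uB :: "nat \<Rightarrow> nat list" where
  "uB 0 = [0]"
| "uB (Suc k) = [Suc k] @ uB k @ [Suc k]"

text \<open>The element $y_{j+2}$ of type D corresponds to the word \<open>uD j\<close>.\<close>

fun uD :: "nat \<Rightarrow> nat list" where
  "uD 0 = [1, 0]"
| "uD (Suc j) = [j + 2] @ uD j @ [j + 2]"

lemma swp_down: "1 \<le> a \<Longrightarrow> swp a (a + 1) = a" "1 \<le> a \<Longrightarrow> swp a (- a) = - (a + 1)"
  by (auto simp: swp_def)

lemma act_uB: "foldr piB (uB k) (int k + 1) = - (int k + 1) \<and> rev (uB k) = uB k \<and> length (uB k) = 2 * k + 1"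
proof (induction k)
  case 0 show ?case by (simp add: piB_def)
next
  case (Suc k)
  have "piB (Suc k) (int (Suc k) + 1) = int k + 1" "piB (Suc k) (- (int k + 1)) = - (int (Suc k) + 1)"
    using swp_down[of "int k + 1"] by (simp_all add: pi_positive add.commute)
  then show ?case using Suc by simp
qed

lemma act_uD: "foldr piD (uD j) (int j + 2) = - (int j + 2) \<and> foldr piD (rev (uD j)) (int j + 2) = - (int j + 2)
  \<and> length (uD j) = 2 * j + 2"
proof (induction j)
  case 0 show ?case by (simp add: piD_table)
next
  case (Suc k)
  have "piD (k + 2) (int (Suc k) + 2) = int k + 2" "piD (k + 2) (- (int k + 2)) = - (int (Suc k) + 2)"
    using swp_down[of "int k + 2"] by (simp_all add: pi_positive add_ac)
  then show ?case using Suc by simp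
qed

lemma red_uB: "red coxeter_B (uB k)"
  by (rule red_displacement[where \<pi> = piB and pos = posB and z = "int k + 1"])
    (use act_uB[of k] in \<open>simp_all add: piB_ceq posB_piB, simp_all add: posB_def\<close>)

lemma red_uD: "red coxeter_D (uD j)"
  by (rule red_displacement[where \<pi> = piD and pos = posD and z = "int j + 2"])
    (use act_uD[of j] in \<open>simp_all add: piD_ceq posD_piD, simp_all add: posD_def\<close>)

lemma yy_B: "BT.yy k = B.sword (uB k)"
  by (induction k) (simp_all add: mult.assoc)

lemma S_L_far: "2 \<le> i \<Longrightarrow> D.S * D.L i = D.L i * D.S"
  by (simp add: D.S_L swD_values)

lemma yy_D: "DT.yy (Suc j) = D.sword (uD j) * D.S"
proof (induction j)
  case 0
  have "D.S * D.L (Suc 0) = D.L 0 * D.S" by (simp add: D.S_L swD_values)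
  then show ?case by (simp add: mult.assoc)
next
  case (Suc j)
  have "DT.yy (Suc (Suc j)) = D.L (j + 2) * D.sword (uD j) * (D.S * D.L (j + 2))"
    using Suc by (simp add: mult.assoc)
  also have "\<dots> = D.L (j + 2) * D.sword (uD j) * (D.L (j + 2) * D.S)"
    by (subst S_L_far) simp_all
  finally show ?case by (simp add: mult.assoc)
qed

lemma piB_fix: "i < k \<Longrightarrow> piB i (int k + 1) = int k + 1"
  by (auto simp: piB_def swp_def)

lemma piD_fix: "1 \<le> i \<Longrightarrow> i < k \<Longrightarrow> piD i (int k + 1) = int k + 1"
  by (auto simp: piD_def swp_def)

text \<open>The automorphism \<varsigma> as a signed permutation: conjugation by it exchanges the
  letters 0 and 1 of type D, see \<open>piD_swD\<close>.\<close>

definition neg1 :: "int \<Rightarrow> int" where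
  "neg1 z = (if \<bar>z\<bar> = 1 then - z else z)"

lemma neg1_table: "neg1 1 = - 1" "neg1 (- 1) = 1" "neg1 2 = 2" "neg1 (- 2) = - 2" "neg1 3 = 3" "neg1 (- 3) = - 3"
  by (simp_all add: neg1_def)

lemma neg1_out: "z \<notin> {1, - 1} \<Longrightarrow> neg1 z = z"
  by (auto simp: neg1_def)

lemma neg1_neg1 [simp]: "neg1 (neg1 z) = z"
  by (simp add: neg1_def)

lemma piD_swD: "piD (swD i) z = neg1 (piD i (neg1 z))"
proof (cases "2 \<le> i")
  case True
  have "neg1 (swp (int i) (neg1 z)) = swp (int i) (neg1 (neg1 z))"
    by (rule commute_disjoint[of "{1, - 1}" neg1 "swp_set (int i)" "swp (int i)"])
      (use True in \<open>auto simp: swp_out swp_in neg1_def, auto simp: swp_set_def\<close>)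
  then show ?thesis using True by (simp add: swD_values pi_positive)
next
  case False
  have 1: "piD (Suc 0) z = neg1 (piD 0 (neg1 z)) \<and> piD 0 z = neg1 (piD (Suc 0) (neg1 z))"
  proof -
    consider "z = 1" | "z = - 1" | "z = 2" | "z = - 2" | "z = 3" | "z = - 3"
      | "z \<notin> {1, - 1, 2, - 2, 3, - 3}" by blast
    then show ?thesis
    proof cases
      case 7
      then have n: "neg1 z = z" by (intro neg1_out) auto
      show ?thesis by (simp only: piD_table_out[OF 7] n)
    qed (simp_all only: piD_table neg1_table)
  qed
  from False have "i = 0 \<or> i = Suc 0" by auto
  with 1 show ?thesis by (auto simp: swD_values)
qed

lemma foldr_swD: "foldr piD (map swD w) z = neg1 (foldr piD w (neg1 z))"
  by (induction w) (simp_all add: piD_swD)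

lemma foldr_swD_fix: "2 \<le> z \<Longrightarrow> foldr piD (rev (map swD w)) z = neg1 (foldr piD (rev w) z)"
  using foldr_swD[of "rev w" z] neg1_out[of z] by (simp add: rev_map)

lemma abs_neg1: "\<bar>neg1 z\<bar> = \<bar>z\<bar>"
  by (simp add: neg1_def)

lemma B_inv: "ceq coxeter_B v w \<Longrightarrow> foldr piB (rev v) z = foldr piB (rev w) z"
  using B.ceq_rev piB_ceq by blast

lemma D_inv: "ceq coxeter_D v w \<Longrightarrow> foldr piD (rev v) z = foldr piD (rev w) z"
  using D.ceq_rev piD_ceq by blast

lemma (in coxeter_aut) delta_L: "app (L i) (delta False []) = delta False [i]"
  by (simp add: app_L_delta)

interpretation BTr: tower_trace B.T "Lop coxeter_B" scl alpha B.tau 0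
proof unfold_locales
  show "B.tau (x + y) = B.tau x + B.tau y" for x y by (rule B.tau_add)
  show "B.tau (scl c * x) = c * B.tau x" for c x by (rule B.tau_scl)
  show "B.tau (B.T i * x) = B.tau (x * B.T i)" if "i < n" "x \<in> BT.A n" for i n x
    using BT.tau_t[of x i] BT.com_A that by simp
  show "B.tau (x * B.L k * y) = 0" if "1 \<le> k" "x \<in> BT.A k" "y \<in> BT.A k" for k x y
  proof -
    \<comment> \<open>The group elements whose inverse sends k + 1 to k. Generators with index below
      k fix k + 1, so left multiplication by them preserves this set, and the identity is not in it.
      For y the image is -(k + 1) instead.\<close>
    let ?Z = "\<lambda>w. foldr piB (rev w) (int k + 1) = int k"
    have "B.tau (y * x * B.L k) = 0"
    proof (rule BT.tau_vanish[where Z = ?Z, OF BT.A_mult[OF that(3,2)] B.delta_L])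
      show "?Z [k]" using that(1) swp_down(1)[of "int k"] by (simp add: pi_positive)
    qed (auto simp: B_inv piB_fix)
    moreover have "B.tau (x * B.L k * y) = B.tau (y * (x * B.L k))"
      using BT.tau_A_comm[OF that(3), of "x * B.L k"] B.com_mult[OF BT.com_A[OF that(2)] B.com_L] by simp
    ultimately show ?thesis by (simp add: mult.assoc)
  qed
  show "B.tau (x * BT.yy k) = 0" if "x \<in> BT.A k" for x k
  proof -
    let ?Z = "\<lambda>w. foldr piB (rev w) (int k + 1) = - (int k + 1)"
    have "app (BT.yy k) (B.delta False []) = B.delta False (uB k)"
      unfolding yy_B using B.app_sword_delta[of "uB k" "[]"] red_uB by simp
    then show ?thesis
    proof (rule BT.tau_vanish[where Z = ?Z, OF that])
      show "?Z (uB k)" using act_uB[of k] by simp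
    qed (auto simp: B_inv piB_fix)
  qed
qed

interpretation DTr: tower_trace tD sD scl 0 D.tau alpha
proof unfold_locales
  show "D.tau (x + y) = D.tau x + D.tau y" for x y by (rule D.tau_add)
  show "D.tau (scl c * x) = c * D.tau x" for c x by (rule D.tau_scl)
  show "D.tau (tD i * x) = D.tau (x * tD i)" if "i < n" "x \<in> DT.A n" for i n x
    using DT.tau_t[of x i] DT.com_A that by simp
  show "D.tau (x * sD k * y) = 0" if "1 \<le> k" "x \<in> DT.A k" "y \<in> DT.A k" for k x y
  proof -
    have sk: "sD k = D.L k" using that(1) by (simp add: sD_def)
    \<comment> \<open>The absolute value makes the set stable under \<varsigma>, which changes the
      sign of the image k when k = 1.\<close>
    let ?Z = "\<lambda>w. \<bar>foldr piD (rev w) (int k + 1)\<bar> = int k"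
    have "D.tau (y * x * D.L k) = 0"
    proof (rule DT.tau_vanish[where Z = ?Z, OF DT.A_mult[OF that(3,2)] D.delta_L])
      show "?Z [k]" using that(1) swp_down(1)[of "int k"] by (simp add: pi_positive)
      fix i assume "i < k"
      then show "tD i = D.T i \<and> (\<forall>w. ?Z (i # w) \<longrightarrow> ?Z w) \<or> tD i = D.S \<and> (\<forall>w. ?Z (map swD w) \<longrightarrow> ?Z w)"
        using piD_fix[of i k] foldr_swD_fix[of "int k + 1"] by (cases "i = 0") (simp_all add: tD_def abs_neg1)
    qed (auto simp: D_inv)
    moreover have "D.tau (x * D.L k * y) = D.tau (y * (x * D.L k))"
      using DT.tau_A_comm[OF that(3), of "x * D.L k"] D.com_mult[OF DT.com_A[OF that(2)] D.com_L] by simp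
    ultimately show ?thesis by (simp add: mult.assoc sk)
  qed
  show "D.tau (x * DT.yy k) = 0" if "x \<in> DT.A k" for x k
  proof (cases k)
    \<comment> \<open>In rank 0 there are only scalars, and \<varsigma> moves the identity to the
      other layer.\<close>
    case 0
    then obtain c where "x = scl c" using DT.A_0 \<open>x \<in> DT.A k\<close> by blast
    moreover have "D.tau D.S = 0" by (simp add: D.tau_def D.app_S_delta) (simp add: D.delta_def)
    ultimately show ?thesis using 0 by (simp add: D.tau_scl)
  next
    case (Suc j)
    let ?Z = "\<lambda>w. foldr piD (rev w) (int k + 1) = - (int k + 1)"
    have "app (DT.yy k) (D.delta False []) = D.delta True (uD j)"
      unfolding Suc yy_D using D.app_sword_delta[of "uD j" "[]"] red_uD by (simp add: D.app_S_delta)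
    then show ?thesis
    proof (rule DT.tau_vanish[where Z = ?Z, OF that])
      show "?Z (uD j)" using act_uD[of j] Suc by (simp add: add.commute)
      fix i assume "i < k"
      then show "tD i = D.T i \<and> (\<forall>w. ?Z (i # w) \<longrightarrow> ?Z w) \<or> tD i = D.S \<and> (\<forall>w. ?Z (map swD w) \<longrightarrow> ?Z w)"
      proof (cases "i = 0")
        case True
        have "?Z w" if "?Z (map swD w)" for w
        proof -
          have "neg1 (foldr piD (rev w) (int k + 1)) = - (int k + 1)"
            using that foldr_swD_fix[of "int k + 1" w] Suc by simp
          then have "foldr piD (rev w) (int k + 1) = neg1 (- (int k + 1))" by (metis neg1_neg1)
          then show ?thesis using Suc by (simp add: neg1_def)
        qed
        then show ?thesis using True by (simp add: tD_def)
      qed (use piD_fix[of i k] in \<open>simp add: tD_def\<close>)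
    qed (auto simp: D_inv)
  qed
qed

lemma finite_B: "finite (coxeter_group coxeter_B n)"
proof (rule BT.finite_coxeter_of_sword)
  fix x assume "x \<in> lists {..<n}"
  then show "B.sword x \<in> BT.A n" by (induction x) (auto intro: BT.A_mult BT.A_s)
qed

text \<open>The generator t_{1'} is not a generator of the tower. It is \<varsigma> t_1 \<varsigma>,
  and this requires rank 2.\<close>

lemma L0_A: "2 \<le> n \<Longrightarrow> i < n \<Longrightarrow> D.L i \<in> DT.A n"
proof (cases "i = 0")
  case True
  assume n: "2 \<le> n"
  have "D.L 0 = tD 0 * sD 1 * tD 0" using D_L0 by simp
  moreover have "tD 0 * sD 1 * tD 0 \<in> DT.A n" using n by (intro DT.A_mult DT.A_t DT.A_s) auto
  ultimately show ?thesis using True by simp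
next
  case False
  assume "i < n"
  then show ?thesis using DT.A_s[of i n] False by (simp add: sD_def)
qed

lemma finite_D: "2 \<le> n \<Longrightarrow> finite (coxeter_group coxeter_D n)"
proof (rule DT.finite_coxeter_of_sword)
  fix x assume "x \<in> lists {..<n}" "2 \<le> n"
  then show "D.sword x \<in> DT.A n" by (induction x) (auto intro: DT.A_mult L0_A)
qed

lemma BH: "finite_coxeter coxeter_B id n"
  by unfold_locales (rule finite_B)

lemma DH: "2 \<le> n \<Longrightarrow> finite_coxeter coxeter_D swD n"
  by unfold_locales (rule finite_D)

section \<open>Markov traces as functionals on operators\<close>

context coxeter_aut
begin

text \<open>The trace of rank n regarded as a functional on the represented algebra. The choice of f
  does not matter because the representation is faithful, see \<open>lift_rho\<close>.\<close>

definition lift :: "(nat \<Rightarrow> free_elt set \<Rightarrow> qva) \<Rightarrow> nat \<Rightarrow> endo \<Rightarrow> qva" where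
  "lift \<phi> n x = \<phi> n (hecke_class m n (SOME f. f \<in> Fr n \<and> rho f = x))"

lemma lift_rho:
  assumes "finite (coxeter_group m n)" "f \<in> Fr n"
  shows "lift \<phi> n (rho f) = \<phi> n (hecke_class m n f)"
proof -
  interpret finite_coxeter m sw n by unfold_locales (rule assms(1))
  let ?g = "SOME g. g \<in> Fr n \<and> rho g = rho f"
  have "?g \<in> Fr n \<and> rho ?g = rho f" by (rule someI[of _ f]) (simp add: assms(2))
  then have "hecke_class m n ?g = hecke_class m n f" using clH_eq_iff[OF _ assms(2)] by blast
  then show ?thesis by (simp add: lift_def)
qed

text \<open>The representation does not depend on the rank, so elements of the free algebra that are
  congruent in rank n have the same image and are congruent in rank n + 1.\<close>

lemma embed_class:
  assumes "f \<in> Fr n" "finite (coxeter_group m (Suc n))"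
  shows "hecke_embed m (Suc n) (hecke_class m n f) = hecke_class m (Suc n) f"
proof -
  interpret finite_coxeter m sw "Suc n" by unfold_locales (rule assms(2))
  have "hecke_class m (Suc n) g = hecke_class m (Suc n) f" if g: "g \<in> hecke_class m n f" for g
  proof -
    obtain i where i: "i \<in> hecke_ideal m n" "g = i + f"
      using g unfolding hecke_class_def a_r_coset_def' by (auto simp: free_algebra_def)
    have F: "f \<in> Fr (Suc n)" "g \<in> Fr (Suc n)"
      using assms i Fr_add hI_Fr Fr_mono by (auto intro: Fr_mono[of _ n])
    have "rho g = rho f" using rho_ideal[OF i(1)] by (simp add: i(2) rho_add)
    then show ?thesis using clH_eq_iff F by simp
  qed
  moreover have "f \<in> hecke_class m n f"
    using hI_zero[of m n] unfolding hecke_class_def a_r_coset_def' by (force simp: free_algebra_def)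
  ultimately show ?thesis unfolding hecke_embed_def by blast
qed

end

locale markov = coxeter_aut m sw for m sw +
  fixes n0 :: nat and \<rho> \<mu> :: qva and \<phi> :: "nat \<Rightarrow> free_elt set \<Rightarrow> qva"
  assumes fin: "n0 \<le> n \<Longrightarrow> finite (coxeter_group m n)"
    and markov: "markov_trace m n0 \<rho> \<mu> \<phi>"
begin

lemma lift_cl: "n0 \<le> n \<Longrightarrow> f \<in> Fr n \<Longrightarrow> lift \<phi> n (rho f) = \<phi> n (hecke_class m n f)"
  by (rule lift_rho[OF fin])

lemma lift_add:
  assumes "n0 \<le> n" "f \<in> Fr n" "g \<in> Fr n"
  shows "lift \<phi> n (rho f + rho g) = lift \<phi> n (rho f) + lift \<phi> n (rho g)"
proof -
  have "\<phi> n (hecke_class m n f \<oplus>\<^bsub>hecke m n\<^esub> hecke_class m n g) = \<phi> n (hecke_class m n f) + \<phi> n (hecke_class m n g)"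
    using markov assms cl_closed unfolding markov_trace_def by blast
  then show ?thesis using assms lift_cl[of n "f + g"] by (simp add: cl_add lift_cl Fr_add rho_add)
qed

lemma lift_scl:
  assumes "n0 \<le> n" "f \<in> Fr n"
  shows "lift \<phi> n (scl c * rho f) = qva_const c * lift \<phi> n (rho f)"
proof -
  have "\<phi> n (hecke_smult m n c (hecke_class m n f)) = qva_const c * \<phi> n (hecke_class m n f)"
    using markov assms cl_closed unfolding markov_trace_def by blast
  then show ?thesis using assms lift_cl[of n "free_const c * f"]
    by (simp add: cl_smult lift_cl Fr_mult Fr_const rho_mult)
qed

lemma lift_comm:
  assumes "n0 \<le> n" "f \<in> Fr n" "g \<in> Fr n"
  shows "lift \<phi> n (rho f * rho g) = lift \<phi> n (rho g * rho f)"
proof -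
  have "\<phi> n (hecke_class m n f \<otimes>\<^bsub>hecke m n\<^esub> hecke_class m n g) =
      \<phi> n (hecke_class m n g \<otimes>\<^bsub>hecke m n\<^esub> hecke_class m n f)"
    using markov assms cl_closed unfolding markov_trace_def by blast
  then show ?thesis using assms lift_cl[of n "f * g"] lift_cl[of n "g * f"]
    by (simp add: cl_mult Fr_mult rho_mult)
qed

lemma lift_embed:
  assumes "n0 \<le> n" "f \<in> Fr n"
  shows "lift \<phi> (Suc n) (rho f) = \<rho> * lift \<phi> n (rho f)"
proof -
  have "\<phi> (Suc n) (hecke_embed m (Suc n) (hecke_class m n f)) = \<rho> * \<phi> n (hecke_class m n f)"
    using markov assms cl_closed[of f n m] unfolding markov_trace_def by (metis diff_Suc_1 le_imp_less_Suc)
  then show ?thesis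
    using embed_class[OF assms(2) fin] assms lift_cl[of "Suc n" f] Fr_mono[of f n "Suc n"] by (simp add: lift_cl)
qed

lemma lift_T:
  assumes "n0 \<le> n" "f \<in> Fr n"
  shows "lift \<phi> (Suc n) (rho f * T n) = \<mu> * lift \<phi> n (rho f)"
proof -
  have "\<phi> (Suc n) (hecke_embed m (Suc n) (hecke_class m n f) \<otimes>\<^bsub>hecke m (Suc n)\<^esub> hecke_gen m (Suc n) n)
      = \<mu> * \<phi> n (hecke_class m n f)"
    using markov assms cl_closed[of f n m] unfolding markov_trace_def by (metis diff_Suc_1 le_imp_less_Suc)
  moreover have "f \<in> Fr (Suc n)" "free_word [n] \<in> Fr (Suc n)"
    using Fr_mono[OF assms(2), of "Suc n"] Fr_gen[of n "Suc n"] by simp_all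
  ultimately show ?thesis
    using embed_class[OF assms(2) fin] assms lift_cl[of "Suc n" "f * free_word [n]"]
    by (simp add: lift_cl hecke_gen_def cl_mult Fr_mult rho_mult)
qed

end

section \<open>The geometric Markov traces\<close>

context coxeter_aut
begin

lemma rho_zero [simp]: "rho 0 = 0"
  by (simp add: rho_def)

lemma rho_prod_list: "rho (prod_list fs) = prod_list (map rho fs)"
  by (induction fs) (simp_all add: rho_mult)

end

lemma (in finite_coxeter) prod_gen_inv:
  assumes "x \<in> lists {..<n}" "y \<in> lists {..<n}"
  shows "hecke_prod m n (map (hecke_gen m n) x @ map (\<lambda>k. inv\<^bsub>H\<^esub> (hecke_gen m n k)) y)
    = clH (free_word x * sfree y)"
proof -
  let ?fs = "map (\<lambda>k. free_word [k]) x @ map (\<lambda>k. free_word [k] - free_const alpha) y"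
  have 2: "inv\<^bsub>H\<^esub> (hecke_gen m n k) = clH (free_word [k] - free_const alpha)" if "k < n" for k
    using inv_word_cl[of "[k]"] that by (simp add: hecke_gen_def)
  have eq: "map (hecke_gen m n) x @ map (\<lambda>k. inv\<^bsub>H\<^esub> (hecke_gen m n k)) y = map clH ?fs"
    using 2 assms(2) by (auto simp: hecke_gen_def)
  have F: "f \<in> Fr n" if f: "f \<in> set ?fs" for f
  proof -
    consider k where "k \<in> set x" "f = free_word [k]" | k where "k \<in> set y" "f = free_word [k] - free_const alpha"
      using f by auto
    then show ?thesis by cases (use assms in \<open>auto intro!: Fr_gen Fr_minus Fr_const\<close>)
  qed
  have "hecke_prod m n (map clH ?fs) = clH (prod_list ?fs)" by (rule cl_prod, rule F)
  then show ?thesis unfolding eq by (simp only: prod_list.append prod_list_free_word sfree_def)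
qed

text \<open>The trace property moves g to the front, (M2) removes the generator, and the trace
  property of the smaller algebra moves g back.\<close>

lemma (in markov) lift_sandwich:
  assumes "n0 \<le> n" "f \<in> Fr n" "g \<in> Fr n"
  shows "lift \<phi> (Suc n) (rho f * T n * rho g) = \<mu> * lift \<phi> n (rho f * rho g)"
proof -
  have F: "f \<in> Fr (Suc n)" "g \<in> Fr (Suc n)" "free_word [n] \<in> Fr (Suc n)"
    using Fr_mono[OF assms(2), of "Suc n"] Fr_mono[OF assms(3), of "Suc n"] Fr_gen[of n "Suc n"] by simp_all
  have "lift \<phi> (Suc n) (rho f * T n * rho g) = lift \<phi> (Suc n) (rho (f * free_word [n]) * rho g)"
    by (simp add: rho_mult)
  also have "\<dots> = lift \<phi> (Suc n) (rho g * rho (f * free_word [n]))"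
    using assms(1) F by (intro lift_comm Fr_mult) auto
  also have "\<dots> = lift \<phi> (Suc n) (rho (g * f) * T n)" by (simp add: rho_mult mult.assoc)
  also have "\<dots> = \<mu> * lift \<phi> n (rho g * rho f)"
    using lift_T[OF assms(1), of "g * f"] assms by (simp add: Fr_mult rho_mult)
  also have "\<dots> = \<mu> * lift \<phi> n (rho f * rho g)" using lift_comm[OF assms] by simp
  finally show ?thesis .
qed

lemma (in markov) lift_zero: "n0 \<le> n \<Longrightarrow> lift \<phi> n 0 = 0"
  using lift_scl[of n 1 0] Fr_one by (simp add: qva_const_def Zero_fract_def[symmetric])

section \<open>The trace of type B\<close>

lemma BT_A: "BT.A n = B.rho ` Fr n"
proof (intro equalityI subsetI)
  fix x assume "x \<in> BT.A n"
  then show "x \<in> B.rho ` Fr n"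
  proof (induction rule: BT.A.induct)
    case (A_C c) show ?case by (rule image_eqI[of _ _ "free_const c"]) (simp_all add: Fr_const)
  next
    case (A_t i) then show ?case by (intro image_eqI[of _ _ "free_word [i]"]) (simp_all add: Fr_gen)
  next
    case (A_add x y)
    then obtain f g where "x = B.rho f" "y = B.rho g" "f \<in> Fr n" "g \<in> Fr n" by blast
    then show ?case by (intro image_eqI[of _ _ "f + g"]) (simp_all add: B.rho_add Fr_add)
  next
    case (A_mult x y)
    then obtain f g where "x = B.rho f" "y = B.rho g" "f \<in> Fr n" "g \<in> Fr n" by blast
    then show ?case by (intro image_eqI[of _ _ "f * g"]) (simp_all add: B.rho_mult Fr_mult)
  qed
next
  fix x assume "x \<in> B.rho ` Fr n"
  then obtain f where f: "f \<in> Fr n" "x = B.rho f" by blast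
  from f(1) have "B.rho f \<in> BT.A n"
    by (induction f rule: Fr_induct) (auto simp: B.rho_add B.rho_mult intro: BT.A_C BT.A_t BT.A_add BT.A_mult)
  then show "x \<in> BT.A n" by (simp add: f(2))
qed

lemma map_upt_1: "map g [1..<n + 1] = map (\<lambda>i. g (Suc i)) [0..<n]"
proof -
  have "[1..<n + 1] = map Suc [0..<n]" using map_Suc_upt[of 0 n] by (simp del: upt_Suc)
  then show ?thesis by (simp only: map_map o_def)
qed

lemma TT_B: "BT.TT k = B.tword (rev [0..<Suc k]) * B.sword [1..<Suc k]"
  by (induction k) (simp_all add: mult.assoc)

lemma T_elts:
  obtains f where "f \<in> Fr n" "hecke_prod coxeter_B n (map (T_elt n) [1..<n + 1]) = hecke_class coxeter_B n f"
    "B.rho f = BT.Pr 1 n"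
proof -
  interpret F: finite_coxeter coxeter_B id n by (rule BH)
  let ?g = "\<lambda>i. free_word (rev [0..<Suc i]) * sfree [1..<Suc i]"
  have 1: "T_elt n (Suc i) = F.clH (?g i)" if "i < n" for i
    unfolding T_elt_def by (rule F.prod_gen_inv) (use that in auto)
  have F: "f \<in> Fr n" if f: "f \<in> set (map ?g [0..<n])" for f
    using f by (auto intro!: Fr_mult Fr_word Fr_sfree simp del: upt_Suc sfree_simps)
  have "map (T_elt n) [1..<n + 1] = map F.clH (map ?g [0..<n])"
    unfolding map_upt_1 by (simp add: 1 del: upt_Suc sfree_simps)
  then have "hecke_prod coxeter_B n (map (T_elt n) [1..<n + 1]) = F.clH (prod_list (map ?g [0..<n]))"
    by (simp only: cl_prod[OF F])
  moreover have "B.rho (?g i) = BT.TT i" for i unfolding TT_B by (simp only: B.rho_mult B.rho_word B.rho_sfree)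
  then have "B.rho (prod_list (map ?g [0..<n])) = BT.Pr 1 n"
    by (simp only: B.rho_prod_list BT.Pr_def map_map o_def mult_1_left)
  moreover have "prod_list (map ?g [0..<n]) \<in> Fr n" by (rule Fr_prod_list[OF F])
  ultimately show thesis using that by blast
qed

lemma Ps_Pr_B: "1 \<le> n \<Longrightarrow> BTr.Ps n d (BT.Pr 1 n) = (if d = 0 then alpha ^ n else 0)"
proof (induction n rule: nat_induct_at_least)
  case base
  have "BTr.Ps (Suc 0) d (1 * BT.TT 0 * 1) = alpha * BTr.Ps 0 d (1 * 1)"
    using BTr.Ps_expect[of "BT.TT 0" alpha 0 1 0 1 1 d] BT.TT_K[of 0] BT.yy_TT_K[of 0] BT.yy2_TT_K[of 0]
    by (simp add: mult.assoc)
  moreover have "BTr.Ps 0 d 1 = (if d = 0 then 1 else 0)"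
    by (simp add: BTr.Ps_def B.tau_zero B.tau_one fps_one_nth)
  ultimately show ?case by (simp add: BT.Pr_def)
next
  case (Suc k)
  then show ?case using BTr.Ps_Pr[of 1 k d 0] by (simp del: BT.TT.simps)
qed

lemma psi_one: "BTr.psi 1 1 = [:1, 1:]" 
proof -
  have "BTr.psi 0 1 = 1" by (simp add: BTr.psi_def BTr.Ps_def B.tau_one monom_0 one_pCons)
  then show ?thesis using BTr.psi_A[of 1 0] by simp
qed

lemma pol_const: "pol [:c:] = qva_const c"
  by (simp add: pol_def qva_const_def)

lemma trace_B:
  assumes tr: "geometric_trace_B trB" and "1 \<le> n" "f \<in> Fr n"
  shows "trB n (hecke_class coxeter_B n f) = pol (BTr.psi n (B.rho f))"
proof -
  have mt: "markov_trace coxeter_B 1 (1 + a_var) (qva_const alpha) trB"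
    and tr1: "\<And>n. 1 \<le> n \<Longrightarrow> trB n \<one>\<^bsub>hecke_B n\<^esub> = (1 + a_var) ^ n"
    and trT: "\<And>n. 1 \<le> n \<Longrightarrow> trB n (hecke_prod coxeter_B n (map (T_elt n) [1..<n + 1])) = qva_const alpha ^ n"
    using tr unfolding geometric_trace_B_def by blast+
  interpret M: markov coxeter_B id 1 "1 + a_var" "qva_const alpha" trB
    by unfold_locales (use mt finite_B in auto)
  have "B.lift trB n x = pol (BTr.psi n x)" if "x \<in> BT.A n" for x
  proof (rule BTr.geometric_unique[where e = 1 and x = x])
    show "B.lift trB n (x + y) = B.lift trB n x + B.lift trB n y"
      if "1 \<le> n" "x \<in> BT.A n" "y \<in> BT.A n" for n x y
      using that M.lift_add unfolding BT_A by blast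
    show "B.lift trB n (scl c * x) = qva_const c * B.lift trB n x" if "1 \<le> n" "x \<in> BT.A n" for n x c
      using that M.lift_scl unfolding BT_A by blast
    show "B.lift trB n (B.T i * x) = B.lift trB n (x * B.T i)" if "1 \<le> i" "i < n" "x \<in> BT.A n" for n i x
      using that M.lift_comm[of n "free_word [i]"] Fr_gen[of i n] unfolding BT_A by auto
    show "B.lift trB (Suc n) x = (1 + a_var) * B.lift trB n x" if "1 \<le> n" "x \<in> BT.A n" for n x
      using that M.lift_embed unfolding BT_A by blast
    show "B.lift trB (Suc n) (x * B.T n * z) = qva_const alpha * B.lift trB n (x * z)"
      if "1 \<le> n" "x \<in> BT.A n" "z \<in> BT.A n" for n x z
      using that M.lift_sandwich unfolding BT_A by blast
    show "B.lift trB 1 1 = pol (BTr.psi 1 1)"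
      using M.lift_cl[OF order.refl Fr_one] tr1[of 1] by (simp add: cl_one psi_one[unfolded One_nat_def] pol_one_a)
    show "B.lift trB n (BT.Jp 0 n) = pol (BTr.psi n (BT.Jp 0 n)) \<or>
        1 ^ n = (1 :: endo) \<and> B.lift trB n (BT.Pr 1 n) = pol (BTr.psi n (BT.Pr 1 n))" if n: "1 \<le> n" for n
    proof -
      obtain f where f: "f \<in> Fr n" "B.rho f = BT.Pr 1 n"
        "hecke_prod coxeter_B n (map (T_elt n) [1..<n + 1]) = hecke_class coxeter_B n f" by (rule T_elts)
      have "B.lift trB n (BT.Pr 1 n) = qva_const alpha ^ n"
        using M.lift_cl[OF n f(1)] trT[OF n] unfolding f by simp
      moreover have "BTr.psi n (BT.Pr 1 n) = [:alpha:] ^ n"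
        by (rule poly_eqI) (simp add: BTr.coeff_psi Ps_Pr_B[OF n] poly_const_pow coeff_pCons split: nat.split)
      ultimately show ?thesis by (simp add: pol_power pol_const)
    qed
  qed (use assms(2) that in auto)
  then show ?thesis using M.lift_cl[OF assms(2,3)] assms(3) unfolding BT_A by auto
qed

text \<open>In type D, \<open>Ev\<close> is the projection of the crossed product onto the Hecke algebra.\<close>

definition par :: "bool \<Rightarrow> endo \<Rightarrow> bool" where
  "par b x \<longleftrightarrow> (\<forall>c. layer c * x = x * layer (c \<noteq> b))"

definition Ev :: "endo \<Rightarrow> endo" where
  "Ev x = layer False * x * layer False + layer True * x * layer True"

lemma layer_layer: "layer c * layer d = (if c = d then layer c else 0)"
  by (rule endo_eqI) simp

lemma layer_sum: "layer False + layer True = 1"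
  by (rule endo_eqI) auto

lemma par_mult: "par a x \<Longrightarrow> par b y \<Longrightarrow> par (a \<noteq> b) (x * y)"
proof -
  assume x: "par a x" and y: "par b y"
  have "layer c * (x * y) = x * (layer (c \<noteq> a) * y)" for c
    using x by (simp add: par_def flip: mult.assoc)
  also have "x * (layer (c \<noteq> a) * y) = x * y * layer ((c \<noteq> a) \<noteq> b)" for c
    using y by (simp add: par_def mult.assoc)
  finally have "layer c * (x * y) = x * y * layer ((c \<noteq> a) \<noteq> b)" for c .
  moreover have "((c \<noteq> a) \<noteq> b) = (c \<noteq> (a \<noteq> b))" for c by blast
  ultimately show ?thesis by (simp add: par_def)
qed

lemma par_add: "par b x \<Longrightarrow> par b y \<Longrightarrow> par b (x + y)"
  and par_diff: "par b x \<Longrightarrow> par b y \<Longrightarrow> par b (x - y)"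
  and par_zero [simp]: "par b 0" and par_one [simp]: "par False 1" and par_scl [simp]: "par False (scl c)"
  by (simp_all add: par_def distrib_left distrib_right left_diff_distrib right_diff_distrib scl_comm)

lemma par_Lop: "par False (Lop m i)"
  by (auto simp: par_def app_Lop intro!: endo_eqI)

lemma Ev_par: "par False x \<Longrightarrow> Ev x = x" "par True x \<Longrightarrow> Ev x = 0"
proof -
  assume "par False x"
  then have "Ev x = x * (layer False + layer True)"
    by (simp add: Ev_def par_def mult.assoc layer_layer distrib_left)
  then show "Ev x = x" by (simp add: layer_sum)
next
  assume "par True x"
  then show "Ev x = 0" by (simp add: Ev_def par_def mult.assoc layer_layer)
qed

lemma Ev_add: "Ev (x + y) = Ev x + Ev y"
  by (simp add: Ev_def distrib_left distrib_right)

context coxeter_aut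
begin

lemma par_S: "par True S"
  by (simp add: par_def layer_S)

lemma par_T: "par False (T i)"
  unfolding T_def by (intro par_add par_Lop par_scl)

lemma par_rho: "f \<in> Fr n \<Longrightarrow> par False (rho f)"
proof (induction f rule: Fr_induct)
  case (mult f g)
  then show ?case using par_mult[of False "rho f" False "rho g"] by (simp add: rho_mult)
qed (simp_all add: rho_add par_add par_T)

lemma tau_par: assumes "par True x" shows "tau x = 0"
proof -
  have d: "app (layer False) (delta False []) = delta False []" by (auto simp: delta_def fun_eq_iff)
  have "app x (delta False []) = app (x * layer False) (delta False [])" by (simp add: d del: app_layer)
  also have "x * layer False = layer True * x" using assms by (simp add: par_def)
  finally show ?thesis by (simp add: tau_def)
qed

end

lemma par_tD: "par (i = 0) (tD i)" and par_sD: "par (i = 0) (sD i)"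
  using D.par_S D.par_T par_Lop by (auto simp: tD_def sD_def)

lemma par_mult3: "par False x \<Longrightarrow> par b y \<Longrightarrow> par False z \<Longrightarrow> par b (x * y * z)"
  using par_mult[OF par_mult, of False x b y False z] by simp

lemma par_tower: "par True (DT.jj k)" "par True (DT.yy k)" "par True (DT.TT k)"
  by (induction k)
    (use par_tD[of "Suc _"] par_sD[of "Suc _"] D.par_S in \<open>simp_all add: par_mult3 del: tD_simps(2,4)\<close>)

text \<open>Every y exchanges the two layers, so the parity of a coefficient is that of its degree
  in X. In particular the even coefficients preserve the layers.\<close>

lemma par_FF: "par (odd d) (DT.FF \<kappa> n $ d)"
proof (induction n arbitrary: d)
  case 0 show ?case by (simp add: fps_one_nth)
next
  case (Suc k)
  have "par (odd d) (DT.FF \<kappa> k $ (d - 1) * (scl \<kappa> * DT.yy k))" if "d \<noteq> 0"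
    using par_mult[OF Suc par_mult[OF par_scl par_tower(2)], of "d - 1" \<kappa> k] that by simp
  moreover have "par (odd d) (DT.FF \<kappa> k $ (d - 2) * (DT.yy k * DT.yy k))" if "\<not> d < 2"
    using par_mult[OF Suc par_mult[OF par_tower(2) par_tower(2)], of "d - 2" k k] that by simp
  ultimately show ?case unfolding DT.FF_nth using Suc[of d] by (auto intro!: par_diff)
qed

lemma par_Jp: "par (odd n) (DT.Jp 0 n)"
proof (induction n)
  case (Suc n)
  then show ?case using par_mult[OF Suc par_tower(1)[of n]] by (simp add: DT.Jp_def)
qed simp

lemma par_Pr: "par False (DT.Pr D.S n)"
proof (induction n)
  case (Suc n)
  then show ?case
    using par_mult[OF Suc par_mult[OF D.par_S par_tower(3)[of n]]] by (simp add: DT.Pr_Suc)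
qed (simp add: DT.Pr_def)

section \<open>The trace of type D\<close>

lemma S_rho:
  assumes "f \<in> Fr n" "2 \<le> n"
  shows "\<exists>g\<in>Fr n. D.S * D.rho f = D.rho g * D.S"
  using assms(1)
proof (induction f rule: Fr_induct)
  case (const c)
  show ?case by (rule bexI[of _ "free_const c"]) (simp_all add: scl_comm Fr_const)
next
  case (gen i)
  have "swD i < n" using gen assms(2) by (cases "i = 0 \<or> i = 1") (auto simp: swD_values)
  then show ?case by (intro bexI[of _ "free_word [swD i]"]) (simp_all add: D.S_T Fr_gen)
next
  case (add f g)
  then obtain f' where 1: "f' \<in> Fr n" "D.S * D.rho f = D.rho f' * D.S" by blast
  obtain g' where 2: "g' \<in> Fr n" "D.S * D.rho g = D.rho g' * D.S" using add by blast
  from 1 2 show ?case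
    by (intro bexI[of _ "f' + g'"]) (simp_all add: D.rho_add distrib_left distrib_right Fr_add)
next
  case (mult f g)
  then obtain f' where 1: "f' \<in> Fr n" "D.S * D.rho f = D.rho f' * D.S" by blast
  obtain g' where 2: "g' \<in> Fr n" "D.S * D.rho g = D.rho g' * D.S" using mult by blast
  have "D.S * (D.rho f * D.rho g) = D.rho f' * (D.S * D.rho g)" using 1(2) by (simp flip: mult.assoc)
  also have "\<dots> = D.rho f' * D.rho g' * D.S" using 2(2) by (simp add: mult.assoc)
  finally show ?case using 1(1) 2(1) by (intro bexI[of _ "f' * g'"]) (simp_all add: D.rho_mult Fr_mult)
qed

text \<open>The rule of the crossed product: c' and d' are the conjugates of c and d by \<varsigma>,
  and \<varsigma>^2 = 1.\<close>

lemma twisted_mult: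
  assumes "D.S * c = c' * D.S" "D.S * d = d' * D.S"
  shows "(a + b * D.S) * (c + d * D.S) = (a * c + b * d') + (a * d + b * c') * D.S"
proof -
  have "b * D.S * c = b * c' * D.S" "b * D.S * (d * D.S) = b * d'"
    using assms by (simp add: mult.assoc, simp add: mult.assoc flip: mult.assoc[of "D.S" d])
      (simp add: mult.assoc D.S_S)
  then show ?thesis by (simp add: distrib_left distrib_right mult.assoc add_ac)
qed

lemma DT_A:
  assumes "x \<in> DT.A n" "2 \<le> n"
  shows "\<exists>f\<in>Fr n. \<exists>g\<in>Fr n. x = D.rho f + D.rho g * D.S"
  using assms(1)
proof (induction rule: DT.A.induct)
  case (A_C c)
  show ?case by (rule bexI[of _ "free_const c"], rule bexI[of _ 0]) (simp_all add: Fr_const Fr_zero)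
next
  case (A_t i)
  show ?case
  proof (cases "i = 0")
    case True
    then show ?thesis
      by (intro bexI[of _ "0 :: free_elt"] bexI[of _ "1 :: free_elt"]) (simp_all add: Fr_one Fr_zero)
  next
    case False
    then show ?thesis using A_t
      by (intro bexI[of _ "free_word [i]"] bexI[of _ "0 :: free_elt"]) (simp_all add: Fr_gen Fr_zero tD_def)
  qed
next
  case (A_add x y)
  obtain f g where 1: "f \<in> Fr n" "g \<in> Fr n" "x = D.rho f + D.rho g * D.S" using A_add by blast
  obtain f' g' where 2: "f' \<in> Fr n" "g' \<in> Fr n" "y = D.rho f' + D.rho g' * D.S" using A_add by blast
  from 1 2 show ?case
    by (intro bexI[of _ "f + f'"] bexI[of _ "g + g'"]) (simp_all add: D.rho_add distrib_right Fr_add)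
next
  case (A_mult x y)
  obtain f g where 1: "f \<in> Fr n" "g \<in> Fr n" "x = D.rho f + D.rho g * D.S" using A_mult by blast
  obtain c d where 2: "c \<in> Fr n" "d \<in> Fr n" "y = D.rho c + D.rho d * D.S" using A_mult by blast
  obtain c' where 3: "c' \<in> Fr n" "D.S * D.rho c = D.rho c' * D.S" using S_rho[OF 2(1) assms(2)] by blast
  obtain d' where 4: "d' \<in> Fr n" "D.S * D.rho d = D.rho d' * D.S" using S_rho[OF 2(2) assms(2)] by blast
  have "x * y = D.rho (f * c + g * d') + D.rho (f * d + g * c') * D.S"
    unfolding 1 2 twisted_mult[OF 3(2) 4(2)] by (simp add: D.rho_add D.rho_mult)
  then show ?case using 1 2 3 4 by (intro bexI[of _ "f * c + g * d'"] bexI[of _ "f * d + g * c'"]) (simp_all add: Fr_add Fr_mult)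
qed

lemma rho_D_A: "f \<in> Fr n \<Longrightarrow> 2 \<le> n \<Longrightarrow> D.rho f \<in> DT.A n"
proof (induction f rule: Fr_induct)
  case (gen i)
  have "tD 0 * tD 1 * tD 0 \<in> DT.A n" using gen by (intro DT.A_mult DT.A_t) auto
  then have "D.T 0 \<in> DT.A n" using D_T0 by simp
  moreover have "D.T i \<in> DT.A n" if "i \<noteq> 0" using DT.A_t[OF gen(1)] that by (simp add: tD_def)
  ultimately show ?case by (cases "i = 0") simp_all
qed (auto simp: D.rho_add D.rho_mult intro: DT.A_C DT.A_add DT.A_mult)

lemma Ev_twisted: "f \<in> Fr n \<Longrightarrow> g \<in> Fr n \<Longrightarrow> Ev (D.rho f + D.rho g * D.S) = D.rho f"
  using par_mult[OF D.par_rho D.par_S, of g n] by (simp add: Ev_add Ev_par D.par_rho[of f n])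

text \<open>In rank 1 only \<varsigma> is available. This algebra has no counterpart in type D,
  where the traces begin in rank 2, and it is treated separately in \<open>trace_D\<close>.\<close>

lemma DT_A1: "x \<in> DT.A 1 \<Longrightarrow> \<exists>c d. x = scl c + scl d * D.S"
proof (induction rule: DT.A.induct)
  case (A_C c) show ?case by (rule exI[of _ c], rule exI[of _ 0]) simp
next
  case (A_t i) then show ?case by (intro exI[of _ 0] exI[of _ 1]) simp
next
  case (A_add x y)
  then obtain c d c' d' where "x = scl c + scl d * D.S" "y = scl c' + scl d' * D.S" by blast
  then show ?case by (intro exI[of _ "c + c'"] exI[of _ "d + d'"]) (simp add: scl_add distrib_right)
next
  case (A_mult x y)
  then obtain c d c' d' where xy: "x = scl c + scl d * D.S" "y = scl c' + scl d' * D.S" by blast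
  have "x * y = scl (c * c' + d * d') + scl (c * d' + d * c') * D.S"
    unfolding xy twisted_mult[OF scl_comm scl_comm] by (simp add: scl_add scl_mult)
  then show ?case by blast
qed


text \<open>On its way to the right \<varsigma> commutes with t_k for k \<ge> 2 and turns t_1 into
  t_{1'}; then it meets the \<varsigma> in the middle and cancels. The right-hand side is
  U_{k+2}.\<close>

lemma S_TT: "D.S * DT.TT (Suc k) = D.tword (rev [2..<k + 2] @ [0]) * D.sword [1..<k + 2]"
proof (induction k)
  case 0
  have "D.S * (D.T (Suc 0) * D.S * Lop coxeter_D (Suc 0)) = (D.S * D.T (Suc 0) * D.S) * Lop coxeter_D (Suc 0)"
    by (simp only: mult.assoc)
  then show ?case by (simp add: D_T0)
next
  case (Suc k)
  have "D.S * DT.TT (Suc (Suc k)) = D.T (k + 2) * (D.S * DT.TT (Suc k)) * Lop coxeter_D (k + 2)"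
    using D.S_T[of "k + 2"] swD_values by (simp flip: mult.assoc)
  also have "\<dots> = (D.T (k + 2) * D.tword (rev [2..<k + 2] @ [0])) * (D.sword [1..<k + 2] * Lop coxeter_D (k + 2))"
    unfolding Suc by (simp only: mult.assoc)
  also have "\<dots> = D.tword (rev [2..<Suc k + 2] @ [0]) * D.sword [1..<Suc k + 2]" by (simp add: mult.assoc)
  finally show ?case .
qed

lemma U_elts:
  assumes "2 \<le> n"
  obtains f where "f \<in> Fr n" "hecke_prod coxeter_D n (map (U_elt n) [1..<n + 1]) = hecke_class coxeter_D n f"
    "D.rho f = DT.Pr D.S n"
proof -
  interpret F: finite_coxeter coxeter_D swD n by (rule DH[OF assms])
  let ?g = "\<lambda>i. if i = 0 then 1 else free_word (rev [2..<Suc i] @ [0]) * sfree [1..<Suc i]"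
  have 1: "U_elt n (Suc i) = F.clH (?g i)" if "i < n" for i
  proof (cases "i = 0")
    case True then show ?thesis by (simp add: U_elt_def cl_one)
  next
    case False
    have "hecke_prod coxeter_D n (map (hecke_gen coxeter_D n) (rev [2..<Suc i] @ [0])
        @ map (\<lambda>k. inv\<^bsub>hecke_D n\<^esub> (hecke_gen coxeter_D n k)) [1..<Suc i])
      = F.clH (free_word (rev [2..<Suc i] @ [0]) * sfree [1..<Suc i])"
      by (rule F.prod_gen_inv) (use that in auto)
    then show ?thesis using False by (simp only: U_elt_def) simp
  qed
  have F: "f \<in> Fr n" if f: "f \<in> set (map ?g [0..<n])" for f
    using f by (auto intro!: Fr_mult Fr_word Fr_sfree Fr_one simp del: upt_Suc sfree_simps split: if_splits)
  have "map (U_elt n) [1..<n + 1] = map F.clH (map ?g [0..<n])"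
    unfolding map_upt_1 by (simp add: 1 del: upt_Suc sfree_simps)
  then have "hecke_prod coxeter_D n (map (U_elt n) [1..<n + 1]) = F.clH (prod_list (map ?g [0..<n]))"
    by (simp only: cl_prod[OF F])
  moreover have "D.rho (?g i) = D.S * DT.TT i" for i
  proof (cases i)
    case 0 then show ?thesis by (simp add: D.S_S)
  next
    case (Suc k)
    then show ?thesis using S_TT[of k] by (simp add: D.rho_mult del: upt_Suc DT.TT.simps D.tword_simps D.sword_simps sfree_simps)
  qed
  then have "D.rho (prod_list (map ?g [0..<n])) = DT.Pr D.S n"
    by (simp only: D.rho_prod_list DT.Pr_def map_map o_def)
  moreover have "prod_list (map ?g [0..<n]) \<in> Fr n" by (rule Fr_prod_list[OF F])
  ultimately show thesis using that by blast
qed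

lemma DPs_odd: "par True (DT.FF alpha n $ d * x) \<Longrightarrow> DTr.Ps n d x = 0"
  unfolding DTr.Ps_def by (rule D.tau_par)

text \<open>Here F is 1 - \<alpha> \<varsigma> X - X^2, and only its linear coefficient gives an
  even operator when multiplied by \<varsigma>.\<close>

lemma DPs_1: "DTr.Ps 1 d D.S = (if d = 1 then - alpha else 0)"
proof -
  have F: "DT.FF alpha (Suc 0) $ d = (if d = 0 then 1 else if d = 1 then - (scl alpha * D.S) else if d = 2 then - 1 else 0)"
    unfolding DT.FF_nth by (auto simp: fps_one_nth D.S_S)
  have "D.tau D.S = 0" by (rule D.tau_par[OF D.par_S])
  moreover have "D.tau (- x) = - D.tau x" for x using D.tau_minus[of 0 x] by (simp add: D.tau_zero)
  moreover have "D.tau (scl alpha * D.S * D.S) = alpha"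
    using D.tau_scl[of alpha 1] by (simp add: mult.assoc D.S_S D.tau_one)
  ultimately show ?thesis unfolding DTr.Ps_def One_nat_def F by (simp add: D.tau_zero)
qed

text \<open>By \<open>Ps_Pr\<close> with \<beta> = 0 and \<kappa> = \<alpha>, each factor raises the
  degree by one and contributes -\<alpha>. The exponent r counts the \<varsigma> that accumulate on
  the right, and the parity condition reduces the base case to \<open>DPs_1\<close>.\<close>

lemma DPs_Pr: "1 \<le> k \<Longrightarrow> even (k + r) \<Longrightarrow> DTr.Ps k d (DT.Pr D.S k * D.S ^ r) = (if d = k then (- alpha) ^ k else 0)"
proof (induction k arbitrary: r d rule: nat_induct_at_least)
  case base
  then obtain q where q: "r = 2 * q + 1" by (auto elim: oddE)
  have "D.S ^ r = D.S" by (simp add: q power_mult power2_eq_square D.S_S)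
  then show ?case using DPs_1[of d] by (simp add: DT.Pr_def D.S_S)
next
  case (Suc k)
  have "DTr.Ps (Suc k) d (DT.Pr D.S (Suc k) * D.S ^ r) = - (if d = 0 then 0 else alpha * DTr.Ps k (d - 1) (DT.Pr D.S k * D.S ^ Suc r))"
    using DTr.Ps_Pr[of D.S k d r] DT.A_t[of 0 1] Suc(1) by simp
  also have "\<dots> = (if d = Suc k then (- alpha) ^ Suc k else 0)"
    using Suc.IH[of "Suc r" "d - 1"] Suc(3) by auto
  finally show ?case .
qed

text \<open>The trace is extended to the crossed product by 0 on the odd part. The tower starts in
  rank 1, where the candidate functional itself is taken. The step from rank 1 to rank 2 then needs
  the traces of t_1 and t_{1'}, which (M2) in type D does not provide directly.\<close>

lemma trace_D:
  assumes tr: "geometric_trace_D trD" and "2 \<le> n" "f \<in> Fr n"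
  shows "trD n (hecke_class coxeter_D n f) = pol (DTr.psi n (D.rho f))"
proof -
  have mt: "markov_trace coxeter_D 2 (1 + a_var) (qva_const alpha) trD"
    and tr1: "\<And>n. 2 \<le> n \<Longrightarrow> trD n \<one>\<^bsub>hecke_D n\<^esub> = (1 + a_var) ^ n"
    and trU: "\<And>m. 1 \<le> m \<Longrightarrow> trD (2 * m) (hecke_prod coxeter_D (2 * m) (map (U_elt (2 * m)) [1..<2 * m + 1]))
              = (- (qva_const alpha ^ 2) * a_var) ^ m"
    using tr unfolding geometric_trace_D_def by blast+
  interpret M: markov coxeter_D swD 2 "1 + a_var" "qva_const alpha" trD
    by unfold_locales (use mt finite_D in auto)
  have one: "D.lift trD n 1 = (1 + a_var) ^ n" if "2 \<le> n" for n
    using M.lift_cl[OF that Fr_one] tr1[OF that] by (simp add: cl_one)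
  have a1: "1 + a_var \<noteq> 0"
    using pol_inject[of "[:1, 1:]" 0] by (simp add: pol_one_a) (simp add: pol_def Zero_fract_def)
  have l3: "D.lift trD 3 (D.T 2) = qva_const alpha * (1 + a_var) ^ 2"
  proof -
    have "D.lift trD (Suc 2) (D.rho 1 * D.T 2) = qva_const alpha * D.lift trD 2 (D.rho 1)"
      by (rule M.lift_T[OF order.refl Fr_one])
    moreover have "Suc 2 = 3" by simp
    ultimately show ?thesis by (simp only: D.rho_one mult_1_left one[OF order.refl])
  qed
  \<comment> \<open>In rank 3 both t_1 and t_{1'} are conjugate to t_2, by the braid relation, and
    so have the trace \<alpha> (1 + a)^2 given by (M2). By (U1) their trace in rank 2 is obtained on
    division by 1 + a, which is nonzero.\<close>
  have l2: "D.lift trD 2 (D.T i) = qva_const alpha * (1 + a_var)" if i: "i < 2" for i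
  proof -
    have b: "D.T i * D.T 2 * D.T i = D.T 2 * D.T i * D.T 2"
    proof (rule D.T_braid3)
      from i consider "i = 0" | "i = 1" by linarith
      then show "coxeter_D i 2 = 3" by cases (simp_all add: coxeter_D_def doubleton_eq_iff)
    qed
    let ?u = "free_word [i, 2]" and ?w = "sfree [2, i]"
    have F: "?w \<in> Fr 3" "?u \<in> Fr 3" "free_word [2] \<in> Fr 3" "free_word [i] \<in> Fr 2"
      using i by (auto intro!: Fr_sfree Fr_word simp del: sfree_simps)
    have "D.T i = D.rho ?w * D.rho (free_word [2] * ?u)"
    proof -
      have "D.rho ?w * D.rho (free_word [2] * ?u) = D.L 2 * D.L i * (D.T 2 * D.T i * D.T 2)"
        by (simp add: D.rho_mult mult.assoc del: sfree_simps)
      also have "\<dots> = D.L 2 * (D.L i * D.T i) * D.T 2 * D.T i" unfolding b[symmetric] by (simp only: mult.assoc)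
      also have "\<dots> = D.T i" by simp
      finally show ?thesis by simp
    qed
    then have "D.lift trD 3 (D.T i) = D.lift trD 3 (D.rho (free_word [2] * ?u) * D.rho ?w)"
      using M.lift_comm[of 3 ?w "free_word [2] * ?u"] F Fr_mult by simp
    also have "D.rho (free_word [2] * ?u) * D.rho ?w = D.T 2 * D.T i * (D.T 2 * D.L 2) * D.L i"
      by (simp only: D.rho_mult D.rho_word D.rho_sfree D.tword_simps D.sword_simps mult_1_right mult.assoc)
    also have "\<dots> = D.T 2" by (simp only: D.T_L mult_1_right) (simp add: mult.assoc)
    finally have "D.lift trD 3 (D.T i) = qva_const alpha * (1 + a_var) ^ 2" using l3 by simp
    then show ?thesis using M.lift_embed[of 2 "free_word [i]"] F(4) a1 by (simp add: power2_eq_square)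
  qed
  have psiS: "DTr.psi 1 D.S = 0"
    by (rule poly_eqI) (simp add: DTr.coeff_psi DPs_1[unfolded One_nat_def])
  have psi1: "DTr.psi 1 1 = [:1, 1:]"
  proof -
    have "DTr.psi 0 1 = 1" by (simp add: DTr.psi_def DTr.Ps_def D.tau_one monom_0 one_pCons)
    then show ?thesis using DTr.psi_A[of 1 0] by simp
  qed
  have psi_lin: "pol (DTr.psi 1 (scl c + scl d * D.S)) = qva_const c * (1 + a_var)" for c d
    using DTr.psi_C[of 1 c 1] DTr.psi_C[of 1 d D.S] psiS psi1
    by (simp add: DTr.psi_add pol_one_a flip: pol_smult) (simp flip: pol_one_a pol_smult)
  define \<Phi> where "\<Phi> n x = (if n = 1 then pol (DTr.psi 1 x) else D.lift trD n (Ev x))" for n x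
  have P: "\<Phi> n (D.rho f + D.rho g * D.S) = D.lift trD n (D.rho f)" if "2 \<le> n" "f \<in> Fr n" "g \<in> Fr n" for n f g
    using that Ev_twisted[of f n g] by (simp add: \<Phi>_def)
  have obt: "\<exists>f g. f \<in> Fr n \<and> g \<in> Fr n \<and> x = D.rho f + D.rho g * D.S" if "x \<in> DT.A n" "2 \<le> n" for x n
    using DT_A[OF that] by blast
  have pol0: "pol 0 = 0" by (simp add: pol_def Zero_fract_def)
  have main: "\<Phi> n x = pol (DTr.psi n x)" if "x \<in> DT.A n" for x
  proof (rule DTr.geometric_unique[where e = D.S and x = x])
    show "\<Phi> n (x + y) = \<Phi> n x + \<Phi> n y" if h: "1 \<le> n" "x \<in> DT.A n" "y \<in> DT.A n" for n x y
    proof (cases "n = 1")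
      case True then show ?thesis by (simp add: \<Phi>_def DTr.psi_add pol_add)
    next
      case False
      then have n: "2 \<le> n" using h by simp
      obtain f g where 1: "f \<in> Fr n" "g \<in> Fr n" "x = D.rho f + D.rho g * D.S" using obt[OF h(2) n] by blast
      obtain c d where 2: "c \<in> Fr n" "d \<in> Fr n" "y = D.rho c + D.rho d * D.S" using obt[OF h(3) n] by blast
      have "x + y = D.rho (f + c) + D.rho (g + d) * D.S" unfolding 1 2 by (simp add: D.rho_add distrib_right)
      then have "\<Phi> n (x + y) = D.lift trD n (D.rho (f + c))" using P[OF n, of "f + c" "g + d"] 1 2 Fr_add by simp
      then show ?thesis unfolding 1(3) 2(3) P[OF n 1(1,2)] P[OF n 2(1,2)] using M.lift_add[OF n 1(1) 2(1)] by (simp add: D.rho_add)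
    qed
    show "\<Phi> n (scl c * x) = qva_const c * \<Phi> n x" if h: "1 \<le> n" "x \<in> DT.A n" for n x c
    proof (cases "n = 1")
      case True then show ?thesis by (simp add: \<Phi>_def DTr.psi_C pol_smult)
    next
      case False
      then have n: "2 \<le> n" using h by simp
      obtain f g where 1: "f \<in> Fr n" "g \<in> Fr n" "x = D.rho f + D.rho g * D.S" using obt[OF h(2) n] by blast
      have "scl c * x = D.rho (free_const c * f) + D.rho (free_const c * g) * D.S"
        unfolding 1 by (simp add: D.rho_mult distrib_left mult.assoc)
      then have "\<Phi> n (scl c * x) = D.lift trD n (D.rho (free_const c * f))"
        using P[OF n, of "free_const c * f" "free_const c * g"] 1 Fr_mult Fr_const by simp
      then show ?thesis unfolding 1(3) P[OF n 1(1,2)] using M.lift_scl[OF n 1(1)] by (simp add: D.rho_mult)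
    qed
    show "\<Phi> n (tD i * x) = \<Phi> n (x * tD i)" if i: "1 \<le> i" "i < n" and x: "x \<in> DT.A n" for n i x
    proof -
      have n: "2 \<le> n" using i by simp
      obtain f g where 1: "f \<in> Fr n" "g \<in> Fr n" "x = D.rho f + D.rho g * D.S" using obt[OF x n] by blast
      have G: "free_word [i] \<in> Fr n" using i Fr_gen by simp
      obtain k where k: "k \<in> Fr n" "D.S * D.T i = D.rho k * D.S" using S_rho[OF G n] by auto
      have t: "tD i = D.T i" using i by (simp add: tD_def)
      have "tD i * x = D.rho (free_word [i] * f) + D.rho (free_word [i] * g) * D.S"
        unfolding 1 t by (simp add: D.rho_mult distrib_left mult.assoc)
      then have l: "\<Phi> n (tD i * x) = D.lift trD n (D.T i * D.rho f)"
        using P[OF n, of "free_word [i] * f" "free_word [i] * g"] 1 G Fr_mult by (simp add: D.rho_mult)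
      have "x * tD i = D.rho (f * free_word [i]) + D.rho (g * k) * D.S"
        using k(2) unfolding 1 t by (simp add: D.rho_mult distrib_right mult.assoc)
      then have r: "\<Phi> n (x * tD i) = D.lift trD n (D.rho f * D.T i)"
        using P[OF n, of "f * free_word [i]" "g * k"] 1 G k Fr_mult by (simp add: D.rho_mult)
      show ?thesis unfolding l r using M.lift_comm[OF n G 1(1)] by simp
    qed
    show "\<Phi> (Suc n) x = (1 + a_var) * \<Phi> n x" if h: "1 \<le> n" "x \<in> DT.A n" for n x
    proof (cases "n = 1")
      case True
      obtain c d where x: "x = scl c + scl d * D.S" using DT_A1 h True by blast
      have "\<Phi> 2 x = D.lift trD 2 (scl c)"
        using P[of 2 "free_const c" "free_const d"] Fr_const by (simp add: x)
      also have "\<dots> = qva_const c * (1 + a_var) ^ 2"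
        using M.lift_scl[of 2 1 c] Fr_one one[of 2] by simp
      finally show ?thesis using psi_lin[of c d] True by (simp add: \<Phi>_def x power2_eq_square eval_nat_numeral)
    next
      case False
      then have n: "2 \<le> n" using h by simp
      obtain f g where 1: "f \<in> Fr n" "g \<in> Fr n" "x = D.rho f + D.rho g * D.S" using obt[OF h(2) n] by blast
      have "f \<in> Fr (Suc n)" "g \<in> Fr (Suc n)" using 1 Fr_mono[of _ n "Suc n"] by auto
      then have "\<Phi> (Suc n) x = D.lift trD (Suc n) (D.rho f)" unfolding 1(3) using n by (intro P) auto
      then show ?thesis unfolding 1(3) P[OF n 1(1,2)] using M.lift_embed[OF n 1(1)] by simp
    qed
    show "\<Phi> (Suc n) (x * tD n * z) = qva_const alpha * \<Phi> n (x * z)"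
      if h: "1 \<le> n" "x \<in> DT.A n" "z \<in> DT.A n" for n x z
    proof (cases "n = 1")
      case True
      obtain c d where x: "x = scl c + scl d * D.S" using DT_A1 h True by blast
      obtain c' d' where z: "z = scl c' + scl d' * D.S" using DT_A1 h True by blast
      have G: "free_word [0] \<in> Fr 2" "free_word [Suc 0] \<in> Fr 2" by (auto intro!: Fr_gen)
      \<comment> \<open>The even part of x t_1 z: the products of two \<varsigma> conjugate t_1 to
        t_{1'}, so both values of \<open>l2\<close> enter. The odd part is
        \<open>?g\<close>.\<close>
      let ?f = "free_const (c * c') * free_word [Suc 0] + free_const (d * d') * free_word [0]"
      let ?g = "free_const (c * d') * free_word [Suc 0] + free_const (d * c') * free_word [0]"
      have FG: "?f \<in> Fr 2" "?g \<in> Fr 2" using G by (simp_all add: Fr_add Fr_mult Fr_const)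
      have ST: "D.S * D.T (Suc 0) = D.T 0 * D.S" by (simp add: D.S_T swD_values)
      have e1: "D.T (Suc 0) * z = scl c' * D.T (Suc 0) + (scl d' * D.T (Suc 0)) * D.S"
        unfolding z by (simp add: distrib_left scl_comm flip: mult.assoc)
      have e2: "D.S * (scl c * D.T (Suc 0)) = (scl c * D.T 0) * D.S" for c
      proof -
        have "D.S * (scl c * D.T (Suc 0)) = (D.S * scl c) * D.T (Suc 0)" by (simp only: mult.assoc)
        also have "\<dots> = scl c * (D.S * D.T (Suc 0))" unfolding scl_comm[of D.S c] by (simp only: mult.assoc)
        also have "\<dots> = (scl c * D.T 0) * D.S" unfolding ST by (simp only: mult.assoc)
        finally show ?thesis .
      qed
      have rf: "D.rho ?f = scl c * (scl c' * D.T (Suc 0)) + scl d * (scl d' * D.T 0)"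
        and rg: "D.rho ?g = scl c * (scl d' * D.T (Suc 0)) + scl d * (scl c' * D.T 0)"
        by (simp_all add: D.rho_add D.rho_mult)
      have "x * (D.T (Suc 0) * z) = D.rho ?f + D.rho ?g * D.S"
        unfolding rf rg x e1 by (rule twisted_mult[OF e2 e2])
      moreover have "x * tD n * z = x * (D.T (Suc 0) * z)" using True by (simp add: mult.assoc)
      ultimately have "\<Phi> 2 (x * tD n * z) = D.lift trD 2 (D.rho ?f)" using P[of 2, OF _ FG] by simp
      also have "\<dots> = qva_const (c * c') * D.lift trD 2 (D.T (Suc 0)) + qva_const (d * d') * D.lift trD 2 (D.T 0)"
        using M.lift_add[of 2 "free_const (c * c') * free_word [Suc 0]" "free_const (d * d') * free_word [0]"]
          M.lift_scl[OF _ G(1)] M.lift_scl[OF _ G(2)] G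
        by (simp add: Fr_mult Fr_const D.rho_add D.rho_mult)
      also have "\<dots> = qva_const alpha * (qva_const (c * c' + d * d') * (1 + a_var))"
      proof -
        have q: "qva_const (c * c' + d * d') = qva_const (c * c') + qva_const (d * d')"
          by (simp add: qva_const_def)
        have "D.lift trD 2 (D.T (Suc 0)) = qva_const alpha * (1 + a_var)" "D.lift trD 2 (D.T 0) = qva_const alpha * (1 + a_var)"
          by (simp_all add: l2)
        then show ?thesis unfolding q by (simp only: algebra_simps)
      qed
      finally have l: "\<Phi> 2 (x * tD n * z) = \<dots>" .
      have xz: "x * z = scl (c * c' + d * d') + scl (c * d' + d * c') * D.S"
        unfolding x z twisted_mult[OF scl_comm scl_comm] by (simp only: scl_add scl_mult)
      have "\<Phi> 1 (x * z) = qva_const (c * c' + d * d') * (1 + a_var)"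
        unfolding xz \<Phi>_def by (simp only: psi_lin simp_thms if_True)
      with l have "\<Phi> 2 (x * tD n * z) = qva_const alpha * \<Phi> 1 (x * z)" by (simp only:)
      then show ?thesis by (simp add: True eval_nat_numeral)
    next
      case False
      then have n: "2 \<le> n" using h by simp
      obtain f g where 1: "f \<in> Fr n" "g \<in> Fr n" "x = D.rho f + D.rho g * D.S" using obt[OF h(2) n] by blast
      obtain c d where 2: "c \<in> Fr n" "d \<in> Fr n" "z = D.rho c + D.rho d * D.S" using obt[OF h(3) n] by blast
      obtain c' where 3: "c' \<in> Fr n" "D.S * D.rho c = D.rho c' * D.S" using S_rho[OF 2(1) n] by blast
      obtain d' where 4: "d' \<in> Fr n" "D.S * D.rho d = D.rho d' * D.S" using S_rho[OF 2(2) n] by blast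
      have up: "f \<in> Fr (Suc n)" if "f \<in> Fr n" for f using that Fr_mono[of _ n "Suc n"] by simp
      let ?t = "free_word [n]"
      have t: "?t \<in> Fr (Suc n)" "tD n = D.rho ?t" "D.S * D.rho ?t = D.rho ?t * D.S"
        using n D.S_T[of n] by (simp_all add: Fr_gen tD_def swD_values)
      have ST: "D.S * (D.rho ?t * y) = D.rho ?t * y' * D.S" if "D.S * y = y' * D.S" for y y'
        using that t(3) by (metis mult.assoc)
      let ?p = "f * ?t * c" and ?q = "g * ?t * d'" and ?r = "f * ?t * d + g * ?t * c'"
      have F: "?p \<in> Fr (Suc n)" "?q \<in> Fr (Suc n)" "?r \<in> Fr (Suc n)"
        using t(1) up 1 2 3 4 by (simp_all add: Fr_mult Fr_add)
      have "x * tD n * z = (D.rho f + D.rho g * D.S) * (D.rho ?t * D.rho c + (D.rho ?t * D.rho d) * D.S)"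
        unfolding 1 2 t(2) by (simp only: mult.assoc distrib_left)
      also have "\<dots> = D.rho (?p + ?q) + D.rho ?r * D.S"
        unfolding twisted_mult[OF ST[OF 3(2)] ST[OF 4(2)]] by (simp add: D.rho_add D.rho_mult mult.assoc)
      finally have "\<Phi> (Suc n) (x * tD n * z) = D.lift trD (Suc n) (D.rho (?p + ?q))"
        using P[of "Suc n" "?p + ?q" ?r] F n Fr_add by simp
      also have "\<dots> = D.lift trD (Suc n) (D.rho ?p) + D.lift trD (Suc n) (D.rho ?q)"
        using M.lift_add[OF _ F(1,2)] n by (simp add: D.rho_add)
      also have "\<dots> = qva_const alpha * (D.lift trD n (D.rho (f * c)) + D.lift trD n (D.rho (g * d')))"
        using M.lift_sandwich[OF n 1(1) 2(1)] M.lift_sandwich[OF n 1(2) 4(1)] by (simp add: D.rho_mult distrib_left)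
      also have "\<dots> = qva_const alpha * D.lift trD n (D.rho (f * c + g * d'))"
        using M.lift_add[of n "f * c" "g * d'"] n 1 2 4 by (simp add: Fr_mult D.rho_add)
      also have "D.lift trD n (D.rho (f * c + g * d')) = \<Phi> n (D.rho (f * c + g * d') + D.rho (f * d + g * c') * D.S)"
        using P[OF n, of "f * c + g * d'" "f * d + g * c'"] 1 2 3 4 by (simp add: Fr_mult Fr_add)
      also have "D.rho (f * c + g * d') + D.rho (f * d + g * c') * D.S = x * z"
        unfolding 1 2 twisted_mult[OF 3(2) 4(2)] by (simp add: D.rho_add D.rho_mult)
      finally show ?thesis .
    qed
    show "\<Phi> 1 1 = pol (DTr.psi 1 1)" by (simp add: \<Phi>_def)
    show "D.S \<in> DT.A 1" using DT.A_t[of 0 1] by simp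
    show "D.S * DT.jj i = DT.jj i * D.S" for i
      using DT.jj_comm[of D.S i] DT.A_t[of 0 i] by (cases i) simp_all
    show "\<Phi> n (DT.Jp 0 n) = pol (DTr.psi n (DT.Jp 0 n)) \<or>
        D.S ^ n = 1 \<and> \<Phi> n (DT.Pr D.S n) = pol (DTr.psi n (DT.Pr D.S n))" if n: "1 \<le> n" for n
    proof (cases "n = 1")
      case True then show ?thesis by (simp add: \<Phi>_def)
    next
      case False
      then have n: "2 \<le> n" using n by simp
      show ?thesis
      proof (cases "odd n")
        \<comment> \<open>In odd rank the product of the Jucys-Murphy elements is odd, so the
          extended trace is 0 there by definition and the candidate by parity.\<close>
        case True
        have J: "par True (DT.Jp 0 n)" using par_Jp[of n] True by simp
        have "par True (DT.FF alpha n $ (2 * k) * DT.Jp 0 n)" for k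
          using par_mult[OF par_FF J, of "2 * k" alpha n] by simp
        then have "DTr.psi n (DT.Jp 0 n) = 0" by (intro poly_eqI) (simp add: DTr.coeff_psi DPs_odd)
        then show ?thesis using n J M.lift_zero by (simp add: \<Phi>_def Ev_par pol0)
      next
        case False
        then obtain m where m: "n = 2 * m" by (auto elim: evenE)
        have S: "D.S ^ n = 1" by (simp add: m power_mult power2_eq_square D.S_S)
        obtain f where f: "f \<in> Fr n" "D.rho f = DT.Pr D.S n"
          "hecke_prod coxeter_D n (map (U_elt n) [1..<n + 1]) = hecke_class coxeter_D n f" using U_elts[OF n] by blast
        have "\<Phi> n (DT.Pr D.S n) = D.lift trD n (D.rho f)" using n f(2) by (simp add: \<Phi>_def Ev_par par_Pr)
        also have "\<dots> = (- (qva_const alpha ^ 2) * a_var) ^ m"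
          unfolding M.lift_cl[OF n f(1)] f(3)[symmetric] using trU[of m] n by (simp add: m del: upt_Suc)
        also have "\<dots> = pol ([:0, - (alpha ^ 2):] ^ m)"
        proof -
          have "pol (smult (- (alpha ^ 2)) [:0, 1:]) = qva_const (- (alpha ^ 2)) * pol [:0, 1:]" by (rule pol_smult)
          moreover have "qva_const (- (alpha ^ 2)) = - (qva_const alpha ^ 2)"
            by (simp add: qva_const_def power2_eq_square)
          moreover have "pol [:0, 1:] = a_var" by (simp add: pol_def a_var_def)
          ultimately have "pol [:0, - (alpha ^ 2):] = - (qva_const alpha ^ 2) * a_var" by simp
          then show ?thesis by (simp only: pol_power)
        qed
        also have "[:0, - (alpha ^ 2):] ^ m = DTr.psi n (DT.Pr D.S n)"
        proof (rule poly_eqI)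
          fix k
          have "DTr.Ps n (2 * k) (DT.Pr D.S n) = (if k = m then alpha ^ n else 0)"
            using DPs_Pr[of n 0 "2 * k"] n m by simp
          moreover have "[:0, - (alpha ^ 2):] = monom (- (alpha ^ 2)) 1" by (simp add: monom_altdef)
          then have "[:0, - (alpha ^ 2):] ^ m = monom ((- (alpha ^ 2)) ^ m) m" by (simp add: monom_power)
          moreover have "(- 1) ^ m * alpha ^ n = (- (alpha ^ 2)) ^ m"
            unfolding power_minus[of "alpha ^ 2"] by (simp add: m power_mult)
          ultimately show "coeff ([:0, - (alpha ^ 2):] ^ m) k = coeff (DTr.psi n (DT.Pr D.S n)) k"
            by (auto simp: DTr.coeff_psi)
        qed
        finally show ?thesis using S by blast
      qed
    qed
  qed (use assms(2) that in auto)
  have "\<Phi> n (D.rho f) = D.lift trD n (D.rho f)"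
    using assms(2) by (simp add: \<Phi>_def Ev_par D.par_rho[OF assms(3)])
  then show ?thesis using main[OF rho_D_A[OF assms(3,2)]] M.lift_cl[OF assms(2,3)] by simp
qed

section \<open>Symmetric polynomials in Jucys-Murphy elements\<close>

definition monom_val :: "(nat \<Rightarrow> 'r :: ring_1) \<Rightarrow> (nat \<Rightarrow>\<^sub>0 nat) \<Rightarrow> 'r" where
  "monom_val Z t = prod_list (map (\<lambda>i. Z i ^ Poly_Mapping.lookup t i) (sorted_list_of_set (Poly_Mapping.keys t)))"

definition degm :: "(nat \<Rightarrow>\<^sub>0 nat) \<Rightarrow> nat" where
  "degm t = (\<Sum>i\<in>Poly_Mapping.keys t. Poly_Mapping.lookup t i)"

text \<open>The coefficients carry a bar because \<open>theta\<close> is semilinear: this is the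
  image under \<open>theta\<close> of a polynomial evaluated in the Hecke algebra, see
  \<open>hecke_eval_pairing\<close>.\<close>

definition mev :: "(nat \<Rightarrow> endo) \<Rightarrow> qv_mpoly \<Rightarrow> endo" where
  "mev Z = lin (\<lambda>t c. scl (qbar c) * monom_val Z t)"

text \<open>Evaluation that keeps track of the degree; on commuting families it is multiplicative.\<close>

definition mevX :: "(nat \<Rightarrow> endo) \<Rightarrow> qv_mpoly \<Rightarrow> endo fps" where
  "mevX Z = lin (\<lambda>t c. fps_const (scl (qbar c) * monom_val Z t) * fps_X ^ degm t)"

lemma degm_lin: "degm t = lin (\<lambda>i. id) t"
  by (simp add: degm_def lin_def)

lemma additive_id: "additive_family (\<lambda>i :: nat. id :: nat \<Rightarrow> nat)"
  by (simp add: additive_family_def)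

lemma degm_add: "degm (s + t) = degm s + degm t" and degm_zero [simp]: "degm 0 = 0"
  and degm_single: "degm (Poly_Mapping.single i k) = k"
  and degm_sum: "degm (\<Sum>i\<in>X. f i) = (\<Sum>i\<in>X. degm (f i))"
  unfolding degm_lin by (simp_all add: lin_add lin_single lin_sum additive_id)

lemma prod_list_filter:
  "(\<And>x. x \<in> set xs \<Longrightarrow> \<not> P x \<Longrightarrow> f x = (1 :: 'r :: ring_1)) \<Longrightarrow>
    prod_list (map f (filter P xs)) = prod_list (map f xs)"
  by (induction xs) auto

lemma monom_val_upt:
  assumes "Poly_Mapping.keys t \<subseteq> {..<N}"
  shows "monom_val Z t = prod_list (map (\<lambda>i. Z i ^ Poly_Mapping.lookup t i) [0..<N])"
proof -
  have "sorted_list_of_set (Poly_Mapping.keys t) = filter (\<lambda>i. i \<in> Poly_Mapping.keys t) [0..<N]"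
    by (rule sorted_distinct_set_unique) (use assms in \<open>auto intro: sorted_wrt_filter\<close>)
  then show ?thesis using prod_list_filter[of "[0..<N]" "\<lambda>i. i \<in> Poly_Mapping.keys t" "\<lambda>i. Z i ^ Poly_Mapping.lookup t i"]
    by (simp add: monom_val_def in_keys_iff)
qed

lemma prod_list_mult:
  fixes f g :: "nat \<Rightarrow> 'r :: ring_1"
  assumes "\<And>i j. g i * f j = f j * g i"
  shows "prod_list (map (\<lambda>i. f i * g i) xs) = prod_list (map f xs) * prod_list (map g xs)"
proof (induction xs)
  case (Cons x xs)
  have "g x * prod_list (map f xs) = prod_list (map f xs) * g x"
    by (rule prod_list_comm) (use assms in auto)
  then have "f x * (g x * prod_list (map f xs)) * prod_list (map g xs)
      = f x * (prod_list (map f xs) * g x) * prod_list (map g xs)" by simp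
  then show ?case by (simp add: Cons.IH mult.assoc)
qed simp

lemma monom_val_add:
  fixes Z :: "nat \<Rightarrow> 'r :: ring_1"
  assumes "\<And>i j. Z i * Z j = Z j * Z i"
  shows "monom_val Z (s + t) = monom_val Z s * monom_val Z t"
proof -
  let ?k = Poly_Mapping.keys
  have "finite (?k s \<union> ?k t)" by simp
  then obtain N where N: "?k s \<union> ?k t \<subseteq> {..<N}" using finite_nat_bounded by blast
  moreover have "?k (s + t) \<subseteq> ?k s \<union> ?k t" by (rule keys_add)
  ultimately have k: "?k s \<subseteq> {..<N}" "?k t \<subseteq> {..<N}" "?k (s + t) \<subseteq> {..<N}" by auto
  have "Z i ^ a * Z j ^ b = Z j ^ b * Z i ^ a" for i j a b
    by (rule power_commuting_commutes, rule power_commuting_commutes[symmetric]) (rule assms)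
  then show ?thesis
    unfolding monom_val_upt[OF k(1)] monom_val_upt[OF k(2)] monom_val_upt[OF k(3)]
    by (simp add: lookup_add power_add prod_list_mult)
qed

lemma monom_val_zero [simp]: "monom_val Z 0 = 1" and monom_val_single [simp]: "monom_val Z (Poly_Mapping.single i (Suc 0)) = Z i"
  by (simp_all add: monom_val_def)

lemma mev_family: "additive_family (\<lambda>t c. scl (qbar c) * monom_val Z t)"
  by (rule additive_familyI) (simp add: qbar_add scl_add distrib_right)

lemma mevX_family: "additive_family (\<lambda>t c. fps_const (scl (qbar c) * monom_val Z t) * fps_X ^ degm t)"
  by (rule additive_familyI) (simp add: qbar_add scl_add distrib_right flip: fps_const_add)

lemma mevX_add: "mevX Z (p + q) = mevX Z p + mevX Z q" and mevX_diff: "mevX Z (p - q) = mevX Z p - mevX Z q"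
  unfolding mevX_def by (simp_all add: lin_add lin_minus mevX_family)

lemma mevX_mult:
  assumes "\<And>i j. Z i * Z j = Z j * Z i"
  shows "mevX Z (p * q) = mevX Z p * mevX Z q"
  unfolding mevX_def
proof (rule lin_mult[OF mevX_family])
  fix s t a b
  have "scl (qbar (a * b)) * monom_val Z (s + t) = (scl (qbar a) * monom_val Z s) * (scl (qbar b) * monom_val Z t)" (is "?c = ?a * ?b")
    using scl_comm[of "monom_val Z s" "qbar b"]
    by (simp only: monom_val_add[OF assms] qbar_mult scl_mult mult.assoc) (simp only: flip: mult.assoc)
  moreover have "fps_const (x * y) * fps_X ^ (k + l) = (fps_const x * fps_X ^ k) * (fps_const y * fps_X ^ l)" for x y :: endo and k l
  proof -
    have "(fps_const x * fps_X ^ k) * (fps_const y * fps_X ^ l) = fps_const x * (fps_X ^ k * fps_const y) * fps_X ^ l"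
      by (simp only: mult.assoc)
    also have "\<dots> = fps_const x * fps_const y * (fps_X ^ k * fps_X ^ l)"
      unfolding fps_mult_fps_X_power_commute[of k "fps_const y"] by (simp only: mult.assoc)
    finally show ?thesis by (simp only: fps_const_mult power_add)
  qed
  ultimately show "fps_const ?c * fps_X ^ degm (s + t) = (fps_const ?a * fps_X ^ degm s) * (fps_const ?b * fps_X ^ degm t)"
    by (simp only: degm_add)
qed

lemma mevX_one: "mevX Z 1 = 1" and mevX_const: "mevX Z (mconst c) = fps_const (scl (qbar c))"
  and mevX_var: "mevX Z (mvar i) = fps_const (Z i) * fps_X"
proof -
  show c: "mevX Z (mconst c) = fps_const (scl (qbar c))" for c
    by (simp add: mevX_def mconst_def lin_single mevX_family)
  show "mevX Z 1 = 1" using c[of 1] by (simp add: mconst_def single_one)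
  show "mevX Z (mvar i) = fps_const (Z i) * fps_X"
    by (simp add: mevX_def mvar_def lin_single[OF mevX_family] degm_single)
qed

lemma hom_part: "homogeneous_part d p = lin (\<lambda>t c. if degm t = d then Poly_Mapping.single t c else 0) p"
  unfolding homogeneous_part_def lin_def degm_def by (rule sum.inter_filter) simp

lemma mev_hom_part: "mev Z (homogeneous_part d p) = mevX Z p $ d"
proof -
  have "mev Z (homogeneous_part d p) =
      (\<Sum>t\<in>Poly_Mapping.keys p. if degm t = d then scl (qbar (Poly_Mapping.lookup p t)) * monom_val Z t else 0)"
    unfolding hom_part lin_def[of _ p] mev_def
    by (subst lin_sum[OF mev_family]) (rule sum.cong, simp_all add: lin_single[OF mev_family])
  also have "\<dots> = mevX Z p $ d"
    unfolding mevX_def lin_def[of _ p] by (simp add: fps_sum_nth fps_X_power_mult_right_nth)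
      (rule sum.cong, auto simp: fps_const_def)
  finally show ?thesis .
qed

text \<open>This gives e_k the same form as \<open>elem_sym'\<close>, a homogeneous part of a
  product over the variables, so that \<open>mev_hom_part\<close> applies to both.\<close>

lemma elem_sym_hom_part: "elem_sym n k = homogeneous_part k (\<Prod>i=1..n. 1 + mvar i)"
proof -
  have fam: "additive_family (\<lambda>t c. if degm t = k then Poly_Mapping.single t c else (0 :: qv_mpoly))"
    by (rule additive_familyI) (simp add: single_add)
  have p: "(\<Prod>i\<in>A. mvar i) = Poly_Mapping.single (\<Sum>i\<in>A. Poly_Mapping.single i 1) 1" if "finite A" for A
    using that by (induction A rule: finite_induct) (simp_all add: mvar_def mult_single single_one)
  have "(\<Prod>i=1..n. 1 + mvar i) = (\<Sum>A\<in>Pow {1..n}. \<Prod>i\<in>A. mvar i)"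
    using prod_add[of "{1..n}" mvar "\<lambda>i. 1"] by (simp add: add.commute)
  then have "homogeneous_part k (\<Prod>i=1..n. 1 + mvar i) = (\<Sum>A\<in>Pow {1..n}. homogeneous_part k (\<Prod>i\<in>A. mvar i))"
    by (simp only: hom_part lin_sum[OF fam])
  also have "\<dots> = (\<Sum>A\<in>Pow {1..n}. if card A = k then \<Prod>i\<in>A. mvar i else 0)"
  proof (rule sum.cong[OF HOL.refl])
    fix A :: "nat set" assume "A \<in> Pow {1..n}"
    then have "finite A" using finite_subset by auto
    then show "homogeneous_part k (\<Prod>i\<in>A. mvar i) = (if card A = k then \<Prod>i\<in>A. mvar i else 0)"
      by (simp add: p hom_part lin_single[OF fam] degm_sum degm_single)
  qed
  also have "\<dots> = (\<Sum>A\<in>{A \<in> Pow {1..n}. card A = k}. \<Prod>i\<in>A. mvar i)"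
    by (rule sum.inter_filter[symmetric]) simp
  also have "{A \<in> Pow {1..n}. card A = k} = {A. A \<subseteq> {1..n} \<and> card A = k}" by auto
  finally show ?thesis by (simp only: elem_sym_def)
qed

text \<open>The elements substituted for the variables are known to lie in the algebra of rank n
  only for the indices 1 to n.\<close>

definition in_vars :: "nat \<Rightarrow> qv_mpoly \<Rightarrow> bool" where
  "in_vars n p \<longleftrightarrow> (\<forall>t\<in>Poly_Mapping.keys p. Poly_Mapping.keys t \<subseteq> {1..n})"

lemma in_vars_add: "in_vars n p \<Longrightarrow> in_vars n q \<Longrightarrow> in_vars n (p + q)"
  using keys_add[of p q] unfolding in_vars_def by blast

lemma in_vars_minus: "in_vars n p \<Longrightarrow> in_vars n q \<Longrightarrow> in_vars n (p - q)"
  using keys_diff[of p q] unfolding in_vars_def by blast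

lemma in_vars_mult: "in_vars n p \<Longrightarrow> in_vars n q \<Longrightarrow> in_vars n (p * q)"
  unfolding in_vars_def
proof
  fix t assume p: "\<forall>t\<in>Poly_Mapping.keys p. Poly_Mapping.keys t \<subseteq> {1..n}"
    and q: "\<forall>t\<in>Poly_Mapping.keys q. Poly_Mapping.keys t \<subseteq> {1..n}" and "t \<in> Poly_Mapping.keys (p * q)"
  then obtain r s where "t = r + s" "r \<in> Poly_Mapping.keys p" "s \<in> Poly_Mapping.keys q"
    using keys_mult[of p q] by blast
  then show "Poly_Mapping.keys t \<subseteq> {1..n}" using keys_add[of r s] p q by blast
qed

lemma in_vars_const: "in_vars n (mconst c)" and in_vars_one: "in_vars n 1"
  and in_vars_var: "i \<in> {1..n} \<Longrightarrow> in_vars n (mvar i)"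
  by (auto simp: in_vars_def mconst_def mvar_def simp flip: single_one)

lemma in_vars_prod: "(\<And>i. i \<in> X \<Longrightarrow> in_vars n (f i)) \<Longrightarrow> in_vars n (\<Prod>i\<in>X. f i)"
  by (induction X rule: infinite_finite_induct) (auto intro: in_vars_mult in_vars_one)

lemma in_vars_hom_part: "in_vars n p \<Longrightarrow> in_vars n (homogeneous_part d p)"
proof -
  assume p: "in_vars n p"
  have s: "in_vars n (\<Sum>t\<in>X. f t)" if "\<And>t. t \<in> X \<Longrightarrow> in_vars n (f t)" for X and f :: "(nat \<Rightarrow>\<^sub>0 nat) \<Rightarrow> qv_mpoly"
    using that by (induction X rule: infinite_finite_induct) (auto intro: in_vars_add simp: in_vars_def[of _ 0])
  show ?thesis unfolding homogeneous_part_def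
    by (rule s) (use p in \<open>auto simp: in_vars_def\<close>)
qed

context finite_coxeter
begin

lemma theta_power: "theta (f ^ k) = theta f ^ k"
  by (induction k) (simp_all add: theta_mult power_commutes)

lemma theta_prod_list:
  assumes "\<And>f g. f \<in> set fs \<Longrightarrow> g \<in> set fs \<Longrightarrow> theta f * theta g = theta g * theta f"
  shows "theta (prod_list fs) = prod_list (map theta fs)"
  using assms
proof (induction fs)
  case (Cons f fs)
  have "theta f * prod_list (map theta fs) = prod_list (map theta fs) * theta f"
    by (rule prod_list_comm) (use Cons.prems in auto)
  then show ?case using Cons by (simp add: theta_mult)
qed simp

text \<open>The polynomial is evaluated on lifts to the free algebra, where
  \<open>pairing_eq\<close> can be used. That \<open>theta\<close> reverses products does no harm,
  since the images of the lifts commute.\<close>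

lemma hecke_eval_pairing:
  assumes p: "in_vars n p" and J: "\<And>i. i \<in> {1..n} \<Longrightarrow> g i \<in> Fr n \<and> J i = clH (g i)"
    and comm: "\<And>i j. theta (g i) * theta (g j) = theta (g j) * theta (g i)" and f: "f \<in> Fr n"
  shows "pairing m n (hecke_eval m n p J) (clH f) = tau (mev (\<lambda>i. theta (g i)) p * rho f)"
proof -
  let ?k = Poly_Mapping.keys and ?l = Poly_Mapping.lookup
  let ?P = "\<lambda>t. prod_list (map (\<lambda>i. g i ^ ?l t i) (sorted_list_of_set (?k t)))"
  let ?F = "\<Sum>t\<in>?k p. free_const (?l p t) * ?P t"
  have pw: "g i ^ k \<in> Fr n" if "i \<in> {1..n}" for i k
    using J[OF that] by (induction k) (auto intro: Fr_mult Fr_one)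
  have P: "?P t \<in> Fr n" if "t \<in> ?k p" for t
  proof (rule Fr_prod_list)
    fix h assume "h \<in> set (map (\<lambda>i. g i ^ ?l t i) (sorted_list_of_set (?k t)))"
    then obtain i where "i \<in> ?k t" "h = g i ^ ?l t i" by auto
    moreover have "?k t \<subseteq> {1..n}" using \<open>t \<in> ?k p\<close> p by (simp add: in_vars_def)
    ultimately show "h \<in> Fr n" using pw by blast
  qed
  have mon: "hecke_prod m n (map (\<lambda>i. J i [^]\<^bsub>H\<^esub> ?l t i) (sorted_list_of_set (?k t))) = clH (?P t)"
    if t: "t \<in> ?k p" for t
  proof -
    have i: "i \<in> {1..n}" if "i \<in> ?k t" for i using that t p unfolding in_vars_def by blast
    have "map (\<lambda>i. J i [^]\<^bsub>H\<^esub> ?l t i) (sorted_list_of_set (?k t))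
        = map clH (map (\<lambda>i. g i ^ ?l t i) (sorted_list_of_set (?k t)))"
      using J[OF i] by (simp add: cl_power)
    moreover have "\<And>h. h \<in> set (map (\<lambda>i. g i ^ ?l t i) (sorted_list_of_set (?k t))) \<Longrightarrow> h \<in> Fr n"
      using i pw by auto
    ultimately show ?thesis by (simp only: cl_prod)
  qed
  have F: "?F \<in> Fr n" using P by (intro Fr_sum Fr_mult Fr_const)
  have "hecke_eval m n p J = (\<Oplus>\<^bsub>H\<^esub>t\<in>?k p. clH (free_const (?l p t) * ?P t))"
  proof -
    interpret R: ring H by (rule hecke_ring)
    show ?thesis unfolding hecke_eval_def
      by (rule R.finsum_cong') (use P in \<open>auto simp: mon cl_smult intro!: cl_closed Fr_mult Fr_const\<close>)
  qed
  also have "\<dots> = clH ?F" using P by (intro cl_sum) (auto intro: Fr_mult Fr_const)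
  finally have e: "hecke_eval m n p J = clH ?F" .
  have "theta (?P t) = monom_val (\<lambda>i. theta (g i)) t" for t
  proof -
    have "theta (g i ^ a) * theta (g j ^ b) = theta (g j ^ b) * theta (g i ^ a)" for i j a b
      unfolding theta_power
      by (rule power_commuting_commutes, rule power_commuting_commutes[symmetric]) (rule comm)
    then have "theta (?P t) = prod_list (map theta (map (\<lambda>i. g i ^ ?l t i) (sorted_list_of_set (?k t))))"
      by (intro theta_prod_list) auto
    then show ?thesis by (simp add: monom_val_def theta_power o_def)
  qed
  then have "theta ?F = mev (\<lambda>i. theta (g i)) p"
    unfolding mev_def lin_def by (simp add: theta_sum theta_mult scl_comm)
  then show ?thesis unfolding e pairing_eq[OF F f] by simp
qed

end

section \<open>Lifts of the Jucys-Murphy elements\<close>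

lemma uB_upt: "uB k = rev [1..<Suc k] @ [0..<Suc k]"
  by (induction k) simp_all

lemma uD_upt: "uD j = rev [1..<j + 2] @ [0] @ [2..<j + 2]"
  by (induction j) simp_all

definition gB :: "nat \<Rightarrow> free_elt" where
  "gB i = free_word (rev [0..<i] @ [1..<i]) ^ 2"

definition gD :: "nat \<Rightarrow> free_elt" where
  "gD i = (if i \<le> 1 then 1 else free_word (rev [2..<i] @ [0] @ [1..<i]))"

lemma theta_gB: "B.theta (gB i) = (if i = 0 then 1 else BT.yy (i - 1) * BT.yy (i - 1))"
proof (cases i)
  case (Suc k)
  have "rev (rev [0..<i] @ [1..<i]) = uB k" unfolding uB_upt Suc by (simp del: upt_Suc)
  then show ?thesis
    by (simp add: gB_def power2_eq_square B.theta_mult Suc yy_B del: rev_append upt_Suc)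
qed (simp add: gB_def free_word_Nil)

text \<open>For i \<ge> 2 the reversed word is the one of \<open>yy_D\<close>, which differs from y
  by \<varsigma>. For i = 1 the right-hand side is \<varsigma>^2 = 1, and i = 0 is a default
  value.\<close>

lemma theta_gD: "D.theta (gD i) = (if i = 0 then 1 else DT.yy (i - 1) * D.S)"
proof -
  consider "i = 0" | "i = 1" | j where "i = j + 2"
    by (metis One_nat_def add_2_eq_Suc' not0_implies_Suc)
  then show ?thesis
  proof cases
    case 3
    have "rev (rev [2..<i] @ [0] @ [1..<i]) = uD j" unfolding uD_upt 3 by (simp del: upt_Suc)
    then have "D.theta (gD i) = D.sword (uD j)" by (simp add: gD_def 3 del: rev_append upt_Suc)
    then show ?thesis using yy_D[of j] by (simp add: 3 mult.assoc D.S_S del: DT.yy.simps)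
  qed (simp_all add: gD_def D.S_S)
qed

lemma theta_gB_comm: "B.theta (gB i) * B.theta (gB j) = B.theta (gB j) * B.theta (gB i)"
proof -
  have "BT.yy p * (BT.yy q * BT.yy q) = BT.yy q * BT.yy q * BT.yy p" for p q
    by (rule commute_mult) (rule BT.yy_yy_comm)+
  then show ?thesis unfolding theta_gB
    using commute_mult[of "BT.yy (j - 1) * BT.yy (j - 1)" "BT.yy (i - 1)" "BT.yy (i - 1)"] by simp
qed

lemma S_yy: "D.S * DT.yy k = DT.yy k * D.S"
  using DT.yy_comm[of D.S k] DT.A_t[of 0 k] by (cases k) simp_all

lemma yy_S_mult: "(DT.yy p * D.S) * (DT.yy q * D.S) = DT.yy p * DT.yy q"
proof -
  have "(DT.yy p * D.S) * (DT.yy q * D.S) = DT.yy p * (D.S * DT.yy q) * D.S" by (simp only: mult.assoc)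
  also have "\<dots> = DT.yy p * DT.yy q * (D.S * D.S)" unfolding S_yy by (simp only: mult.assoc)
  finally show ?thesis by (simp only: D.S_S mult_1_right)
qed

lemma theta_gD_comm: "D.theta (gD i) * D.theta (gD j) = D.theta (gD j) * D.theta (gD i)"
  unfolding theta_gD using yy_S_mult DT.yy_yy_comm[of "i - 1" "j - 1"] by simp

lemma minus_one_power: "(- 1 :: endo) ^ k = scl ((- 1) ^ k)"
  by (induction k) (simp_all add: scl_minus)

text \<open>The variables stand for the squares y^2, so degree k becomes degree 2k in X. The passage
  from factors 1 + y^2 X to factors 1 - y^2 X^2 accounts for the sign.\<close>

lemma mevX_B: "mevX (\<lambda>i. B.theta (gB i)) (\<Prod>i=1..n. 1 + mvar i) $ k = (- 1) ^ k * BT.FF 0 n $ (2 * k)"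
proof -
  let ?Z = "\<lambda>i. B.theta (gB i)"
  note c = theta_gB_comm
  show ?thesis
  proof (induction n arbitrary: k)
    case 0 show ?case by (simp add: mevX_one fps_one_nth)
  next
    case (Suc n)
    have Z: "?Z (Suc n) = BT.yy n * BT.yy n" by (simp add: theta_gB)
    have q: "(\<Prod>i=1..Suc n. 1 + mvar i) = (\<Prod>i=1..n. 1 + mvar i) * (1 + mvar (Suc n))"
      by (simp add: prod.nat_ivl_Suc' mult.commute)
    have "mevX ?Z (\<Prod>i=1..Suc n. 1 + mvar i)
        = mevX ?Z (\<Prod>i=1..n. 1 + mvar i) * (1 + fps_const (BT.yy n * BT.yy n) * fps_X)"
      by (simp only: q mevX_mult[OF c] mevX_add mevX_one mevX_var Z)
    then have "mevX ?Z (\<Prod>i=1..Suc n. 1 + mvar i) $ k = mevX ?Z (\<Prod>i=1..n. 1 + mvar i) $ k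
        + (if k = 0 then 0 else mevX ?Z (\<Prod>i=1..n. 1 + mvar i) $ (k - 1) * (BT.yy n * BT.yy n))"
      by (simp only: distrib_left mult_1_right fps_add_nth fps_mult_const_X_nth)
    also have "\<dots> = (- 1) ^ k * BT.FF 0 (Suc n) $ (2 * k)"
      unfolding Suc BT.FF_nth by (cases k) (simp_all add: right_diff_distrib mult.assoc del: BT.yy.simps)
    finally show ?case .
  qed
qed

text \<open>The bar involution turns the coefficient \<alpha> into -\<alpha>, as in the factors of
  F. Each variable stands for y \<varsigma>, and since \<varsigma> commutes with all y the factors
  \<varsigma> collect into one power, which is 1 in even degree.\<close>

lemma mevX_D: "mevX (\<lambda>i. D.theta (gD i)) (\<Prod>i=1..n. 1 + mconst alpha * mvar i - mvar i ^ 2) $ d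
    = DT.FF alpha n $ d * D.S ^ d"
proof -
  let ?Z = "\<lambda>i. D.theta (gD i)" and ?q = "\<lambda>i. 1 + mconst alpha * mvar i - mvar i ^ 2"
  note c = theta_gD_comm and yS = yy_S_mult
  have Sp: "D.S ^ (d - 2) = D.S ^ d" if "\<not> d < 2" for d
  proof -
    from that have "D.S ^ d = D.S ^ (d - 2) * (D.S * D.S)"
      by (metis le_add_diff_inverse2 not_less power2_eq_square power_add)
    then show ?thesis by (simp add: D.S_S)
  qed
  have Sy: "D.S ^ d * DT.yy k = DT.yy k * D.S ^ d" for d k
    by (rule power_commuting_commutes[OF S_yy])
  show ?thesis
  proof (induction n arbitrary: d)
    case 0 show ?case by (simp add: mevX_one fps_one_nth)
  next
    case (Suc n)
    let ?G = "mevX ?Z (\<Prod>i=1..n. ?q i)" and ?y = "DT.yy n"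
    have Z: "?Z (Suc n) = DT.yy n * D.S" by (simp add: theta_gD)
    have v2: "mevX ?Z (mvar (Suc n) ^ 2) = fps_const (?y * ?y) * (fps_X * fps_X)"
    proof -
      have "mevX ?Z (mvar (Suc n) ^ 2) = fps_const (?y * D.S) * (fps_X * fps_const (?y * D.S)) * fps_X"
        by (simp only: power2_eq_square mevX_mult[OF c] mevX_var Z mult.assoc)
      also have "\<dots> = fps_const (?y * D.S) * fps_const (?y * D.S) * (fps_X * fps_X)"
        unfolding fps_mult_fps_X_commute[of "fps_const (?y * D.S)"] by (simp only: mult.assoc)
      finally show ?thesis by (simp only: fps_const_mult yS)
    qed
    have v1: "mevX ?Z (mconst alpha * mvar (Suc n)) = - (fps_const (scl alpha * (?y * D.S)) * fps_X)"
      by (simp only: mevX_mult[OF c] mevX_var mevX_const Z qbar_alpha, simp only: scl_minus flip: fps_const_neg fps_const_mult,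
          simp only: mult_minus_left mult.assoc)
    have q: "(\<Prod>i=1..Suc n. ?q i) = (\<Prod>i=1..n. ?q i) * ?q (Suc n)"
      by (simp add: prod.nat_ivl_Suc' mult.commute)
    have qv: "mevX ?Z (?q (Suc n)) = 1 - fps_const (scl alpha * (?y * D.S)) * fps_X - fps_const (?y * ?y) * (fps_X * fps_X)"
      by (simp only: mevX_diff mevX_add mevX_one v1 v2 add_uminus_conv_diff)
    have "mevX ?Z (\<Prod>i=1..Suc n. ?q i)
        = ?G - ?G * (fps_const (scl alpha * (?y * D.S)) * fps_X) - ?G * (fps_const (?y * ?y) * (fps_X * fps_X))"
      unfolding q by (simp only: mevX_mult[OF c] qv, simp only: right_diff_distrib mult_1_right)
    then have "mevX ?Z (\<Prod>i=1..Suc n. ?q i) $ d = ?G $ d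
        - (if d = 0 then 0 else ?G $ (d - 1) * (scl alpha * (?y * D.S)))
        - (if d < 2 then 0 else ?G $ (d - 2) * (?y * ?y))"
      by (simp only: fps_sub_nth fps_mult_const_X_nth fps_mult_const_XX_nth)
    also have "\<dots> = DT.FF alpha (Suc n) $ d * D.S ^ d"
    proof -
      have 1: "DT.FF alpha n $ (d - 1) * D.S ^ (d - 1) * (scl alpha * (?y * D.S))
          = DT.FF alpha n $ (d - 1) * (scl alpha * ?y) * D.S ^ d" if "d \<noteq> 0"
      proof -
        have "D.S ^ d = D.S ^ (d - 1) * D.S" using that by (cases d) (simp_all add: power_commutes)
        moreover have "D.S ^ (d - 1) * (scl alpha * (?y * D.S)) = scl alpha * (D.S ^ (d - 1) * ?y) * D.S"
          using scl_comm[of "D.S ^ (d - 1)" alpha] by (simp only: flip: mult.assoc)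
        ultimately show ?thesis unfolding Sy by (simp only: mult.assoc)
      qed
      have 2: "DT.FF alpha n $ (d - 2) * D.S ^ (d - 2) * (?y * ?y) = DT.FF alpha n $ (d - 2) * (?y * ?y) * D.S ^ d"
        if "\<not> d < 2"
      proof -
        have "D.S ^ d * (?y * ?y) = ?y * ?y * D.S ^ d" by (rule commute_mult) (rule Sy)+
        then show ?thesis unfolding Sp[OF that] by (simp only: mult.assoc)
      qed
      show ?thesis unfolding Suc DT.FF_nth left_diff_distrib using 1 2 by auto
    qed
    finally show ?case .
  qed
qed

theorem theorem3p3p1:
  fixes trB trD :: "nat \<Rightarrow> free_elt set \<Rightarrow> qva"
  assumes trB: "geometric_trace_B trB"
    and trD: "geometric_trace_D trD"
  shows
    "(\<forall>n\<ge>1. \<forall>k. \<forall>h\<in>carrier (hecke_B n).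
        a_coeff k (trB n h) =
          pairing coxeter_B n (hecke_eval coxeter_B n (elem_sym n k) (JM_B n)) h) \<and>
     (\<forall>n\<ge>2. \<forall>k. \<forall>h\<in>carrier (hecke_D n).
        a_coeff k (trD n h) =
          (-1) ^ k * pairing coxeter_D n (hecke_eval coxeter_D n (elem_sym' n k) (jm_D n)) h)"
proof (intro conjI allI impI ballI)
  fix n k h assume n: "1 \<le> n" and "h \<in> carrier (hecke_B n)"
  then obtain f where f: "f \<in> Fr n" "h = hecke_class coxeter_B n f" unfolding hecke_carrier by blast
  interpret F: finite_coxeter coxeter_B id n by (rule BH)
  have J: "gB i \<in> Fr n \<and> JM_B n i = F.clH (gB i)" if i: "i \<in> {1..n}" for i
  proof -
    have w: "rev [0..<i] @ [1..<i] \<in> lists {..<n}" using i by auto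
    then have "jm_B n i = F.clH (free_word (rev [0..<i] @ [1..<i]))"
      unfolding jm_B_def using F.prod_gen_inv[of "rev [0..<i] @ [1..<i]" "[]"] by simp
    then show ?thesis unfolding JM_B_def gB_def
      using cl_power[OF Fr_word[OF w], of coxeter_B 2] Fr_word[OF w] by (simp add: power2_eq_square Fr_mult)
  qed
  have "pairing coxeter_B n (hecke_eval coxeter_B n (elem_sym n k) (JM_B n)) h
      = B.tau (mev (\<lambda>i. B.theta (gB i)) (elem_sym n k) * B.rho f)"
    unfolding f(2) by (rule F.hecke_eval_pairing[OF _ J theta_gB_comm f(1)])
      (auto simp: elem_sym_hom_part intro!: in_vars_hom_part in_vars_prod in_vars_add in_vars_one in_vars_var)
  also have "\<dots> = (- 1) ^ k * BTr.Ps n (2 * k) (B.rho f)"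
    by (simp only: elem_sym_hom_part mev_hom_part mevX_B minus_one_power mult.assoc B.tau_scl BTr.Ps_def)
  also have "\<dots> = a_coeff k (trB n h)"
    by (simp only: f(2) trace_B[OF trB n f(1)] a_coeff_pol BTr.coeff_psi)
  finally show "a_coeff k (trB n h) = pairing coxeter_B n (hecke_eval coxeter_B n (elem_sym n k) (JM_B n)) h" ..
next
  fix n k h assume n: "2 \<le> n" and "h \<in> carrier (hecke_D n)"
  then obtain f where f: "f \<in> Fr n" "h = hecke_class coxeter_D n f" unfolding hecke_carrier by blast
  interpret F: finite_coxeter coxeter_D swD n by (rule DH[OF n])
  have J: "gD i \<in> Fr n \<and> jm_D n i = F.clH (gD i)" if i: "i \<in> {1..n}" for i
  proof (cases "i \<le> 1")
    case True then show ?thesis by (simp add: gD_def jm_D_def Fr_one cl_one)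
  next
    case False
    have w: "rev [2..<i] @ [0] @ [1..<i] \<in> lists {..<n}" using i False by auto
    then have "hecke_prod coxeter_D n (map (hecke_gen coxeter_D n) (rev [2..<i] @ [0] @ [1..<i]))
        = F.clH (free_word (rev [2..<i] @ [0] @ [1..<i]))"
      using F.prod_gen_inv[of "rev [2..<i] @ [0] @ [1..<i]" "[]"] by simp
    then show ?thesis using False Fr_word[OF w] by (simp only: gD_def jm_D_def if_False simp_thms)
  qed
  have "pairing coxeter_D n (hecke_eval coxeter_D n (elem_sym' n k) (jm_D n)) h
      = D.tau (mev (\<lambda>i. D.theta (gD i)) (elem_sym' n k) * D.rho f)"
    unfolding f(2) by (rule F.hecke_eval_pairing[OF _ J theta_gD_comm f(1)])
      (auto simp: elem_sym'_def power2_eq_square intro!: in_vars_hom_part in_vars_prod in_vars_add in_vars_minus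
        in_vars_mult in_vars_const in_vars_one in_vars_var)
  also have "\<dots> = DTr.Ps n (2 * k) (D.rho f)"
  proof -
    have "D.S ^ (2 * k) = 1" by (simp add: power_mult power2_eq_square D.S_S)
    then show ?thesis by (simp only: elem_sym'_def mev_hom_part mevX_D mult_1_right DTr.Ps_def)
  qed
  also have "(- 1) ^ k * DTr.Ps n (2 * k) (D.rho f) = a_coeff k (trD n h)"
    by (simp only: f(2) trace_D[OF trD n f(1)] a_coeff_pol DTr.coeff_psi)
  finally show "a_coeff k (trD n h) =
      (- 1) ^ k * pairing coxeter_D n (hecke_eval coxeter_D n (elem_sym' n k) (jm_D n)) h" ..
qed

end
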